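(* For $i=0,1$ let $p_i\colon E_i\to B_i$ be a smooth vector bundle of rank $n_i\ge1$ over a compact manifold $B_i$ without boundary and let $f_i\colon E_i\to\mathbb{R}$ be a definite $2$-homogeneous $C^\infty$ function. Suppose there is a diffeomorphism $\psi\colon f_0^{-1}(1)\to f_1^{-1}(1)$, and let $\mathbf{L}_\xi$, $f\colon\mathbf{L}_\xi\to[0;1]$ and $\mathcal{F}$ be the corresponding glued manifold, function and foliation (defined in the context). Then the projection $p_2\colon\mathcal{S}^{img}_{LR}(f)\to\mathcal{D}^{fol}(\mathcal{F})$, $p_2(\phi,h)=h$, induces an isomorphism of the short exact sequences $$1\to\mathcal{S}_R(f)\xrightarrow{\ j\ }\mathcal{S}^{img+}_{LR}(f)\xrightarrow{\ p_1\ }\mathcal{D}^+([0;1])\to1,$$ $$1\to\mathcal{D}^{lp}(\mathcal{F})\hookrightarrow\mathcal{D}^{fol}_+(\mathcal{F})\xrightarrow{\ \sigma\ }\mathcal{D}^+([0;1])\to1,$$ being the identity on $\mathcal{S}_R(f)=\mathcal{D}^{lp}(\mathcal{F})$ and on $\mathcal{D}^+([0;1])$, where $\widehat\sigma(h)=(\sigma(h),h)$ is the inverse to $p_2$, $\widehat\theta(\phi)=(\phi,\theta(\phi))$ is a section of $p_1$, and $\theta$ is a section of $\sigma$. In particular, $\mathcal{D}^{lp}(\mathcal{F})$ is a strong deformation retract of $\mathcal{D}^{fol}_+(\mathcal{F})$. Moreover, if $\mathcal{D}^{fol}_+(\mathcal{F})\ne\mathcal{D}^{fol}(\mathcal{F})$,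 then $p_2$ (with inverse $\widehat\sigma$) also gives an isomorphism of the short exact sequences $$1\to\mathcal{S}_R(f)\xrightarrow{\ j\ }\mathcal{S}^{img}_{LR}(f)\xrightarrow{\ p_1\ }\mathcal{D}([0;1])\to1,$$ $$1\to\mathcal{D}^{lp}(\mathcal{F})\hookrightarrow\mathcal{D}^{fol}(\mathcal{F})\xrightarrow{\ \sigma\ }\mathcal{D}([0;1])\to1,$$ being the identity on $\mathcal{S}_R(f)=\mathcal{D}^{lp}(\mathcal{F})$ and on $\mathcal{D}([0;1])$.
   Context: $B_i$ is identified with the zero section of $E_i$. $f_i$ is $k$-homogeneous if $f_i(tx)=t^kf_i(x)$ for all $t\ge0$, $x\in E_i$; definite if $f_i>0$ on $E_i\setminus B_i$. Put $\mathbf{T}_i=f_i^{-1}([0;1])$, so $\partial\mathbf{T}_i=f_i^{-1}(1)$, and $\mathbf{U}_i=f_i^{-1}([0;1))$. The map $\xi\colon\mathbf{U}_0\setminus B_0\to\mathbf{U}_1\setminus B_1$, $\xi(x)=\sqrt{1-f_0(x)}\cdot\psi\bigl(x/\sqrt{f_0(x)}\bigr)$, is a diffeomorphism with $f_0(x)+f_1(\xi(x))=1$. Let $\mathbf{L}_\xi=\mathbf{U}_0\cup_\xi\mathbf{U}_1$ be the smooth manifold obtained by gluing $\mathbf{U}_0$ and $\mathbf{U}_1$ via $\xi$, with the natural open embeddings of $\mathbf{U}_0,\mathbf{U}_1$. Let $f\colon\mathbf{L}_\xi\to[0;1]$ be the $C^\infty$ function equal to $f_0$ on $\mathbf{U}_0$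 and to $1-f_1$ on $\mathbf{U}_1$. Put $L_t=f^{-1}(t)$ and $\mathcal{F}=\{L_t\}_{t\in[0;1]}$, a partition of $\mathbf{L}_\xi$; $L_0\cong B_0$ and $L_1\cong B_1$ are the singular leaves. $\mathcal{D}(\cdot)$ is the group of $C^\infty$ diffeomorphisms with $C^\infty$ topology, $\mathcal{D}^+([0;1])\subset\mathcal{D}([0;1])$ the orientation preserving ones. $\mathcal{D}^{fol}(\mathcal{F})$ (resp. $\mathcal{D}^{lp}(\mathcal{F})$) is the group of diffeomorphisms of $\mathbf{L}_\xi$ sending each leaf of $\mathcal{F}$ onto a leaf (resp. onto itself), and $\mathcal{D}^{fol}_+(\mathcal{F})=\{h\in\mathcal{D}^{fol}(\mathcal{F})\mid h(L_0)=L_0,\ h(L_1)=L_1\}$. Also $\mathcal{S}_R(f)=\{h\in\mathcal{D}(\mathbf{L}_\xi)\mid f\circ h=f\}$, $\mathcal{S}^{img}_{LR}(f)=\{(\phi,h)\in\mathcal{D}([0;1])\times\mathcal{D}(\mathbf{L}_\xi)\mid\phi\circ f=f\circ h\}$, $\mathcal{S}^{img+}_{LR}(f)$ is its subgroup of pairs with $\phi\in\mathcal{D}^+([0;1])$; $j(h)=(\mathrm{id}_{[0;1]},h)$, $p_1(\phi,h)=\phi$. For $h\in\mathcal{D}^{fol}(\mathcal{F})$, $\sigma(h)\in\mathcal{D}([0;1])$ is the unique diffeomorphism with $\sigma(h)\circ f=f\circ h$; $\sigma$ is a continuous homomorphism. For $\phi\in\mathcal{D}^+([0;1])$ put $\phi_0=\phi$,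 $\phi_1(t)=1-\phi(1-t)$, and let $g_i\colon[0;1]\to(0;+\infty)$ be the unique $C^\infty$ functions with $\phi_i(t)=t\,g_i(t)$; then $\theta(\phi)\in\mathcal{D}^{fol}_+(\mathcal{F})$ is the diffeomorphism given on $\mathbf{U}_i$ by $x\mapsto\sqrt{g_i(f_i(x))}\,x$, $i=0,1$; $\theta$ is a continuous homomorphism with $\phi\circ f=f\circ\theta(\phi)$. *)

theory Defs
  imports "HOL-Analysis.Analysis" "HOL-Algebra.Exact_Sequence" "HOL-Algebra.Bij"
begin

section \<open>Calculus\<close>

text \<open>
  \<open>dderiv S f [v\<^sub>1, \<dots>, v\<^sub>k]\<close> is the iterated directional derivative of \<open>f\<close> along
  \<open>v\<^sub>k, \<dots>, v\<^sub>1\<close>, that is, the \<open>k\<close>-linear form \<open>D\<^sup>k f\<close> applied to these vectors.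
  It is only used where derivatives within \<open>S\<close> are unique: \<open>S\<close> is (relatively) open in a
  finite-dimensional space or in the interval \<open>{0..1}\<close>; in the latter case derivatives at
  the end points are one-sided.
\<close>

primrec dderiv ::
    "'a::real_normed_vector set \<Rightarrow> ('a \<Rightarrow> 'b::real_normed_vector) \<Rightarrow> 'a list \<Rightarrow> 'a \<Rightarrow> 'b" where
  "dderiv S f [] = f"
| "dderiv S f (v # vs) = (\<lambda>x. frechet_derivative (dderiv S f vs) (at x within S) v)"

definition smooth_on :: "'a::real_normed_vector set \<Rightarrow> ('a \<Rightarrow> 'b::real_normed_vector) \<Rightarrow> bool" where
  "smooth_on S f \<longleftrightarrow> (\<forall>vs. dderiv S f vs differentiable_on S)"


section \<open>Smooth manifolds\<close>

text \<open>
  A chart is a pair of its domain and the coordinate map.  Model spaces are the types of sort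
  \<open>{real_normed_vector, heine_borel}\<close>: these are the finite-dimensional normed spaces,
  including (unlike \<open>euclidean_space\<close>) the zero-dimensional one, which is needed for
  bundles over finite sets of points.
\<close>

record ('p, 'm) manifold =
  mtop :: "'p topology"
  charts :: "('p set \<times> ('p \<Rightarrow> 'm)) set"

abbreviation pts :: "('p, 'm, 'z) manifold_scheme \<Rightarrow> 'p set" where
  "pts M \<equiv> topspace (mtop M)"

definition smooth_manifold :: "('p, 'm::{real_normed_vector, heine_borel}) manifold \<Rightarrow> bool" where
  "smooth_manifold M \<longleftrightarrow>
     Hausdorff_space (mtop M) \<and> second_countable (mtop M) \<and>
     (\<Union>(U, c)\<in>charts M. U) = pts M \<and>
     (\<forall>(U, c)\<in>charts M. openin (mtop M) U \<and> open (c ` U) \<and>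
        homeomorphic_map (subtopology (mtop M) U) (top_of_set (c ` U)) c) \<and>
     (\<forall>(U, c)\<in>charts M. \<forall>(V, d)\<in>charts M. smooth_on (c ` (U \<inter> V)) (d \<circ> inv_into U c))"

text \<open>The zero-dimensional model space.\<close>

instantiation unit :: real_normed_vector
begin
definition zero_unit :: unit where "zero_unit = ()"
definition plus_unit :: "unit \<Rightarrow> unit \<Rightarrow> unit" where "plus_unit x y = ()"
definition scaleR_unit :: "real \<Rightarrow> unit \<Rightarrow> unit" where "scaleR_unit a x = ()"
definition norm_unit :: "unit \<Rightarrow> real" where "norm_unit x = 0"
definition sgn_unit :: "unit \<Rightarrow> unit" where "sgn_unit x = ()"
definition dist_unit :: "unit \<Rightarrow> unit \<Rightarrow> real" where "dist_unit x y = 0"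
definition uniformity_unit :: "(unit \<times> unit) filter" where
  "uniformity_unit = (INF e\<in>{0 <..}. principal {(x, y). dist x y < e})"
definition open_unit :: "unit set \<Rightarrow> bool" where
  "open_unit U = (\<forall>x\<in>U. eventually (\<lambda>(x', y). x' = x \<longrightarrow> y \<in> U) uniformity)"
instance
  by standard (auto simp: norm_unit_def dist_unit_def uniformity_unit_def open_unit_def)
end

instance unit :: heine_borel
proof
  fix s :: "nat \<Rightarrow> unit"
  have "strict_mono (id :: nat \<Rightarrow> nat) \<and> ((s \<circ> id) \<longlongrightarrow> ()) sequentially"
    by (auto intro!: tendstoI simp: strict_mono_def dist_unit_def)
  then show "\<exists>l r. strict_mono (r :: nat \<Rightarrow> nat) \<and> ((s \<circ> r) \<longlongrightarrow> l) sequentially"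
    by blast
qed

text \<open>The manifold structures of a finite-dimensional vector space and of the interval
  \<open>[0;1]\<close>.  The latter has boundary, so it does not satisfy \<^const>\<open>smooth_manifold\<close>;
  all notions below that do not assume \<^const>\<open>smooth_manifold\<close> apply to it with its single
  chart and have their usual meaning.\<close>

definition vector_manifold :: "('m::real_normed_vector, 'm) manifold" where
  "vector_manifold = \<lparr>mtop = euclidean, charts = {(UNIV, \<lambda>x. x)}\<rparr>"

definition unit_interval :: "(real, real) manifold" where
  "unit_interval = \<lparr>mtop = top_of_set {0..1}, charts = {({0..1}, \<lambda>t. t)}\<rparr>"

definition submanifold_open :: "('p, 'm) manifold \<Rightarrow> 'p set \<Rightarrow> ('p, 'm) manifold" where
  "submanifold_open M W =
     \<lparr>mtop = subtopology (mtop M) W, charts = (\<lambda>(U, c). (U \<inter> W, c)) ` charts M\<rparr>"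

definition prod_manifold ::
    "('p, 'm) manifold \<Rightarrow> ('q, 'n) manifold \<Rightarrow> ('p \<times> 'q, 'm \<times> 'n) manifold" where
  "prod_manifold M N =
     \<lparr>mtop = prod_topology (mtop M) (mtop N),
      charts = {(U \<times> V, map_prod c d) | U c V d. (U, c) \<in> charts M \<and> (V, d) \<in> charts N}\<rparr>"

text \<open>The local representation \<open>d \<circ> f \<circ> c\<^sup>-\<^sup>1\<close> of \<open>f\<close> and its domain.\<close>

definition loc_dom :: "'p set \<times> ('p \<Rightarrow> 'm) \<Rightarrow> 'q set \<times> ('q \<Rightarrow> 'n) \<Rightarrow> ('p \<Rightarrow> 'q) \<Rightarrow> 'm set" where
  "loc_dom C D f = snd C ` (fst C \<inter> f -` fst D)"

definition loc_rep :: "'p set \<times> ('p \<Rightarrow> 'm) \<Rightarrow> 'q set \<times> ('q \<Rightarrow> 'n) \<Rightarrow> ('p \<Rightarrow> 'q) \<Rightarrow> 'm \<Rightarrow> 'n" where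
  "loc_rep C D f = snd D \<circ> f \<circ> inv_into (fst C) (snd C)"

definition smooth_map ::
    "('p, 'm::real_normed_vector) manifold \<Rightarrow> ('q, 'n::real_normed_vector) manifold \<Rightarrow> ('p \<Rightarrow> 'q) \<Rightarrow> bool"
  where
  "smooth_map M N f \<longleftrightarrow> continuous_map (mtop M) (mtop N) f \<and>
     (\<forall>C\<in>charts M. \<forall>D\<in>charts N. smooth_on (loc_dom C D f) (loc_rep C D f))"

definition diffeo ::
    "('p, 'm::real_normed_vector) manifold \<Rightarrow> ('q, 'n::real_normed_vector) manifold \<Rightarrow> ('p \<Rightarrow> 'q) \<Rightarrow> bool"
  where
  "diffeo M N f \<longleftrightarrow> bij_betw f (pts M) (pts N) \<and> smooth_map M N f \<and>
     smooth_map N M (inv_into (pts M) f)"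

text \<open>Smooth maps and diffeomorphisms between subsets of manifolds, by local smooth extension;
  for embedded submanifolds (here: regular level sets) these are the smooth maps and the
  diffeomorphisms of the submanifold structures.\<close>

definition smooth_map_subset ::
    "('p, 'm::real_normed_vector) manifold \<Rightarrow> 'p set \<Rightarrow>
     ('q, 'n::real_normed_vector) manifold \<Rightarrow> 'q set \<Rightarrow> ('p \<Rightarrow> 'q) \<Rightarrow> bool" where
  "smooth_map_subset M S N T f \<longleftrightarrow> f ` S \<subseteq> T \<and>
     (\<forall>x\<in>S. \<exists>W g. openin (mtop M) W \<and> x \<in> W \<and> smooth_map (submanifold_open M W) N g \<and>
        (\<forall>y\<in>W \<inter> S. g y = f y))"

definition diffeo_subset ::
    "('p, 'm::real_normed_vector) manifold \<Rightarrow> 'p set \<Rightarrow>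
     ('q, 'n::real_normed_vector) manifold \<Rightarrow> 'q set \<Rightarrow> ('p \<Rightarrow> 'q) \<Rightarrow> bool" where
  "diffeo_subset M S N T f \<longleftrightarrow> bij_betw f S T \<and> smooth_map_subset M S N T f \<and>
     smooth_map_subset N T M S (inv_into S f)"


section \<open>Vector bundles and homogeneous functions\<close>

record ('e, 'k, 'b, 'm) vbundle =
  total :: "('e, 'k) manifold"
  base :: "('b, 'm) manifold"
  proj :: "'e \<Rightarrow> 'b"
  vadd :: "'e \<Rightarrow> 'e \<Rightarrow> 'e"
  vscale :: "real \<Rightarrow> 'e \<Rightarrow> 'e"

text \<open>The fibre model is the type \<open>'v\<close>, so the rank is \<open>DIM('v)\<close>, which is at least 1.
  The vector space axioms of the fibres follow from the fibrewise linear trivializations \<open>\<tau>\<close>.\<close>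

definition smooth_vector_bundle ::
    "'v::euclidean_space itself \<Rightarrow>
     ('e, 'k::{real_normed_vector, heine_borel}, 'b, 'm::{real_normed_vector, heine_borel}) vbundle \<Rightarrow> bool"
  where
  "smooth_vector_bundle (_ :: 'v itself) V \<longleftrightarrow>
     smooth_manifold (total V) \<and> smooth_manifold (base V) \<and>
     smooth_map (total V) (base V) (proj V) \<and>
     (\<forall>x\<in>pts (total V). \<forall>y\<in>pts (total V). proj V x = proj V y \<longrightarrow>
        vadd V x y \<in> pts (total V) \<and> proj V (vadd V x y) = proj V x) \<and>
     (\<forall>a. \<forall>x\<in>pts (total V). vscale V a x \<in> pts (total V) \<and> proj V (vscale V a x) = proj V x) \<and>
     (\<forall>b\<in>pts (base V). \<exists>W (\<tau> :: 'e \<Rightarrow> 'v). openin (mtop (base V)) W \<and> b \<in> W \<and>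
        diffeo (submanifold_open (total V) (proj V -` W))
               (prod_manifold (submanifold_open (base V) W) vector_manifold)
               (\<lambda>x. (proj V x, \<tau> x)) \<and>
        (\<forall>x\<in>pts (total V). \<forall>y\<in>pts (total V). proj V x \<in> W \<and> proj V x = proj V y \<longrightarrow>
           \<tau> (vadd V x y) = \<tau> x + \<tau> y) \<and>
        (\<forall>a. \<forall>x\<in>pts (total V). proj V x \<in> W \<longrightarrow> \<tau> (vscale V a x) = a *\<^sub>R \<tau> x))"

definition zero_section :: "('e, 'k, 'b, 'm) vbundle \<Rightarrow> 'e set" where
  "zero_section V = vscale V 0 ` pts (total V)"

definition homogeneous :: "nat \<Rightarrow> ('e, 'k, 'b, 'm) vbundle \<Rightarrow> ('e \<Rightarrow> real) \<Rightarrow> bool" where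
  "homogeneous k V f \<longleftrightarrow> (\<forall>t\<ge>0. \<forall>x\<in>pts (total V). f (vscale V t x) = t ^ k * f x)"

definition definite :: "('e, 'k, 'b, 'm) vbundle \<Rightarrow> ('e \<Rightarrow> real) \<Rightarrow> bool" where
  "definite V f \<longleftrightarrow> (\<forall>x\<in>pts (total V) - zero_section V. f x > 0)"


section \<open>Gluing\<close>

text \<open>The manifold \<open>M \<union>\<^sub>\<xi> N\<close> obtained by gluing \<open>x \<in> D \<subseteq> M\<close> to \<open>\<xi> x \<in> N\<close>.  It has the quotient topology,
  and the charts of \<open>M\<close> and \<open>N\<close> transported along the natural maps \<open>glue_inl\<close> and \<open>glue_inr\<close>.\<close>

definition glue_rel ::
    "'p set \<Rightarrow> 'q set \<Rightarrow> 'p set \<Rightarrow> ('p \<Rightarrow> 'q) \<Rightarrow> (('p + 'q) \<times> ('p + 'q)) set" where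
  "glue_rel A B D \<xi> =
     Id_on (A <+> B) \<union> (\<lambda>x. (Inl x, Inr (\<xi> x))) ` D \<union> (\<lambda>x. (Inr (\<xi> x), Inl x)) ` D"

definition glue_inl ::
    "('p, 'm) manifold \<Rightarrow> ('q, 'm) manifold \<Rightarrow> 'p set \<Rightarrow> ('p \<Rightarrow> 'q) \<Rightarrow> 'p \<Rightarrow> ('p + 'q) set" where
  "glue_inl M N D \<xi> x = glue_rel (pts M) (pts N) D \<xi> `` {Inl x}"

definition glue_inr ::
    "('p, 'm) manifold \<Rightarrow> ('q, 'm) manifold \<Rightarrow> 'p set \<Rightarrow> ('p \<Rightarrow> 'q) \<Rightarrow> 'q \<Rightarrow> ('p + 'q) set" where
  "glue_inr M N D \<xi> y = glue_rel (pts M) (pts N) D \<xi> `` {Inr y}"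

definition glue_topology ::
    "('p, 'm) manifold \<Rightarrow> ('q, 'm) manifold \<Rightarrow> 'p set \<Rightarrow> ('p \<Rightarrow> 'q) \<Rightarrow> ('p + 'q) set topology" where
  "glue_topology M N D \<xi> = topology (\<lambda>W.
     W \<subseteq> (pts M <+> pts N) // glue_rel (pts M) (pts N) D \<xi> \<and>
     openin (mtop M) {x \<in> pts M. glue_inl M N D \<xi> x \<in> W} \<and>
     openin (mtop N) {y \<in> pts N. glue_inr M N D \<xi> y \<in> W})"

lemma openin_glue_topology:
  "openin (glue_topology M N D \<xi>) W \<longleftrightarrow>
     W \<subseteq> (pts M <+> pts N) // glue_rel (pts M) (pts N) D \<xi> \<and>
     openin (mtop M) {x \<in> pts M. glue_inl M N D \<xi> x \<in> W} \<and>
     openin (mtop N) {y \<in> pts N. glue_inr M N D \<xi> y \<in> W}"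
proof -
  have coll: "{x \<in> X. g x \<in> A \<inter> B} = {x \<in> X. g x \<in> A} \<inter> {x \<in> X. g x \<in> B}"
             "{x \<in> X. g x \<in> \<Union>\<K>} = (\<Union>K\<in>\<K>. {x \<in> X. g x \<in> K})"
    for X :: "'x set" and g :: "'x \<Rightarrow> 'y" and A B \<K> by auto
  have "istopology (\<lambda>W.
     W \<subseteq> (pts M <+> pts N) // glue_rel (pts M) (pts N) D \<xi> \<and>
     openin (mtop M) {x \<in> pts M. glue_inl M N D \<xi> x \<in> W} \<and>
     openin (mtop N) {y \<in> pts N. glue_inr M N D \<xi> y \<in> W})"
    unfolding istopology_def coll
    by (intro conjI allI impI openin_Int openin_Union Union_least; (elim conjE)?; auto)
  then show ?thesis
    unfolding glue_topology_def by (simp add: topology_inverse')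
qed

definition glue ::
    "('p, 'm) manifold \<Rightarrow> ('q, 'm) manifold \<Rightarrow> 'p set \<Rightarrow> ('p \<Rightarrow> 'q) \<Rightarrow> (('p + 'q) set, 'm) manifold" where
  "glue M N D \<xi> =
     \<lparr>mtop = glue_topology M N D \<xi>,
      charts =
        (\<lambda>(U, c). (glue_inl M N D \<xi> ` U, c \<circ> inv_into (pts M) (glue_inl M N D \<xi>))) ` charts M \<union>
        (\<lambda>(V, d). (glue_inr M N D \<xi> ` V, d \<circ> inv_into (pts N) (glue_inr M N D \<xi>))) ` charts N\<rparr>"


section \<open>The manifold \<open>L\<^sub>\<xi>\<close> and the function on it\<close>

text \<open>Both total spaces have the same model type \<open>'k\<close>.  This is no restriction, as a
  diffeomorphism between (nonempty) level sets forces the total spaces to have the same dimension.\<close>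

definition level_one :: "('e, 'k, 'b, 'm) vbundle \<Rightarrow> ('e \<Rightarrow> real) \<Rightarrow> 'e set" where
  "level_one V f = {x \<in> pts (total V). f x = 1}"

definition open_tube :: "('e, 'k, 'b, 'm) vbundle \<Rightarrow> ('e \<Rightarrow> real) \<Rightarrow> ('e, 'k) manifold" where
  "open_tube V f = submanifold_open (total V) {x. 0 \<le> f x \<and> f x < 1}"

definition xi_map ::
    "('e0, 'k, 'b0, 'm0) vbundle \<Rightarrow> ('e0 \<Rightarrow> real) \<Rightarrow> ('e1, 'k, 'b1, 'm1) vbundle \<Rightarrow> ('e0 \<Rightarrow> 'e1) \<Rightarrow> 'e0 \<Rightarrow> 'e1"
  where
  "xi_map V\<^sub>0 f\<^sub>0 V\<^sub>1 \<psi> x = vscale V\<^sub>1 (sqrt (1 - f\<^sub>0 x)) (\<psi> (vscale V\<^sub>0 (1 / sqrt (f\<^sub>0 x)) x))"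

definition L_xi ::
    "('e0, 'k, 'b0, 'm0) vbundle \<Rightarrow> ('e0 \<Rightarrow> real) \<Rightarrow> ('e1, 'k, 'b1, 'm1) vbundle \<Rightarrow> ('e1 \<Rightarrow> real) \<Rightarrow>
     ('e0 \<Rightarrow> 'e1) \<Rightarrow> (('e0 + 'e1) set, 'k) manifold" where
  "L_xi V\<^sub>0 f\<^sub>0 V\<^sub>1 f\<^sub>1 \<psi> =
     glue (open_tube V\<^sub>0 f\<^sub>0) (open_tube V\<^sub>1 f\<^sub>1)
       (pts (open_tube V\<^sub>0 f\<^sub>0) - zero_section V\<^sub>0) (xi_map V\<^sub>0 f\<^sub>0 V\<^sub>1 \<psi>)"

definition emb0 ::
    "('e0, 'k, 'b0, 'm0) vbundle \<Rightarrow> ('e0 \<Rightarrow> real) \<Rightarrow> ('e1, 'k, 'b1, 'm1) vbundle \<Rightarrow> ('e1 \<Rightarrow> real) \<Rightarrow>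
     ('e0 \<Rightarrow> 'e1) \<Rightarrow> 'e0 \<Rightarrow> ('e0 + 'e1) set" where
  "emb0 V\<^sub>0 f\<^sub>0 V\<^sub>1 f\<^sub>1 \<psi> =
     glue_inl (open_tube V\<^sub>0 f\<^sub>0) (open_tube V\<^sub>1 f\<^sub>1)
       (pts (open_tube V\<^sub>0 f\<^sub>0) - zero_section V\<^sub>0) (xi_map V\<^sub>0 f\<^sub>0 V\<^sub>1 \<psi>)"

definition emb1 ::
    "('e0, 'k, 'b0, 'm0) vbundle \<Rightarrow> ('e0 \<Rightarrow> real) \<Rightarrow> ('e1, 'k, 'b1, 'm1) vbundle \<Rightarrow> ('e1 \<Rightarrow> real) \<Rightarrow>
     ('e0 \<Rightarrow> 'e1) \<Rightarrow> 'e1 \<Rightarrow> ('e0 + 'e1) set" where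
  "emb1 V\<^sub>0 f\<^sub>0 V\<^sub>1 f\<^sub>1 \<psi> =
     glue_inr (open_tube V\<^sub>0 f\<^sub>0) (open_tube V\<^sub>1 f\<^sub>1)
       (pts (open_tube V\<^sub>0 f\<^sub>0) - zero_section V\<^sub>0) (xi_map V\<^sub>0 f\<^sub>0 V\<^sub>1 \<psi>)"

definition f_xi ::
    "('e0, 'k, 'b0, 'm0) vbundle \<Rightarrow> ('e0 \<Rightarrow> real) \<Rightarrow> ('e1, 'k, 'b1, 'm1) vbundle \<Rightarrow> ('e1 \<Rightarrow> real) \<Rightarrow>
     ('e0 \<Rightarrow> 'e1) \<Rightarrow> ('e0 + 'e1) set \<Rightarrow> real" where
  "f_xi V\<^sub>0 f\<^sub>0 V\<^sub>1 f\<^sub>1 \<psi> = (THE f. f \<in> extensional (pts (L_xi V\<^sub>0 f\<^sub>0 V\<^sub>1 f\<^sub>1 \<psi>)) \<and>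
     (\<forall>x\<in>pts (open_tube V\<^sub>0 f\<^sub>0). f (emb0 V\<^sub>0 f\<^sub>0 V\<^sub>1 f\<^sub>1 \<psi> x) = f\<^sub>0 x) \<and>
     (\<forall>y\<in>pts (open_tube V\<^sub>1 f\<^sub>1). f (emb1 V\<^sub>0 f\<^sub>0 V\<^sub>1 f\<^sub>1 \<psi> y) = 1 - f\<^sub>1 y))"


section \<open>Topological groups and short exact sequences\<close>

record 'a tgroup = "'a monoid" +
  gtop :: "'a topology"

definition tsubgroup :: "'a tgroup \<Rightarrow> 'a set \<Rightarrow> 'a tgroup" where
  "tsubgroup G S = G\<lparr>carrier := S, gtop := subtopology (gtop G) S\<rparr>"

definition tprod :: "'a tgroup \<Rightarrow> 'b tgroup \<Rightarrow> ('a \<times> 'b) tgroup" where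
  "tprod G H = \<lparr>carrier = carrier (G \<times>\<times> H), mult = mult (G \<times>\<times> H), one = one (G \<times>\<times> H),
     gtop = prod_topology (gtop G) (gtop H)\<rparr>"

definition tgroup_hom :: "'a tgroup \<Rightarrow> 'b tgroup \<Rightarrow> ('a \<Rightarrow> 'b) \<Rightarrow> bool" where
  "tgroup_hom G H f \<longleftrightarrow> f \<in> hom G H \<and> continuous_map (gtop G) (gtop H) f"

definition tgroup_isomorphisms :: "'a tgroup \<Rightarrow> 'b tgroup \<Rightarrow> ('a \<Rightarrow> 'b) \<Rightarrow> ('b \<Rightarrow> 'a) \<Rightarrow> bool" where
  "tgroup_isomorphisms G H f g \<longleftrightarrow>
     group_isomorphisms G H f g \<and> homeomorphic_maps (gtop G) (gtop H) f g"

definition tgroup_iso :: "'a tgroup \<Rightarrow> 'b tgroup \<Rightarrow> ('a \<Rightarrow> 'b) \<Rightarrow> bool" where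
  "tgroup_iso G H f \<longleftrightarrow> f \<in> iso G H \<and> homeomorphic_map (gtop G) (gtop H) f"

text \<open>A section of \<open>q : G \<rightarrow> H\<close> as a continuous homomorphism.\<close>

definition tgroup_section :: "'a tgroup \<Rightarrow> 'b tgroup \<Rightarrow> ('a \<Rightarrow> 'b) \<Rightarrow> ('b \<Rightarrow> 'a) \<Rightarrow> bool" where
  "tgroup_section G H q s \<longleftrightarrow> tgroup_hom H G s \<and> (\<forall>y\<in>carrier H. q (s y) = y)"

text \<open>The sequence \<open>1 \<rightarrow> A \<rightarrow> G \<rightarrow> H \<rightarrow> 1\<close> with maps \<open>j\<close> and \<open>q\<close>.  The library's
  \<^const>\<open>short_exact_sequence\<close> requires the three groups to have the same element type.\<close>

definition tgroup_ses ::
    "'a tgroup \<Rightarrow> ('a \<Rightarrow> 'b) \<Rightarrow> 'b tgroup \<Rightarrow> ('b \<Rightarrow> 'c) \<Rightarrow> 'c tgroup \<Rightarrow> bool" where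
  "tgroup_ses A j G q H \<longleftrightarrow> group A \<and> group G \<and> group H \<and>
     tgroup_hom A G j \<and> tgroup_hom G H q \<and>
     j \<in> mon A G \<and> q \<in> epi G H \<and> j ` carrier A = kernel G H q"

definition ses_isomorphism ::
    "('a \<Rightarrow> 'd) \<Rightarrow> ('b \<Rightarrow> 'e) \<Rightarrow> ('c \<Rightarrow> 'f) \<Rightarrow>
     'a tgroup \<Rightarrow> ('a \<Rightarrow> 'b) \<Rightarrow> 'b tgroup \<Rightarrow> ('b \<Rightarrow> 'c) \<Rightarrow> 'c tgroup \<Rightarrow>
     'd tgroup \<Rightarrow> ('d \<Rightarrow> 'e) \<Rightarrow> 'e tgroup \<Rightarrow> ('e \<Rightarrow> 'f) \<Rightarrow> 'f tgroup \<Rightarrow> bool" where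
  "ses_isomorphism \<alpha> \<beta> \<gamma> A j G q H A' j' G' q' H' \<longleftrightarrow>
     tgroup_ses A j G q H \<and> tgroup_ses A' j' G' q' H' \<and>
     tgroup_iso A A' \<alpha> \<and> tgroup_iso G G' \<beta> \<and> tgroup_iso H H' \<gamma> \<and>
     (\<forall>x\<in>carrier A. \<beta> (j x) = j' (\<alpha> x)) \<and> (\<forall>x\<in>carrier G. \<gamma> (q x) = q' (\<beta> x))"

definition strong_deformation_retract :: "'a topology \<Rightarrow> 'a set \<Rightarrow> bool" where
  "strong_deformation_retract X S \<longleftrightarrow> S \<subseteq> topspace X \<and>
     (\<exists>r. r ` topspace X \<subseteq> S \<and> homotopic_with (\<lambda>k. \<forall>x\<in>S. k x = x) X X id r)"


section \<open>Diffeomorphism groups\<close>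

definition smooth_maps ::
    "('p, 'm::real_normed_vector) manifold \<Rightarrow> ('q, 'n::real_normed_vector) manifold \<Rightarrow> ('p \<Rightarrow> 'q) set" where
  "smooth_maps M N = {f \<in> pts M \<rightarrow>\<^sub>E pts N. smooth_map M N f}"

text \<open>The (weak) \<open>C\<^sup>\<infinity>\<close> topology: uniform closeness on a compact subset of a chart domain of the
  local representations and of their derivatives up to order \<open>r\<close>.\<close>

definition Cinf_nbhd ::
    "('p, 'm::real_normed_vector) manifold \<Rightarrow> ('q, 'n::real_normed_vector) manifold \<Rightarrow> ('p \<Rightarrow> 'q) \<Rightarrow>
     'p set \<times> ('p \<Rightarrow> 'm) \<Rightarrow> 'q set \<times> ('q \<Rightarrow> 'n) \<Rightarrow> 'p set \<Rightarrow> nat \<Rightarrow> real \<Rightarrow> ('p \<Rightarrow> 'q) set" where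
  "Cinf_nbhd M N f C D K r \<epsilon> = {g \<in> smooth_maps M N. g ` K \<subseteq> fst D \<and>
     (\<forall>x\<in>K. \<forall>vs. length vs \<le> r \<and> (\<forall>v\<in>set vs. norm v \<le> 1) \<longrightarrow>
        norm (dderiv (loc_dom C D g) (loc_rep C D g) vs (snd C x)
            - dderiv (loc_dom C D f) (loc_rep C D f) vs (snd C x)) < \<epsilon>)}"

definition Cinf_topology ::
    "('p, 'm::real_normed_vector) manifold \<Rightarrow> ('q, 'n::real_normed_vector) manifold \<Rightarrow> ('p \<Rightarrow> 'q) topology"
  where
  "Cinf_topology M N = topology_generated_by (insert (smooth_maps M N)
     {Cinf_nbhd M N f C D K r \<epsilon> | f C D K r \<epsilon>.
        f \<in> smooth_maps M N \<and> C \<in> charts M \<and> D \<in> charts N \<and>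
        compactin (mtop M) K \<and> K \<subseteq> fst C \<and> f ` K \<subseteq> fst D \<and> \<epsilon> > 0})"

text \<open>As in \<^const>\<open>BijGroup\<close>, elements are functions that are \<open>undefined\<close> outside \<open>M\<close>.\<close>

definition Diff :: "('p, 'm::real_normed_vector) manifold \<Rightarrow> ('p \<Rightarrow> 'p) tgroup" where
  "Diff M = \<lparr>carrier = {h \<in> Bij (pts M). diffeo M M h},
     mult = mult (BijGroup (pts M)), one = one (BijGroup (pts M)),
     gtop = subtopology (Cinf_topology M M) {h \<in> Bij (pts M). diffeo M M h}\<rparr>"

definition Diff_interval_plus :: "(real \<Rightarrow> real) tgroup" where
  "Diff_interval_plus = tsubgroup (Diff unit_interval)
     {\<phi> \<in> carrier (Diff unit_interval). \<forall>t\<in>{0..1}. vector_derivative \<phi> (at t within {0..1}) > 0}"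

definition leaf :: "('p, 'm) manifold \<Rightarrow> ('p \<Rightarrow> real) \<Rightarrow> real \<Rightarrow> 'p set" where
  "leaf M f t = {z \<in> pts M. f z = t}"

definition leaves :: "('p, 'm) manifold \<Rightarrow> ('p \<Rightarrow> real) \<Rightarrow> 'p set set" where
  "leaves M f = leaf M f ` {0..1}"

definition D_fol :: "('p, 'm::real_normed_vector) manifold \<Rightarrow> 'p set set \<Rightarrow> ('p \<Rightarrow> 'p) tgroup" where
  "D_fol M \<F> = tsubgroup (Diff M) {h \<in> carrier (Diff M). \<forall>l\<in>\<F>. h ` l \<in> \<F>}"

definition D_lp :: "('p, 'm::real_normed_vector) manifold \<Rightarrow> 'p set set \<Rightarrow> ('p \<Rightarrow> 'p) tgroup" where
  "D_lp M \<F> = tsubgroup (Diff M) {h \<in> carrier (Diff M). \<forall>l\<in>\<F>. h ` l = l}"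

definition D_fol_plus :: "('p, 'm::real_normed_vector) manifold \<Rightarrow> ('p \<Rightarrow> real) \<Rightarrow> ('p \<Rightarrow> 'p) tgroup" where
  "D_fol_plus M f = tsubgroup (Diff M) {h \<in> carrier (D_fol M (leaves M f)).
     h ` leaf M f 0 = leaf M f 0 \<and> h ` leaf M f 1 = leaf M f 1}"

definition S_R :: "('p, 'm::real_normed_vector) manifold \<Rightarrow> ('p \<Rightarrow> real) \<Rightarrow> ('p \<Rightarrow> 'p) tgroup" where
  "S_R M f = tsubgroup (Diff M) {h \<in> carrier (Diff M). \<forall>z\<in>pts M. f (h z) = f z}"

definition S_LR ::
    "('p, 'm::real_normed_vector) manifold \<Rightarrow> ('p \<Rightarrow> real) \<Rightarrow> ((real \<Rightarrow> real) \<times> ('p \<Rightarrow> 'p)) tgroup" where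
  "S_LR M f = tsubgroup (tprod (Diff unit_interval) (Diff M))
     {(\<phi>, h). \<phi> \<in> carrier (Diff unit_interval) \<and> h \<in> carrier (Diff M) \<and>
        (\<forall>z\<in>pts M. \<phi> (f z) = f (h z))}"

definition S_LR_plus ::
    "('p, 'm::real_normed_vector) manifold \<Rightarrow> ('p \<Rightarrow> real) \<Rightarrow> ((real \<Rightarrow> real) \<times> ('p \<Rightarrow> 'p)) tgroup" where
  "S_LR_plus M f = tsubgroup (S_LR M f)
     {(\<phi>, h) \<in> carrier (S_LR M f). \<phi> \<in> carrier Diff_interval_plus}"


section \<open>The homomorphisms \<open>\<sigma>\<close> and \<open>\<theta>\<close>\<close>

definition sigma ::
    "('p, 'm) manifold \<Rightarrow> ('p \<Rightarrow> real) \<Rightarrow> ('p \<Rightarrow> 'p) \<Rightarrow> real \<Rightarrow> real" where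
  "sigma M f h = (THE \<phi>. \<phi> \<in> carrier (Diff unit_interval) \<and> (\<forall>z\<in>pts M. \<phi> (f z) = f (h z)))"

text \<open>The factor \<open>g\<close> in \<open>\<phi> t = t * g t\<close>.\<close>

definition theta_factor :: "(real \<Rightarrow> real) \<Rightarrow> real \<Rightarrow> real" where
  "theta_factor \<phi> = (THE g. g \<in> extensional {0..1} \<and> smooth_on {0..1} g \<and>
     (\<forall>t\<in>{0..1}. g t > 0 \<and> \<phi> t = t * g t))"

definition theta ::
    "('e0, 'k::real_normed_vector, 'b0, 'm0) vbundle \<Rightarrow> ('e0 \<Rightarrow> real) \<Rightarrow>
     ('e1, 'k, 'b1, 'm1) vbundle \<Rightarrow> ('e1 \<Rightarrow> real) \<Rightarrow> ('e0 \<Rightarrow> 'e1) \<Rightarrow>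
     (real \<Rightarrow> real) \<Rightarrow> ('e0 + 'e1) set \<Rightarrow> ('e0 + 'e1) set" where
  "theta V\<^sub>0 f\<^sub>0 V\<^sub>1 f\<^sub>1 \<psi> \<phi> = (THE h. h \<in> carrier (Diff (L_xi V\<^sub>0 f\<^sub>0 V\<^sub>1 f\<^sub>1 \<psi>)) \<and>
     (\<forall>x\<in>pts (open_tube V\<^sub>0 f\<^sub>0). h (emb0 V\<^sub>0 f\<^sub>0 V\<^sub>1 f\<^sub>1 \<psi> x) =
        emb0 V\<^sub>0 f\<^sub>0 V\<^sub>1 f\<^sub>1 \<psi> (vscale V\<^sub>0 (sqrt (theta_factor \<phi> (f\<^sub>0 x))) x)) \<and>
     (\<forall>y\<in>pts (open_tube V\<^sub>1 f\<^sub>1). h (emb1 V\<^sub>0 f\<^sub>0 V\<^sub>1 f\<^sub>1 \<psi> y) =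
        emb1 V\<^sub>0 f\<^sub>0 V\<^sub>1 f\<^sub>1 \<psi>
          (vscale V\<^sub>1 (sqrt (theta_factor (\<lambda>t. 1 - \<phi> (1 - t)) (f\<^sub>1 y))) y)))"

end

theory Submission
  imports Defs
begin

text \<open>
  A diffeomorphism \<open>h\<close> that permutes the leaves induces a map \<open>\<sigma>(h)\<close> of \<open>[0;1]\<close>.  On a fibre
  line normalized to \<open>f\<^sub>0 = u\<^sup>2\<close> the function \<open>u \<mapsto> \<sigma>(h)(u\<^sup>2)\<close> is smooth and even, so \<open>\<sigma>(h)\<close> is smooth up to the
  end points by Whitney's theorem.  The pairs \<open>(\<phi>, h)\<close> with \<open>\<phi> \<circ> f = f \<circ> h\<close> form the graph of \<open>\<sigma>\<close>, which
  makes \<open>p\<^sub>2\<close> an isomorphism.  Hadamard's quotients \<open>\<phi>\<^sub>i(t)/t\<close> are smooth and positive, and rescaling the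
  fibres by their square roots gives the section \<open>\<theta>\<close>.  All continuity statements reduce to one exponential law:
  a map into a space of smooth maps with the \<open>C\<^sup>\<infinity>\<close> topology is continuous if and only if it is a
  family of maps whose derivatives are jointly continuous in the parameter and the point, so it suffices to carry
  a continuous parameter through the calculus.  The retraction is
  \<open>(s, h) \<mapsto> \<theta>((1 - s) id + s \<sigma>(h)\<^sup>-\<^sup>1) \<circ> h\<close>.
\<close>

text \<open>Families are never differentiated in the parameter. Hence any topological space can be a
  parameter space, in particular a diffeomorphism group itself, and the tautological family over it
  turns the calculus into continuity of \<open>\<sigma>\<close>, of \<open>\<theta>\<close> and of
  the retraction; estimates on neighbourhoods of maps occur only in the exponential law. The
  obstacle is the singular leaves. There f is critical, and on a fibre line the level t is the
  square of the coordinate u, so a smooth function of u need not be smooth in t. Evenness in u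
  repairs this. It is available because a smooth function that is positively homogeneous of degree 2
  takes equal values at x and -x. A foliated h need not respect fibres; only the values of f along
  the image of one line enter. The retraction rests on convexity: increasing diffeomorphisms of the
  interval with fixed ends form a convex set. The map at time s has the reparametrization (1 - s)
  \<open>\<sigma>(h)\<close> + s id, which runs from \<open>\<sigma>(h)\<close> to the identity and
  does not move if \<open>\<sigma>(h)\<close> is already the identity. For orientation reversing
  reparametrizations there is no \<open>\<theta>\<close>; surjectivity of \<open>\<sigma>\<close>
  then rests on one h that swaps the ends.\<close>

section \<open>Smooth functions with a continuous parameter\<close>

text \<open>Derivatives within \<open>Q\<close> are unique.  The model sets in use are the whole space and the unit
  interval, for which manifold and manifold with boundary are treated at once.\<close>

definition fat :: "'a::real_normed_vector set \<Rightarrow> bool" where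
  "fat Q \<longleftrightarrow> (\<forall>x\<in>Q. \<exists>B. span B = UNIV \<and>
     (\<forall>b\<in>B. \<forall>e>0. \<exists>d. 0 < \<bar>d\<bar> \<and> \<bar>d\<bar> < e \<and> x + d *\<^sub>R b \<in> Q))"

text \<open>The difference of two derivatives is a derivative of the zero function. A nonzero value
  on a direction along which \<open>Q\<close> is reached would violate the first-order bound at
  small multiples of it, and such directions span the space.\<close>

lemma fat_unique:
  fixes f :: "'a::real_normed_vector \<Rightarrow> 'b::real_normed_vector"
  assumes "fat Q" "x \<in> Q" and D: "(f has_derivative D) (at x within Q)"
    and D': "(f has_derivative D') (at x within Q)"
  shows "D = D'"
proof -
  obtain B where B: "span B = UNIV"
    and tan: "\<forall>b\<in>B. \<forall>e>0. \<exists>d. 0 < \<bar>d\<bar> \<and> \<bar>d\<bar> < e \<and> x + d *\<^sub>R b \<in> Q"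
    using assms(1,2) unfolding fat_def by metis
  define F where "F = (\<lambda>v. D v - D' v)"
  have F: "((\<lambda>y. 0::'b) has_derivative F) (at x within Q)"
    using has_derivative_diff[OF D D'] by (simp add: F_def)
  then have lin: "linear F"
    by (rule has_derivative_linear)
  have "F b = 0" if bB: "b \<in> B" for b
  proof (rule ccontr)
    assume Fb: "F b \<noteq> 0"
    then have b: "b \<noteq> 0"
      using linear_0[OF lin] by auto
    \<comment> \<open>With this error rate, \<open>norm (F b)\<close> is bounded by half of
      itself.\<close>
    define e where "e = norm (F b) / (2 * norm b)"
    have "e > 0" using Fb b by (simp add: e_def)
    with F obtain d where d: "d > 0"
      "\<And>y. y \<in> Q \<Longrightarrow> norm (y - x) < d \<Longrightarrow> norm (F (y - x)) \<le> e * norm (y - x)"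
      unfolding has_derivative_within_alt by fastforce
    obtain t where t: "0 < \<bar>t\<bar>" "\<bar>t\<bar> < d / norm b" "x + t *\<^sub>R b \<in> Q"
      using tan[rule_format, OF bB, of "d / norm b"] d(1) b by auto
    have "norm (F (t *\<^sub>R b)) \<le> e * norm (t *\<^sub>R b)"
      using d(2)[OF t(3)] t(2) b by (simp add: field_simps)
    then have "\<bar>t\<bar> * norm (F b) \<le> e * (\<bar>t\<bar> * norm b)"
      by (simp add: linear_cmul[OF lin])
    also have "\<dots> = \<bar>t\<bar> * (norm (F b) / 2)"
      using b by (simp add: e_def)
    finally have "\<bar>t\<bar> * norm (F b) \<le> 0"
      by simp
    moreover have "\<bar>t\<bar> * norm (F b) > 0"
      using t(1) Fb by simp
    ultimately show False by linarith
  qed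
  then have "F v = 0" for v
    using linear_eq_0_on_span[OF lin, of B v] B by auto
  then show ?thesis
    by (auto simp: F_def fun_eq_iff)
qed

lemma fat_UNIV: "fat UNIV"
  unfolding fat_def
proof (intro ballI exI[of _ UNIV] conjI allI impI)
  show "span UNIV = (UNIV :: 'a set)"
    by (rule span_UNIV)
  fix x b :: 'a and e :: real assume "e > 0"
  then show "\<exists>d. 0 < \<bar>d\<bar> \<and> \<bar>d\<bar> < e \<and> x + d *\<^sub>R b \<in> UNIV"
    by (intro exI[of _ "e/2"]) auto
qed

lemma fat_unit_interval: "fat {0..1::real}"
  unfolding fat_def
proof (intro ballI exI[of _ "{1::real}"] conjI allI impI)
  show "span {1::real} = UNIV"
    by (simp add: span_singleton)
  fix x b e :: real assume x: "x \<in> {0..1}" and b: "b \<in> {1}" and "e > 0"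
  show "\<exists>d. 0 < \<bar>d\<bar> \<and> \<bar>d\<bar> < e \<and> x + d *\<^sub>R b \<in> {0..1}"
  \<comment> \<open>The step points away from the nearer end, so it stays in the interval; at an end
    point this is the one-sided direction.\<close>
  proof (cases "x \<le> 1/2")
    case True
    then show ?thesis using x b \<open>e > 0\<close> by (intro exI[of _ "min (e/2) (1/2)"]) auto
  next
    case False
    then show ?thesis using x b \<open>e > 0\<close> by (intro exI[of _ "- min (e/2) (1/2)"]) auto
  qed
qed

lemma at_within_openin:
  assumes "openin (top_of_set Q) S" "x \<in> S"
  shows "at x within S = at x within Q"
proof -
  obtain T where "open T" "S = Q \<inter> T"
    using assms(1) by (auto simp: openin_open)
  then show ?thesis
    using assms(2) by (intro at_within_nhd[of x T]) auto
qed

section \<open>Open domains in the product of a parameter space and a model set\<close>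

abbreviation ptop :: "'a::real_normed_vector set \<Rightarrow> 'x topology \<Rightarrow> ('x \<times> 'a) topology" where
  "ptop Q X \<equiv> prod_topology X (top_of_set Q)"

definition pdom :: "'a::real_normed_vector set \<Rightarrow> 'x topology \<Rightarrow> ('x \<times> 'a) set \<Rightarrow> bool" where
  "pdom Q X W \<longleftrightarrow> fat Q \<and> openin (ptop Q X) W"

lemma pdom_fat: "pdom Q X W \<Longrightarrow> fat Q"
  by (simp add: pdom_def)

lemma pdom_sub:
  assumes "pdom Q X W" "(p, x) \<in> W" shows "p \<in> topspace X" "x \<in> Q"
  using assms openin_subset[of "ptop Q X" W] by (auto simp: pdom_def)

lemma pdom_Int: "pdom Q X W \<Longrightarrow> pdom Q X W' \<Longrightarrow> pdom Q X (W \<inter> W')"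
  by (auto simp: pdom_def)

lemma pdom_box:
  "fat Q \<Longrightarrow> openin X A \<Longrightarrow> openin (top_of_set Q) S \<Longrightarrow> pdom Q X (A \<times> S)"
  by (auto simp: pdom_def openin_prod_Times_iff)

lemma pdom_slice:
  assumes "pdom Q X W"
  shows "openin (top_of_set Q) (W `` {p})"
proof (cases "p \<in> topspace X")
  case True
  have "continuous_map (top_of_set Q) (ptop Q X) (\<lambda>x. (p, x))"
    using True by (simp add: continuous_map_pairwise o_def)
  from openin_continuous_map_preimage[OF this] assms
  have "openin (top_of_set Q) {x \<in> topspace (top_of_set Q). (p, x) \<in> W}"
    by (auto simp: pdom_def)
  moreover have "{x \<in> topspace (top_of_set Q). (p, x) \<in> W} = W `` {p}"
    using pdom_sub[OF assms] by auto
  ultimately show ?thesis by simp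
next
  case False
  then have "W `` {p} = {}"
    using pdom_sub[OF assms] by auto
  then show ?thesis by simp
qed

text \<open>Slices are open in \<open>Q\<close>. This reconciles derivatives within a slice, as in
  \<open>dderiv\<close>, with derivatives within the fixed set \<open>Q\<close>, as in
  \<open>psm\<close>.\<close>

lemma pdom_at_within:
  "pdom Q X W \<Longrightarrow> (p, x) \<in> W \<Longrightarrow> at x within (W `` {p}) = at x within Q"
  by (rule at_within_openin) (auto intro: pdom_slice)

lemma pdom_eventually:
  assumes "pdom Q X W" "(p, x) \<in> W"
  shows "\<forall>\<^sub>F y in at x within Q. (p, y) \<in> W"
proof -
  have "\<forall>\<^sub>F y in at x within (W `` {p}). (p, y) \<in> W"
    by (auto simp: eventually_at_filter)
  then show ?thesis
    by (simp add: pdom_at_within[OF assms])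
qed

text \<open>Differentiation takes place in the second argument only; the parameter is continuous.\<close>

primrec psm :: "'a::real_normed_vector set \<Rightarrow> 'x topology \<Rightarrow> ('x \<times> 'a) set \<Rightarrow> nat \<Rightarrow>
    ('x \<times> 'a \<Rightarrow> 'b::real_normed_vector) \<Rightarrow> bool" where
  "psm Q X W 0 F \<longleftrightarrow> continuous_map (subtopology (ptop Q X) W) euclidean F"
| "psm Q X W (Suc n) F \<longleftrightarrow> continuous_map (subtopology (ptop Q X) W) euclidean F \<and>
     (\<exists>F'. (\<forall>p x. (p, x) \<in> W \<longrightarrow> ((\<lambda>y. F (p, y)) has_derivative F' (p, x)) (at x within Q)) \<and>
        (\<forall>v. norm v \<le> 1 \<longrightarrow> psm Q X W n (\<lambda>z. F' z v)))"

definition psmooth where "psmooth Q X W F \<longleftrightarrow> pdom Q X W \<and> (\<forall>n. psm Q X W n F)"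

lemma psmooth_pdom: "psmooth Q X W F \<Longrightarrow> pdom Q X W"
  by (simp add: psmooth_def)

lemma psm_cont: "psm Q X W n F \<Longrightarrow> continuous_map (subtopology (ptop Q X) W) euclidean F"
  by (cases n) auto

lemma psm_SucI:
  assumes "continuous_map (subtopology (ptop Q X) W) euclidean F"
    and "\<And>p x. (p, x) \<in> W \<Longrightarrow> ((\<lambda>y. F (p, y)) has_derivative F' (p, x)) (at x within Q)"
    and "\<And>v. norm v \<le> 1 \<Longrightarrow> psm Q X W n (\<lambda>z. F' z v)"
  shows "psm Q X W (Suc n) F"
  using assms by auto

lemma psm_SucE:
  assumes "psm Q X W (Suc n) F"
  obtains F' where "\<And>p x. (p, x) \<in> W \<Longrightarrow> ((\<lambda>y. F (p, y)) has_derivative F' (p, x)) (at x within Q)"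
    and "\<And>v. norm v \<le> 1 \<Longrightarrow> psm Q X W n (\<lambda>z. F' z v)"
  using assms by auto

lemma psm_SucD: "psm Q X W (Suc n) F \<Longrightarrow> psm Q X W n F"
proof (induction n arbitrary: F)
  case 0
  then show ?case by simp
next
  case (Suc n)
  then obtain F' where d: "\<And>p x. (p, x) \<in> W \<Longrightarrow> ((\<lambda>y. F (p, y)) has_derivative F' (p, x)) (at x within Q)"
    and F': "\<And>v. norm v \<le> 1 \<Longrightarrow> psm Q X W (Suc n) (\<lambda>z. F' z v)" by (metis psm_SucE)
  show ?case
    by (rule psm_SucI[where F' = F']) (use d Suc.IH[OF F'] psm_cont[OF Suc.prems] in auto)
qed

declare psm.simps(2) [simp del]

lemma psm_subset: "psm Q X W n F \<Longrightarrow> W' \<subseteq> W \<Longrightarrow> psm Q X W' n F"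
proof (induction n arbitrary: F)
  case 0
  then show ?case
    using continuous_map_from_subtopology_mono by (simp) blast
next
  case (Suc n)
  then obtain F' where "\<And>p x. (p, x) \<in> W \<Longrightarrow> ((\<lambda>y. F (p, y)) has_derivative F' (p, x)) (at x within Q)"
    and "\<And>v. norm v \<le> 1 \<Longrightarrow> psm Q X W n (\<lambda>z. F' z v)" by (metis psm_SucE)
  with Suc show ?case
    by (intro psm_SucI[where F' = F'])
      (auto intro: continuous_map_from_subtopology_mono[OF psm_cont[OF Suc.prems(1)]])
qed

text \<open>Agreement on \<open>W\<close> is enough for the derivatives too, since every slice of
  \<open>W\<close> is a neighbourhood, relative to \<open>Q\<close>, of each of its points.\<close>

lemma psm_cong:
  "pdom Q X W \<Longrightarrow> psm Q X W n F \<Longrightarrow> (\<And>z. z \<in> W \<Longrightarrow> F z = G z) \<Longrightarrow> psm Q X W n G"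
proof (induction n arbitrary: F G)
  case 0
  then show ?case
    by (auto elim!: continuous_map_eq)
next
  case (Suc n)
  then obtain F' where d: "\<And>p x. (p, x) \<in> W \<Longrightarrow> ((\<lambda>y. F (p, y)) has_derivative F' (p, x)) (at x within Q)"
    and F': "\<And>v. norm v \<le> 1 \<Longrightarrow> psm Q X W n (\<lambda>z. F' z v)" by (metis psm_SucE)
  show ?case
  proof (rule psm_SucI[where F' = F'])
    show "continuous_map (subtopology (ptop Q X) W) euclidean G"
      by (rule continuous_map_eq[OF psm_cont[OF Suc.prems(2)]]) (use Suc.prems in auto)
    fix p x assume px: "(p, x) \<in> W"
    show "((\<lambda>y. G (p, y)) has_derivative F' (p, x)) (at x within Q)"
      by (rule has_derivative_transform_eventually[OF d[OF px]])
        (use px pdom_eventually[OF Suc.prems(1) px] Suc.prems(3) pdom_sub[OF Suc.prems(1) px] in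
          \<open>auto elim!: eventually_mono\<close>)
  qed (use F' in auto)
qed

text \<open>The derivative in \<open>psm\<close> hides behind an existential quantifier. Uniqueness
  on fat sets makes every other candidate coincide with that witness on \<open>W\<close> and so
  inherit its regularity.\<close>

lemma psm_derivative_unique:
  assumes "pdom Q X W" "psm Q X W (Suc n) F"
    and d: "\<And>p x. (p, x) \<in> W \<Longrightarrow> ((\<lambda>y. F (p, y)) has_derivative F' (p, x)) (at x within Q)"
  shows "norm v \<le> 1 \<Longrightarrow> psm Q X W n (\<lambda>z. F' z v)"
proof -
  assume v: "norm v \<le> 1"
  obtain G where G: "\<And>p x. (p, x) \<in> W \<Longrightarrow> ((\<lambda>y. F (p, y)) has_derivative G (p, x)) (at x within Q)"
    and G': "\<And>v. norm v \<le> 1 \<Longrightarrow> psm Q X W n (\<lambda>z. G z v)" using assms(2) by (metis psm_SucE)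
  have "G z = F' z" if "z \<in> W" for z
  proof -
    obtain p x where z: "z = (p, x)" by force
    show ?thesis
      using fat_unique[OF pdom_fat[OF assms(1)] pdom_sub(2)[OF assms(1)] G d] that by (simp add: z)
  qed
  then show ?thesis
    by (intro psm_cong[OF assms(1) G'[OF v]]) auto
qed

lemma psm_differentiable:
  assumes "psm Q X W (Suc n) F" "(p, x) \<in> W"
  shows "(\<lambda>y. F (p, y)) differentiable (at x within Q)"
  using psm_SucE[OF assms(1)] assms(2) by (metis differentiable_def)

lemma psm_frechet:
  assumes "pdom Q X W" "psm Q X W (Suc n) F" "norm v \<le> 1"
  shows "psm Q X W n (\<lambda>(p, x). frechet_derivative (\<lambda>y. F (p, y)) (at x within Q) v)"
proof -
  have "psm Q X W n (\<lambda>z. (\<lambda>(p, x). frechet_derivative (\<lambda>y. F (p, y)) (at x within Q)) z v)"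
    by (rule psm_derivative_unique[OF assms(1,2) _ assms(3)])
      (use psm_differentiable[OF assms(2)] in \<open>auto simp: frechet_derivative_works\<close>)
  then show ?thesis
    by (simp add: case_prod_unfold)
qed

text \<open>The local witnesses for the derivative agree where they overlap, since derivatives are
  unique; hence they fit together and the order can be lowered by induction.\<close>

lemma psm_local:
  assumes W: "pdom Q X W"
    and "\<And>z. z \<in> W \<Longrightarrow> \<exists>W'. z \<in> W' \<and> pdom Q X W' \<and> psm Q X (W \<inter> W') n F"
  shows "psm Q X W n F"
  using assms(2)
proof (induction n arbitrary: F)
  case 0
  show ?case
    unfolding psm.simps continuous_map_eq_topcontinuous_at topcontinuous_at_def
  proof (intro ballI conjI allI impI)
    fix z V assume z: "z \<in> topspace (subtopology (ptop Q X) W)" and V: "openin euclidean V \<and> F z \<in> V"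
    obtain W' where W': "z \<in> W'" "pdom Q X W'"
      and c: "continuous_map (subtopology (ptop Q X) (W \<inter> W')) euclidean F"
      using 0[of z] z by auto
    have z': "z \<in> topspace (subtopology (ptop Q X) (W \<inter> W'))" using z W' by auto
    obtain U where U: "openin (subtopology (ptop Q X) (W \<inter> W')) U" "z \<in> U" "\<forall>y\<in>U. F y \<in> V"
      using c[unfolded continuous_map_eq_topcontinuous_at topcontinuous_at_def, rule_format, OF z'] V
      by auto
    have "openin (ptop Q X) (W \<inter> W')"
      using W W' by (auto simp: pdom_def)
    then have "openin (ptop Q X) U" "U \<subseteq> W"
      using U(1) openin_open_subtopology[of "ptop Q X" "W \<inter> W'" U] by auto
    then have "openin (subtopology (ptop Q X) W) U"
      using W openin_open_subtopology[of "ptop Q X" W U] by (auto simp: pdom_def)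
    then show "\<exists>U. openin (subtopology (ptop Q X) W) U \<and> z \<in> U \<and> (\<forall>y\<in>U. F y \<in> V)"
      using U by auto
  qed auto
next
  case (Suc n)
  \<comment> \<open>One derivative must be named for all members of the cover at once, so the
    canonical one is taken instead of the local witnesses.\<close>
  define F' where "F' = (\<lambda>(p, x). frechet_derivative (\<lambda>y. F (p, y)) (at x within Q))"
  show ?case
  proof (rule psm_SucI[where F' = F'])
    have "psm Q X W n F"
    proof (rule Suc.IH)
      fix z assume "z \<in> W"
      from Suc.prems[OF this] show "\<exists>W'. z \<in> W' \<and> pdom Q X W' \<and> psm Q X (W \<inter> W') n F"
        using psm_SucD by meson
    qed
    then show "continuous_map (subtopology (ptop Q X) W) euclidean F"
      by (rule psm_cont)
    show "((\<lambda>y. F (p, y)) has_derivative F' (p, x)) (at x within Q)" if px: "(p, x) \<in> W" for p x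
    proof -
      have "(\<lambda>y. F (p, y)) differentiable (at x within Q)"
        using Suc.prems[OF px] psm_differentiable px by (metis IntI)
      then show ?thesis
        by (simp add: F'_def frechet_derivative_works)
    qed
    show "psm Q X W n (\<lambda>z. F' z v)" if v: "norm v \<le> 1" for v
    proof (rule Suc.IH)
      fix z assume "z \<in> W"
      from Suc.prems[OF this] obtain W' where W': "z \<in> W'" "pdom Q X W'" "psm Q X (W \<inter> W') (Suc n) F"
        by auto
      from psm_frechet[OF pdom_Int[OF W W'(2)] W'(3) v]
      show "\<exists>W'. z \<in> W' \<and> pdom Q X W' \<and> psm Q X (W \<inter> W') n (\<lambda>z. F' z v)"
        using W' by (auto simp: F'_def case_prod_unfold)
    qed
  qed
qed

section \<open>Elementary operations on families\<close>

lemma cont_snd: "continuous_map (subtopology (ptop Q X) W) euclidean snd"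
  using continuous_map_from_subtopology[OF continuous_map_snd[of X "top_of_set Q"], of W]
  by (simp add: continuous_map_in_subtopology)

lemma cont_fst: "continuous_map (subtopology (ptop Q X) W) X fst"
  using continuous_map_from_subtopology[OF continuous_map_fst[of X "top_of_set Q"], of W] by simp

lemma psm_param:
  assumes "continuous_map X euclidean u"
  shows "psm Q X W n (\<lambda>z. u (fst z))"
proof -
  have c: "continuous_map (subtopology (ptop Q X) W) euclidean (\<lambda>z. u (fst z))"
    using continuous_map_compose[OF cont_fst assms, of Q W] by (simp add: o_def)
  have 0: "psm Q X W n (\<lambda>z. 0)" for n
    by (induction n) (auto intro!: psm_SucI[of _ _ _ _ "\<lambda>_ _. 0"])
  show ?thesis
    by (cases n) (use c 0 in \<open>auto intro!: psm_SucI[of _ _ _ _ "\<lambda>_ _. 0"]\<close>)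
qed

lemma psm_const: "psm Q X W n (\<lambda>z. c)"
  using psm_param[of X "\<lambda>_. c" Q W n] by simp

lemma psm_snd: "psm Q X W n snd"
  by (cases n) (auto intro!: cont_snd psm_SucI[of _ _ _ _ "\<lambda>_ v. v"] psm_const derivative_eq_intros)

lemma psm_linear:
  assumes L: "bounded_linear L"
  shows "psm Q X W n F \<Longrightarrow> psm Q X W n (\<lambda>z. L (F z))"
proof (induction n arbitrary: F)
  case 0
  have "continuous_map euclidean euclidean L"
    using L by (simp add: linear_continuous_on)
  from continuous_map_compose[OF _ this] show ?case
    using 0 by (auto simp: o_def)
next
  case (Suc n)
  then obtain F' where d: "\<And>p x. (p, x) \<in> W \<Longrightarrow> ((\<lambda>y. F (p, y)) has_derivative F' (p, x)) (at x within Q)"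
    and F': "\<And>v. norm v \<le> 1 \<Longrightarrow> psm Q X W n (\<lambda>z. F' z v)" by (metis psm_SucE)
  show ?case
  proof (rule psm_SucI[where F' = "\<lambda>z v. L (F' z v)"])
    have "continuous_map euclidean euclidean L"
      using L by (simp add: linear_continuous_on)
    from continuous_map_compose[OF psm_cont[OF Suc.prems] this]
    show "continuous_map (subtopology (ptop Q X) W) euclidean (\<lambda>z. L (F z))"
      by (auto simp: o_def)
  qed (use F' Suc.IH bounded_linear.has_derivative[OF L d] in auto)
qed

lemma psm_add: "psm Q X W n F \<Longrightarrow> psm Q X W n G \<Longrightarrow> psm Q X W n (\<lambda>z. F z + G z)"
proof (induction n arbitrary: F G)
  case 0
  then show ?case by (auto intro: continuous_map_add)
next
  case (Suc n)
  obtain F' where F: "\<And>p x. (p, x) \<in> W \<Longrightarrow> ((\<lambda>y. F (p, y)) has_derivative F' (p, x)) (at x within Q)"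
    and F': "\<And>v. norm v \<le> 1 \<Longrightarrow> psm Q X W n (\<lambda>z. F' z v)"
    using psm_SucE[OF Suc.prems(1)] by metis
  obtain G' where G: "\<And>p x. (p, x) \<in> W \<Longrightarrow> ((\<lambda>y. G (p, y)) has_derivative G' (p, x)) (at x within Q)"
    and G': "\<And>v. norm v \<le> 1 \<Longrightarrow> psm Q X W n (\<lambda>z. G' z v)"
    using psm_SucE[OF Suc.prems(2)] by metis
  show ?case
    by (rule psm_SucI[where F' = "\<lambda>z v. F' z v + G' z v"])
      (use F F' G G' Suc.IH psm_cont[OF Suc.prems(1)] psm_cont[OF Suc.prems(2)] in \<open>auto intro!: has_derivative_add continuous_map_add\<close>)
qed

lemma psm_scaleR:
  fixes F :: "'x \<times> 'a::real_normed_vector \<Rightarrow> real" and G :: "'x \<times> 'a \<Rightarrow> 'b::real_normed_vector"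
  shows "psm Q X W n F \<Longrightarrow> psm Q X W n G \<Longrightarrow> psm Q X W n (\<lambda>z. F z *\<^sub>R G z)"
proof (induction n arbitrary: F G)
  case 0
  then show ?case
    by (auto simp: continuous_map_atin intro!: tendsto_scaleR)
next
  case (Suc n)
  obtain F' where F: "\<And>p x. (p, x) \<in> W \<Longrightarrow> ((\<lambda>y. F (p, y)) has_derivative F' (p, x)) (at x within Q)"
    and F': "\<And>v. norm v \<le> 1 \<Longrightarrow> psm Q X W n (\<lambda>z. F' z v)"
    using psm_SucE[OF Suc.prems(1)] by metis
  obtain G' where G: "\<And>p x. (p, x) \<in> W \<Longrightarrow> ((\<lambda>y. G (p, y)) has_derivative G' (p, x)) (at x within Q)"
    and G': "\<And>v. norm v \<le> 1 \<Longrightarrow> psm Q X W n (\<lambda>z. G' z v)"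
    using psm_SucE[OF Suc.prems(2)] by metis
  have c: "continuous_map (subtopology (ptop Q X) W) euclidean (\<lambda>z. F z *\<^sub>R G z)"
    using psm_cont[OF Suc.prems(1)] psm_cont[OF Suc.prems(2)]
    by (auto simp: continuous_map_atin intro!: tendsto_scaleR)
  show ?case
    by (rule psm_SucI[where F' = "\<lambda>z v. F z *\<^sub>R G' z v + F' z v *\<^sub>R G z"])
      (use F F' G G' Suc.IH psm_SucD[OF Suc.prems(1)] psm_SucD[OF Suc.prems(2)] c in \<open>auto intro!: has_derivative_scaleR psm_add\<close>)
qed

lemma psm_mult:
  fixes F G :: "'x \<times> 'a::real_normed_vector \<Rightarrow> real"
  shows "psm Q X W n F \<Longrightarrow> psm Q X W n G \<Longrightarrow> psm Q X W n (\<lambda>z. F z * G z)"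
  using psm_scaleR[of Q X W n F G] by simp

lemma psm_minus: "psm Q X W n F \<Longrightarrow> psm Q X W n (\<lambda>z. - F z)"
  by (rule psm_linear[OF bounded_linear_minus[OF bounded_linear_ident]])

lemma psm_diff: "psm Q X W n F \<Longrightarrow> psm Q X W n G \<Longrightarrow> psm Q X W n (\<lambda>z. F z - G z)"
  using psm_add[OF _ psm_minus, of Q X W n F G] by simp

lemma psm_sum: "finite I \<Longrightarrow> (\<And>i. i \<in> I \<Longrightarrow> psm Q X W n (F i)) \<Longrightarrow> psm Q X W n (\<lambda>z. \<Sum>i\<in>I. F i z)"
  by (induction rule: finite_induct) (auto intro: psm_const psm_add)

lemma psm_derivative_any:
  assumes "pdom Q X W"
    and d: "\<And>p x. (p, x) \<in> W \<Longrightarrow> ((\<lambda>y. F (p, y)) has_derivative F' (p, x)) (at x within Q)"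
    and F': "\<And>v. norm v \<le> 1 \<Longrightarrow> psm Q X W n (\<lambda>z. F' z v)"
  shows "psm Q X W n (\<lambda>z. F' z v)"
proof -
  have "psm Q X W n (\<lambda>z. norm v *\<^sub>R F' z (v /\<^sub>R norm v))"
    by (intro psm_scaleR psm_const F') (auto simp: divide_simps)
  moreover have "norm v *\<^sub>R F' z (v /\<^sub>R norm v) = F' z v" if "z \<in> W" for z
  proof -
    have "linear (F' z)"
      using d[of "fst z" "snd z"] that has_derivative_linear by fastforce
    then show ?thesis
      by (cases "v = 0") (simp_all add: linear_cmul linear_0)
  qed
  ultimately show ?thesis
    by (rule psm_cong[OF assms(1)])
qed

text \<open>The model space of the base of a bundle is only known to be locally compact; this is the form in
  which its finite dimension is used.\<close>

definition findim :: "'b::real_normed_vector itself \<Rightarrow> bool" where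
  "findim _ \<longleftrightarrow> (\<exists>(I :: nat set) (e :: nat \<Rightarrow> 'b) \<xi>. finite I \<and> (\<forall>i\<in>I. bounded_linear (\<xi> i)) \<and>
     (\<forall>w. w = (\<Sum>i\<in>I. \<xi> i w *\<^sub>R e i)))"

text \<open>A linear retract inherits coordinates: the coefficients of \<open>B w\<close> in the
  Euclidean basis, with the images of the basis vectors under \<open>A\<close>, reproduce
  \<open>w\<close>.\<close>

lemma findim_retract:
  fixes A :: "'k::euclidean_space \<Rightarrow> 'b::real_normed_vector"
  assumes A: "bounded_linear A" and B: "bounded_linear B" and AB: "\<And>w. A (B w) = w"
  shows "findim TYPE('b)"
proof -
  obtain n and u :: "nat \<Rightarrow> 'k" where u: "bij_betw u {..<n} Basis"
    using ex_bij_betw_nat_finite[OF finite_Basis] by (metis atLeast0LessThan)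
  have "w = (\<Sum>i<n. (B w \<bullet> u i) *\<^sub>R A (u i))" for w
  proof -
    have "w = A (\<Sum>b\<in>Basis. (B w \<bullet> b) *\<^sub>R b)"
      by (simp add: euclidean_representation AB)
    also have "\<dots> = (\<Sum>b\<in>Basis. (B w \<bullet> b) *\<^sub>R A b)"
      using A by (simp add: linear_sum linear_cmul bounded_linear.linear o_def)
    also have "\<dots> = (\<Sum>i<n. (B w \<bullet> u i) *\<^sub>R A (u i))"
      using sum.reindex_bij_betw[OF u, of "\<lambda>b. (B w \<bullet> b) *\<^sub>R A b"] by simp
    finally show ?thesis .
  qed
  then show ?thesis
    unfolding findim_def
    by (intro exI[of _ "{..<n}"] exI[of _ "\<lambda>i. A (u i)"] exI[of _ "\<lambda>i w. B w \<bullet> u i"])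
      (auto intro!: bounded_linear_compose[OF bounded_linear_inner_left B])
qed

lemma findim_euclidean: "findim TYPE('k::euclidean_space)"
  by (rule findim_retract[of "\<lambda>x::'k. x" "\<lambda>x. x"]) (auto intro: bounded_linear_ident)

text \<open>In the chain rule the derivative of \<open>G\<close> is applied to
  \<open>F' z v\<close>, a direction that moves with the point, while \<open>psm\<close> speaks of
  fixed directions. Expanding this vector in a finite system of vectors leaves fixed directions with
  scalar coefficients; this is where \<open>findim\<close> enters.\<close>

lemma psm_compose:
  fixes F :: "'x \<times> 'a::real_normed_vector \<Rightarrow> 'b::real_normed_vector"
    and G :: "'x \<times> 'b \<Rightarrow> 'c::real_normed_vector"
  assumes fd: "findim TYPE('b)" and W: "pdom Q X W" and V: "pdom Q' X V"
    and WV: "\<And>p x. (p, x) \<in> W \<Longrightarrow> (p, F (p, x)) \<in> V"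
  shows "psm Q X W n F \<Longrightarrow> psm Q' X V n G \<Longrightarrow> psm Q X W n (\<lambda>z. G (fst z, F z))"
  using WV
proof (induction n arbitrary: G)
  case 0
  have "continuous_map (subtopology (ptop Q X) W) (subtopology (ptop Q' X) V) (\<lambda>z. (fst z, F z))"
    using 0 pdom_sub(2)[OF V 0(3)] 
    by (auto simp: continuous_map_in_subtopology continuous_map_pairwise o_def cont_fst Pi_iff)
  from continuous_map_compose[OF this] 0(2) show ?case
    by (auto simp: o_def)
next
  case (Suc n)
  obtain F' where F: "\<And>p x. (p, x) \<in> W \<Longrightarrow> ((\<lambda>y. F (p, y)) has_derivative F' (p, x)) (at x within Q)"
    and F': "\<And>v. norm v \<le> 1 \<Longrightarrow> psm Q X W n (\<lambda>z. F' z v)" using Suc.prems(1) by (metis psm_SucE)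
  obtain G' where G: "\<And>p x. (p, x) \<in> V \<Longrightarrow> ((\<lambda>y. G (p, y)) has_derivative G' (p, x)) (at x within Q')"
    and G': "\<And>v. norm v \<le> 1 \<Longrightarrow> psm Q' X V n (\<lambda>z. G' z v)" using Suc.prems(2) by (metis psm_SucE)
  obtain I and e :: "nat \<Rightarrow> 'b" and \<xi> where I: "finite I" "\<And>i. i \<in> I \<Longrightarrow> bounded_linear (\<xi> i)"
    and e: "\<And>w. w = (\<Sum>i\<in>I. \<xi> i w *\<^sub>R e i)" using fd unfolding findim_def by metis
  have Fn: "psm Q X W n F" using Suc.prems(1) psm_SucD by blast
  show ?case
  proof (rule psm_SucI[where F' = "\<lambda>z v. G' (fst z, F z) (F' z v)"])
    have "psm Q X W n (\<lambda>z. G (fst z, F z))"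
      using Suc.IH[OF Fn _ Suc.prems(3)] Suc.prems(2) psm_SucD by blast
    then show "continuous_map (subtopology (ptop Q X) W) euclidean (\<lambda>z. G (fst z, F z))"
      by (rule psm_cont)
    show "((\<lambda>y. G (fst (p, y), F (p, y))) has_derivative (\<lambda>v. G' (fst (p, x), F (p, x)) (F' (p, x) v))) (at x within Q)"
      if px: "(p, x) \<in> W" for p x
    proof -
      have "((\<lambda>y. F (p, y)) has_derivative F' (p, x)) (at x within W `` {p})"
        using F[OF px] by (simp add: pdom_at_within[OF W px])
      moreover have "((\<lambda>y. G (p, y)) has_derivative G' (p, F (p, x))) (at (F (p, x)) within (\<lambda>y. F (p, y)) ` (W `` {p}))"
        by (rule has_derivative_subset[OF G[OF Suc.prems(3)[OF px]]]) (auto intro: pdom_sub(2)[OF V Suc.prems(3)])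
      ultimately have "((\<lambda>y. G (p, F (p, y))) has_derivative (\<lambda>v. G' (p, F (p, x)) (F' (p, x) v))) (at x within W `` {p})"
        using has_derivative_in_compose[of "\<lambda>y. F (p, y)" _ x "W `` {p}" "\<lambda>y. G (p, y)"] by simp
      then show ?thesis
        by (simp add: pdom_at_within[OF W px])
    qed
    fix v :: 'a assume v: "norm v \<le> 1"
    have "psm Q X W n (\<lambda>z. \<Sum>i\<in>I. \<xi> i (F' z v) *\<^sub>R G' (fst z, F z) (e i))"
      by (intro psm_sum psm_scaleR psm_linear[OF I(2)] I F'[OF v] Suc.IH[OF Fn _ Suc.prems(3)]
        psm_derivative_any[OF V G G'])
    moreover have "(\<Sum>i\<in>I. \<xi> i (F' z v) *\<^sub>R G' (fst z, F z) (e i)) = G' (fst z, F z) (F' z v)" if "z \<in> W" for z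
    proof -
      have "linear (G' (fst z, F z))"
        using G[of "fst z" "F z"] Suc.prems(3)[of "fst z" "snd z"] that has_derivative_linear by force
      then show ?thesis
        by (subst (2) e) (simp add: linear_sum linear_cmul o_def)
    qed
    ultimately show "psm Q X W n (\<lambda>z. G' (fst z, F z) (F' z v))"
      by (rule psm_cong[OF W])
  qed
qed

text \<open>A change of parameter does not interact with differentiation in the point, so continuity
  of \<open>u\<close> suffices at every order.\<close>

lemma psm_pull:
  assumes u: "continuous_map X' X u" and W': "\<And>p x. (p, x) \<in> W' \<Longrightarrow> (u p, x) \<in> W"
    and sub: "pdom Q X' W'"
  shows "psm Q X W n F \<Longrightarrow> psm Q X' W' n (\<lambda>z. F (u (fst z), snd z))"
proof (induction n arbitrary: F)
  case 0
  have "continuous_map (subtopology (ptop Q X') W') (subtopology (ptop Q X) W) (\<lambda>z. (u (fst z), snd z))"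
    using W' pdom_sub[OF sub] continuous_map_compose[OF cont_fst[where X=X' and W=W' and Q=Q] u] cont_snd[where X=X' and W=W' and Q=Q]
    by (auto simp: continuous_map_in_subtopology continuous_map_pairwise o_def)
  from continuous_map_compose[OF this] 0 show ?case
    by (auto simp: o_def)
next
  case (Suc n)
  obtain F' where F: "\<And>p x. (p, x) \<in> W \<Longrightarrow> ((\<lambda>y. F (p, y)) has_derivative F' (p, x)) (at x within Q)"
    and F': "\<And>v. norm v \<le> 1 \<Longrightarrow> psm Q X W n (\<lambda>z. F' z v)" using psm_SucE[OF Suc.prems(1)] by metis
  show ?case
  proof (rule psm_SucI[where F' = "\<lambda>z. F' (u (fst z), snd z)"])
    show "continuous_map (subtopology (ptop Q X') W') euclidean (\<lambda>z. F (u (fst z), snd z))"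
      using psm_cont[OF Suc.IH] Suc.prems psm_SucD by blast
  qed (use W' F Suc.IH[OF F'] in auto)
qed


section \<open>Iterated directional derivatives\<close>

lemma dderiv_append: "dderiv S f (vs @ ws) = dderiv S (dderiv S f ws) vs"
  by (induction vs) auto

lemma psm_frechet_any:
  assumes "pdom Q X W" "psm Q X W (Suc n) F"
  shows "psm Q X W n (\<lambda>(p, x). frechet_derivative (\<lambda>y. F (p, y)) (at x within Q) v)"
proof -
  have "psm Q X W n (\<lambda>z. (\<lambda>(p, x). frechet_derivative (\<lambda>y. F (p, y)) (at x within Q)) z v)"
  proof (rule psm_derivative_any[OF assms(1)])
    show "((\<lambda>y. F (p, y)) has_derivative (\<lambda>(p, x). frechet_derivative (\<lambda>y. F (p, y)) (at x within Q)) (p, x))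
        (at x within Q)" if "(p, x) \<in> W" for p x
      using psm_differentiable[OF assms(2) that] by (simp add: frechet_derivative_works)
  qed (use psm_frechet[OF assms] in \<open>simp add: case_prod_unfold\<close>)
  then show ?thesis
    by (simp add: case_prod_unfold)
qed

lemma psm_dderiv:
  assumes W: "pdom Q X W"
  shows "psm Q X W (length vs + n) F \<Longrightarrow>
    psm Q X W n (\<lambda>(p, x). dderiv (W `` {p}) (\<lambda>y. F (p, y)) vs x)"
proof (induction vs arbitrary: n)
  case Nil
  then show ?case by simp
next
  case (Cons v vs)
  then have "psm Q X W (Suc n) (\<lambda>(p, x). dderiv (W `` {p}) (\<lambda>y. F (p, y)) vs x)"
    by simp
  from psm_frechet_any[OF W this, of v]
  show ?case
    by (rule psm_cong[OF W]) (auto simp: pdom_at_within[OF W])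
qed

lemma psmooth_smooth_on:
  fixes F :: "'x \<times> 'a::real_normed_vector \<Rightarrow> 'b::real_normed_vector"
  assumes "psmooth Q X W F"
  shows "smooth_on (W `` {p}) (\<lambda>y. F (p, y))"
  unfolding smooth_on_def differentiable_on_def
proof (intro allI ballI)
  fix vs :: "'a list" and x assume x: "x \<in> W `` {p}"
  \<comment> \<open>One order beyond the length of the list pays for the differentiability of the
    iterated derivative itself.\<close>
  have W: "pdom Q X W" and "psm Q X W (length vs + Suc 0) (\<lambda>z. F z)"
    using assms by (auto simp: psmooth_def)
  from psm_differentiable[OF psm_dderiv[OF this(1) this(2)], of p x] x
  show "dderiv (W `` {p}) (\<lambda>y. F (p, y)) vs differentiable at x within W `` {p}"
    by (simp add: pdom_at_within[OF W])
qed

lemma smooth_on_dderiv: "smooth_on S f \<Longrightarrow> smooth_on S (dderiv S f vs)"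
  by (simp add: smooth_on_def flip: dderiv_append)

text \<open>This is the way into \<open>psm\<close> from data in the form of
  \<open>smooth_on\<close> and \<open>Cinf_nbhd\<close>: smooth slices whose iterated derivatives
  along vectors of the unit ball are continuous in both variables.\<close>

lemma psmI_dderiv:
  assumes W: "pdom Q X W"
  shows "(\<And>p. p \<in> topspace X \<Longrightarrow> smooth_on (W `` {p}) (\<lambda>y. F (p, y))) \<Longrightarrow>
    (\<And>vs. \<forall>v\<in>set vs. norm v \<le> 1 \<Longrightarrow>
      continuous_map (subtopology (ptop Q X) W) euclidean (\<lambda>(p, x). dderiv (W `` {p}) (\<lambda>y. F (p, y)) vs x)) \<Longrightarrow>
    psm Q X W n F"
proof (induction n arbitrary: F)
  case 0
  show ?case using 0(2)[of "[]"] by simp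
next
  case (Suc n)
  show ?case
  proof (rule psm_SucI[where F' = "\<lambda>(p, x). frechet_derivative (\<lambda>y. F (p, y)) (at x within Q)"])
    show "continuous_map (subtopology (ptop Q X) W) euclidean F"
      using Suc.prems(2)[of "[]"] by simp
    fix p x assume px: "(p, x) \<in> W"
    then have "dderiv (W `` {p}) (\<lambda>y. F (p, y)) [] differentiable at x within W `` {p}"
      using Suc.prems(1)[OF pdom_sub(1)[OF W px]] unfolding smooth_on_def differentiable_on_def by blast
    then show "((\<lambda>y. F (p, y)) has_derivative
        (\<lambda>(p, x). frechet_derivative (\<lambda>y. F (p, y)) (at x within Q)) (p, x)) (at x within Q)"
      by (simp add: pdom_at_within[OF W px] frechet_derivative_works)
  next
    fix v :: 'a assume v: "norm v \<le> 1"
    have "psm Q X W n (\<lambda>(p, x). dderiv (W `` {p}) (\<lambda>y. F (p, y)) [v] x)"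
    proof (rule Suc.IH)
      show "smooth_on (W `` {p}) (\<lambda>y. case (p, y) of (p, x) \<Rightarrow> dderiv (W `` {p}) (\<lambda>y. F (p, y)) [v] x)"
        if "p \<in> topspace X" for p
        using smooth_on_dderiv[OF Suc.prems(1)[OF that], of "[v]"] by simp
      fix vs :: "'a list" assume "\<forall>v\<in>set vs. norm v \<le> 1"
      \<comment> \<open>In \<open>dderiv\<close> the last vector of the list is differentiated along
        first, so taking the derivative along \<open>v\<close> before those along \<open>vs\<close>
        means appending \<open>v\<close> at the end.\<close>
      with Suc.prems(2)[of "vs @ [v]"] v
      show "continuous_map (subtopology (ptop Q X) W) euclidean
          (\<lambda>(p, x). dderiv (W `` {p}) (\<lambda>y. case (p, y) of (p, x) \<Rightarrow> dderiv (W `` {p}) (\<lambda>y. F (p, y)) [v] x) vs x)"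
        by (auto simp: dderiv_append case_prod_unfold)
    qed
    then show "psm Q X W n (\<lambda>z. (case z of (p, x) \<Rightarrow> frechet_derivative (\<lambda>y. F (p, y)) (at x within Q)) v)"
      by (rule psm_cong[OF W]) (auto simp: pdom_at_within[OF W])
  qed
qed

lemma dderiv_cong:
  "(\<And>y. y \<in> S \<Longrightarrow> f y = g y) \<Longrightarrow> x \<in> S \<Longrightarrow> dderiv S f vs x = dderiv S g vs x"
proof (induction vs arbitrary: x)
  case (Cons v vs)
  have "(dderiv S f vs has_derivative D) (at x within S) \<longleftrightarrow> (dderiv S g vs has_derivative D) (at x within S)" for D
    using has_derivative_transform[OF Cons.prems(2), of "dderiv S f vs" "dderiv S g vs" D]
      has_derivative_transform[OF Cons.prems(2), of "dderiv S g vs" "dderiv S f vs" D] Cons.IH[OF Cons.prems(1)]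
    by auto
  then show ?case
    by (simp add: frechet_derivative_def)
qed auto

lemma smooth_on_cong:
  assumes "smooth_on S f" "\<And>y. y \<in> S \<Longrightarrow> f y = g y"
  shows "smooth_on S g"
  unfolding smooth_on_def differentiable_on_def
proof (intro allI ballI)
  fix vs x assume "x \<in> S"
  with assms(1) have "dderiv S f vs differentiable at x within S"
    unfolding smooth_on_def differentiable_on_def by blast
  then obtain D where "(dderiv S f vs has_derivative D) (at x within S)"
    unfolding differentiable_def by blast
  from has_derivative_transform[OF \<open>x \<in> S\<close> dderiv_cong[OF assms(2)[symmetric]] this]
  show "dderiv S g vs differentiable at x within S"
    unfolding differentiable_def by blast
qed

text \<open>Constant families over an arbitrary parameter space allow a fixed smooth function to be
  composed with families. Continuity in the pair is continuity of each derivative after the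
  projection.\<close>

lemma smooth_on_psmooth:
  assumes f: "smooth_on S f" and "fat Q" "openin (top_of_set Q) S"
  shows "psmooth Q X (topspace X \<times> S) (\<lambda>z. f (snd z))"
  unfolding psmooth_def
proof (intro conjI allI)
  show W: "pdom Q X (topspace X \<times> S)"
    using assms by (auto intro: pdom_box)
  show "psm Q X (topspace X \<times> S) n (\<lambda>z. f (snd z))" for n
  proof (rule psmI_dderiv[OF W])
    fix p assume "p \<in> topspace X"
    then have "(topspace X \<times> S) `` {p} = S"
      by auto
    then show "smooth_on ((topspace X \<times> S) `` {p}) (\<lambda>y. f (snd (p, y)))"
      using f by simp
  next
    fix vs :: "'a list"
    have "continuous_map (subtopology (ptop Q X) (topspace X \<times> S)) (top_of_set S) snd"
      using cont_snd[where X=X and W="topspace X \<times> S" and Q=Q] by (auto simp: continuous_map_in_subtopology)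
    moreover have "continuous_map (top_of_set S) euclidean (dderiv S f vs)"
      using f by (simp add: smooth_on_def differentiable_imp_continuous_on)
    ultimately have "continuous_map (subtopology (ptop Q X) (topspace X \<times> S)) euclidean (dderiv S f vs \<circ> snd)"
      by (rule continuous_map_compose)
    then have "continuous_map (subtopology (ptop Q X) (topspace X \<times> S)) euclidean (\<lambda>z. dderiv S f vs (snd z))"
      by (simp add: o_def)
    then show "continuous_map (subtopology (ptop Q X) (topspace X \<times> S)) euclidean
        (\<lambda>(p, x). dderiv ((topspace X \<times> S) `` {p}) (\<lambda>y. f (snd (p, y))) vs x)"
      by (rule continuous_map_eq) (auto intro!: arg_cong[where f = "\<lambda>S. dderiv S f vs _"])
  qed
qed

section \<open>Calculus rules for families of class \<open>psmooth\<close>\<close>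

lemma psmooth_subset: "psmooth Q X W F \<Longrightarrow> pdom Q X W' \<Longrightarrow> W' \<subseteq> W \<Longrightarrow> psmooth Q X W' F"
  unfolding psmooth_def using psm_subset by blast

lemma psmooth_cong: "psmooth Q X W F \<Longrightarrow> (\<And>z. z \<in> W \<Longrightarrow> F z = G z) \<Longrightarrow> psmooth Q X W G"
  unfolding psmooth_def using psm_cong by blast

lemma psmooth_compose:
  fixes F :: "'x \<times> 'a::real_normed_vector \<Rightarrow> 'b::real_normed_vector"
    and G :: "'x \<times> 'b \<Rightarrow> 'c::real_normed_vector"
  assumes "findim TYPE('b)" "psmooth Q X W F" "psmooth Q' X V G"
    and "\<And>p x. (p, x) \<in> W \<Longrightarrow> (p, F (p, x)) \<in> V"
  shows "psmooth Q X W (\<lambda>z. G (fst z, F z))"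
  using assms psm_compose[OF assms(1), of Q X W Q' V F _ G] by (auto simp: psmooth_def)

lemma psmooth_pull:
  assumes "continuous_map X' X u" "\<And>p x. (p, x) \<in> W' \<Longrightarrow> (u p, x) \<in> W" "pdom Q X' W'"
    and "psmooth Q X W F"
  shows "psmooth Q X' W' (\<lambda>z. F (u (fst z), snd z))"
  using assms(4) psm_pull[OF assms(1,2,3)] assms(3) by (auto simp: psmooth_def)

lemma psmooth_local:
  assumes "pdom Q X W" "\<And>z. z \<in> W \<Longrightarrow> \<exists>W'. z \<in> W' \<and> psmooth Q X W' F"
  shows "psmooth Q X W F"
  unfolding psmooth_def
proof (intro conjI allI assms(1) psm_local)
  fix z n assume "z \<in> W"
  from assms(2)[OF this] obtain W' where "z \<in> W'" "pdom Q X W'" "psm Q X W' n F"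
    by (auto simp: psmooth_def)
  then show "\<exists>W'. z \<in> W' \<and> pdom Q X W' \<and> psm Q X (W \<inter> W') n F"
    by (intro exI[of _ W']) (simp add: psm_subset[of Q X W'])
qed

lemma psmooth_intros:
  "pdom Q X W \<Longrightarrow> psmooth Q X W (\<lambda>z. c)"
  "pdom Q X W \<Longrightarrow> psmooth Q X W snd"
  "psmooth Q X W F \<Longrightarrow> psmooth Q X W G \<Longrightarrow> psmooth Q X W (\<lambda>z. F z + G z)"
  "psmooth Q X W F \<Longrightarrow> psmooth Q X W G \<Longrightarrow> psmooth Q X W (\<lambda>z. F z - G z)"
  "psmooth Q X W R \<Longrightarrow> psmooth Q X W G \<Longrightarrow> psmooth Q X W (\<lambda>z. R z *\<^sub>R G z)"
  "psmooth Q X W R \<Longrightarrow> psmooth Q X W S \<Longrightarrow> psmooth Q X W (\<lambda>z. R z * S z)"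
  unfolding psmooth_def
  by (auto intro: psm_const psm_snd psm_add psm_diff psm_scaleR psm_mult)

lemma psmooth_param: "pdom Q X W \<Longrightarrow> continuous_map X euclidean u \<Longrightarrow> psmooth Q X W (\<lambda>z. u (fst z))"
  unfolding psmooth_def by (auto intro: psm_param)

lemma psmooth_linear: "bounded_linear L \<Longrightarrow> psmooth Q X W F \<Longrightarrow> psmooth Q X W (\<lambda>z. L (F z))"
  unfolding psmooth_def by (auto intro: psm_linear)

lemma psmooth_Pair:
  assumes F: "psmooth Q X W F" and G: "psmooth Q X W G"
  shows "psmooth Q X W (\<lambda>z. (F z, G z))"
proof -
  have "psmooth Q X W (\<lambda>z. (F z, 0) + (0, G z))"
    by (intro psmooth_intros(3) psmooth_linear[OF _ F, of "\<lambda>x. (x, 0)"] psmooth_linear[OF _ G, of "\<lambda>x. (0, x)"]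
      bounded_linear_Pair bounded_linear_ident bounded_linear_zero)
  then show ?thesis by simp
qed

section \<open>Hadamard quotients, even functions and inverse functions\<close>

lemma psm_realE:
  fixes F :: "'x \<times> real \<Rightarrow> real"
  assumes "psm Q X W (Suc n) F"
  obtains D where "\<And>p x. (p, x) \<in> W \<Longrightarrow> ((\<lambda>y. F (p, y)) has_real_derivative D (p, x)) (at x within Q)"
    and "psm Q X W n D"
proof -
  obtain F' where F: "\<And>p x. (p, x) \<in> W \<Longrightarrow> ((\<lambda>y. F (p, y)) has_derivative F' (p, x)) (at x within Q)"
    and F': "\<And>v. norm v \<le> 1 \<Longrightarrow> psm Q X W n (\<lambda>z. F' z v)" using psm_SucE[OF assms] by metis
  have "((\<lambda>y. F (p, y)) has_real_derivative F' (p, x) 1) (at x within Q)" if "(p, x) \<in> W" for p x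
  proof -
    have "F' (p, x) v = F' (p, x) 1 * v" for v
      using linear_cmul[OF has_derivative_linear[OF F[OF that]], of v 1] by (simp add: mult.commute)
    then have "F' (p, x) = (*) (F' (p, x) 1)"
      by (rule ext)
    then show ?thesis
      using F[OF that] unfolding has_field_derivative_def by simp
  qed
  then show thesis
    by (rule that[of "\<lambda>z. F' z 1"]) (use F' in simp_all)
qed

lemma psm_realI:
  fixes F :: "'x \<times> real \<Rightarrow> real"
  assumes "continuous_map (subtopology (ptop Q X) W) euclidean F"
    and "\<And>p x. (p, x) \<in> W \<Longrightarrow> ((\<lambda>y. F (p, y)) has_real_derivative D (p, x)) (at x within Q)"
    and "psm Q X W n D"
  shows "psm Q X W (Suc n) F"
proof (rule psm_SucI[where F' = "\<lambda>z v. D z * v"])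
  show "psm Q X W n (\<lambda>z. D z * v)" for v
    by (intro psm_mult assms(3) psm_const)
qed (use assms in \<open>auto simp: has_field_derivative_def\<close>)

text \<open>The witness from \<open>psm\<close> could change with the order. By uniqueness the
  derivative obtained at the lowest order serves for all of them.\<close>

lemma psmooth_realE:
  fixes F :: "'x \<times> real \<Rightarrow> real"
  assumes "psmooth Q X W F"
  obtains D where "\<And>p x. (p, x) \<in> W \<Longrightarrow> ((\<lambda>y. F (p, y)) has_real_derivative D (p, x)) (at x within Q)"
    and "psmooth Q X W D"
proof -
  have W: "pdom Q X W" and n: "\<And>n. psm Q X W (Suc n) F"
    using assms by (auto simp: psmooth_def)
  obtain D where D: "\<And>p x. (p, x) \<in> W \<Longrightarrow> ((\<lambda>y. F (p, y)) has_real_derivative D (p, x)) (at x within Q)"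
    using psm_realE[OF n[of 0]] by metis
  have "psm Q X W n D" for n
    using psm_derivative_unique[OF W n[of n], of "\<lambda>z v. D z * v" 1] D
    by (simp add: has_field_derivative_def)
  then show thesis
    using D W that by (auto simp: psmooth_def)
qed

text \<open>The derivative is built by products from the reciprocal itself and the derivative of
  \<open>F\<close>, so the reciprocal at order \<open>n\<close> gives its derivative at order
  \<open>n\<close>. The square root below is handled in the same way.\<close>

lemma psm_inverse:
  fixes F :: "'x \<times> 'a::real_normed_vector \<Rightarrow> real"
  assumes "\<And>z. z \<in> W \<Longrightarrow> F z \<noteq> 0"
  shows "psm Q X W n F \<Longrightarrow> psm Q X W n (\<lambda>z. inverse (F z))"
proof (induction n)
  case 0
  then show ?case
    using assms by (auto intro!: continuous_map_real_inverse)
next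
  case (Suc n)
  obtain F' where F: "\<And>p x. (p, x) \<in> W \<Longrightarrow> ((\<lambda>y. F (p, y)) has_derivative F' (p, x)) (at x within Q)"
    and F': "\<And>v. norm v \<le> 1 \<Longrightarrow> psm Q X W n (\<lambda>z. F' z v)" using psm_SucE[OF Suc.prems] by metis
  have I: "psm Q X W n (\<lambda>z. inverse (F z))"
    by (rule Suc.IH[OF psm_SucD[OF Suc.prems]])
  show ?case
  proof (rule psm_SucI[where F' = "\<lambda>z v. - (inverse (F z) * F' z v * inverse (F z))"])
    show "((\<lambda>y. inverse (F (p, y))) has_derivative (\<lambda>v. - (inverse (F (p, x)) * F' (p, x) v * inverse (F (p, x)))))
        (at x within Q)" if "(p, x) \<in> W" for p x
      by (rule Deriv.has_derivative_inverse[OF assms[OF that] F[OF that]])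
  qed (intro psm_cont[OF I] psm_minus psm_mult I F'; assumption)+
qed

lemma psm_sqrt:
  fixes F :: "'x \<times> 'a::real_normed_vector \<Rightarrow> real"
  assumes "\<And>z. z \<in> W \<Longrightarrow> F z > 0"
  shows "psm Q X W n F \<Longrightarrow> psm Q X W n (\<lambda>z. sqrt (F z))"
proof (induction n)
  case 0
  then show ?case
    by (auto intro!: continuous_map_sqrt)
next
  case (Suc n)
  obtain F' where F: "\<And>p x. (p, x) \<in> W \<Longrightarrow> ((\<lambda>y. F (p, y)) has_derivative F' (p, x)) (at x within Q)"
    and F': "\<And>v. norm v \<le> 1 \<Longrightarrow> psm Q X W n (\<lambda>z. F' z v)" using psm_SucE[OF Suc.prems] by metis
  have S: "psm Q X W n (\<lambda>z. sqrt (F z))"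
    by (rule Suc.IH[OF psm_SucD[OF Suc.prems]])
  have I: "psm Q X W n (\<lambda>z. inverse (sqrt (F z)))"
    by (rule psm_inverse[OF _ S]) (use assms in fastforce)
  show ?case
  proof (rule psm_SucI[where F' = "\<lambda>z v. F' z v * (inverse (sqrt (F z)) * inverse 2)"])
    show "((\<lambda>y. sqrt (F (p, y))) has_derivative (\<lambda>v. F' (p, x) v * (inverse (sqrt (F (p, x))) * inverse 2)))
        (at x within Q)" if "(p, x) \<in> W" for p x
      using has_derivative_real_sqrt[OF assms[OF that] F[OF that]] by (simp add: divide_simps mult.commute)
  qed (intro psm_cont[OF S] psm_mult I psm_const F'; assumption)+
qed

lemma psmooth_inverse:
  fixes F :: "'x \<times> 'a::real_normed_vector \<Rightarrow> real"
  shows "psmooth Q X W F \<Longrightarrow> (\<And>z. z \<in> W \<Longrightarrow> F z \<noteq> 0) \<Longrightarrow> psmooth Q X W (\<lambda>z. inverse (F z))"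
  by (auto simp: psmooth_def intro: psm_inverse)

lemma psmooth_sqrt:
  fixes F :: "'x \<times> 'a::real_normed_vector \<Rightarrow> real"
  shows "psmooth Q X W F \<Longrightarrow> (\<And>z. z \<in> W \<Longrightarrow> F z > 0) \<Longrightarrow> psmooth Q X W (\<lambda>z. sqrt (F z))"
  by (auto simp: psmooth_def intro: psm_sqrt)

text \<open>Compactness of the interval and the tube lemma make the integrand uniformly close to the
  one at \<open>z0\<close>; no metric on the parameter space is involved.\<close>

lemma continuous_map_integral_param:
  fixes H :: "'z \<times> real \<Rightarrow> real"
  assumes H: "continuous_map (prod_topology Z (top_of_set {0..1})) euclidean H"
  shows "continuous_map Z euclidean (\<lambda>z. integral {0..1} (\<lambda>s. H (z, s)))"
  unfolding continuous_map_eq_topcontinuous_at topcontinuous_at_def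
proof (intro ballI conjI allI impI)
  fix z0 V assume z0: "z0 \<in> topspace Z" and "openin euclidean V \<and> integral {0..1} (\<lambda>s. H (z0, s)) \<in> V"
  then obtain e where e: "e > 0" "ball (integral {0..1} (\<lambda>s. H (z0, s))) e \<subseteq> V"
    unfolding open_openin[symmetric] open_contains_ball by metis
  have sl: "continuous_on {0..1} (\<lambda>s. H (z, s))" if "z \<in> topspace Z" for z
  proof -
    have "continuous_map (top_of_set {0..1::real}) (prod_topology Z (top_of_set {0..1})) (\<lambda>s. (z, s))"
      using that by (simp add: continuous_map_pairwise o_def)
    from continuous_map_compose[OF this H] show ?thesis
      by (simp add: o_def)
  qed
  have "continuous_map (top_of_set {0..1::real}) euclidean (\<lambda>s. H (z0, s))"
    using sl[OF z0] by simp
  from continuous_map_compose[OF continuous_map_snd this, of Z]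
  have "continuous_map (prod_topology Z (top_of_set {0..1})) euclidean (\<lambda>w. H w - H (z0, snd w))"
    by (intro continuous_map_diff H) (simp add: o_def)
  from openin_continuous_map_preimage[OF this, of "ball 0 (e/2)"]
  have "openin (prod_topology Z (top_of_set {0..1}))
      {w \<in> topspace (prod_topology Z (top_of_set {0..1})). H w - H (z0, snd w) \<in> ball 0 (e/2)}"
    by simp
  moreover have "{z0} \<times> {0..1} \<subseteq>
      {w \<in> topspace (prod_topology Z (top_of_set {0..1})). H w - H (z0, snd w) \<in> ball 0 (e/2)}"
    using z0 e(1) by auto
  moreover have "compactin (top_of_set {0..1}) {0..1::real}"
    by (simp add: compactin_subtopology)
 ultimately have "\<exists>U T. openin Z U \<and> openin (top_of_set {0..1}) T \<and> z0 \<in> U \<and> {0..1} \<subseteq> T \<and> U \<times> T \<subseteq>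
      {w \<in> topspace (prod_topology Z (top_of_set {0..1})). H w - H (z0, snd w) \<in> ball 0 (e/2)}"
    by (intro tube_lemma_right z0)
  then obtain U T where U: "openin Z U" "z0 \<in> U" "{0..1} \<subseteq> T"
    "U \<times> T \<subseteq> {w \<in> topspace (prod_topology Z (top_of_set {0..1})). H w - H (z0, snd w) \<in> ball 0 (e/2)}"
    by (elim exE conjE) (rule that; assumption)
  show "\<exists>U. openin Z U \<and> z0 \<in> U \<and> (\<forall>y\<in>U. integral {0..1} (\<lambda>s. H (y, s)) \<in> V)"
  proof (intro exI conjI ballI)
    fix y assume y: "y \<in> U"
    then have yZ: "y \<in> topspace Z" using U(1) openin_subset by blast
    have "norm (integral {0..1} (\<lambda>s. H (y, s) - H (z0, s))) \<le> e/2 * (1 - 0)"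
    proof (rule integral_bound)
      show "continuous_on {0..1} (\<lambda>s. H (y, s) - H (z0, s))"
        by (intro continuous_intros sl z0 yZ)
      show "norm (H (y, t) - H (z0, t)) \<le> e/2" if "t \<in> {0..1}" for t
      proof -
        have "(y, t) \<in> U \<times> T" using y U(3) that by auto
        then have "H (y, t) - H (z0, t) \<in> ball 0 (e/2)" using U(4) by auto
        then show ?thesis by simp
      qed
    qed simp
    moreover have "integral {0..1} (\<lambda>s. H (y, s) - H (z0, s)) = integral {0..1} (\<lambda>s. H (y, s)) - integral {0..1} (\<lambda>s. H (z0, s))"
      by (intro integral_diff integrable_continuous_real sl z0 yZ)
    ultimately have "integral {0..1} (\<lambda>s. H (y, s)) \<in> ball (integral {0..1} (\<lambda>s. H (z0, s))) e"
      using e(1) by (simp add: dist_real_def abs_minus_commute)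
    then show "integral {0..1} (\<lambda>s. H (y, s)) \<in> V"
      using e(2) by blast
  qed (use U in auto)
qed auto

text \<open>Differentiation under the integral sign produces a factor \<open>s\<close> each time;
  the power \<open>s ^ k\<close> is carried along so that the induction hypothesis covers the
  derivative. Convexity of \<open>J\<close> and \<open>0 \<in> J\<close> keep the points
  \<open>t * s\<close> in \<open>J\<close>.\<close>

lemma psm_integral:
  fixes F :: "'x \<times> real \<Rightarrow> real"
  assumes Q: "fat Q" and J: "openin (top_of_set Q) J" "convex J" "0 \<in> J"
  shows "psm Q X (topspace X \<times> J) n F \<Longrightarrow>
    psm Q X (topspace X \<times> J) n (\<lambda>z. integral {0..1} (\<lambda>s. s ^ k * F (fst z, snd z * s)))"
proof (induction n arbitrary: F k)
  have sub: "t * s \<in> J" if "t \<in> J" "s \<in> {0..1}" for t s :: real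
    using convexD_alt[OF J(2) J(3) that(1), of s] that(2) by (simp add: mult.commute)
  have cont: "continuous_map (prod_topology (subtopology (ptop Q X) (topspace X \<times> J)) (top_of_set {0..1})) euclidean
      (\<lambda>w. snd w ^ k * F (fst (fst w), snd (fst w) * snd w))"
    if F: "continuous_map (subtopology (ptop Q X) (topspace X \<times> J)) euclidean F" for F :: "'x \<times> real \<Rightarrow> real" and k
  proof (intro continuous_map_real_mult)
    let ?Z = "subtopology (ptop Q X) (topspace X \<times> J)"
    let ?P = "prod_topology ?Z (top_of_set {0..1::real})"
    have s: "continuous_map ?P euclidean snd"
      using continuous_map_snd[of ?Z "top_of_set {0..1::real}"] by (simp add: continuous_map_in_subtopology)
    then show "continuous_map ?P euclidean (\<lambda>w. snd w ^ k)"
      by (intro continuous_map_real_pow)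
    have f: "continuous_map ?P ?Z fst"
      by (rule continuous_map_fst)
    have p: "continuous_map ?P X (\<lambda>w. fst (fst w))"
      using continuous_map_compose[OF f cont_fst] by (simp add: o_def)
    have t: "continuous_map ?P euclidean (\<lambda>w. snd (fst w))"
      using continuous_map_compose[OF f cont_snd] by (simp add: o_def)
    have "continuous_map ?P ?Z (\<lambda>w. (fst (fst w), snd (fst w) * snd w))"
      using p continuous_map_real_mult[OF t s] sub openin_subset[OF J(1)]
      by (auto simp: continuous_map_in_subtopology continuous_map_pairwise o_def Pi_iff)
    from continuous_map_compose[OF this F]
    show "continuous_map ?P euclidean (\<lambda>w. F (fst (fst w), snd (fst w) * snd w))"
      by (simp add: o_def)
  qed
  have cont0: "continuous_map (subtopology (ptop Q X) (topspace X \<times> J)) euclidean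
      (\<lambda>z. integral {0..1} (\<lambda>s. s ^ k * F (fst z, snd z * s)))"
    if "continuous_map (subtopology (ptop Q X) (topspace X \<times> J)) euclidean F" for F :: "'x \<times> real \<Rightarrow> real" and k
    using continuous_map_integral_param[OF cont[OF that, of k]] by simp
  {
    case 0
    then show ?case using cont0 by simp
  next
    case (Suc n)
    obtain D where D: "\<And>p x. (p, x) \<in> topspace X \<times> J \<Longrightarrow> ((\<lambda>y. F (p, y)) has_real_derivative D (p, x)) (at x within Q)"
      and Dn: "psm Q X (topspace X \<times> J) n D"
      using psm_realE[OF Suc.prems] by metis
    show ?case
    proof (rule psm_realI)
      show "psm Q X (topspace X \<times> J) n (\<lambda>z. integral {0..1} (\<lambda>s. s ^ Suc k * D (fst z, snd z * s)))"
        by (rule Suc.IH[OF Dn])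
      show "continuous_map (subtopology (ptop Q X) (topspace X \<times> J)) euclidean
          (\<lambda>z. integral {0..1} (\<lambda>s. s ^ k * F (fst z, snd z * s)))"
        by (rule cont0[OF psm_cont[OF Suc.prems]])
      fix p t assume pt: "(p, t) \<in> topspace X \<times> J"
      have sl: "continuous_on (J \<times> {0..1}) (\<lambda>(x, s). s ^ k * F (p, x * s))"
        if "continuous_map (subtopology (ptop Q X) (topspace X \<times> J)) euclidean F" for F :: "'x \<times> real \<Rightarrow> real" and k
      proof -
        have "continuous_map (top_of_set (J \<times> {0..1})) euclidean (\<lambda>w :: real \<times> real. fst w)"
          "continuous_map (top_of_set (J \<times> {0..1})) euclidean (\<lambda>w :: real \<times> real. snd w)"
          by (auto intro!: continuous_intros)
        then have "continuous_map (top_of_set (J \<times> {0..1}))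
            (prod_topology (subtopology (ptop Q X) (topspace X \<times> J)) (top_of_set {0..1::real})) (\<lambda>w. ((p, fst w), snd w))"
          using pt openin_subset[OF J(1)]
          by (auto simp: continuous_map_in_subtopology continuous_map_pairwise o_def Pi_iff)
        from continuous_map_compose[OF this cont[OF that, of k]] show ?thesis
          by (simp add: o_def case_prod_unfold)
      qed
      have "((\<lambda>x. integral (cbox 0 1) (\<lambda>s. s ^ k * F (p, x * s))) has_field_derivative
          integral (cbox 0 1) (\<lambda>s. s ^ Suc k * D (p, t * s))) (at t within J)"
      proof (rule leibniz_rule_field_derivative)
        show "t \<in> J" "convex J" using pt J by auto
        show "continuous_on (J \<times> cbox 0 1) (\<lambda>(x, s). s ^ Suc k * D (p, x * s))"
          using sl[OF psm_cont[OF Dn], of "Suc k"] by simp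
        show "(\<lambda>s. s ^ k * F (p, x * s)) integrable_on cbox 0 1" if "x \<in> J" for x
        proof -
          have "continuous_on {0..1} (\<lambda>s. (\<lambda>(x, s). s ^ k * F (p, x * s)) (x, s))"
            by (rule continuous_on_compose2[OF sl[OF psm_cont[OF Suc.prems], of k]])
              (use that in \<open>auto intro!: continuous_intros\<close>)
          then show ?thesis
            by (simp add: integrable_continuous_real)
        qed
        fix x s :: real assume xs: "x \<in> J" "s \<in> cbox 0 1"
        have "((\<lambda>y. F (p, y)) has_real_derivative D (p, x * s)) (at (x * s) within (\<lambda>x. x * s) ` J)"
          by (rule has_field_derivative_subset[OF D]) (use pt xs sub openin_subset[OF J(1)] in auto)
        moreover have "((\<lambda>x. x * s) has_real_derivative s) (at x within J)"
          by (auto intro!: derivative_eq_intros)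
        ultimately have "((\<lambda>x. F (p, x * s)) has_real_derivative D (p, x * s) * s) (at x within J)"
          using DERIV_image_chain[of "\<lambda>y. F (p, y)" _ "\<lambda>x. x * s" x J s] by (simp add: o_def)
        from DERIV_cmult[OF this, of "s ^ k"]
        show "((\<lambda>x. s ^ k * F (p, x * s)) has_real_derivative s ^ Suc k * D (p, x * s)) (at x within J)"
          by (simp add: mult_ac)
      qed
      then show "((\<lambda>y. integral {0..1} (\<lambda>s. s ^ k * F (fst (p, y), snd (p, y) * s))) has_real_derivative
          integral {0..1} (\<lambda>s. s ^ Suc k * D (fst (p, t), snd (p, t) * s))) (at t within Q)"
        using at_within_openin[OF J(1)] pt by simp
    qed
  }
qed

text \<open>The quotient is the mean of the derivative along the segment from 0 to \<open>t\<close>,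
  an expression that does not notice the division by zero at \<open>t = 0\<close>.\<close>

lemma hadamard:
  fixes F :: "'x \<times> real \<Rightarrow> real"
  assumes F: "psmooth Q X (topspace X \<times> J) F" and J: "openin (top_of_set Q) J" "convex J" "0 \<in> J"
  obtains G where "psmooth Q X (topspace X \<times> J) G"
    "\<And>p t. p \<in> topspace X \<Longrightarrow> t \<in> J \<Longrightarrow> F (p, t) - F (p, 0) = t * G (p, t)"
proof -
  obtain D where D: "\<And>p x. (p, x) \<in> topspace X \<times> J \<Longrightarrow> ((\<lambda>y. F (p, y)) has_real_derivative D (p, x)) (at x within Q)"
    and Ds: "psmooth Q X (topspace X \<times> J) D"
    using psmooth_realE[OF F] by metis
  \<comment> \<open>The trivial factor \<open>s ^ 0\<close> brings the mean into the shape of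
    \<open>psm_integral\<close>.\<close>
  define G where "G = (\<lambda>z. integral {0..1} (\<lambda>s. s ^ 0 * D (fst z, snd z * s)))"
  have fatQ: "fat Q"
    using F by (auto simp: psmooth_def pdom_def)
  have G: "psmooth Q X (topspace X \<times> J) G"
    using Ds psm_integral[OF fatQ J, of X _ D 0] unfolding G_def psmooth_def by blast
  have sub: "t * s \<in> J" if "t \<in> J" "s \<in> {0..1}" for t s :: real
    using convexD_alt[OF J(2) J(3) that(1), of s] that(2) by (simp add: mult.commute)
  have "F (p, t) - F (p, 0) = t * G (p, t)" if pt: "p \<in> topspace X" "t \<in> J" for p t
  proof -
    have "((\<lambda>s. D (p, t * s) * t) has_integral (F (p, t * 1) - F (p, t * 0))) {0..1}"
    proof (rule fundamental_theorem_of_calculus)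
      fix s :: real assume s: "s \<in> {0..1}"
      have "((\<lambda>y. F (p, y)) has_real_derivative D (p, t * s)) (at (t * s) within (\<lambda>s. t * s) ` {0..1})"
        by (rule has_field_derivative_subset[OF D]) (use pt s sub openin_subset[OF J(1)] in auto)
      from DERIV_image_chain[OF this, of t]
      show "((\<lambda>s. F (p, t * s)) has_vector_derivative D (p, t * s) * t) (at s within {0..1})"
        by (auto simp: o_def has_real_derivative_iff_has_vector_derivative[symmetric] intro!: derivative_eq_intros)
    qed simp
    from integral_unique[OF this] have "F (p, t) - F (p, 0) = integral {0..1} (\<lambda>s. D (p, t * s) * t)"
      by simp
    then show ?thesis
      by (simp add: G_def mult.commute)
  qed
  then show thesis using G that by blast
qed


text \<open>Whitney's theorem on even functions.  On the fibre line through a point of level one, \<open>f\<close> is the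
  square of the coordinate, and this turns smoothness on the total space into smoothness in the value of \<open>f\<close>.\<close>

lemma even_imp_smooth_in_square:
  fixes F :: "'x \<times> real \<Rightarrow> real"
  defines "J \<equiv> {-1<..<1::real}" and "I \<equiv> {0..<1::real}"
  shows "psmooth UNIV X (topspace X \<times> J) F \<Longrightarrow>
    (\<And>p u. p \<in> topspace X \<Longrightarrow> u \<in> J \<Longrightarrow> F (p, - u) = F (p, u)) \<Longrightarrow>
    psm {0..1} X (topspace X \<times> I) n (\<lambda>z. F (fst z, sqrt (snd z)))"
proof (induction n arbitrary: F)
  have I: "openin (top_of_set {0..1}) I"
    unfolding openin_open by (rule exI[of _ "{-1<..<1}"]) (auto simp: I_def)
  have sqI: "sqrt t \<in> J" if "t \<in> I" for t
  proof -
    have "sqrt t \<ge> 0" "sqrt t < 1" using that by (auto simp: I_def)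
    then have "-1 < sqrt t" by linarith
    then show ?thesis using \<open>sqrt t < 1\<close> unfolding J_def by simp
  qed
  have cont: "continuous_map (subtopology (ptop {0..1} X) (topspace X \<times> I)) euclidean (\<lambda>z. F (fst z, sqrt (snd z)))"
    if F: "psmooth UNIV X (topspace X \<times> J) F" for F :: "'x \<times> real \<Rightarrow> real"
  proof -
    let ?Z = "subtopology (ptop {0..1} X) (topspace X \<times> I)"
    have "continuous_map ?Z (subtopology (ptop UNIV X) (topspace X \<times> J)) (\<lambda>z. (fst z, sqrt (snd z)))"
      using cont_fst[of X "{0..1}" "topspace X \<times> I"] continuous_map_sqrt[OF cont_snd[of X "{0..1}" "topspace X \<times> I"]] sqI
      by (auto simp: continuous_map_in_subtopology continuous_map_pairwise o_def Pi_iff)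
    moreover have "continuous_map (subtopology (ptop UNIV X) (topspace X \<times> J)) euclidean F"
      using F psm_cont unfolding psmooth_def by blast
    ultimately have "continuous_map ?Z euclidean (F \<circ> (\<lambda>z. (fst z, sqrt (snd z))))"
      by (rule continuous_map_compose)
    then show ?thesis
      by (simp add: o_def)
  qed
  {
    case 0
    then show ?case using cont by simp
  next
    case (Suc n)
    have J: "openin (top_of_set UNIV) J" "convex J" "0 \<in> J"
      by (auto simp: J_def)
    obtain D where D: "\<And>p x. (p, x) \<in> topspace X \<times> J \<Longrightarrow> ((\<lambda>y. F (p, y)) has_real_derivative D (p, x)) (at x)"
      and Ds: "psmooth UNIV X (topspace X \<times> J) D"
      using psmooth_realE[OF Suc.prems(1)] by metis
    obtain K where K: "psmooth UNIV X (topspace X \<times> J) K"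
      "\<And>p t. p \<in> topspace X \<Longrightarrow> t \<in> J \<Longrightarrow> D (p, t) - D (p, 0) = t * K (p, t)"
      using hadamard[OF Ds J] by metis
    have odd: "D (p, - u) = - D (p, u)" if pu: "p \<in> topspace X" "u \<in> J" for p u
    proof -
      have "((\<lambda>y. F (p, - y)) has_real_derivative - D (p, - u)) (at u)"
      proof -
        have "(p, - u) \<in> topspace X \<times> J" using pu by (auto simp: J_def)
        moreover have "((\<lambda>y. - y) has_real_derivative -1) (at u)"
          by (auto intro!: derivative_eq_intros)
        ultimately show ?thesis
          using DERIV_chain2[OF D, of p "\<lambda>y. - y" u "-1"] by simp
      qed
      then have "((\<lambda>y. F (p, y)) has_real_derivative - D (p, - u)) (at u)"
        by (rule has_field_derivative_transform_within_open[where S = J])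
          (use pu Suc.prems(2) in \<open>auto simp: J_def\<close>)
      from DERIV_unique[OF this D[of p u]] pu show ?thesis by simp
    qed
    have D0: "D (p, 0) = 0" if "p \<in> topspace X" for p
      using odd[OF that, of 0] J(3) by simp
    \<comment> \<open>This is the derivative of F divided by 2u. By the chain rule it is, at u =
      sqrt t, the derivative of \<open>F (p, sqrt t)\<close> in t, and it is again smooth and even,
      so the induction can be repeated with it.\<close>
    define G where "G = (\<lambda>z. K z * inverse 2)"
    have G: "psmooth UNIV X (topspace X \<times> J) G"
      unfolding G_def by (intro psmooth_intros K(1) psmooth_pdom[OF K(1)])
    have DG: "D (p, u) = 2 * u * G (p, u)" if "p \<in> topspace X" "u \<in> J" for p u
      using K(2)[OF that] D0[OF that(1)] by (simp add: G_def)
    have even: "G (p, - u) = G (p, u)" if pu: "p \<in> topspace X" "u \<in> J" for p u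
    proof (cases "u = 0")
      case False
      have "- u \<in> J" using pu by (auto simp: J_def)
      with DG[OF pu] DG[of p "- u"] odd[OF pu] pu(1) False show ?thesis
        by simp
    qed simp
    show ?case
    proof (rule psm_realI)
      show "continuous_map (subtopology (ptop {0..1} X) (topspace X \<times> I)) euclidean (\<lambda>z. F (fst z, sqrt (snd z)))"
        by (rule cont[OF Suc.prems(1)])
      show "psm {0..1} X (topspace X \<times> I) n (\<lambda>z. G (fst z, sqrt (snd z)))"
        by (rule Suc.IH[OF G even])
      fix p t assume "(p, t) \<in> topspace X \<times> I"
      then have p: "p \<in> topspace X" and t: "t \<in> I" by auto
      show "((\<lambda>y. F (fst (p, y), sqrt (snd (p, y)))) has_real_derivative G (fst (p, t), sqrt (snd (p, t)))) (at t within {0..1})"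
      proof (cases "t = 0")
        case False
        then have t0: "t > 0" using t by (simp add: I_def)
        have "((\<lambda>y. F (p, sqrt y)) has_real_derivative D (p, sqrt t) * (inverse (sqrt t) / 2)) (at t)"
          by (rule DERIV_chain2[OF D DERIV_real_sqrt]) (use p sqI[OF t] t0 in auto)
        moreover have "D (p, sqrt t) * (inverse (sqrt t) / 2) = G (p, sqrt t)"
          using DG[OF p sqI[OF t]] t0 by simp
        ultimately show ?thesis
          by (simp add: has_field_derivative_at_within)
      next
        case True
        \<comment> \<open>At t = 0 the root is not differentiable and the difference quotient is
          computed directly. Integrating the derivative 2uG along the segment writes it as
          \<open>2 * M (p, sqrt t)\<close>, which has a limit by continuity.\<close>
        define M where "M = (\<lambda>z. integral {0..1} (\<lambda>s. s ^ 1 * G (fst z, snd z * s)))"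
        have "psm UNIV X (topspace X \<times> J) 0 M"
          unfolding M_def by (rule psm_integral[OF fat_UNIV J]) (use G in \<open>simp only: psmooth_def\<close>)
        then have cM: "continuous_map (subtopology (ptop UNIV X) (topspace X \<times> J)) euclidean M"
          by simp
        have FM: "F (p, u) - F (p, 0) = u\<^sup>2 * (2 * M (p, u))" if u: "u \<in> J" for u
        proof -
          have sub: "u * s \<in> J" if "s \<in> {0..1}" for s :: real
            using convexD_alt[OF J(2) J(3) u, of s] that by (simp add: mult.commute)
          have "((\<lambda>s. D (p, u * s) * u) has_integral (F (p, u * 1) - F (p, u * 0))) {0..1}"
          proof (rule fundamental_theorem_of_calculus)
            fix s :: real assume s: "s \<in> {0..1}"
            have "((\<lambda>s. F (p, u * s)) has_real_derivative D (p, u * s) * u) (at s)"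
              by (rule DERIV_chain2[OF D]) (use p sub[OF s] in \<open>auto intro!: derivative_eq_intros\<close>)
            then show "((\<lambda>s. F (p, u * s)) has_vector_derivative D (p, u * s) * u) (at s within {0..1})"
              by (simp add: has_field_derivative_at_within has_real_derivative_iff_has_vector_derivative[symmetric])
          qed simp
          from integral_unique[OF this]
          have "F (p, u) - F (p, 0) = integral {0..1} (\<lambda>s. D (p, u * s) * u)"
            by simp
          also have "\<dots> = integral {0..1} (\<lambda>s. (u\<^sup>2 * 2) * (s ^ 1 * G (p, u * s)))"
            by (rule integral_cong) (use DG[OF p sub] in \<open>simp add: power2_eq_square\<close>)
          also have "\<dots> = u\<^sup>2 * (2 * M (p, u))"
            by (simp only: integral_mult_right) (simp add: M_def)
          finally show ?thesis .
        qed
        \<comment> \<open>The weight \<open>s\<close> has integral 1/2.\<close>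
        have M0: "2 * M (p, 0) = G (p, 0)"
        proof -
          have "((\<lambda>s. G (p, 0) * s) has_integral (G (p, 0) * (1\<^sup>2 / 2) - G (p, 0) * (0\<^sup>2 / 2))) {0..1}"
            by (rule fundamental_theorem_of_calculus)
              (auto intro!: derivative_eq_intros simp: has_real_derivative_iff_has_vector_derivative[symmetric])
          from integral_unique[OF this] show ?thesis
            by (simp add: M_def mult.commute)
        qed
        have "continuous_map (top_of_set J) (subtopology (ptop UNIV X) (topspace X \<times> J)) (\<lambda>u. (p, u))"
          using p by (auto simp: continuous_map_in_subtopology continuous_map_pairwise o_def)
        from continuous_map_compose[OF this cM] have "continuous_on J (\<lambda>u. M (p, u))"
          by (simp add: o_def)
        moreover have "open J" by (simp add: J_def)
        ultimately have "isCont (\<lambda>u. M (p, u)) (sqrt 0)"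
          using J(3) by (simp add: continuous_on_eq_continuous_at)
        then have "isCont (\<lambda>t. M (p, sqrt t)) 0"
          by (rule isCont_o2[OF isCont_real_sqrt])
        then have "((\<lambda>t. 2 * M (p, sqrt t)) \<longlongrightarrow> 2 * M (p, sqrt 0)) (at 0 within {0..1})"
          by (intro tendsto_mult tendsto_const) (metis continuous_at_imp_continuous_at_within continuous_within)
        then have "((\<lambda>t. 2 * M (p, sqrt t)) \<longlongrightarrow> G (p, 0)) (at 0 within {0..1})"
          by (simp add: M0)
        then have "((\<lambda>t. (F (p, sqrt t) - F (p, sqrt 0)) / (t - 0)) \<longlongrightarrow> G (p, 0)) (at 0 within {0..1})"
        proof (rule Lim_transform_within[where d = 1])
          fix t :: real assume "t \<in> {0..1}" "0 < dist t 0" "dist t 0 < 1"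
          then have t: "t > 0" "t \<in> I" by (auto simp: I_def)
          then show "2 * M (p, sqrt t) = (F (p, sqrt t) - F (p, sqrt 0)) / (t - 0)"
            using FM[OF sqI[OF t(2)]] by simp
        qed simp
        then show ?thesis
          using True by (simp add: has_field_derivative_iff)
      qed
    qed
  }
qed

text \<open>Joint continuity of the inverse comes from monotonicity alone. Higher orders follow by
  bootstrapping, since the derivative of \<open>G\<close> is the reciprocal of \<open>D\<close>
  evaluated at \<open>G\<close>.\<close>

lemma psmooth_inverse_function:
  fixes F :: "'x \<times> real \<Rightarrow> real"
  assumes F: "psmooth {0..1} X (topspace X \<times> {0..1}) F"
    and D: "\<And>p t. p \<in> topspace X \<Longrightarrow> t \<in> {0..1} \<Longrightarrow>
      D (p, t) > 0 \<and> ((\<lambda>y. F (p, y)) has_real_derivative D (p, t)) (at t within {0..1})"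
    and G: "\<And>p t. p \<in> topspace X \<Longrightarrow> t \<in> {0..1} \<Longrightarrow> G (p, t) \<in> {0..1} \<and> F (p, G (p, t)) = t"
    and F01: "\<And>p t. p \<in> topspace X \<Longrightarrow> t \<in> {0..1} \<Longrightarrow> F (p, t) \<in> {0..1}"
  shows "psmooth {0..1} X (topspace X \<times> {0..1}) G"
proof -
  let ?W = "topspace X \<times> {0..1::real}"
  have W: "pdom {0..1} X ?W"
    using F by (rule psmooth_pdom)
  obtain D' where D': "\<And>p x. (p, x) \<in> ?W \<Longrightarrow> ((\<lambda>y. F (p, y)) has_real_derivative D' (p, x)) (at x within {0..1})"
    and Ds': "psmooth {0..1} X ?W D'"
    using psmooth_realE[OF F] by metis
  \<comment> \<open>\<open>D\<close> is only a pointwise choice of derivatives; uniqueness on the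
    interval identifies it with a smooth one.\<close>
  have "D' z = D z" if "z \<in> ?W" for z
  proof -
    obtain p t where z: "z = (p, t)" "p \<in> topspace X" "t \<in> {0..1}" using \<open>z \<in> ?W\<close> by auto
    have "(*) (D' (p, t)) = (*) (D (p, t))"
      by (rule fat_unique[OF fat_unit_interval z(3)])
        (use D'[of p t] D[of p t] z in \<open>auto simp: has_field_derivative_def\<close>)
    then have "D' (p, t) * 1 = D (p, t) * 1" by (rule fun_cong)
    then show ?thesis using z by simp
  qed
  then have Ds: "psmooth {0..1} X ?W D"
    by (rule psmooth_cong[OF Ds'])
  have mono: "F (p, a) < F (p, b)" if p: "p \<in> topspace X" and ab: "0 \<le> a" "a < b" "b \<le> 1" for p a b
  proof (rule DERIV_pos_imp_increasing_open[OF ab(2)])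
    show "\<exists>y. DERIV (\<lambda>y. F (p, y)) x :> y \<and> y > 0" if "a < x" "x < b" for x
      using D[OF p, of x] that ab at_within_Icc_at[of 0 x 1] by auto
    show "continuous_on {a..b} (\<lambda>y. F (p, y))"
    proof (rule DERIV_continuous_on)
      show "((\<lambda>y. F (p, y)) has_real_derivative D (p, x)) (at x within {a..b})" if "x \<in> {a..b}" for x
        using D[OF p, of x] that ab by (auto intro: has_field_derivative_subset)
    qed
  qed
  have GF: "G (p, F (p, x)) = x" if "p \<in> topspace X" "x \<in> {0..1}" for p x
  proof (rule ccontr)
    assume "G (p, F (p, x)) \<noteq> x"
    then consider "G (p, F (p, x)) < x" | "G (p, F (p, x)) > x" by linarith
    then show False
      using G[OF that(1) F01[OF that]] mono[OF that(1), of "G (p, F (p, x))" x] mono[OF that(1), of x "G (p, F (p, x))"] that(2)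
      by cases auto
  qed
  \<comment> \<open>Monotonicity turns bounds on \<open>G\<close> into strict inequalities between
    \<open>t\<close> and \<open>F (p, x)\<close>, which are open conditions on the pair
    \<open>(p, t)\<close>.\<close>
  have lt: "G (p, t) < x \<longleftrightarrow> t < F (p, x)" if "p \<in> topspace X" "t \<in> {0..1}" "x \<in> {0..1}" for p t x
    using G[OF that(1,2)] mono[OF that(1), of "G (p, t)" x] mono[OF that(1), of x "G (p, t)"] that(3)
    by (metis atLeastAtMost_iff less_asym linorder_less_linear)
  have gt: "G (p, t) > x \<longleftrightarrow> t > F (p, x)" if "p \<in> topspace X" "t \<in> {0..1}" "x \<in> {0..1}" for p t x
    using G[OF that(1,2)] mono[OF that(1), of "G (p, t)" x] mono[OF that(1), of x "G (p, t)"] that(3)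
    by (metis atLeastAtMost_iff less_asym linorder_less_linear)
  let ?Z = "subtopology (ptop {0..1} X) ?W"
  have cF: "continuous_map ?Z euclidean F"
    using F psm_cont unfolding psmooth_def by blast
  have opn: "openin ?Z {z \<in> topspace ?Z. snd z < F (fst z, x)}" "openin ?Z {z \<in> topspace ?Z. snd z > F (fst z, x)}"
    if x: "x \<in> {0..1}" for x
  proof -
    have "continuous_map ?Z ?Z (\<lambda>z. (fst z, x))"
      using cont_fst[of X "{0..1::real}" ?W] x
      by (auto simp: continuous_map_in_subtopology continuous_map_pairwise o_def Pi_iff)
    from continuous_map_compose[OF this cF] have c: "continuous_map ?Z euclidean (\<lambda>z. F (fst z, x) - snd z)"
      using cont_snd[of X "{0..1::real}" ?W] by (intro continuous_map_diff) (auto simp: o_def)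
    have e1: "{z \<in> topspace ?Z. snd z < F (fst z, x)} = {z \<in> topspace ?Z. F (fst z, x) - snd z \<in> {0<..}}"
      and e2: "{z \<in> topspace ?Z. snd z > F (fst z, x)} = {z \<in> topspace ?Z. F (fst z, x) - snd z \<in> {..<0}}"
      by auto
    show "openin ?Z {z \<in> topspace ?Z. snd z < F (fst z, x)}" "openin ?Z {z \<in> topspace ?Z. snd z > F (fst z, x)}"
      unfolding e1 e2 by (rule openin_continuous_map_preimage[OF c]; simp add: open_openin[symmetric])+
  qed
  have cG: "continuous_map ?Z euclidean G"
    unfolding continuous_map_eq_topcontinuous_at topcontinuous_at_def
  proof (intro ballI conjI allI impI)
    fix z0 V assume z0: "z0 \<in> topspace ?Z" and "openin euclidean V \<and> G z0 \<in> V"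
    then obtain e where e: "e > 0" "ball (G z0) e \<subseteq> V"
      unfolding open_openin[symmetric] open_contains_ball by metis
    obtain p0 t0 where pt: "z0 = (p0, t0)" "p0 \<in> topspace X" "t0 \<in> {0..1}" using z0 by auto
    let ?a = "G z0 - e/2" and ?b = "G z0 + e/2"
    have y0: "G z0 \<in> {0..1}" using G pt by auto
    \<comment> \<open>If the lower bound is negative it holds for every value in the interval, and
      \<open>F\<close> must not be evaluated there; \<open>U2\<close> treats the upper bound
      likewise.\<close>
    define U1 where "U1 = (if ?a < 0 then topspace ?Z else {z \<in> topspace ?Z. snd z > F (fst z, ?a)})"
    define U2 where "U2 = (if ?b > 1 then topspace ?Z else {z \<in> topspace ?Z. snd z < F (fst z, ?b)})"
    show "\<exists>U. openin ?Z U \<and> z0 \<in> U \<and> (\<forall>y\<in>U. G y \<in> V)"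
    proof (intro exI[of _ "U1 \<inter> U2"] conjI ballI)
      show "openin ?Z (U1 \<inter> U2)"
      proof (rule openin_Int)
        show "openin ?Z U1"
          using opn(2)[of ?a] y0 e(1) openin_topspace[of ?Z] by (cases "?a < 0") (simp_all add: U1_def)
        show "openin ?Z U2"
          using opn(1)[of ?b] y0 e(1) openin_topspace[of ?Z] by (cases "?b > 1") (simp_all add: U2_def)
      qed
      show "z0 \<in> U1 \<inter> U2"
        using z0 y0 e(1) gt[OF pt(2,3), of ?a] lt[OF pt(2,3), of ?b] by (auto simp: U1_def U2_def pt(1))
      fix z assume z: "z \<in> U1 \<inter> U2"
      obtain p t where zp: "z = (p, t)" by force
      have "z \<in> topspace ?Z" using z by (auto simp: U1_def split: if_splits)
      then have p: "p \<in> topspace X" "t \<in> {0..1}" by (auto simp: zp)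
      have "G z > ?a" "G z < ?b"
        using z gt[OF p, of ?a] lt[OF p, of ?b] G[OF p] y0 e(1)
        by (auto simp: U1_def U2_def zp split: if_splits)
      then have "G z \<in> ball (G z0) e"
        using e(1) by (auto simp: dist_real_def)
      then show "G z \<in> V" using e(2) by blast
    qed
  qed auto
  have "psm {0..1} X ?W n G" for n
  proof (induction n)
    case 0
    then show ?case using cG by simp
  next
    case (Suc n)
    \<comment> \<open>Order \<open>n\<close> of \<open>G\<close> passes to \<open>D\<close> at
      \<open>G\<close> and to its reciprocal, the derivative of \<open>G\<close>, and so yields
      order \<open>Suc n\<close>.\<close>
    have "psm {0..1} X ?W n (\<lambda>z. D (fst z, G z))"
      by (rule psm_compose[OF findim_euclidean W W _ Suc]) (use G Ds in \<open>auto simp: psmooth_def\<close>)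
    then have I: "psm {0..1} X ?W n (\<lambda>z. inverse (D (fst z, G z)))"
    proof (rule psm_inverse[rotated])
      fix z assume "z \<in> ?W"
      then show "D (fst z, G z) \<noteq> 0"
        using D[of "fst z" "G z"] G[of "fst z" "snd z"] by force
    qed
    show ?case
    proof (rule psm_realI[OF cG _ I])
      fix p t assume "(p, t) \<in> ?W"
      then have p: "p \<in> topspace X" "t \<in> {0..1}" by auto
      have img: "(\<lambda>y. F (p, y)) ` {0..1} = {0..1}"
      proof
        show "(\<lambda>y. F (p, y)) ` {0..1} \<subseteq> {0..1}"
          using F01[OF p(1)] by blast
        show "{0..1} \<subseteq> (\<lambda>y. F (p, y)) ` {0..1}"
        proof
          fix t :: real assume "t \<in> {0..1}"
          from G[OF p(1) this] show "t \<in> (\<lambda>y. F (p, y)) ` {0..1}"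
            by (intro image_eqI[of _ _ "G (p, t)"]) auto
        qed
      qed
      note dd = D[OF p(1), of "G (p, t)"] G[OF p]
      have "continuous_map (top_of_set {0..1}) ?Z (\<lambda>t. (p, t))"
        using p by (auto simp: continuous_map_in_subtopology continuous_map_pairwise o_def)
      from continuous_map_compose[OF this cG] have "continuous_on {0..1} (\<lambda>t. G (p, t))"
        by (simp add: o_def)
      then have cGp: "continuous (at t within {0..1}) (\<lambda>t. G (p, t))"
        using p(2) by (simp add: continuous_on_eq_continuous_within)
      have "((\<lambda>t. G (p, t)) has_derivative (\<lambda>v. inverse (D (p, G (p, t))) * v))
          (at (F (p, G (p, t))) within (\<lambda>y. F (p, y)) ` {0..1})"
      proof (rule has_derivative_inverse_within[where a = "G (p, t)" and f' = "\<lambda>v. D (p, G (p, t)) * v"])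
        show "((\<lambda>y. F (p, y)) has_derivative (*) (D (p, G (p, t)))) (at (G (p, t)) within {0..1})"
          using dd by (simp add: has_field_derivative_def)
        show "continuous (at (F (p, G (p, t))) within (\<lambda>y. F (p, y)) ` {0..1}) (\<lambda>t. G (p, t))"
          using cGp dd by (simp add: img)
        show "linear (\<lambda>v. inverse (D (p, G (p, t))) * v)"
          by (simp add: linear_times)
        show "(\<lambda>v. inverse (D (p, G (p, t))) * v) \<circ> (*) (D (p, G (p, t))) = id"
          using dd by (auto simp: fun_eq_iff)
      qed (use dd GF p in auto)
      then show "((\<lambda>y. G (p, y)) has_real_derivative inverse (D (fst (p, t), G (p, t)))) (at t within {0..1})"
        using dd by (simp add: img has_field_derivative_def)
    qed
  qed
  then show ?thesis
    using W by (simp add: psmooth_def)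
qed

section \<open>Smooth families of maps between manifolds\<close>

lemma psmooth_compose_smooth:
  fixes F :: "'x \<times> 'a::real_normed_vector \<Rightarrow> 'b::real_normed_vector"
  assumes fd: "findim TYPE('b)" and F: "psmooth Q X W F" and g: "smooth_on S g" "fat R" "openin (top_of_set R) S"
    and FS: "\<And>z. z \<in> W \<Longrightarrow> F z \<in> S"
  shows "psmooth Q X W (\<lambda>z. g (F z))"
proof -
  have "psmooth Q X W (\<lambda>z. g (snd (fst z, F z)))"
    by (rule psmooth_compose[OF fd F smooth_on_psmooth[OF g]])
      (use FS pdom_sub(1)[OF psmooth_pdom[OF F]] in auto)
  then show ?thesis by simp
qed

text \<open>The openness of \<open>W\<close> is itself obtained from the cover, because each
  \<open>W'\<close> lies inside \<open>W\<close>.\<close>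

lemma psmooth_local_cover:
  assumes "fat Q" "\<And>z. z \<in> W \<Longrightarrow> \<exists>W'. z \<in> W' \<and> W' \<subseteq> W \<and> psmooth Q X W' F"
  shows "psmooth Q X W F"
proof (rule psmooth_local)
  show "pdom Q X W"
    unfolding pdom_def
  proof
    show "openin (ptop Q X) W"
      by (subst openin_subopen) (metis assms(2) pdom_def psmooth_pdom)
  qed (rule assms(1))
qed (use assms(2) in blast)

lemma open_box:
  assumes "openin (ptop Q X) W" "(p0, y0) \<in> W"
  shows "\<exists>A S. openin X A \<and> openin (top_of_set Q) S \<and> p0 \<in> A \<and> y0 \<in> S \<and> A \<times> S \<subseteq> W"
  using assms by (simp add: openin_prod_topology_alt)

lemma psmooth_box:
  assumes F: "psmooth Q X W F" and W: "(p0, y0) \<in> W" and T: "open T" "F (p0, y0) \<in> T"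
  obtains A S where "openin X A" "openin (top_of_set Q) S" "p0 \<in> A" "y0 \<in> S" "A \<times> S \<subseteq> W"
    "\<forall>p\<in>A. \<forall>y\<in>S. F (p, y) \<in> T"
proof -
  have op: "openin (ptop Q X) W"
    using psmooth_pdom[OF F] by (simp add: pdom_def)
  have "continuous_map (subtopology (ptop Q X) W) euclidean F"
    using F psm_cont unfolding psmooth_def by blast
  from openin_continuous_map_preimage[OF this, of T]
  have "openin (subtopology (ptop Q X) W) {z \<in> topspace (subtopology (ptop Q X) W). F z \<in> T}"
    using T(1) by simp
  then have "openin (ptop Q X) {z \<in> topspace (subtopology (ptop Q X) W). F z \<in> T}"
    using op openin_trans_full by blast
  moreover have "(p0, y0) \<in> {z \<in> topspace (subtopology (ptop Q X) W). F z \<in> T}"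
    using W T openin_subset[OF op] by auto
  ultimately have "\<exists>A S. openin X A \<and> openin (top_of_set Q) S \<and> p0 \<in> A \<and> y0 \<in> S \<and>
      A \<times> S \<subseteq> {z \<in> topspace (subtopology (ptop Q X) W). F z \<in> T}"
    by (rule open_box)
  then obtain A S where AS: "openin X A \<and> openin (top_of_set Q) S \<and> p0 \<in> A \<and> y0 \<in> S \<and>
      A \<times> S \<subseteq> {z \<in> topspace (subtopology (ptop Q X) W). F z \<in> T}"
    by (elim exE)
  show thesis
    by (rule that[of A S]) (use AS in auto)
qed

lemma fd_eq:
  assumes "fat Q" "openin (top_of_set Q) S" "x \<in> S" "(f has_derivative D) (at x within S)"
  shows "frechet_derivative f (at x within S) = D"
proof -
  have at: "at x within S = at x within Q"
    by (rule at_within_openin[OF assms(2,3)])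
  have "(f has_derivative frechet_derivative f (at x within S)) (at x within S)"
    using assms(4) unfolding frechet_derivative_works[symmetric] by (rule differentiableI)
  then show ?thesis
    using fat_unique[OF assms(1), of x f] assms(3,4) openin_subset[OF assms(2)] unfolding at by auto
qed

lemma smooth_on_has_derivative:
  assumes "smooth_on S f" "x \<in> S"
  shows "(dderiv S f vs has_derivative frechet_derivative (dderiv S f vs) (at x within S)) (at x within S)"
  using assms unfolding smooth_on_def differentiable_on_def by (simp flip: frechet_derivative_works)

lemma dderiv_sum:
  assumes Q: "fat Q" "openin (top_of_set Q) S" and f: "\<And>i. i \<in> I \<Longrightarrow> smooth_on S (f i)" and x: "x \<in> S"
  shows "dderiv S (\<lambda>x. \<Sum>i\<in>I. a i *\<^sub>R f i x) vs x = (\<Sum>i\<in>I. a i *\<^sub>R dderiv S (f i) vs x)"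
  using x
proof (induction vs arbitrary: x)
  case (Cons v vs)
  have "((\<lambda>x. \<Sum>i\<in>I. a i *\<^sub>R dderiv S (f i) vs x) has_derivative
      (\<lambda>v. \<Sum>i\<in>I. a i *\<^sub>R frechet_derivative (dderiv S (f i) vs) (at x within S) v)) (at x within S)"
    by (intro has_derivative_sum has_derivative_scaleR_right smooth_on_has_derivative f Cons.prems)
  then have "(dderiv S (\<lambda>x. \<Sum>i\<in>I. a i *\<^sub>R f i x) vs has_derivative
      (\<lambda>v. \<Sum>i\<in>I. a i *\<^sub>R frechet_derivative (dderiv S (f i) vs) (at x within S) v)) (at x within S)"
    by (rule has_derivative_transform[OF Cons.prems, rotated]) (rule Cons.IH)
  from fd_eq[OF Q Cons.prems this] show ?case
    by simp
qed simp

lemma dderiv_subset: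
  assumes "openin (top_of_set Q) S" "openin (top_of_set Q) S'" "S' \<subseteq> S"
  shows "x \<in> S' \<Longrightarrow> dderiv S' f vs x = dderiv S f vs x"
proof (induction vs arbitrary: x)
  case (Cons v vs)
  have at: "at x within S' = at x within S"
    using at_within_openin[OF assms(1), of x] at_within_openin[OF assms(2), of x] Cons.prems assms(3) by auto
  have S: "at x within S = at x within (S' :: 'a set)" by (simp add: at)
  have "(dderiv S' f vs has_derivative D) (at x within S') \<longleftrightarrow> (dderiv S f vs has_derivative D) (at x within S')" for D
    using has_derivative_transform[OF Cons.prems, of "dderiv S f vs" "dderiv S' f vs" D]
      has_derivative_transform[OF Cons.prems, of "dderiv S' f vs" "dderiv S f vs" D] Cons.IH
    by auto
  then show ?case
    by (simp add: frechet_derivative_def S)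
qed simp

lemma smooth_on_open_subset:
  assumes "smooth_on S f" and o: "openin (top_of_set Q) S" "openin (top_of_set Q) S'" and sub: "S' \<subseteq> S"
  shows "smooth_on S' f"
  unfolding smooth_on_def differentiable_on_def
proof (intro allI ballI)
  fix vs x assume x: "x \<in> S'"
  then have "(dderiv S f vs has_derivative frechet_derivative (dderiv S f vs) (at x within S)) (at x within S)"
    using smooth_on_has_derivative[OF assms(1)] sub by blast
  then have "(dderiv S f vs has_derivative frechet_derivative (dderiv S f vs) (at x within S)) (at x within S')"
    using sub has_derivative_subset by blast
  then have "(dderiv S' f vs has_derivative frechet_derivative (dderiv S f vs) (at x within S)) (at x within S')"
    by (rule has_derivative_transform[OF x, rotated]) (rule dderiv_subset[OF o sub])
  then show "dderiv S' f vs differentiable at x within S'"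
    by (rule differentiableI)
qed

text \<open>\<open>Q\<close> is the model set: a chart has an open subset of \<open>Q\<close> as its image.\<close>

definition atlas :: "'m::real_normed_vector set \<Rightarrow> ('p, 'm) manifold \<Rightarrow> bool" where
  "atlas Q M \<longleftrightarrow> fat Q \<and> (\<forall>x\<in>pts M. \<exists>(U, c)\<in>charts M. x \<in> U) \<and>
     (\<forall>(U, c)\<in>charts M. openin (mtop M) U \<and> openin (top_of_set Q) (c ` U) \<and>
        homeomorphic_map (subtopology (mtop M) U) (top_of_set (c ` U)) c) \<and>
     (\<forall>(U, c)\<in>charts M. \<forall>(V, d)\<in>charts M. smooth_on (c ` (U \<inter> V)) (d \<circ> inv_into U c))"

lemma smooth_manifold_atlas: "smooth_manifold M \<Longrightarrow> atlas UNIV M"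
  unfolding smooth_manifold_def atlas_def by (fastforce simp: fat_UNIV)

lemma atlas_fat: "atlas Q M \<Longrightarrow> fat Q"
  by (simp add: atlas_def)

lemma atlas_chart:
  assumes "atlas Q M" "x \<in> pts M"
  obtains U c where "(U, c) \<in> charts M" "x \<in> U"
  using assms unfolding atlas_def by blast

section \<open>Charts as homeomorphisms onto open subsets of the model set\<close>

context
  fixes Q :: "'m::real_normed_vector set" and M :: "('p, 'm) manifold" and U c
  assumes M: "atlas Q M" and C: "(U, c) \<in> charts M"
begin

lemma chart_open: "openin (mtop M) U"
  using M C unfolding atlas_def by blast

lemma chart_homeo: "homeomorphic_map (subtopology (mtop M) U) (top_of_set (c ` U)) c"
  using M C unfolding atlas_def by blast

lemma chart_sub: "U \<subseteq> pts M"
  using chart_open by (rule openin_subset)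

lemma chart_inj: "inj_on c U"
  using homeomorphic_imp_injective_map[OF chart_homeo] chart_sub by (simp add: inf_absorb2)

lemma chart_img_open:
  assumes "openin (mtop M) B" "B \<subseteq> U"
  shows "openin (top_of_set Q) (c ` B)"
proof -
  have "openin (subtopology (mtop M) U) B"
    using assms openin_open_subtopology[OF chart_open] by simp
  then have "openin (top_of_set (c ` U)) (c ` B)"
    using homeomorphic_imp_open_map[OF chart_homeo] by (simp add: open_map_def)
  moreover have "openin (top_of_set Q) (c ` U)"
    using M C unfolding atlas_def by blast
  ultimately show ?thesis
    by (rule openin_trans)
qed

lemma chart_preimage_open:
  assumes "openin (top_of_set Q) S"
  shows "openin (mtop M) {x \<in> U. c x \<in> S}"
proof -
  obtain T where T: "open T" "S = Q \<inter> T" using assms by (auto simp: openin_open)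
  have "continuous_map (subtopology (mtop M) U) euclidean c"
    using homeomorphic_imp_continuous_map[OF chart_homeo] by (simp add: continuous_map_in_subtopology)
  from openin_continuous_map_preimage[OF this, of T] T(1)
  have "openin (subtopology (mtop M) U) {x \<in> U. c x \<in> T}"
    using chart_sub by (simp add: inf_absorb2)
  moreover have "{x \<in> U. c x \<in> T} = {x \<in> U. c x \<in> S}"
    using openin_subset[OF chart_img_open[OF chart_open]] T by auto
  ultimately show ?thesis
    using openin_trans_full[OF _ chart_open] by simp
qed

lemma chart_inv: "x \<in> U \<Longrightarrow> inv_into U c (c x) = x"
  by (rule inv_into_f_f[OF chart_inj])

lemma chart_inv_cont: "continuous_map (top_of_set (c ` U)) (mtop M) (inv_into U c)"
proof -
  obtain g where g: "homeomorphic_maps (subtopology (mtop M) U) (top_of_set (c ` U)) c g"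
    using chart_homeo by (auto simp: homeomorphic_map_maps)
  then have "continuous_map (top_of_set (c ` U)) (mtop M) g"
    by (auto simp: homeomorphic_maps_def continuous_map_in_subtopology)
  then show ?thesis
    by (rule continuous_map_eq)
      (use g chart_sub chart_inv in \<open>auto simp: homeomorphic_maps_def\<close>)
qed

end

lemma chart_transition:
  assumes "atlas Q M" "(U, c) \<in> charts M" "(V, d) \<in> charts M"
  shows "smooth_on (c ` (U \<inter> V)) (d \<circ> inv_into U c)"
  using assms unfolding atlas_def by blast

text \<open>A family of maps \<open>\<Phi>\<close>, continuous in the parameter together with all derivatives in the point.\<close>

definition sm_at :: "'m::real_normed_vector set \<Rightarrow> 'x topology \<Rightarrow> ('p, 'm) manifold \<Rightarrow>
    ('q, 'n::real_normed_vector) manifold \<Rightarrow> ('x \<Rightarrow> 'p \<Rightarrow> 'q) \<Rightarrow> 'x \<Rightarrow> 'p \<Rightarrow> bool" where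
  "sm_at Q X M N \<Phi> p0 x0 \<longleftrightarrow>
     (\<exists>U c V d A B. (U, c) \<in> charts M \<and> (V, d) \<in> charts N \<and> openin X A \<and> p0 \<in> A \<and>
        openin (mtop M) B \<and> x0 \<in> B \<and> B \<subseteq> U \<and> (\<forall>p\<in>A. \<forall>x\<in>B. \<Phi> p x \<in> V) \<and>
        psmooth Q X (A \<times> c ` B) (\<lambda>z. d (\<Phi> (fst z) (inv_into U c (snd z)))))"

definition psmap where
  "psmap Q X M N \<Phi> \<longleftrightarrow> (\<forall>p\<in>topspace X. \<forall>x\<in>pts M. sm_at Q X M N \<Phi> p x)"

text \<open>Smoothness does not depend on the charts in which it is read. After shrinking both
  neighbourhoods so that points and values lie in the overlaps, the local representation is
  conjugated with the transition maps.\<close>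

lemma sm_at_charts:
  fixes M :: "('p, 'm::real_normed_vector) manifold" and N :: "('q, 'n::real_normed_vector) manifold"
  assumes M: "atlas Q M" and N: "atlas R N" and fd: "findim TYPE('m)" "findim TYPE('n)"
    and sm: "sm_at Q X M N \<Phi> p0 x0" and c': "(U', c') \<in> charts M" "x0 \<in> U'"
    and d': "(V', d') \<in> charts N" "\<Phi> p0 x0 \<in> V'"
  obtains A B where "openin X A" "p0 \<in> A" "openin (mtop M) B" "x0 \<in> B" "B \<subseteq> U'"
    "\<forall>p\<in>A. \<forall>x\<in>B. \<Phi> p x \<in> V'"
    "psmooth Q X (A \<times> c' ` B) (\<lambda>z. d' (\<Phi> (fst z) (inv_into U' c' (snd z))))"
proof -
  obtain U c V d A B where c: "(U, c) \<in> charts M" and d: "(V, d) \<in> charts N"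
    and A: "openin X A" "p0 \<in> A" and B: "openin (mtop M) B" "x0 \<in> B" "B \<subseteq> U"
    and V: "\<And>p x. p \<in> A \<Longrightarrow> x \<in> B \<Longrightarrow> \<Phi> p x \<in> V"
    and F: "psmooth Q X (A \<times> c ` B) (\<lambda>z. d (\<Phi> (fst z) (inv_into U c (snd z))))" (is "psmooth _ _ _ ?F")
    using sm unfolding sm_at_def by blast
  have "openin (mtop N) (V \<inter> V')"
    by (intro openin_Int chart_open[OF N d] chart_open[OF N d'(1)])
  then have "openin (top_of_set R) (d ` (V \<inter> V'))"
    by (rule chart_img_open[OF N d]) auto
  \<comment> \<open>\<open>psmooth_box\<close> asks for an open set of the ambient vector space, so
    the overlap is described by \<open>T\<close>; membership in \<open>R\<close> is recovered later
    from the chart image.\<close>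
  then obtain T where T: "open T" "d ` (V \<inter> V') = R \<inter> T" by (auto simp: openin_open)
  have inv: "inv_into U c (c x) = x" if "x \<in> B" for x
    using chart_inv[OF M c] B(3) that by blast
  have inT: "?F (p0, c x0) \<in> T"
    using T(2) V[OF A(2) B(2)] d'(2) inv[OF B(2)] by auto
  obtain A2 S where A2: "openin X A2" "p0 \<in> A2" and S: "openin (top_of_set Q) S" "c x0 \<in> S"
    and sub: "A2 \<times> S \<subseteq> A \<times> c ` B" and FT: "\<forall>p\<in>A2. \<forall>y\<in>S. ?F (p, y) \<in> T"
    by (rule psmooth_box[OF F _ T(1) inT]) (use A B in auto)
  have A2A: "A2 \<subseteq> A" and SB: "S \<subseteq> c ` B" using sub A2(2) S(2) by auto
  define B2 where "B2 = {x \<in> U. c x \<in> S} \<inter> B \<inter> U'"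
  have B2: "openin (mtop M) B2"
    unfolding B2_def by (intro openin_Int chart_preimage_open[OF M c S(1)] B(1) chart_open[OF M c'(1)])
  have x0: "x0 \<in> B2" using B c'(2) S(2) by (auto simp: B2_def)
  have imgV': "\<Phi> p x \<in> V \<inter> V'" if "p \<in> A2" "x \<in> B2" for p x
  proof -
    have xB: "x \<in> B" "c x \<in> S" using that(2) by (auto simp: B2_def)
    have V1: "\<Phi> p x \<in> V" using V that(1) A2A xB(1) by blast
    have "?F (p, c x) \<in> T" using FT that(1) xB(2) by blast
    then have "d (\<Phi> p x) \<in> T" using inv[OF xB(1)] by simp
    moreover have "d (\<Phi> p x) \<in> R"
      using V1 openin_subset[OF chart_img_open[OF N d chart_open[OF N d]]] by auto
    ultimately have "d (\<Phi> p x) \<in> d ` (V \<inter> V')" using T(2) by auto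
    then show ?thesis
      using V1 inj_on_image_mem_iff[OF chart_inj[OF N d], of "\<Phi> p x" "V \<inter> V'"] by auto
  qed
  have W2: "pdom Q X (A2 \<times> c' ` B2)"
    using chart_img_open[OF M c'(1) B2] by (intro pdom_box atlas_fat[OF M] A2) (auto simp: B2_def)
  have tr: "c (inv_into U' c' (c' x)) = c x" if "x \<in> B2" for x
    using chart_inv[OF M c'(1)] that by (simp add: B2_def)
  have "psmooth Q X (A2 \<times> c' ` B2) (\<lambda>z. (c \<circ> inv_into U' c') (snd z))"
  proof (rule psmooth_compose_smooth[OF fd(1) _ chart_transition[OF M c'(1) c] atlas_fat[OF M]])
    show "psmooth Q X (A2 \<times> c' ` B2) snd" by (rule psmooth_intros(2)[OF W2])
    show "openin (top_of_set Q) (c' ` (U' \<inter> U))"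
      using chart_img_open[OF M c'(1)] chart_open[OF M c'(1)] chart_open[OF M c] by auto
  qed (auto simp: B2_def)
  then have "psmooth Q X (A2 \<times> c' ` B2) (\<lambda>z. ?F (fst z, (c \<circ> inv_into U' c') (snd z)))"
    by (rule psmooth_compose[OF fd(1) _ F]) (use A2A tr in \<open>auto simp: B2_def\<close>)
  then have "psmooth Q X (A2 \<times> c' ` B2) (\<lambda>z. (d' \<circ> inv_into V d) (?F (fst z, (c \<circ> inv_into U' c') (snd z))))"
  proof (rule psmooth_compose_smooth[OF fd(2) _ chart_transition[OF N d d'(1)] atlas_fat[OF N]])
    show "openin (top_of_set R) (d ` (V \<inter> V'))" by fact
    fix z assume z: "z \<in> A2 \<times> c' ` B2"
    then obtain p x where zp: "z = (p, c' x)" "p \<in> A2" "x \<in> B2" by auto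
    moreover have "x \<in> B" using zp(3) by (simp add: B2_def)
    ultimately show "?F (fst z, (c \<circ> inv_into U' c') (snd z)) \<in> d ` (V \<inter> V')"
      using imgV' tr inv by auto
  qed
  then have "psmooth Q X (A2 \<times> c' ` B2) (\<lambda>z. d' (\<Phi> (fst z) (inv_into U' c' (snd z))))"
  proof (rule psmooth_cong)
    fix z assume z: "z \<in> A2 \<times> c' ` B2"
    then obtain p x where zp: "z = (p, c' x)" "p \<in> A2" "x \<in> B2" by auto
    moreover have "x \<in> B" "x \<in> U'" using zp(3) by (auto simp: B2_def)
    moreover have "inv_into V d (d (\<Phi> p x)) = \<Phi> p x"
      using chart_inv[OF N d] imgV'[OF zp(2,3)] by blast
    ultimately show "(d' \<circ> inv_into V d) (?F (fst z, (c \<circ> inv_into U' c') (snd z))) =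
        d' (\<Phi> (fst z) (inv_into U' c' (snd z)))"
      using tr inv chart_inv[OF M c'(1)] by simp
  qed
  then show thesis
    using that[OF A2 B2 x0] imgV' by (auto simp: B2_def)
qed

text \<open>The domain of the local representation varies with the parameter, so it is not a
  product. This explains why \<open>pdom\<close> admits arbitrary open sets of pairs.\<close>

lemma psmap_loc_rep:
  fixes M :: "('p, 'm::real_normed_vector) manifold" and N :: "('q, 'n::real_normed_vector) manifold"
  assumes M: "atlas Q M" and N: "atlas R N" and fd: "findim TYPE('m)" "findim TYPE('n)"
    and \<Phi>: "psmap Q X M N \<Phi>" and c: "(U, c) \<in> charts M" and d: "(V, d) \<in> charts N"
  shows "psmooth Q X {(p, y). p \<in> topspace X \<and> y \<in> loc_dom (U, c) (V, d) (\<Phi> p)}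
    (\<lambda>(p, y). loc_rep (U, c) (V, d) (\<Phi> p) y)"
proof (rule psmooth_local_cover[OF atlas_fat[OF M]])
  fix z assume "z \<in> {(p, y). p \<in> topspace X \<and> y \<in> loc_dom (U, c) (V, d) (\<Phi> p)}"
  then obtain p x where z: "z = (p, c x)" "p \<in> topspace X" "x \<in> U" "\<Phi> p x \<in> V"
    by (auto simp: loc_dom_def)
  have sm: "sm_at Q X M N \<Phi> p x"
    using \<Phi> z chart_sub[OF M c] by (auto simp: psmap_def)
  obtain A B where AB: "openin X A" "p \<in> A" "openin (mtop M) B" "x \<in> B" "B \<subseteq> U"
    "\<forall>p\<in>A. \<forall>x\<in>B. \<Phi> p x \<in> V"
    "psmooth Q X (A \<times> c ` B) (\<lambda>z. d (\<Phi> (fst z) (inv_into U c (snd z))))"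
    by (rule sm_at_charts[OF M N fd sm c z(3) d z(4)])
  show "\<exists>W'. z \<in> W' \<and> W' \<subseteq> {(p, y). p \<in> topspace X \<and> y \<in> loc_dom (U, c) (V, d) (\<Phi> p)} \<and>
      psmooth Q X W' (\<lambda>(p, y). loc_rep (U, c) (V, d) (\<Phi> p) y)"
  proof (intro exI conjI)
    show "z \<in> A \<times> c ` B" using z AB by auto
    show "A \<times> c ` B \<subseteq> {(p, y). p \<in> topspace X \<and> y \<in> loc_dom (U, c) (V, d) (\<Phi> p)}"
      using AB(5,6) openin_subset[OF AB(1)] by (auto simp: loc_dom_def)
    show "psmooth Q X (A \<times> c ` B) (\<lambda>(p, y). loc_rep (U, c) (V, d) (\<Phi> p) y)"
      by (rule psmooth_cong[OF AB(7)]) (auto simp: loc_rep_def)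
  qed
qed

lemma sm_at_cont:
  assumes M: "atlas Q M" and N: "atlas R N" and sm: "sm_at Q X M N \<Phi> p0 x0"
    and Y: "openin (mtop N) Y" "\<Phi> p0 x0 \<in> Y"
  obtains A B where "openin X A" "p0 \<in> A" "openin (mtop M) B" "x0 \<in> B"
    "\<forall>p\<in>A. \<forall>x\<in>B. \<Phi> p x \<in> Y"
proof -
  obtain U c V d A B where c: "(U, c) \<in> charts M" and d: "(V, d) \<in> charts N"
    and A: "openin X A" "p0 \<in> A" and B: "openin (mtop M) B" "x0 \<in> B" "B \<subseteq> U"
    and V: "\<And>p x. p \<in> A \<Longrightarrow> x \<in> B \<Longrightarrow> \<Phi> p x \<in> V"
    and F: "psmooth Q X (A \<times> c ` B) (\<lambda>z. d (\<Phi> (fst z) (inv_into U c (snd z))))" (is "psmooth _ _ _ ?F")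
    using sm unfolding sm_at_def by blast
  have "openin (mtop N) (V \<inter> Y)"
    by (intro openin_Int chart_open[OF N d] Y)
  then have "openin (top_of_set R) (d ` (V \<inter> Y))"
    by (rule chart_img_open[OF N d]) auto
  then obtain T where T: "open T" "d ` (V \<inter> Y) = R \<inter> T" by (auto simp: openin_open)
  have inv: "inv_into U c (c x) = x" if "x \<in> B" for x
    using chart_inv[OF M c] B(3) that by blast
  have inT: "?F (p0, c x0) \<in> T"
    using T(2) V[OF A(2) B(2)] Y(2) inv[OF B(2)] by auto
  obtain A2 S where A2: "openin X A2" "p0 \<in> A2" and S: "openin (top_of_set Q) S" "c x0 \<in> S"
    and sub: "A2 \<times> S \<subseteq> A \<times> c ` B" and FT: "\<forall>p\<in>A2. \<forall>y\<in>S. ?F (p, y) \<in> T"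
    by (rule psmooth_box[OF F _ T(1) inT]) (use A B in auto)
  have A2A: "A2 \<subseteq> A" using sub S(2) by auto
  show thesis
  proof (rule that[OF A2]; (intro ballI)?)
    show "openin (mtop M) ({x \<in> U. c x \<in> S} \<inter> B)"
      by (intro openin_Int chart_preimage_open[OF M c S(1)] B(1))
    show "x0 \<in> {x \<in> U. c x \<in> S} \<inter> B" using B S by auto
    fix p x assume "p \<in> A2" "x \<in> {x \<in> U. c x \<in> S} \<inter> B"
    then have p: "p \<in> A2" "x \<in> B" "c x \<in> S" by auto
    have V1: "\<Phi> p x \<in> V" using V p A2A by blast
    have "d (\<Phi> p x) \<in> T" using bspec[OF bspec[OF FT p(1)] p(3)] inv[OF p(2)] by simp
    moreover have "d (\<Phi> p x) \<in> R"
      using V1 openin_subset[OF chart_img_open[OF N d chart_open[OF N d]]] by auto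
    ultimately have "d (\<Phi> p x) \<in> d ` (V \<inter> Y)" using T(2) by auto
    then show "\<Phi> p x \<in> Y"
      using V1 inj_on_image_mem_iff[OF chart_inj[OF N d], of "\<Phi> p x" "V \<inter> Y"] by auto
  qed
qed

lemma sm_at_pts:
  assumes "atlas R N" "sm_at Q X M N \<Phi> p0 x0"
  shows "\<Phi> p0 x0 \<in> pts N"
  using assms chart_sub unfolding sm_at_def by blast

lemma psmap_continuous:
  assumes M: "atlas Q M" and N: "atlas R N" and \<Phi>: "psmap Q X M N \<Phi>"
  shows "continuous_map (prod_topology X (mtop M)) (mtop N) (\<lambda>z. \<Phi> (fst z) (snd z))"
  unfolding continuous_map_eq_topcontinuous_at topcontinuous_at_def
proof (intro ballI conjI allI impI)
  show "(\<lambda>z. \<Phi> (fst z) (snd z)) \<in> topspace (prod_topology X (mtop M)) \<rightarrow> pts N"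
  proof
    fix z assume "z \<in> topspace (prod_topology X (mtop M))"
    then have "sm_at Q X M N \<Phi> (fst z) (snd z)" using \<Phi> by (auto simp: psmap_def)
    then show "\<Phi> (fst z) (snd z) \<in> pts N" by (rule sm_at_pts[OF N])
  qed
  fix z Y assume z: "z \<in> topspace (prod_topology X (mtop M))"
    and Y: "openin (mtop N) Y \<and> \<Phi> (fst z) (snd z) \<in> Y"
  then have "sm_at Q X M N \<Phi> (fst z) (snd z)" using \<Phi> by (auto simp: psmap_def)
  then obtain A B where AB: "openin X A" "fst z \<in> A" "openin (mtop M) B" "snd z \<in> B"
    "\<forall>p\<in>A. \<forall>x\<in>B. \<Phi> p x \<in> Y"
    using sm_at_cont[OF M N] Y by metis
  then show "\<exists>U. openin (prod_topology X (mtop M)) U \<and> z \<in> U \<and> (\<forall>y\<in>U. \<Phi> (fst y) (snd y) \<in> Y)"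
    by (intro exI[of _ "A \<times> B"]) (auto simp: openin_prod_Times_iff mem_Times_iff)
qed

lemma psmap_smooth_map:
  fixes M :: "('p, 'm::real_normed_vector) manifold" and N :: "('q, 'n::real_normed_vector) manifold"
  assumes M: "atlas Q M" and N: "atlas R N" and fd: "findim TYPE('m)" "findim TYPE('n)"
    and \<Phi>: "psmap Q X M N \<Phi>" and p: "p \<in> topspace X"
  shows "smooth_map M N (\<Phi> p)"
  unfolding smooth_map_def
proof (intro conjI ballI)
  have "continuous_map (mtop M) (prod_topology X (mtop M)) (\<lambda>x. (p, x))"
    using p by (simp add: continuous_map_pairwise o_def)
  from continuous_map_compose[OF this psmap_continuous[OF M N \<Phi>]]
  show "continuous_map (mtop M) (mtop N) (\<Phi> p)" by (simp add: o_def)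
  fix C D assume "C \<in> charts M" "D \<in> charts N"
  then obtain U c V d where C: "C = (U, c)" "(U, c) \<in> charts M" and D: "D = (V, d)" "(V, d) \<in> charts N"
    by (metis surj_pair)
  from psmooth_smooth_on[OF psmap_loc_rep[OF M N fd \<Phi> C(2) D(2)], of p]
  show "smooth_on (loc_dom C D (\<Phi> p)) (loc_rep C D (\<Phi> p))"
    using p by (simp add: C D Image_def)
qed

lemma loc_dom_open:
  assumes M: "atlas Q M" and N: "atlas R N" and f: "continuous_map (mtop M) (mtop N) f"
    and c: "(U, c) \<in> charts M" and d: "(V, d) \<in> charts N"
  shows "openin (mtop M) (U \<inter> f -` V)" "openin (top_of_set Q) (loc_dom (U, c) (V, d) f)"
proof -
  have "openin (mtop M) {x \<in> pts M. f x \<in> V}"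
    by (rule openin_continuous_map_preimage[OF f chart_open[OF N d]])
  then have "openin (mtop M) (U \<inter> {x \<in> pts M. f x \<in> V})"
    using chart_open[OF M c] by (rule openin_Int[rotated])
  moreover have "U \<inter> {x \<in> pts M. f x \<in> V} = U \<inter> f -` V"
    using chart_sub[OF M c] by auto
  ultimately show *: "openin (mtop M) (U \<inter> f -` V)" by simp
  show "openin (top_of_set Q) (loc_dom (U, c) (V, d) f)"
    using chart_img_open[OF M c *] by (simp add: loc_dom_def)
qed

text \<open>With \<open>psmap_smooth_map\<close> over a one-point parameter space, this transports
  facts about single smooth maps through the calculus of families.\<close>

lemma smooth_map_psmap:
  assumes M: "atlas Q M" and N: "atlas R N" and f: "smooth_map M N f"
  shows "psmap Q X M N (\<lambda>_. f)"
  unfolding psmap_def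
proof (intro ballI)
  fix p x assume p: "p \<in> topspace X" and x: "x \<in> pts M"
  have cf: "continuous_map (mtop M) (mtop N) f" using f by (simp add: smooth_map_def)
  then have "f x \<in> pts N" using x by (auto simp: continuous_map_def)
  then obtain V d where d: "(V, d) \<in> charts N" "f x \<in> V" using atlas_chart[OF N] by metis
  obtain U c where c: "(U, c) \<in> charts M" "x \<in> U" using atlas_chart[OF M x] by metis
  have "smooth_on (loc_dom (U, c) (V, d) f) (loc_rep (U, c) (V, d) f)"
    using f c d by (auto simp: smooth_map_def)
  from smooth_on_psmooth[OF this atlas_fat[OF M] loc_dom_open(2)[OF M N cf c(1) d(1)], of X]
  have "psmooth Q X (topspace X \<times> c ` (U \<inter> f -` V)) (\<lambda>z. d (f (inv_into U c (snd z))))"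
    by (simp add: loc_dom_def loc_rep_def)
  then show "sm_at Q X M N (\<lambda>_. f) p x"
    unfolding sm_at_def
    using p c d loc_dom_open(1)[OF M N cf c(1) d(1)] openin_topspace[of X]
    by (intro exI[of _ U] exI[of _ c] exI[of _ V] exI[of _ d] exI[of _ "topspace X"] exI[of _ "U \<inter> f -` V"])
      auto
qed

text \<open>The chart in the middle is dictated by \<open>\<Psi>\<close>;
  \<open>sm_at_charts\<close> re-expresses \<open>\<Phi>\<close> in it, and continuity keeps the
  inner values in the domain of the outer representation.\<close>

lemma sm_at_compose:
  fixes M :: "('p, 'm::real_normed_vector) manifold" and N :: "('q, 'n::real_normed_vector) manifold"
    and P :: "('r, 'l::real_normed_vector) manifold"
  assumes M: "atlas Q M" and N: "atlas R N" and fd: "findim TYPE('m)" "findim TYPE('n)"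
    and \<Phi>: "sm_at Q X M N \<Phi> p0 x0" and \<Psi>: "sm_at R X N P \<Psi> p0 (\<Phi> p0 x0)"
  shows "sm_at Q X M P (\<lambda>p x. \<Psi> p (\<Phi> p x)) p0 x0"
proof -
  obtain V d Z e A2 B2 where d: "(V, d) \<in> charts N" and e: "(Z, e) \<in> charts P"
    and A2: "openin X A2" "p0 \<in> A2" and B2: "openin (mtop N) B2" "\<Phi> p0 x0 \<in> B2" "B2 \<subseteq> V"
    and Z: "\<And>p x. p \<in> A2 \<Longrightarrow> x \<in> B2 \<Longrightarrow> \<Psi> p x \<in> Z"
    and G: "psmooth R X (A2 \<times> d ` B2) (\<lambda>z. e (\<Psi> (fst z) (inv_into V d (snd z))))" (is "psmooth _ _ _ ?G")
    using \<Psi> unfolding sm_at_def by blast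
  obtain U c where c: "(U, c) \<in> charts M" "x0 \<in> U"
    using \<Phi> unfolding sm_at_def by blast
  obtain A B where AB: "openin X A" "p0 \<in> A" "openin (mtop M) B" "x0 \<in> B" "B \<subseteq> U"
    "\<forall>p\<in>A. \<forall>x\<in>B. \<Phi> p x \<in> V"
    and F: "psmooth Q X (A \<times> c ` B) (\<lambda>z. d (\<Phi> (fst z) (inv_into U c (snd z))))"
    by (rule sm_at_charts[OF M N fd \<Phi> c d subsetD[OF B2(3,2)]])
  obtain A3 B3 where AB3: "openin X A3" "p0 \<in> A3" "openin (mtop M) B3" "x0 \<in> B3"
    "\<forall>p\<in>A3. \<forall>x\<in>B3. \<Phi> p x \<in> B2"
    using sm_at_cont[OF M N \<Phi> B2(1,2)] by metis
  let ?A = "A \<inter> A2 \<inter> A3" and ?B = "B \<inter> B3"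
  have W: "pdom Q X (?A \<times> c ` ?B)"
    using AB AB3 A2 by (intro pdom_box atlas_fat[OF M] openin_Int chart_img_open[OF M c(1)]) auto
  have inv: "inv_into U c (c x) = x" if "x \<in> B" for x
    using chart_inv[OF M c(1)] AB(5) that by blast
  have "psmooth Q X (?A \<times> c ` ?B) (\<lambda>z. ?G (fst z, d (\<Phi> (fst z) (inv_into U c (snd z)))))"
    by (rule psmooth_compose[OF fd(2) psmooth_subset[OF F W] G]) (use AB3(5) inv in auto)
  then have "psmooth Q X (?A \<times> c ` ?B) (\<lambda>z. e (\<Psi> (fst z) (\<Phi> (fst z) (inv_into U c (snd z)))))"
    by (rule psmooth_cong) (use AB(6) inv chart_inv[OF N d] in auto)
  moreover have "\<forall>p\<in>?A. \<forall>x\<in>?B. \<Psi> p (\<Phi> p x) \<in> Z" using Z AB3(5) by auto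
  moreover have "openin X ?A" "p0 \<in> ?A" "openin (mtop M) ?B" "x0 \<in> ?B" "?B \<subseteq> U"
    using AB AB3 A2 by auto
  ultimately show ?thesis
    unfolding sm_at_def using c e by blast
qed

lemma psmap_compose:
  fixes M :: "('p, 'm::real_normed_vector) manifold" and N :: "('q, 'n::real_normed_vector) manifold"
    and P :: "('r, 'l::real_normed_vector) manifold"
  assumes "atlas Q M" "atlas R N" "findim TYPE('m)" "findim TYPE('n)"
    and "psmap Q X M N \<Phi>" "psmap R X N P \<Psi>"
  shows "psmap Q X M P (\<lambda>p x. \<Psi> p (\<Phi> p x))"
  unfolding psmap_def
proof (intro ballI)
  fix p x assume p: "p \<in> topspace X" and x: "x \<in> pts M"
  have \<Phi>: "sm_at Q X M N \<Phi> p x" using assms(5) p x by (auto simp: psmap_def)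
  have "sm_at R X N P \<Psi> p (\<Phi> p x)"
    using assms(6) p sm_at_pts[OF assms(2) \<Phi>] by (auto simp: psmap_def)
  then show "sm_at Q X M P (\<lambda>p x. \<Psi> p (\<Phi> p x)) p x"
    by (rule sm_at_compose[OF assms(1-4) \<Phi>])
qed

lemma sm_at_pull:
  assumes M: "atlas Q M" and u: "continuous_map X' X u" and p: "p \<in> topspace X'"
    and \<Phi>: "sm_at Q X M N \<Phi> (u p) x"
  shows "sm_at Q X' M N (\<lambda>q. \<Phi> (u q)) p x"
proof -
  obtain U c V d A B where c: "(U, c) \<in> charts M" and d: "(V, d) \<in> charts N"
    and A: "openin X A" "u p \<in> A" and B: "openin (mtop M) B" "x \<in> B" "B \<subseteq> U"
    and V: "\<forall>p\<in>A. \<forall>x\<in>B. \<Phi> p x \<in> V"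
    and F: "psmooth Q X (A \<times> c ` B) (\<lambda>z. d (\<Phi> (fst z) (inv_into U c (snd z))))"
    using \<Phi> unfolding sm_at_def by blast
  have A': "openin X' {q \<in> topspace X'. u q \<in> A}"
    by (rule openin_continuous_map_preimage[OF u A(1)])
  have "psmooth Q X' ({q \<in> topspace X'. u q \<in> A} \<times> c ` B) (\<lambda>z. d (\<Phi> (fst (u (fst z), snd z)) (inv_into U c (snd (u (fst z), snd z)))))"
    by (rule psmooth_pull[OF u _ _ F])
      (use chart_img_open[OF M c B(1,3)] in \<open>auto intro!: pdom_box atlas_fat[OF M] A'\<close>)
  then show ?thesis
    unfolding sm_at_def using c d A' A B V p
    by (intro exI[of _ U] exI[of _ c] exI[of _ V] exI[of _ d] exI[of _ "{q \<in> topspace X'. u q \<in> A}"] exI[of _ B])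
      auto
qed

lemma psmap_pull:
  assumes "atlas Q M" "continuous_map X' X u" "psmap Q X M N \<Phi>"
  shows "psmap Q X' M N (\<lambda>q. \<Phi> (u q))"
  unfolding psmap_def
proof (intro ballI)
  fix p x assume "p \<in> topspace X'" "x \<in> pts M"
  moreover from this have "u p \<in> topspace X"
    using assms(2) by (auto simp: continuous_map_def)
  ultimately have "sm_at Q X M N \<Phi> (u p) x"
    using assms(3) by (auto simp: psmap_def)
  then show "sm_at Q X' M N (\<lambda>q. \<Phi> (u q)) p x"
    by (rule sm_at_pull[OF assms(1,2) \<open>p \<in> topspace X'\<close>])
qed

lemma sm_at_cong:
  assumes M: "atlas Q M" and \<Phi>: "sm_at Q X M N \<Phi> p x" and A: "openin X A" "p \<in> A" and B: "openin (mtop M) B" "x \<in> B"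
    and eq: "\<And>p x. p \<in> A \<Longrightarrow> x \<in> B \<Longrightarrow> \<Phi> p x = \<Psi> p x"
  shows "sm_at Q X M N \<Psi> p x"
proof -
  obtain U c V d A' B' where c: "(U, c) \<in> charts M" and d: "(V, d) \<in> charts N"
    and A': "openin X A'" "p \<in> A'" and B': "openin (mtop M) B'" "x \<in> B'" "B' \<subseteq> U"
    and V: "\<forall>p\<in>A'. \<forall>x\<in>B'. \<Phi> p x \<in> V"
    and F: "psmooth Q X (A' \<times> c ` B') (\<lambda>z. d (\<Phi> (fst z) (inv_into U c (snd z))))"
    using \<Phi> unfolding sm_at_def by blast
  have "pdom Q X ((A \<inter> A') \<times> c ` (B \<inter> B'))"
    using A A' B B' by (intro pdom_box atlas_fat[OF M] chart_img_open[OF M c]) auto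
  then have "psmooth Q X ((A \<inter> A') \<times> c ` (B \<inter> B')) (\<lambda>z. d (\<Phi> (fst z) (inv_into U c (snd z))))"
    by (rule psmooth_subset[OF F]) auto
  then have "psmooth Q X ((A \<inter> A') \<times> c ` (B \<inter> B')) (\<lambda>z. d (\<Psi> (fst z) (inv_into U c (snd z))))"
    by (rule psmooth_cong) (use eq chart_inv[OF M c] B'(3) in auto)
  moreover have "\<forall>p\<in>A \<inter> A'. \<forall>x\<in>B \<inter> B'. \<Psi> p x \<in> V" using V by (auto simp flip: eq)
  ultimately show ?thesis
    unfolding sm_at_def using c d A A' B B'
    by (intro exI[of _ U] exI[of _ c] exI[of _ V] exI[of _ d] exI[of _ "A \<inter> A'"] exI[of _ "B \<inter> B'"]) auto
qed

lemma psmap_cong: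
  assumes "atlas Q M" "psmap Q X M N \<Phi>" "\<And>p x. p \<in> topspace X \<Longrightarrow> x \<in> pts M \<Longrightarrow> \<Phi> p x = \<Psi> p x"
  shows "psmap Q X M N \<Psi>"
  using assms sm_at_cong[OF assms(1), of X N \<Phi> _ _ "topspace X" "pts M" \<Psi>] unfolding psmap_def by auto

section \<open>The topology on spaces of smooth maps\<close>

lemma psmooth_dderiv:
  assumes "psmooth Q X W F"
  shows "psmooth Q X W (\<lambda>(p, x). dderiv (W `` {p}) (\<lambda>y. F (p, y)) vs x)"
  using assms psm_dderiv[of Q X W vs _ F] by (auto simp: psmooth_def)

lemma frechet_derivative_euclidean:
  fixes f :: "'a::euclidean_space \<Rightarrow> 'b::real_normed_vector"
  assumes "smooth_on S f" "x \<in> S"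
  shows "frechet_derivative f (at x within S) v = (\<Sum>b\<in>Basis. (v \<bullet> b) *\<^sub>R frechet_derivative f (at x within S) b)"
proof -
  have "linear (frechet_derivative f (at x within S))"
    using smooth_on_has_derivative[OF assms, of "[]"] has_derivative_linear by simp
  then show ?thesis
    by (subst (1) euclidean_representation[symmetric]) (simp add: linear_sum linear_cmul o_def)
qed

text \<open>The directions must vary together with the point for uniform estimates over all unit
  vectors. They are encoded as the first \<open>l\<close> entries of a sequence, so that one product
  space serves for every length.\<close>

lemma dderiv_jointly_continuous:
  fixes F :: "'x \<times> 'a::euclidean_space \<Rightarrow> 'b::real_normed_vector"
  shows "psmooth Q X W F \<Longrightarrow> continuous_map (prod_topology (subtopology (ptop Q X) W) euclidean) euclidean
    (\<lambda>u. dderiv (W `` {fst (fst u)}) (\<lambda>y. F (fst (fst u), y)) (map (snd u :: nat \<Rightarrow> 'a) [0..<l]) (snd (fst u)))"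
proof (induction l arbitrary: F)
  case 0
  have "continuous_map (subtopology (ptop Q X) W) euclidean F"
    using 0 psm_cont unfolding psmooth_def by blast
  from continuous_map_compose[OF continuous_map_fst this] show ?case
    by (simp add: o_def)
next
  case (Suc l)
  let ?T = "prod_topology (subtopology (ptop Q X) W) (euclidean :: (nat \<Rightarrow> 'a) topology)"
  define G where "G = (\<lambda>b. \<lambda>(p, x). dderiv (W `` {p}) (\<lambda>y. F (p, y)) [b] x)"
  have W: "pdom Q X W" using Suc.prems by (rule psmooth_pdom)
  have G: "psmooth Q X W (G b)" for b
    unfolding G_def by (rule psmooth_dderiv[OF Suc.prems])
  have "continuous_map (euclidean :: (nat \<Rightarrow> 'a) topology) euclidean (\<lambda>w. w l)"
    by (simp add: continuous_on_product_coordinates)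
  from continuous_map_compose[OF continuous_map_snd this]
  have wl: "continuous_map ?T euclidean (\<lambda>u. snd u l)"
    by (simp add: o_def)
  \<comment> \<open>The vector \<open>w l\<close> belongs to the innermost derivative. Its expansion
    in the basis leaves finitely many fixed families \<open>G b\<close>, to which the induction
    hypothesis applies.\<close>
  have "continuous_map ?T euclidean (\<lambda>u. \<Sum>b\<in>Basis. (snd u l \<bullet> b) *\<^sub>R
      dderiv (W `` {fst (fst u)}) (\<lambda>y. G b (fst (fst u), y)) (map (snd u) [0..<l]) (snd (fst u)))"
    using Suc.IH[OF G] wl
    by (intro continuous_map_sum) (auto simp: continuous_map_atin intro!: tendsto_scaleR tendsto_inner)
  then show ?case
  proof (rule continuous_map_eq)
    fix u assume "u \<in> topspace ?T"
    then obtain p x w where u: "u = ((p, x), w)" "(p, x) \<in> W" by (cases u) auto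
    let ?S = "W `` {p}"
    have x: "x \<in> ?S" using u by simp
    have sm: "smooth_on ?S (\<lambda>y. F (p, y))"
      by (rule psmooth_smooth_on[OF Suc.prems])
    have "(\<Sum>b\<in>Basis. (w l \<bullet> b) *\<^sub>R dderiv ?S (\<lambda>y. G b (p, y)) (map w [0..<l]) x) =
        dderiv ?S (\<lambda>x. \<Sum>b\<in>Basis. (w l \<bullet> b) *\<^sub>R G b (p, x)) (map w [0..<l]) x"
      by (rule dderiv_sum[OF pdom_fat[OF W] pdom_slice[OF W] psmooth_smooth_on[OF G] x, symmetric])
    also have "\<dots> = dderiv ?S (dderiv ?S (\<lambda>y. F (p, y)) [w l]) (map w [0..<l]) x"
      by (rule dderiv_cong[OF _ x]) (simp add: G_def frechet_derivative_euclidean[OF sm, of _ "w l"])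
    also have "\<dots> = dderiv ?S (\<lambda>y. F (p, y)) (map w [0..<Suc l]) x"
      by (simp add: dderiv_append)
    finally show "(\<Sum>b\<in>Basis. (snd u l \<bullet> b) *\<^sub>R
        dderiv (W `` {fst (fst u)}) (\<lambda>y. G b (fst (fst u), y)) (map (snd u) [0..<l]) (snd (fst u))) =
      dderiv (W `` {fst (fst u)}) (\<lambda>y. F (fst (fst u), y)) (map (snd u) [0..<Suc l]) (snd (fst u))"
      by (simp add: u(1))
  qed
qed

text \<open>Tychonoff's theorem for the unit ball; this is the compact factor in the tube lemma over
  all unit directions.\<close>

lemma compact_bounded_sequences: "compact {w :: nat \<Rightarrow> 'a::{real_normed_vector, heine_borel}. \<forall>i. norm (w i) \<le> 1}"
proof -
  have "compactin (product_topology (\<lambda>_. euclidean) UNIV) (PiE UNIV (\<lambda>_::nat. cball (0::'a) 1))"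
    by (simp add: compactin_PiE)
  moreover have "PiE UNIV (\<lambda>_::nat. cball (0::'a) 1) = {w. \<forall>i. norm (w i) \<le> 1}"
    by (auto simp: PiE_UNIV_domain)
  ultimately show ?thesis
    by (simp add: euclidean_product_topology)
qed

lemma openin_Cinf_nbhd:
  assumes "f \<in> smooth_maps M N" "C \<in> charts M" "D \<in> charts N" "compactin (mtop M) K" "K \<subseteq> fst C" "f ` K \<subseteq> fst D" "\<epsilon> > 0"
  shows "openin (Cinf_topology M N) (Cinf_nbhd M N f C D K r \<epsilon>)"
  unfolding Cinf_topology_def by (rule topology_generated_by_Basis) (use assms in blast)

lemma Cinf_nbhd_self:
  assumes "f \<in> smooth_maps M N" "f ` K \<subseteq> fst D" "\<epsilon> > 0"
  shows "f \<in> Cinf_nbhd M N f C D K r \<epsilon>"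
  using assms by (simp add: Cinf_nbhd_def)

lemma topspace_Cinf: "topspace (Cinf_topology M N) = smooth_maps M N"
  unfolding Cinf_topology_def topology_generated_by_topspace by (auto simp: Cinf_nbhd_def)

text \<open>The exponential law: a map into the space of smooth maps is continuous if it is a smooth family
  (and conversely, by the next lemma, as the tautological family is smooth).\<close>

lemma psmap_imp_continuous_Cinf:
  fixes M :: "('p, 'm::euclidean_space) manifold" and N :: "('q, 'n::real_normed_vector) manifold"
    and X :: "'x topology"
  assumes M: "atlas Q M" and N: "atlas R N" and fd: "findim TYPE('n)"
    and \<Phi>: "psmap Q X M N \<Phi>" and sm: "\<And>p. p \<in> topspace X \<Longrightarrow> \<Phi> p \<in> smooth_maps M N"
  shows "continuous_map X (Cinf_topology M N) \<Phi>"
proof -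
  have "openin X {p \<in> topspace X. \<Phi> p \<in> Cinf_nbhd M N f C D K r \<epsilon>}"
    if f: "f \<in> smooth_maps M N" and C': "C \<in> charts M" and D': "D \<in> charts N" and K: "compactin (mtop M) K"
      "K \<subseteq> fst C" "f ` K \<subseteq> fst D" and \<epsilon>: "\<epsilon> > 0" for f C D K r \<epsilon>
  proof (subst openin_subopen, intro ballI)
    obtain U c V d where C: "C = (U, c)" "(U, c) \<in> charts M" and D: "D = (V, d)" "(V, d) \<in> charts N"
      using C' D' by (metis surj_pair)
    fix p0 assume "p0 \<in> {p \<in> topspace X. \<Phi> p \<in> Cinf_nbhd M N f C D K r \<epsilon>}"
    then have p0: "p0 \<in> topspace X" "\<Phi> p0 ` K \<subseteq> V"
      and near: "\<And>x vs. x \<in> K \<Longrightarrow> length vs \<le> r \<Longrightarrow> \<forall>v\<in>set vs. norm v \<le> 1 \<Longrightarrow>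
         norm (dderiv (loc_dom C D (\<Phi> p0)) (loc_rep C D (\<Phi> p0)) vs (c x) - dderiv (loc_dom C D f) (loc_rep C D f) vs (c x)) < \<epsilon>"
      by (auto simp: Cinf_nbhd_def C D)
    \<comment> \<open>First tube, over the compact set \<open>K\<close>: maps with nearby parameter
      still send all of \<open>K\<close> into the chart domain \<open>V\<close>.\<close>
    have "openin (prod_topology X (mtop M)) {z \<in> topspace (prod_topology X (mtop M)). \<Phi> (fst z) (snd z) \<in> V}"
      by (rule openin_continuous_map_preimage[OF psmap_continuous[OF M N \<Phi>] chart_open[OF N D(2)]])
    moreover have "{p0} \<times> K \<subseteq> {z \<in> topspace (prod_topology X (mtop M)). \<Phi> (fst z) (snd z) \<in> V}"
      using p0 compactin_subset_topspace[OF K(1)] by auto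
    ultimately have "\<exists>A B. openin X A \<and> openin (mtop M) B \<and> p0 \<in> A \<and> K \<subseteq> B \<and>
        A \<times> B \<subseteq> {z \<in> topspace (prod_topology X (mtop M)). \<Phi> (fst z) (snd z) \<in> V}"
      by (intro tube_lemma_right K(1) p0(1))
    then obtain A B where A: "openin X A" "p0 \<in> A" and AB: "K \<subseteq> B"
      "A \<times> B \<subseteq> {z \<in> topspace (prod_topology X (mtop M)). \<Phi> (fst z) (snd z) \<in> V}" by blast
    have AV: "\<Phi> p ` K \<subseteq> V" if "p \<in> A" for p
    proof
      fix v assume "v \<in> \<Phi> p ` K"
      then obtain x where "x \<in> K" "v = \<Phi> p x" by auto
      then show "v \<in> V" using subsetD[OF AB(2), of "(p, x)"] AB(1) that by auto
    qed
    define W where "W = {(p, y). p \<in> topspace X \<and> y \<in> loc_dom (U, c) (V, d) (\<Phi> p)}"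
    define F where "F = (\<lambda>(p, y). loc_rep (U, c) (V, d) (\<Phi> p) y)"
    have F: "psmooth Q X W F"
      unfolding W_def F_def by (rule psmap_loc_rep[OF M N findim_euclidean fd \<Phi> C(2) D(2)])
    define h where "h = dderiv (loc_dom C D f) (loc_rep C D f)"
    have cf: "continuous_map (mtop M) (mtop N) f" and smf: "smooth_on (loc_dom C D f) (loc_rep C D f)"
      using f C' D' by (auto simp: smooth_maps_def smooth_map_def)
    have cK: "compact (c ` K)"
    proof -
      have "compactin (subtopology (mtop M) U) K"
        using K C by (auto simp: compactin_subtopology)
      then have "compactin (top_of_set (c ` U)) (c ` K)"
        using image_compactin homeomorphic_imp_continuous_map[OF chart_homeo[OF M C(2)]] by blast
      then show ?thesis by (simp add: compactin_subtopology)
    qed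
    let ?Wb = "{w :: nat \<Rightarrow> 'm. \<forall>i. norm (w i) \<le> 1}"
    let ?Y = "prod_topology (top_of_set (c ` K)) (euclidean :: (nat \<Rightarrow> 'm) topology)"
    have KW: "(p, y) \<in> W" if pA: "p \<in> A" and yK: "y \<in> c ` K" for p y
    proof -
      obtain x where x: "x \<in> K" "y = c x" using yK by auto
      then have "x \<in> U" "\<Phi> p x \<in> V" using AV[OF pA] K(2) C(1) by auto
      then show ?thesis using x openin_subset[OF A(1)] pA by (auto simp: W_def loc_dom_def)
    qed
    have "K \<subseteq> U \<inter> f -` V"
      using K C D by auto
    then have Kf: "c ` K \<subseteq> loc_dom C D f"
      by (auto simp: loc_dom_def C D)
    have KQ: "c ` K \<subseteq> Q"
      using openin_subset[OF loc_dom_open(2)[OF M N cf C(2) D(2)]] Kf C D by auto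
    \<comment> \<open>Second tube, one for each order \<open>l\<close>. The compact factor consists
      of the coordinates of \<open>K\<close> and the unit directions, so the estimate is uniform in
      both.\<close>
    have ex: "\<exists>A'. openin X A' \<and> p0 \<in> A' \<and> A' \<subseteq> A \<and> (\<forall>p\<in>A'. \<forall>x\<in>K. \<forall>w\<in>?Wb.
        norm (dderiv (W `` {p}) (\<lambda>y. F (p, y)) (map w [0..<l]) (c x) - h (map w [0..<l]) (c x)) < \<epsilon>)"
      if l: "l \<le> r" for l
    proof -
      let ?T = "prod_topology (subtopology X A) ?Y"
      define H1 where "H1 = (\<lambda>u::('x \<times> 'm) \<times> (nat \<Rightarrow> 'm). dderiv (W `` {fst (fst u)}) (\<lambda>y. F (fst (fst u), y)) (map (snd u) [0..<l]) (snd (fst u)))"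
      have H1: "continuous_map (prod_topology (subtopology (ptop Q X) W) euclidean) euclidean H1"
        unfolding H1_def by (rule dderiv_jointly_continuous[OF F])
      have c1: "continuous_map ?T X fst"
        using continuous_map_fst[of "subtopology X A" ?Y] by (simp add: continuous_map_in_subtopology)
      have c2: "continuous_map ?T (top_of_set (c ` K)) (\<lambda>u. fst (snd u))"
        using continuous_map_compose[OF continuous_map_snd continuous_map_fst] by (simp add: o_def)
      have c3: "continuous_map ?T euclidean (\<lambda>u. snd (snd u))"
        using continuous_map_compose[OF continuous_map_snd continuous_map_snd] by (simp add: o_def)
      have "continuous_map ?T (prod_topology (subtopology (ptop Q X) W) euclidean) (\<lambda>u. ((fst u, fst (snd u)), snd (snd u)))"
        using c1 c2 c3 KW KQ
        by (auto simp: continuous_map_pairwise continuous_map_in_subtopology o_def Pi_iff)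
      from continuous_map_compose[OF this H1]
      have k1: "continuous_map ?T euclidean (\<lambda>u. H1 ((fst u, fst (snd u)), snd (snd u)))"
        by (simp add: o_def)
      \<comment> \<open>The fixed map \<open>f\<close> is viewed as a family over a one-point space,
        so that its derivatives are covered by the same joint continuity statement.\<close>
      let ?f0 = "\<lambda>z::unit \<times> 'm. loc_rep C D f (snd z)"
      let ?W0 = "topspace (euclidean :: unit topology) \<times> loc_dom C D f"
      define H2 where "H2 = (\<lambda>u::(unit \<times> 'm) \<times> (nat \<Rightarrow> 'm). dderiv (?W0 `` {fst (fst u)}) (\<lambda>y. ?f0 (fst (fst u), y)) (map (snd u) [0..<l]) (snd (fst u)))"
      have "psmooth Q euclidean ?W0 ?f0"
        by (rule smooth_on_psmooth[OF smf atlas_fat[OF M]])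
          (use loc_dom_open(2)[OF M N cf C(2) D(2)] C D in simp)
      from dderiv_jointly_continuous[OF this, of l]
      have H2: "continuous_map (prod_topology (subtopology (ptop Q euclidean) ?W0) euclidean) euclidean H2"
        unfolding H2_def .
      have "continuous_map ?T (prod_topology (subtopology (ptop Q euclidean) ?W0) euclidean) (\<lambda>u. (((), fst (snd u)), snd (snd u)))"
        using c2 c3 Kf KQ
        by (auto simp: continuous_map_pairwise continuous_map_in_subtopology o_def Pi_iff)
      from continuous_map_compose[OF this H2]
      have k2: "continuous_map ?T euclidean (\<lambda>u. H2 (((), fst (snd u)), snd (snd u)))"
        by (simp add: o_def)
      have "continuous_map ?T euclidean (\<lambda>u. norm (H1 ((fst u, fst (snd u)), snd (snd u)) - H2 (((), fst (snd u)), snd (snd u))))"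
        by (intro continuous_map_norm continuous_map_diff k1 k2)
      from openin_continuous_map_preimage[OF this, of "{..<\<epsilon>}"]
      have "openin ?T {u \<in> topspace ?T. norm (H1 ((fst u, fst (snd u)), snd (snd u)) - H2 (((), fst (snd u)), snd (snd u))) \<in> {..<\<epsilon>}}" (is "openin ?T ?E")
        by simp
      moreover have H2h: "H2 (((), y), w) = h (map w [0..<l]) y" for y w
        by (simp add: H2_def h_def Image_def)
      have slice: "W `` {p} = loc_dom C D (\<Phi> p)" "(\<lambda>y. F (p, y)) = loc_rep C D (\<Phi> p)" if "p \<in> topspace X" for p
        using that by (auto simp: W_def F_def C D)
      have "{p0} \<times> (c ` K \<times> ?Wb) \<subseteq> ?E"
      proof
        fix u assume "u \<in> {p0} \<times> (c ` K \<times> ?Wb)"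
        then obtain x w where u: "u = (p0, c x, w)" "x \<in> K" "w \<in> ?Wb" by auto
        have "norm (H1 ((p0, c x), w) - H2 (((), c x), w)) < \<epsilon>"
          using near[OF u(2), of "map w [0..<l]"] l u(3) by (simp add: H2h h_def H1_def slice[OF p0(1)])
        then show "u \<in> ?E" using u A openin_subset[OF A(1)] by auto
      qed
      moreover have "compactin ?Y (c ` K \<times> ?Wb)"
        using cK compact_bounded_sequences[where 'a = 'm] by (simp add: compactin_Times compactin_subtopology)
      moreover have "p0 \<in> topspace (subtopology X A)" using A p0 by simp
      ultimately have "\<exists>A' B'. openin (subtopology X A) A' \<and> openin ?Y B' \<and> p0 \<in> A' \<and> c ` K \<times> ?Wb \<subseteq> B' \<and> A' \<times> B' \<subseteq> ?E"
        by (intro tube_lemma_right)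
      then obtain A' B' where A': "openin (subtopology X A) A'" "p0 \<in> A'" "c ` K \<times> ?Wb \<subseteq> B'" "A' \<times> B' \<subseteq> ?E" by blast
      show ?thesis
      proof (intro exI[of _ A'] conjI ballI)
        show "openin X A'" "A' \<subseteq> A" "p0 \<in> A'"
          using A' openin_open_subtopology[OF A(1)] by auto
        fix p x w assume "p \<in> A'" "x \<in> K" "w \<in> ?Wb"
        then have "(p, c x, w) \<in> ?E" using A'(3,4) by blast
        then show "norm (dderiv (W `` {p}) (\<lambda>y. F (p, y)) (map w [0..<l]) (c x) - h (map w [0..<l]) (c x)) < \<epsilon>"
          by (simp add: H2h H1_def)
      qed
    qed
    define P where "P = (\<lambda>l A'. openin X A' \<and> p0 \<in> A' \<and> A' \<subseteq> A \<and> (\<forall>p\<in>A'. \<forall>x\<in>K. \<forall>w\<in>?Wb.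
        norm (dderiv (W `` {p}) (\<lambda>y. F (p, y)) (map w [0..<l]) (c x) - h (map w [0..<l]) (c x)) < \<epsilon>))"
    have "\<forall>l\<in>{..r}. \<exists>A'. P l A'"
      using ex by (simp only: P_def) blast
    from bchoice[OF this] obtain A' where P: "\<forall>l\<in>{..r}. P l (A' l)" by (elim exE)
    have A': "openin X (A' l) \<and> p0 \<in> A' l \<and> A' l \<subseteq> A \<and> (\<forall>p\<in>A' l. \<forall>x\<in>K. \<forall>w\<in>?Wb.
        norm (dderiv (W `` {p}) (\<lambda>y. F (p, y)) (map w [0..<l]) (c x) - h (map w [0..<l]) (c x)) < \<epsilon>)"
      if "l \<le> r" for l
    proof -
      have "l \<in> {..r}" using that by simp
      from bspec[OF P this] show ?thesis unfolding P_def .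
    qed
    \<comment> \<open>Only the finitely many orders up to \<open>r\<close> matter, so the
      intersection of the neighbourhoods is open.\<close>
    show "\<exists>T. openin X T \<and> p0 \<in> T \<and> T \<subseteq> {p \<in> topspace X. \<Phi> p \<in> Cinf_nbhd M N f C D K r \<epsilon>}"
    proof (intro exI[of _ "\<Inter>l\<in>{..r}. A' l"] conjI)
      show "openin X (\<Inter>l\<in>{..r}. A' l)"
        by (rule openin_INT2) (use A' in auto)
      show "p0 \<in> (\<Inter>l\<in>{..r}. A' l)" using A' by auto
      show "(\<Inter>l\<in>{..r}. A' l) \<subseteq> {p \<in> topspace X. \<Phi> p \<in> Cinf_nbhd M N f C D K r \<epsilon>}"
      proof
        fix p assume p: "p \<in> (\<Inter>l\<in>{..r}. A' l)"
        then have pA: "p \<in> A" using A'[of 0] by auto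
        then have pX: "p \<in> topspace X" using openin_subset[OF A(1)] by blast
        have "norm (dderiv (loc_dom C D (\<Phi> p)) (loc_rep C D (\<Phi> p)) vs (c x) - dderiv (loc_dom C D f) (loc_rep C D f) vs (c x)) < \<epsilon>"
          if x: "x \<in> K" and vs: "length vs \<le> r" "\<forall>v\<in>set vs. norm v \<le> 1" for x vs
        proof -
          \<comment> \<open>A list of unit vectors is padded with zeros to a sequence, which stays
            in the compact set of directions.\<close>
          define w where "w i = (if i < length vs then vs ! i else 0)" for i
          have "map w [0..<length vs] = vs"
            by (rule nth_equalityI) (auto simp: w_def)
          moreover have "w \<in> ?Wb" using vs(2) by (auto simp: w_def)
          moreover have "p \<in> A' (length vs)" using p vs(1) by auto
          ultimately have "norm (dderiv (W `` {p}) (\<lambda>y. F (p, y)) vs (c x) - h vs (c x)) < \<epsilon>"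
            using A'[OF vs(1)] x by metis
          moreover have "W `` {p} = loc_dom C D (\<Phi> p)" "(\<lambda>y. F (p, y)) = loc_rep C D (\<Phi> p)"
            using pX by (auto simp: W_def F_def C D)
          ultimately show ?thesis by (simp add: h_def)
        qed
        then show "p \<in> {p \<in> topspace X. \<Phi> p \<in> Cinf_nbhd M N f C D K r \<epsilon>}"
          using pX sm[OF pX] AV[OF pA] by (auto simp: Cinf_nbhd_def C D)
      qed
    qed
  qed
  moreover have "{p \<in> topspace X. \<Phi> p \<in> S} = \<Phi> -` S \<inter> topspace X" for S by auto
  moreover have "\<Phi> -` smooth_maps M N \<inter> topspace X = topspace X" using sm by auto
  ultimately show ?thesis
    unfolding Cinf_topology_def continuous_on_generated_topo_iff using sm by auto
qed

text \<open>A subbasic neighbourhood controls derivatives uniformly on a compact piece of a chart.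
  Adding the continuity of the derivatives of one fixed map gives continuity in the map and the
  point together.\<close>

lemma tautological_psmap:
  fixes M :: "('p, 'm::{real_normed_vector, heine_borel}) manifold" and N :: "('q, 'n::real_normed_vector) manifold"
  assumes M: "atlas Q M" and Q: "closed Q" and N: "atlas R N" and S: "S \<subseteq> smooth_maps M N"
  shows "psmap Q (subtopology (Cinf_topology M N) S) M N (\<lambda>h. h)"
  unfolding psmap_def
proof (intro ballI)
  let ?X = "subtopology (Cinf_topology M N) S"
  fix h0 x0 assume h0': "h0 \<in> topspace ?X" and x0: "x0 \<in> pts M"
  have XS: "h \<in> smooth_maps M N" if "h \<in> topspace ?X" for h
    using that S by auto
  have ch: "continuous_map (mtop M) (mtop N) h" if "h \<in> topspace ?X" for h
    using XS[OF that] by (auto simp: smooth_maps_def smooth_map_def)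
  obtain U c where c: "(U, c) \<in> charts M" "x0 \<in> U" using atlas_chart[OF M x0] by metis
  have "h0 x0 \<in> pts N" using ch[OF h0'] x0 by (auto simp: continuous_map_def)
  then obtain V d where d: "(V, d) \<in> charts N" "h0 x0 \<in> V" using atlas_chart[OF N] by metis
  let ?C = "(U, c)" and ?D = "(V, d)"
  have ld: "openin (top_of_set Q) (loc_dom ?C ?D h)" if "h \<in> topspace ?X" for h
    by (rule loc_dom_open(2)[OF M N ch[OF that] c(1) d(1)])
  have "c x0 \<in> loc_dom ?C ?D h0" using c d by (auto simp: loc_dom_def)
  moreover obtain T where T: "open T" "loc_dom ?C ?D h0 = Q \<inter> T"
    using ld[OF h0'] by (auto simp: openin_open)
  ultimately obtain e where e: "e > 0" "cball (c x0) e \<subseteq> T" "c x0 \<in> Q"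
    using open_contains_cball by blast
  \<comment> \<open>A closed coordinate ball on which \<open>h0\<close> stays in one chart of the
    target. It is compact because the model set is closed and closed balls of the model space are
    compact.\<close>
  define K where "K = inv_into U c ` (cball (c x0) e \<inter> Q)"
  have sub: "cball (c x0) e \<inter> Q \<subseteq> loc_dom ?C ?D h0" using e T by auto
  then have subU: "cball (c x0) e \<inter> Q \<subseteq> c ` U" by (auto simp: loc_dom_def)
  have KU: "K \<subseteq> U" unfolding K_def using inv_into_into[of _ c U] subU by blast
  have hK: "h0 ` K \<subseteq> V"
  proof
    fix v assume "v \<in> h0 ` K"
    then obtain y where y: "y \<in> cball (c x0) e \<inter> Q" "v = h0 (inv_into U c y)" by (auto simp: K_def)
    then obtain x where "y = c x" "x \<in> U" "h0 x \<in> V" using sub by (auto simp: loc_dom_def)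
    then show "v \<in> V" using chart_inv[OF M c(1)] y(2) by simp
  qed
  have cK: "compactin (mtop M) K"
    unfolding K_def
  proof (rule image_compactin[OF _ chart_inv_cont[OF M c(1)]])
    have "compact (cball (c x0) e \<inter> Q)" by (rule compact_Int_closed[OF compact_cball Q])
    then show "compactin (top_of_set (c ` U)) (cball (c x0) e \<inter> Q)"
      using subU by (simp add: compactin_subtopology)
  qed
  \<comment> \<open>A neighbourhood of order 0 with arbitrary radius: its purpose is to keep the
    images of \<open>K\<close> in \<open>V\<close>.\<close>
  define A where "A = topspace ?X \<inter> Cinf_nbhd M N h0 ?C ?D K 0 1"
  define B where "B = {x \<in> U. c x \<in> ball (c x0) e \<inter> Q}"
  have nb: "openin ?X (topspace ?X \<inter> Cinf_nbhd M N h1 ?C ?D K r \<epsilon>)" "h1 \<in> Cinf_nbhd M N h1 ?C ?D K r \<epsilon>"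
    if "h1 \<in> topspace ?X" "h1 ` K \<subseteq> V" "\<epsilon> > 0" for h1 r \<epsilon>
  proof -
    have "openin (Cinf_topology M N) (Cinf_nbhd M N h1 ?C ?D K r \<epsilon>)"
      by (rule openin_Cinf_nbhd) (use XS that c d cK KU in auto)
    then have "openin ?X (S \<inter> Cinf_nbhd M N h1 ?C ?D K r \<epsilon>)"
      by (rule openin_subtopology_Int2)
    moreover have "S \<inter> Cinf_nbhd M N h1 ?C ?D K r \<epsilon> = topspace ?X \<inter> Cinf_nbhd M N h1 ?C ?D K r \<epsilon>"
      by (auto simp: topspace_Cinf Cinf_nbhd_def)
    ultimately show "openin ?X (topspace ?X \<inter> Cinf_nbhd M N h1 ?C ?D K r \<epsilon>)"
      by simp
    show "h1 \<in> Cinf_nbhd M N h1 ?C ?D K r \<epsilon>"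
      by (rule Cinf_nbhd_self) (use XS that in auto)
  qed
  have A: "openin ?X A" "h0 \<in> A"
    using nb[OF h0' hK, of 1 0] h0' by (auto simp: A_def)
  have AV: "h ` K \<subseteq> V" "h \<in> topspace ?X" if "h \<in> A" for h
    using that by (auto simp: A_def Cinf_nbhd_def)
  have oQ: "openin (top_of_set Q) (ball (c x0) e \<inter> Q)"
    by (auto simp: openin_open)
  have B: "openin (mtop M) B" "x0 \<in> B" "B \<subseteq> U"
    unfolding B_def using chart_preimage_open[OF M c(1) oQ] c e by auto
  have BK: "B \<subseteq> K"
  proof
    fix x assume "x \<in> B"
    then have "c x \<in> cball (c x0) e \<inter> Q" "x = inv_into U c (c x)"
      using chart_inv[OF M c(1)] by (auto simp: B_def)
    then show "x \<in> K" by (auto simp: K_def)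
  qed
  have cB: "openin (top_of_set Q) (c ` B)" by (rule chart_img_open[OF M c(1) B(1,3)])
  have W: "pdom Q ?X (A \<times> c ` B)" by (rule pdom_box[OF atlas_fat[OF M] A(1) cB])
  have Bl: "c ` B \<subseteq> loc_dom ?C ?D h" if "h \<in> A" for h
  proof
    fix y assume "y \<in> c ` B"
    then obtain x where x: "x \<in> B" "y = c x" by auto
    then have "x \<in> U" "h x \<in> V" using AV(1)[OF that] BK B(3) by auto
    then show "y \<in> loc_dom ?C ?D h" using x(2) by (auto simp: loc_dom_def)
  qed
  have sm: "smooth_on (loc_dom ?C ?D h) (loc_rep ?C ?D h)" if "h \<in> topspace ?X" for h
    using XS[OF that] c d by (auto simp: smooth_maps_def smooth_map_def)
  let ?F = "\<lambda>z. d (fst z (inv_into U c (snd z)))"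
  have Frep: "(\<lambda>y. ?F (h, y)) = loc_rep ?C ?D h" for h by (auto simp: loc_rep_def)
  have "psmooth Q ?X (A \<times> c ` B) ?F"
    unfolding psmooth_def
  proof (intro conjI allI W psmI_dderiv)
    fix h assume "h \<in> topspace ?X"
    show "smooth_on ((A \<times> c ` B) `` {h}) (\<lambda>y. ?F (h, y))"
    proof (cases "h \<in> A")
      case True
      then have "(A \<times> c ` B) `` {h} = c ` B" by auto
      then show ?thesis
        unfolding Frep using smooth_on_open_subset[OF sm ld cB Bl[OF True]] \<open>h \<in> topspace ?X\<close> by simp
    next
      case False
      then have "(A \<times> c ` B) `` {h} = {}" by auto
      then show ?thesis by (simp add: smooth_on_def differentiable_on_def)
    qed
  next
    fix vs :: "'m list" assume vs: "\<forall>v\<in>set vs. norm v \<le> 1"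
    let ?Z = "subtopology (ptop Q ?X) (A \<times> c ` B)"
    have dd: "dderiv ((A \<times> c ` B) `` {h}) (\<lambda>y. ?F (h, y)) vs y = dderiv (loc_dom ?C ?D h) (loc_rep ?C ?D h) vs y"
      if "h \<in> A" "y \<in> c ` B" for h y
    proof -
      have "(A \<times> c ` B) `` {h} = c ` B" using that by auto
      then show ?thesis
        unfolding Frep using dderiv_subset[OF ld cB Bl] AV(2) that by simp
    qed
    show "continuous_map ?Z euclidean (\<lambda>(h, y). dderiv ((A \<times> c ` B) `` {h}) (\<lambda>y. ?F (h, y)) vs y)"
      unfolding continuous_map_eq_topcontinuous_at topcontinuous_at_def
    proof (intro ballI conjI allI impI)
      fix z Y assume z: "z \<in> topspace ?Z"
        and Y: "openin euclidean Y \<and> (case z of (h, y) \<Rightarrow> dderiv ((A \<times> c ` B) `` {h}) (\<lambda>y. ?F (h, y)) vs y) \<in> Y"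
      obtain h1 y1 where z1: "z = (h1, y1)" "h1 \<in> A" "y1 \<in> c ` B" using z by auto
      let ?D1 = "dderiv (loc_dom ?C ?D h1) (loc_rep ?C ?D h1) vs"
      obtain \<epsilon> where \<epsilon>: "\<epsilon> > 0" "ball (?D1 y1) \<epsilon> \<subseteq> Y"
        using Y dd[OF z1(2,3)] unfolding z1(1) open_openin[symmetric] open_contains_ball by auto
      have "continuous_on (loc_dom ?C ?D h1) ?D1"
        using sm[OF AV(2)[OF z1(2)]] by (simp add: smooth_on_def differentiable_imp_continuous_on)
      then have "continuous_on (c ` B) ?D1"
        by (rule continuous_on_subset[OF _ Bl[OF z1(2)]])
      then have "openin (top_of_set (c ` B)) (c ` B \<inter> ?D1 -` ball (?D1 y1) (\<epsilon>/2))"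
        by (rule continuous_openin_preimage_gen) simp
      then have S1: "openin (top_of_set Q) (c ` B \<inter> ?D1 -` ball (?D1 y1) (\<epsilon>/2))"
        using cB by (rule openin_trans)
      \<comment> \<open>One half of \<open>\<epsilon>\<close> bounds the change of the derivative
        from \<open>h1\<close> to \<open>h\<close>, uniformly on \<open>K\<close>; the set
        \<open>?S1\<close> spends the other half on the change of the derivative of
        \<open>h1\<close> between points.\<close>
      let ?A1 = "A \<inter> (topspace ?X \<inter> Cinf_nbhd M N h1 ?C ?D K (length vs) (\<epsilon>/2))"
      let ?S1 = "c ` B \<inter> ?D1 -` ball (?D1 y1) (\<epsilon>/2)"
      have A1: "openin ?X ?A1" "h1 \<in> ?A1"
        using nb[OF AV(2,1)[OF z1(2)] , of "\<epsilon>/2" "length vs"] \<epsilon>(1) A(1) AV(2)[OF z1(2)] z1(2) by auto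
      show "\<exists>U. openin ?Z U \<and> z \<in> U \<and>
          (\<forall>y\<in>U. (case y of (h, y) \<Rightarrow> dderiv ((A \<times> c ` B) `` {h}) (\<lambda>y. ?F (h, y)) vs y) \<in> Y)"
      proof (intro exI[of _ "?A1 \<times> ?S1"] conjI ballI)
        have "openin (ptop Q ?X) (?A1 \<times> ?S1)"
          using A1 S1 by (auto simp: openin_prod_Times_iff)
        moreover have "?A1 \<times> ?S1 \<subseteq> A \<times> c ` B" by auto
        ultimately show "openin ?Z (?A1 \<times> ?S1)"
          using W openin_open_subtopology[of "ptop Q ?X" "A \<times> c ` B"] unfolding pdom_def by blast
        show "z \<in> ?A1 \<times> ?S1" using A1 z1 \<epsilon>(1) by auto
        fix z2 assume "z2 \<in> ?A1 \<times> ?S1"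
        then obtain h y where z2: "z2 = (h, y)" "h \<in> A" "h \<in> Cinf_nbhd M N h1 ?C ?D K (length vs) (\<epsilon>/2)"
          "y \<in> c ` B" "?D1 y \<in> ball (?D1 y1) (\<epsilon>/2)" by auto
        obtain x where x: "y = c x" "x \<in> B" using z2(4) by auto
        have "x \<in> K" using x(2) BK by blast
        then have "norm (dderiv (loc_dom ?C ?D h) (loc_rep ?C ?D h) vs (c x) - ?D1 (c x)) < \<epsilon>/2"
          using z2(3) vs by (simp add: Cinf_nbhd_def)
        then have n: "dist (dderiv (loc_dom ?C ?D h) (loc_rep ?C ?D h) vs y) (?D1 y) < \<epsilon>/2"
          by (simp only: x(1) dist_norm)
        have "dist (?D1 y1) (dderiv (loc_dom ?C ?D h) (loc_rep ?C ?D h) vs y) < \<epsilon>"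
          by (rule dist_triangle_half_l[OF _ n]) (use z2(5) in \<open>simp only: mem_ball\<close>)
        then show "(case z2 of (h, y) \<Rightarrow> dderiv ((A \<times> c ` B) `` {h}) (\<lambda>y. ?F (h, y)) vs y) \<in> Y"
          using \<epsilon>(2) dd[OF z2(2,4)] by (auto simp: z2(1))
      qed
    qed auto
  qed
  moreover have "\<forall>h\<in>A. \<forall>x\<in>B. h x \<in> V" using AV BK by blast
  ultimately show "sm_at Q ?X M N (\<lambda>h. h) h0 x0"
    unfolding sm_at_def using A B c(1) d(1)
    by (intro exI[of _ U] exI[of _ c] exI[of _ V] exI[of _ d] exI[of _ A] exI[of _ B] conjI)
qed

section \<open>Open submanifolds and gluing\<close>

lemma submanifold_open_simps:
  "mtop (submanifold_open M W) = subtopology (mtop M) W"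
  "charts (submanifold_open M W) = (\<lambda>(U, c). (U \<inter> W, c)) ` charts M"
  "pts (submanifold_open M W) = pts M \<inter> W"
  by (auto simp: submanifold_open_def)

lemma inv_into_Int: "inj_on c U \<Longrightarrow> x \<in> U \<inter> W \<Longrightarrow> inv_into (U \<inter> W) c (c x) = x"
  by (rule inv_into_f_f) (auto intro: inj_on_subset)

lemma atlas_submanifold:
  assumes M: "atlas Q M" and W: "openin (mtop M) (pts M \<inter> W)"
  shows "atlas Q (submanifold_open M W)"
proof -
  have oW: "openin (mtop M) (U \<inter> W)" if "openin (mtop M) U" for U
  proof -
    have "U \<inter> W = U \<inter> (pts M \<inter> W)" using openin_subset[OF that] by auto
    then show ?thesis using openin_Int[OF that W] by simp
  qed
  have f1: "\<exists>(U, c)\<in>charts (submanifold_open M W). x \<in> U" if "x \<in> pts (submanifold_open M W)" for x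
  proof -
    have x: "x \<in> pts M" "x \<in> W" using that by (auto simp: submanifold_open_simps)
    obtain U c where c: "(U, c) \<in> charts M" "x \<in> U" using atlas_chart[OF M x(1)] by metis
    then show ?thesis
      using x unfolding submanifold_open_simps by (intro bexI[of _ "(U \<inter> W, c)"]) force+
  qed
  have f2: "openin (mtop (submanifold_open M W)) (U \<inter> W) \<and> openin (top_of_set Q) (c ` (U \<inter> W)) \<and>
      homeomorphic_map (subtopology (mtop (submanifold_open M W)) (U \<inter> W)) (top_of_set (c ` (U \<inter> W))) c"
    if c: "(U, c) \<in> charts M" for U c
  proof (intro conjI)
    have U: "openin (mtop M) (U \<inter> W)" by (rule oW[OF chart_open[OF M c]])
    show "openin (mtop (submanifold_open M W)) (U \<inter> W)"
      unfolding submanifold_open_simps using openin_subtopology_Int2[OF chart_open[OF M c], of W] by (simp add: Int_commute)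
    show "openin (top_of_set Q) (c ` (U \<inter> W))"
      by (rule chart_img_open[OF M c U]) auto
    have "homeomorphic_map (subtopology (subtopology (mtop M) U) (U \<inter> W)) (subtopology (top_of_set (c ` U)) (c ` (U \<inter> W))) c"
      by (rule homeomorphic_map_subtopologies[OF chart_homeo[OF M c]])
        (use chart_sub[OF M c] chart_inj[OF M c] in \<open>auto simp: inj_on_def\<close>)
    moreover have "subtopology (subtopology (mtop M) U) (U \<inter> W) = subtopology (mtop (submanifold_open M W)) (U \<inter> W)"
      by (simp add: submanifold_open_simps subtopology_subtopology Int_absorb1 Int_absorb2 inf_commute inf_left_commute)
    moreover have "subtopology (top_of_set (c ` U)) (c ` (U \<inter> W)) = top_of_set (c ` (U \<inter> W))"
      by (simp add: subtopology_subtopology) (metis Int_absorb1 image_mono inf_le1)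
    ultimately show "homeomorphic_map (subtopology (mtop (submanifold_open M W)) (U \<inter> W)) (top_of_set (c ` (U \<inter> W))) c"
      by simp
  qed
  have f3: "smooth_on (c ` ((U \<inter> W) \<inter> (V \<inter> W))) (d \<circ> inv_into (U \<inter> W) c)"
    if c: "(U, c) \<in> charts M" and d: "(V, d) \<in> charts M" for U c V d
  proof -
    have o: "openin (mtop M) (U \<inter> V)"
      by (intro openin_Int chart_open[OF M c] chart_open[OF M d])
    have "smooth_on (c ` ((U \<inter> W) \<inter> (V \<inter> W))) (d \<circ> inv_into U c)"
    proof (rule smooth_on_open_subset[OF chart_transition[OF M c d]])
      show "openin (top_of_set Q) (c ` (U \<inter> V))"
        by (rule chart_img_open[OF M c o]) auto
      have "openin (mtop M) ((U \<inter> W) \<inter> (V \<inter> W))"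
        by (intro openin_Int oW chart_open[OF M c] chart_open[OF M d])
      then show "openin (top_of_set Q) (c ` ((U \<inter> W) \<inter> (V \<inter> W)))"
        by (rule chart_img_open[OF M c]) auto
    qed auto
    then show ?thesis
      by (rule smooth_on_cong) (auto simp: chart_inv[OF M c] inv_into_Int[OF chart_inj[OF M c]])
  qed
  have ch: "\<exists>U. (U, c) \<in> charts M \<and> U' = U \<inter> W" if "(U', c) \<in> charts (submanifold_open M W)" for U' c
    using that by (auto simp: submanifold_open_simps(2))
  show ?thesis
    unfolding atlas_def
  proof (intro conjI ballI)
    fix C assume "C \<in> charts (submanifold_open M W)"
    then obtain U c where C: "C = (U \<inter> W, c)" "(U, c) \<in> charts M"
      using ch by (metis surj_pair)
    show "case C of (U, c) \<Rightarrow> openin (mtop (submanifold_open M W)) U \<and> openin (top_of_set Q) (c ` U) \<and>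
        homeomorphic_map (subtopology (mtop (submanifold_open M W)) U) (top_of_set (c ` U)) c"
      using f2[OF C(2)] by (simp add: C(1))
    show "case C of (U, c) \<Rightarrow> \<forall>(V, d)\<in>charts (submanifold_open M W). smooth_on (c ` (U \<inter> V)) (d \<circ> inv_into U c)"
      unfolding C(1) prod.case
    proof (intro ballI)
      fix C' assume "C' \<in> charts (submanifold_open M W)"
      then obtain V d where C': "C' = (V \<inter> W, d)" "(V, d) \<in> charts M"
        using ch by (metis surj_pair)
      show "case C' of (V, d) \<Rightarrow> smooth_on (c ` (U \<inter> W \<inter> V)) (d \<circ> inv_into (U \<inter> W) c)"
        using f3[OF C(2) C'(2)] by (simp add: C'(1))
    qed
  qed (use f1 atlas_fat[OF M] in auto)
qed

text \<open>In two charts with the same coordinate map the identity is represented by the identity.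
  The source and target domains are separate so that inclusions of open submanifolds and maps into
  them are both instances.\<close>

lemma sm_at_id:
  assumes M: "atlas Q M" and c: "(U, c) \<in> charts M" "x \<in> B" and B: "openin (mtop M') B" "openin (mtop M) B" "B \<subseteq> U'"
    and U': "(U', c) \<in> charts M'" "U' \<subseteq> U" and N: "(V, c) \<in> charts N" "B \<subseteq> V" and p: "p \<in> topspace X"
  shows "sm_at Q X M' N (\<lambda>_ x. x) p x"
proof -
  have cB: "openin (top_of_set Q) (c ` B)"
    using chart_img_open[OF M c(1) B(2)] B(3) U'(2) by auto
  have "psmooth Q X (topspace X \<times> c ` B) snd"
    by (intro psmooth_intros pdom_box atlas_fat[OF M] cB openin_topspace)
  then have "psmooth Q X (topspace X \<times> c ` B) (\<lambda>z. c (inv_into U' c (snd z)))"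
  proof (rule psmooth_cong)
    fix z assume "z \<in> topspace X \<times> c ` B"
    then have "snd z \<in> c ` U'" using B(3) by auto
    then show "snd z = c (inv_into U' c (snd z))" by (simp add: f_inv_into_f)
  qed
  then show ?thesis
    unfolding sm_at_def using c B U' N p openin_topspace[of X]
    by (intro exI[of _ U'] exI[of _ c] exI[of _ V] exI[of _ c] exI[of _ "topspace X"] exI[of _ B]) auto
qed

lemma sm_at_ident:
  assumes M: "atlas Q M" and "p \<in> topspace X" "x \<in> pts M"
  shows "sm_at Q X M M (\<lambda>_ x. x) p x"
proof -
  obtain U c where c: "(U, c) \<in> charts M" "x \<in> U" using atlas_chart[OF M assms(3)] by metis
  show ?thesis
    by (rule sm_at_id[OF M c(1), where B = U and U' = U and V = U]) (use c assms chart_open[OF M] in auto)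
qed

lemma sm_at_sub:
  assumes M: "atlas Q M" and W: "openin (mtop M) (pts M \<inter> W)" and p: "p \<in> topspace X" and x: "x \<in> pts M \<inter> W"
  shows "sm_at Q X (submanifold_open M W) M (\<lambda>_ x. x) p x" "sm_at Q X M (submanifold_open M W) (\<lambda>_ x. x) p x"
proof -
  obtain U c where c: "(U, c) \<in> charts M" "x \<in> U" using atlas_chart[OF M] x by blast
  have "U \<inter> W = U \<inter> (pts M \<inter> W)" using chart_sub[OF M c(1)] by auto
  then have B: "openin (mtop M) (U \<inter> W)" using openin_Int[OF chart_open[OF M c(1)] W] by simp
  have B': "openin (mtop (submanifold_open M W)) (U \<inter> W)"
    unfolding submanifold_open_simps using openin_subtopology_Int2[OF chart_open[OF M c(1)], of W] by (simp add: Int_commute)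
  have c': "(U \<inter> W, c) \<in> charts (submanifold_open M W)"
    unfolding submanifold_open_simps using c by force
  show "sm_at Q X (submanifold_open M W) M (\<lambda>_ x. x) p x"
    by (rule sm_at_id[OF M c(1), where B = "U \<inter> W" and U' = "U \<inter> W" and V = U]) (use c c' B B' x p in auto)
  show "sm_at Q X M (submanifold_open M W) (\<lambda>_ x. x) p x"
    by (rule sm_at_id[OF M c(1), where B = "U \<inter> W" and U' = U and V = "U \<inter> W"]) (use c c' B B' x p in auto)
qed

section \<open>Functions with values in a vector space\<close>

lemma charts_vector: "charts vector_manifold = {(UNIV, \<lambda>x. x)}" "mtop vector_manifold = euclidean"
  by (simp_all add: vector_manifold_def)

lemma smooth_on_linear:
  assumes f: "bounded_linear f" and S: "open S"
  shows "smooth_on S f"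
proof -
  have "psmooth UNIV (euclidean :: unit topology) (UNIV \<times> S) (\<lambda>z. f (snd z))"
    using S by (intro psmooth_linear[OF f] psmooth_intros) (auto intro!: pdom_box fat_UNIV simp: open_openin[symmetric])
  from psmooth_smooth_on[OF this, of "()"] show ?thesis by (simp add: Image_def)
qed

lemma atlas_vector: "atlas UNIV (vector_manifold :: ('a::real_normed_vector, 'a) manifold)"
proof -
  have "homeomorphic_map (euclidean :: 'a topology) euclidean (\<lambda>x. x)"
    using homeomorphic_map_id[of "euclidean :: 'a topology" euclidean] by (simp add: id_def)
  moreover have "smooth_on UNIV ((\<lambda>x. x) \<circ> inv_into UNIV (\<lambda>x::'a. x))"
    by (rule smooth_on_cong[OF smooth_on_linear[OF bounded_linear_ident]])
      (auto intro!: inv_f_eq[symmetric])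
  ultimately show ?thesis
    by (auto simp: atlas_def charts_vector fat_UNIV)
qed

lemma sm_at_vectorE:
  fixes a :: "'x \<Rightarrow> 'p \<Rightarrow> 'a::real_normed_vector"
  assumes M: "atlas Q M" and fd: "findim TYPE('m)" "findim TYPE('a)"
    and a: "sm_at Q X (M :: ('p, 'm::real_normed_vector) manifold) vector_manifold a p0 x0" and c: "(U, c) \<in> charts M" "x0 \<in> U"
  obtains A B where "openin X A" "p0 \<in> A" "openin (mtop M) B" "x0 \<in> B" "B \<subseteq> U"
    "psmooth Q X (A \<times> c ` B) (\<lambda>z. a (fst z) (inv_into U c (snd z)))"
proof -
  have d: "(UNIV, \<lambda>x. x) \<in> charts (vector_manifold :: ('a, 'a) manifold)" by (simp add: charts_vector)
  show thesis
    by (rule sm_at_charts[OF M atlas_vector fd a c d]) (auto intro: that)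
qed

lemma sm_at_vectorI:
  fixes a :: "'x \<Rightarrow> 'p \<Rightarrow> 'a::real_normed_vector"
  assumes "(U, c) \<in> charts M" "openin X A" "p0 \<in> A" "openin (mtop M) B" "x0 \<in> B" "B \<subseteq> U"
    "psmooth Q X (A \<times> c ` B) (\<lambda>z. a (fst z) (inv_into U c (snd z)))"
  shows "sm_at Q X M vector_manifold a p0 x0"
  unfolding sm_at_def using assms
  by (intro exI[of _ U] exI[of _ c] exI[of _ UNIV] exI[of _ "\<lambda>x. x"] exI[of _ A] exI[of _ B])
    (auto simp: charts_vector)

text \<open>The model set \<open>R\<close> of \<open>G\<close> is free. This allows values of f to
  be inserted into functions on the unit interval that are smooth only up to its ends.\<close>

lemma sm_at_scalar_compose:
  fixes M :: "('p, 'm::real_normed_vector) manifold" and a :: "'x \<Rightarrow> 'p \<Rightarrow> real"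
    and G :: "'x \<times> real \<Rightarrow> 'b::real_normed_vector"
  assumes M: "atlas Q M" and fd: "findim TYPE('m)" and a: "sm_at Q X M vector_manifold a p0 x0" and G: "psmooth R X V G"
    and A: "openin X A" "p0 \<in> A" and B: "openin (mtop M) B" "x0 \<in> B"
    and V: "\<And>p x. p \<in> A \<Longrightarrow> x \<in> B \<Longrightarrow> (p, a p x) \<in> V"
  shows "sm_at Q X M vector_manifold (\<lambda>p x. G (p, a p x)) p0 x0"
proof -
  obtain U c where c: "(U, c) \<in> charts M" "x0 \<in> U"
    using a unfolding sm_at_def by blast
  obtain A' B' where A': "openin X A'" "p0 \<in> A'" and B': "openin (mtop M) B'" "x0 \<in> B'" "B' \<subseteq> U"
    and F: "psmooth Q X (A' \<times> c ` B') (\<lambda>z. a (fst z) (inv_into U c (snd z)))"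
    by (rule sm_at_vectorE[OF M fd findim_euclidean a c])
  have inv: "inv_into U c (c x) = x" if "x \<in> B'" for x
    using chart_inv[OF M c(1)] B'(3) that by blast
  have W: "pdom Q X ((A \<inter> A') \<times> c ` (B \<inter> B'))"
    using A A' B B' by (intro pdom_box atlas_fat[OF M] chart_img_open[OF M c(1)]) auto
  have "psmooth Q X ((A \<inter> A') \<times> c ` (B \<inter> B')) (\<lambda>z. G (fst z, a (fst z) (inv_into U c (snd z))))"
    by (rule psmooth_compose[OF findim_euclidean psmooth_subset[OF F W] G]) (use V inv in auto)
  then show ?thesis
    by (rule sm_at_vectorI[OF c(1), where A = "A \<inter> A'" and B = "B \<inter> B'", rotated -1]) (use A A' B B' in auto)
qed

lemma sm_at_scalar_compose_open:
  fixes M :: "('p, 'm::real_normed_vector) manifold" and a :: "'x \<Rightarrow> 'p \<Rightarrow> real"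
  assumes M: "atlas Q M" and fd: "findim TYPE('m)" and a: "sm_at Q X M vector_manifold a p0 x0"
    and S: "open S" "a p0 x0 \<in> S" and g: "psmooth UNIV X (topspace X \<times> S) (\<lambda>z. g (snd z))"
  shows "sm_at Q X M vector_manifold (\<lambda>p x. g (a p x)) p0 x0"
proof -
  have "openin (mtop vector_manifold) S" using S by (simp add: charts_vector)
  then obtain A B where AB: "openin X A" "p0 \<in> A" "openin (mtop M) B" "x0 \<in> B" "\<forall>p\<in>A. \<forall>x\<in>B. a p x \<in> S"
    using sm_at_cont[OF M atlas_vector a _ S(2)] by metis
  have "sm_at Q X M vector_manifold (\<lambda>p x. (\<lambda>z. g (snd z)) (p, a p x)) p0 x0"
    by (rule sm_at_scalar_compose[OF M fd a g AB(1-4)]) (use AB(5) openin_subset[OF AB(1)] in auto)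
  then show ?thesis by simp
qed

lemma psmooth_snd_open: "open S \<Longrightarrow> psmooth UNIV X (topspace X \<times> S) snd"
  by (intro psmooth_intros pdom_box fat_UNIV) (auto simp: open_openin[symmetric])

lemma sm_at_sqrt:
  fixes M :: "('p, 'm::real_normed_vector) manifold"
  assumes "atlas Q M" "findim TYPE('m)" "sm_at Q X M vector_manifold a p0 x0" "a p0 x0 > 0"
  shows "sm_at Q X M vector_manifold (\<lambda>p x. sqrt (a p x)) p0 x0"
  by (rule sm_at_scalar_compose_open[OF assms(1-3), where S = "{0<..}"])
    (use assms(4) in \<open>auto intro!: psmooth_sqrt psmooth_snd_open\<close>)

lemma sm_at_inverse:
  fixes M :: "('p, 'm::real_normed_vector) manifold" and a :: "'x \<Rightarrow> 'p \<Rightarrow> real"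
  assumes "atlas Q M" "findim TYPE('m)" "sm_at Q X M vector_manifold a p0 x0" "a p0 x0 \<noteq> 0"
  shows "sm_at Q X M vector_manifold (\<lambda>p x. inverse (a p x)) p0 x0"
  by (rule sm_at_scalar_compose_open[OF assms(1-3), where S = "- {0}"])
    (use assms(4) in \<open>auto intro!: psmooth_inverse psmooth_snd_open\<close>)

lemma sm_at_one_minus:
  fixes M :: "('p, 'm::real_normed_vector) manifold" and a :: "'x \<Rightarrow> 'p \<Rightarrow> real"
  assumes "atlas Q M" "findim TYPE('m)" "sm_at Q X M vector_manifold a p0 x0"
  shows "sm_at Q X M vector_manifold (\<lambda>p x. 1 - a p x) p0 x0"
proof -
  have "psmooth UNIV X (topspace X \<times> UNIV) (\<lambda>z. 1 - snd z :: real)"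
    using psmooth_snd_open[of UNIV X] psmooth_pdom by (intro psmooth_intros) auto
  then show ?thesis
    using sm_at_scalar_compose_open[OF assms, of UNIV "\<lambda>t. 1 - t"] by simp
qed

text \<open>Open embeddings under which the charts of the source become charts of the target.\<close>

definition chart_embedding :: "('p, 'm) manifold \<Rightarrow> ('q, 'm) manifold \<Rightarrow> ('p \<Rightarrow> 'q) \<Rightarrow> bool" where
  "chart_embedding M L e \<longleftrightarrow> inj_on e (pts M) \<and> continuous_map (mtop M) (mtop L) e \<and>
     (\<forall>A. openin (mtop M) A \<longrightarrow> openin (mtop L) (e ` A)) \<and>
     (\<forall>(U, c)\<in>charts M. (e ` U, c \<circ> inv_into (pts M) e) \<in> charts L)"

context
  fixes Q :: "'m::real_normed_vector set" and M :: "('p, 'm) manifold" and L :: "('q, 'm) manifold" and e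
  assumes M: "atlas Q M" and e: "chart_embedding M L e"
begin

lemma emb_inv: "x \<in> pts M \<Longrightarrow> inv_into (pts M) e (e x) = x"
  using e by (auto simp: chart_embedding_def inv_into_f_f)

lemma emb_open: "openin (mtop M) A \<Longrightarrow> openin (mtop L) (e ` A)"
  using e by (auto simp: chart_embedding_def)

lemma emb_chart_inv:
  assumes c: "(U, c) \<in> charts M" and x: "x \<in> U"
  shows "inv_into (e ` U) (c \<circ> inv_into (pts M) e) (c x) = e x"
proof -
  have "inj_on (c \<circ> inv_into (pts M) e) (e ` U)"
    using chart_inj[OF M c] chart_sub[OF M c] emb_inv by (auto simp: inj_on_def subset_iff)
  then have "inv_into (e ` U) (c \<circ> inv_into (pts M) e) ((c \<circ> inv_into (pts M) e) (e x)) = e x"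
    using x by (intro inv_into_f_f) auto
  then show ?thesis using emb_inv chart_sub[OF M c] x by (auto simp: subset_iff)
qed

lemma emb_chart_img:
  assumes "(U, c) \<in> charts M" "B \<subseteq> U"
  shows "(c \<circ> inv_into (pts M) e) ` (e ` B) = c ` B"
proof -
  have "(c \<circ> inv_into (pts M) e) (e x) = c x" if "x \<in> B" for x
    using emb_inv chart_sub[OF M assms(1)] assms(2) that by (auto simp: subset_iff)
  then show ?thesis by (auto simp: image_iff)
qed

lemma emb_chart_homeo:
  assumes c: "(U, c) \<in> charts M"
  shows "homeomorphic_map (subtopology (mtop L) (e ` U)) (top_of_set (c ` U)) (c \<circ> inv_into (pts M) e)"
proof -
  have ce: "continuous_map (mtop M) (mtop L) e" and ie: "inj_on e (pts M)"
    using e by (auto simp: chart_embedding_def)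
  have U: "U \<subseteq> pts M" by (rule chart_sub[OF M c])
  have UL: "e ` U \<subseteq> pts L" using ce U by (auto simp: continuous_map_def)
  have "homeomorphic_map (subtopology (mtop M) U) (subtopology (mtop L) (e ` U)) e"
  proof (rule bijective_open_imp_homeomorphic_map)
    show "continuous_map (subtopology (mtop M) U) (subtopology (mtop L) (e ` U)) e"
      using ce by (auto simp: continuous_map_in_subtopology continuous_map_from_subtopology)
    show "open_map (subtopology (mtop M) U) (subtopology (mtop L) (e ` U)) e"
      unfolding open_map_def
    proof (intro allI impI)
      fix A assume "openin (subtopology (mtop M) U) A"
      then have "openin (mtop M) A" "A \<subseteq> U"
        using openin_open_subtopology[OF chart_open[OF M c]] by auto
      then show "openin (subtopology (mtop L) (e ` U)) (e ` A)"
        using emb_open openin_open_subtopology[OF emb_open[OF chart_open[OF M c]]] by auto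
    qed
    show "e ` topspace (subtopology (mtop M) U) = topspace (subtopology (mtop L) (e ` U))"
      using U UL by auto
    show "inj_on e (topspace (subtopology (mtop M) U))"
      using ie by (rule inj_on_subset) auto
  qed
  then obtain g where g: "homeomorphic_maps (subtopology (mtop M) U) (subtopology (mtop L) (e ` U)) e g"
    by (auto simp: homeomorphic_map_maps)
  have "homeomorphic_map (subtopology (mtop L) (e ` U)) (subtopology (mtop M) U) g"
    using g homeomorphic_maps_map homeomorphic_maps_sym by blast
  then have "homeomorphic_map (subtopology (mtop L) (e ` U)) (top_of_set (c ` U)) (c \<circ> g)"
    by (rule homeomorphic_map_compose[OF _ chart_homeo[OF M c]])
  then show ?thesis
  proof (rule homeomorphic_map_eq)
    fix z assume "z \<in> topspace (subtopology (mtop L) (e ` U))"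
    then obtain x where x: "z = e x" "x \<in> U" by auto
    then show "(c \<circ> g) z = (c \<circ> inv_into (pts M) e) z"
      using g U emb_inv by (auto simp: homeomorphic_maps_def subset_iff)
  qed
qed

text \<open>In a chart of \<open>M\<close> and its transported copy both \<open>e\<close> and its
  inverse are represented by the identity.\<close>

lemma sm_at_emb:
  assumes p: "p \<in> topspace X" and x: "x \<in> pts M"
  shows "sm_at Q X M L (\<lambda>_. e) p x" "sm_at Q X L M (\<lambda>_. inv_into (pts M) e) p (e x)"
proof -
  obtain U c where c: "(U, c) \<in> charts M" "x \<in> U" using atlas_chart[OF M x] by metis
  have c': "(e ` U, c \<circ> inv_into (pts M) e) \<in> charts L"
    using e c by (auto simp: chart_embedding_def)
  have W: "pdom Q X (topspace X \<times> c ` U)"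
    by (intro pdom_box atlas_fat[OF M] openin_topspace chart_img_open[OF M c(1) chart_open[OF M c(1)]]) simp
  have eU: "inv_into (pts M) e (e x) = x" if "x \<in> U" for x
    using emb_inv chart_sub[OF M c(1)] that by auto
  have 1: "psmooth Q X (topspace X \<times> c ` U) (\<lambda>z. (c \<circ> inv_into (pts M) e) (e (inv_into U c (snd z))))"
    by (rule psmooth_cong[OF psmooth_intros(2)[OF W]]) (auto simp: chart_inv[OF M c(1)] eU)
  have 2: "psmooth Q X (topspace X \<times> c ` U) (\<lambda>z. c (inv_into (pts M) e (inv_into (e ` U) (c \<circ> inv_into (pts M) e) (snd z))))"
    by (rule psmooth_cong[OF psmooth_intros(2)[OF W]]) (auto simp: emb_chart_inv[OF c(1)] eU)
  show "sm_at Q X M L (\<lambda>_. e) p x"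
    unfolding sm_at_def
    by (intro exI[of _ U] exI[of _ c] exI[of _ "e ` U"] exI[of _ "c \<circ> inv_into (pts M) e"]
        exI[of _ "topspace X"] exI[of _ U]) (use c c' p 1 chart_open[OF M c(1)] in auto)
  show "sm_at Q X L M (\<lambda>_. inv_into (pts M) e) p (e x)"
    unfolding sm_at_def
    by (intro exI[of _ U] exI[of _ c] exI[of _ "e ` U"] exI[of _ "c \<circ> inv_into (pts M) e"]
        exI[of _ "topspace X"] exI[of _ "e ` U"])
      (use c c' p 2 emb_open[OF chart_open[OF M c(1)]] emb_chart_img[OF c(1) subset_refl] eU in auto)
qed

end

section \<open>Gluing two manifolds along open subsets\<close>

lemma emb_same_transition:
  assumes M: "atlas Q M" and e: "chart_embedding M L e" and c: "(U, c) \<in> charts M" and d: "(V, d) \<in> charts M"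
  shows "smooth_on ((c \<circ> inv_into (pts M) e) ` (e ` U \<inter> e ` V))
    ((d \<circ> inv_into (pts M) e) \<circ> inv_into (e ` U) (c \<circ> inv_into (pts M) e))"
proof -
  have "inj_on e (pts M)" using e by (simp add: chart_embedding_def)
  then have "e ` U \<inter> e ` V = e ` (U \<inter> V)"
    using chart_sub[OF M c] chart_sub[OF M d] by (simp add: inj_on_image_Int)
  then have img: "(c \<circ> inv_into (pts M) e) ` (e ` U \<inter> e ` V) = c ` (U \<inter> V)"
    using emb_chart_img[OF M e c, of "U \<inter> V"] by auto
  show ?thesis
    unfolding img
    by (rule smooth_on_cong[OF chart_transition[OF M c d]])
      (use chart_sub[OF M c] in \<open>auto simp: emb_chart_inv[OF M e c] chart_inv[OF M c] emb_inv[OF M e] subset_iff\<close>)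
qed

text \<open>The inverse \<open>\<zeta>\<close> is a parameter of its own, because its smoothness
  supplies the transition maps from charts of \<open>N\<close> back to charts of
  \<open>M\<close>.\<close>

locale gluing =
  fixes Q :: "'m::real_normed_vector set" and M :: "('p, 'm) manifold" and N :: "('q, 'm) manifold"
    and D :: "'p set" and D' :: "'q set" and \<xi> :: "'p \<Rightarrow> 'q" and \<zeta> :: "'q \<Rightarrow> 'p"
  assumes M: "atlas Q M" and N: "atlas Q N" and D: "openin (mtop M) D" and D': "openin (mtop N) D'"
    and \<xi>: "smooth_map (submanifold_open M D) N \<xi>" and \<zeta>: "smooth_map (submanifold_open N D') M \<zeta>"
    and \<xi>D: "\<And>x. x \<in> D \<Longrightarrow> \<xi> x \<in> D' \<and> \<zeta> (\<xi> x) = x" and \<zeta>D': "\<And>y. y \<in> D' \<Longrightarrow> \<zeta> y \<in> D \<and> \<xi> (\<zeta> y) = y"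
begin

abbreviation "L \<equiv> glue M N D \<xi>"
abbreviation "inl \<equiv> glue_inl M N D \<xi>"
abbreviation "inr \<equiv> glue_inr M N D \<xi>"

lemma DM: "D \<subseteq> pts M" and DN: "D' \<subseteq> pts N"
  using openin_subset[OF D] openin_subset[OF D'] by auto

lemma inl_eq: "x \<in> pts M \<Longrightarrow> inl x = insert (Inl x) (if x \<in> D then {Inr (\<xi> x)} else {})"
  unfolding glue_inl_def glue_rel_def by auto

lemma inr_eq: "y \<in> pts N \<Longrightarrow> inr y = insert (Inr y) (if y \<in> D' then {Inl (\<zeta> y)} else {})"
  unfolding glue_inr_def glue_rel_def using \<xi>D \<zeta>D' by (auto simp: image_iff)

lemma inl_inj: "inj_on inl (pts M)" and inr_inj: "inj_on inr (pts N)"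
  by (auto simp: inj_on_def inl_eq inr_eq split: if_splits)

lemma inl_eq_inr: "x \<in> pts M \<Longrightarrow> y \<in> pts N \<Longrightarrow> inl x = inr y \<longleftrightarrow> x \<in> D \<and> y = \<xi> x"
  using \<xi>D \<zeta>D' by (auto simp: inl_eq inr_eq split: if_splits)

lemma quotient_eq: "(pts M <+> pts N) // glue_rel (pts M) (pts N) D \<xi> = inl ` pts M \<union> inr ` pts N"
  unfolding quotient_def glue_inl_def glue_inr_def by auto

lemma openin_L:
  "openin (mtop L) W \<longleftrightarrow> W \<subseteq> inl ` pts M \<union> inr ` pts N \<and>
     openin (mtop M) {x \<in> pts M. inl x \<in> W} \<and> openin (mtop N) {y \<in> pts N. inr y \<in> W}"
  by (simp add: glue_def openin_glue_topology quotient_eq)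

lemma pts_L: "pts L = inl ` pts M \<union> inr ` pts N"
proof
  show "pts L \<subseteq> inl ` pts M \<union> inr ` pts N"
    using openin_L[of "pts L"] by auto
  have "{x \<in> pts M. inl x \<in> inl ` pts M \<union> inr ` pts N} = pts M" "{y \<in> pts N. inr y \<in> inl ` pts M \<union> inr ` pts N} = pts N"
    by auto
  then have "openin (mtop L) (inl ` pts M \<union> inr ` pts N)"
    using openin_L by simp
  then show "inl ` pts M \<union> inr ` pts N \<subseteq> pts L"
    by (rule openin_subset)
qed

lemma open_image_preimage:
  assumes c: "continuous_map (subtopology X S) Y f" and S: "openin X S" and A: "openin Y A"
  shows "openin X {x \<in> S. f x \<in> A}"
proof -
  have "openin (subtopology X S) {x \<in> topspace (subtopology X S). f x \<in> A}"
    by (rule openin_continuous_map_preimage[OF c A])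
  moreover have "{x \<in> topspace (subtopology X S). f x \<in> A} = {x \<in> S. f x \<in> A}"
    using openin_subset[OF S] by auto
  ultimately show ?thesis using openin_trans_full[OF _ S] by simp
qed

lemma emb_inl: "chart_embedding M L inl"
  unfolding chart_embedding_def
proof (intro conjI allI impI)
  show "continuous_map (mtop M) (mtop L) inl"
    unfolding continuous_map_def using pts_L openin_L by auto
  fix A assume A: "openin (mtop M) A"
  have AM: "A \<subseteq> pts M" using openin_subset[OF A] .
  have "{x \<in> pts M. inl x \<in> inl ` A} = A"
    using inl_inj AM by (auto simp: inj_on_def)
  \<comment> \<open>Openness in the quotient is tested on both sides. On the other side the image of
    \<open>A\<close> appears as its preimage under the inverse gluing map, which is open since
    \<open>\<zeta>\<close> is continuous.\<close>
  moreover have "{y \<in> pts N. inr y \<in> inl ` A} = {y \<in> D'. \<zeta> y \<in> A}"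
  proof (intro Set.set_eqI iffI)
    fix y assume "y \<in> {y \<in> pts N. inr y \<in> inl ` A}"
    then obtain x where x: "y \<in> pts N" "x \<in> A" "inl x = inr y" by auto
    then have "x \<in> D" "y = \<xi> x" using inl_eq_inr AM by auto
    then show "y \<in> {y \<in> D'. \<zeta> y \<in> A}" using \<xi>D x by auto
  next
    fix y assume "y \<in> {y \<in> D'. \<zeta> y \<in> A}"
    then have "y \<in> pts N" "inl (\<zeta> y) = inr y" "\<zeta> y \<in> A"
      using inl_eq_inr[of "\<zeta> y" y] \<zeta>D' DN AM DM by auto
    then show "y \<in> {y \<in> pts N. inr y \<in> inl ` A}" by auto
  qed
  moreover have "openin (mtop N) {y \<in> D'. \<zeta> y \<in> A}"
    by (rule open_image_preimage[OF _ D' A]) (use \<zeta> in \<open>simp add: smooth_map_def submanifold_open_simps\<close>)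
  ultimately show "openin (mtop L) (inl ` A)"
    using A AM by (auto simp: openin_L)
qed (use inl_inj in \<open>force simp: glue_def\<close>)+

lemma emb_inr: "chart_embedding N L inr"
  unfolding chart_embedding_def
proof (intro conjI allI impI)
  show "continuous_map (mtop N) (mtop L) inr"
    unfolding continuous_map_def using pts_L openin_L by auto
  fix A assume A: "openin (mtop N) A"
  have AN: "A \<subseteq> pts N" using openin_subset[OF A] .
  have "{x \<in> pts N. inr x \<in> inr ` A} = A"
    using inr_inj AN by (auto simp: inj_on_def)
  moreover have "{y \<in> pts M. inl y \<in> inr ` A} = {y \<in> D. \<xi> y \<in> A}"
  proof (intro Set.set_eqI iffI)
    fix y assume "y \<in> {y \<in> pts M. inl y \<in> inr ` A}"
    then obtain x where x: "y \<in> pts M" "x \<in> A" "inl y = inr x" by auto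
    then have "y \<in> D" "x = \<xi> y" using inl_eq_inr AN by auto
    then show "y \<in> {y \<in> D. \<xi> y \<in> A}" using \<xi>D x by auto
  next
    fix y assume "y \<in> {y \<in> D. \<xi> y \<in> A}"
    then have "y \<in> pts M" "inl y = inr (\<xi> y)" "\<xi> y \<in> A"
      using inl_eq_inr[of y "\<xi> y"] DM AN by auto
    then show "y \<in> {y \<in> pts M. inl y \<in> inr ` A}" by auto
  qed
  moreover have "openin (mtop M) {y \<in> D. \<xi> y \<in> A}"
    by (rule open_image_preimage[OF _ D A]) (use \<xi> in \<open>simp add: smooth_map_def submanifold_open_simps\<close>)
  ultimately show "openin (mtop L) (inr ` A)"
    using A AN by (auto simp: openin_L)
qed (use inr_inj in \<open>force simp: glue_def\<close>)+

lemma charts_L: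
  assumes "(W, w) \<in> charts L"
  obtains U c where "(U, c) \<in> charts M" "W = inl ` U" "w = c \<circ> inv_into (pts M) inl"
  | V d where "(V, d) \<in> charts N" "W = inr ` V" "w = d \<circ> inv_into (pts N) inr"
  using assms by (auto simp: glue_def)

text \<open>Read in the original charts, the transitions between the two sides are exactly the local
  representations of \<open>\<xi>\<close> and \<open>\<zeta>\<close>.\<close>

lemma transition_lr:
  assumes c: "(U, c) \<in> charts M" and d: "(V, d) \<in> charts N"
  shows "smooth_on ((c \<circ> inv_into (pts M) inl) ` (inl ` U \<inter> inr ` V))
      ((d \<circ> inv_into (pts N) inr) \<circ> inv_into (inl ` U) (c \<circ> inv_into (pts M) inl))" (is ?lr)
    and "smooth_on ((d \<circ> inv_into (pts N) inr) ` (inr ` V \<inter> inl ` U))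
      ((c \<circ> inv_into (pts M) inl) \<circ> inv_into (inr ` V) (d \<circ> inv_into (pts N) inr))" (is ?rl)
proof -
  have UM: "U \<subseteq> pts M" and VN: "V \<subseteq> pts N"
    using chart_sub[OF M c] chart_sub[OF N d] by auto
  have int: "inl ` U \<inter> inr ` V = inl ` (U \<inter> D \<inter> \<xi> -` V)"
  proof (intro Set.set_eqI iffI)
    fix z assume "z \<in> inl ` U \<inter> inr ` V"
    then obtain x y where xy: "z = inl x" "x \<in> U" "z = inr y" "y \<in> V" by auto
    then have "inl x = inr y" "x \<in> pts M" "y \<in> pts N" using UM VN by auto
    then have "x \<in> D \<and> y = \<xi> x" using inl_eq_inr by simp
    then show "z \<in> inl ` (U \<inter> D \<inter> \<xi> -` V)" using xy by (intro image_eqI[of _ _ x]) auto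
  next
    fix z assume "z \<in> inl ` (U \<inter> D \<inter> \<xi> -` V)"
    then obtain x where x: "z = inl x" "x \<in> U" "x \<in> D" "\<xi> x \<in> V" by auto
    then have "z = inr (\<xi> x)" using inl_eq_inr[of x "\<xi> x"] UM VN by auto
    then show "z \<in> inl ` U \<inter> inr ` V" using x by auto
  qed
  have int': "inr ` V \<inter> inl ` U = inr ` (V \<inter> D' \<inter> \<zeta> -` U)"
  proof (intro Set.set_eqI iffI)
    fix z assume "z \<in> inr ` V \<inter> inl ` U"
    then obtain x y where xy: "z = inl x" "x \<in> U" "z = inr y" "y \<in> V" by auto
    then have "inl x = inr y" "x \<in> pts M" "y \<in> pts N" using UM VN by auto
    then have "x \<in> D \<and> y = \<xi> x" using inl_eq_inr by simp
    then show "z \<in> inr ` (V \<inter> D' \<inter> \<zeta> -` U)" using xy \<xi>D by (intro image_eqI[of _ _ y]) auto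
  next
    fix z assume "z \<in> inr ` (V \<inter> D' \<inter> \<zeta> -` U)"
    then obtain y where y: "z = inr y" "y \<in> V" "y \<in> D'" "\<zeta> y \<in> U" by auto
    then have "z = inl (\<zeta> y)" using inl_eq_inr[of "\<zeta> y" y] UM VN \<zeta>D' by auto
    then show "z \<in> inr ` V \<inter> inl ` U" using y by auto
  qed
  have img: "(c \<circ> inv_into (pts M) inl) ` (inl ` (U \<inter> D \<inter> \<xi> -` V)) = c ` (U \<inter> D \<inter> \<xi> -` V)"
    by (rule emb_chart_img[OF M emb_inl c]) auto
  have img': "(d \<circ> inv_into (pts N) inr) ` (inr ` (V \<inter> D' \<inter> \<zeta> -` U)) = d ` (V \<inter> D' \<inter> \<zeta> -` U)"
    by (rule emb_chart_img[OF N emb_inr d]) auto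
  have c': "(U \<inter> D, c) \<in> charts (submanifold_open M D)" and d': "(V \<inter> D', d) \<in> charts (submanifold_open N D')"
    unfolding submanifold_open_simps using c d by force+
  have "smooth_on (loc_dom (U \<inter> D, c) (V, d) \<xi>) (loc_rep (U \<inter> D, c) (V, d) \<xi>)"
    using \<xi> c' d unfolding smooth_map_def by blast
  then have s1: "smooth_on (c ` (U \<inter> D \<inter> \<xi> -` V)) (loc_rep (U \<inter> D, c) (V, d) \<xi>)"
    by (simp add: loc_dom_def)
  show ?lr
    unfolding int img
  proof (rule smooth_on_cong[OF s1])
    fix y assume "y \<in> c ` (U \<inter> D \<inter> \<xi> -` V)"
    then obtain x where x: "y = c x" "x \<in> U" "x \<in> D" "\<xi> x \<in> V" by auto
    have "inl x = inr (\<xi> x)" using inl_eq_inr[of x "\<xi> x"] x UM VN by auto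
    moreover have "inv_into (U \<inter> D) c (c x) = x"
      by (rule inv_into_Int[OF chart_inj[OF M c]]) (use x in auto)
    moreover have "inv_into (pts N) inr (inr (\<xi> x)) = \<xi> x"
      by (rule emb_inv[OF N emb_inr]) (use x VN in auto)
    ultimately show "loc_rep (U \<inter> D, c) (V, d) \<xi> y =
        ((d \<circ> inv_into (pts N) inr) \<circ> inv_into (inl ` U) (c \<circ> inv_into (pts M) inl)) y"
      using x emb_chart_inv[OF M emb_inl c x(2)] by (simp add: loc_rep_def)
  qed
  have "smooth_on (loc_dom (V \<inter> D', d) (U, c) \<zeta>) (loc_rep (V \<inter> D', d) (U, c) \<zeta>)"
    using \<zeta> d' c unfolding smooth_map_def by blast
  then have s2: "smooth_on (d ` (V \<inter> D' \<inter> \<zeta> -` U)) (loc_rep (V \<inter> D', d) (U, c) \<zeta>)"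
    by (simp add: loc_dom_def)
  show ?rl
    unfolding int' img'
  proof (rule smooth_on_cong[OF s2])
    fix z assume "z \<in> d ` (V \<inter> D' \<inter> \<zeta> -` U)"
    then obtain y where y: "z = d y" "y \<in> V" "y \<in> D'" "\<zeta> y \<in> U" by auto
    have "inl (\<zeta> y) = inr y" using inl_eq_inr[of "\<zeta> y" y] y UM VN \<zeta>D' by auto
    moreover have "inv_into (V \<inter> D') d (d y) = y"
      by (rule inv_into_Int[OF chart_inj[OF N d]]) (use y in auto)
    moreover have "inv_into (pts M) inl (inl (\<zeta> y)) = \<zeta> y"
      by (rule emb_inv[OF M emb_inl]) (use y UM in auto)
    ultimately show "loc_rep (V \<inter> D', d) (U, c) \<zeta> z =
        ((c \<circ> inv_into (pts M) inl) \<circ> inv_into (inr ` V) (d \<circ> inv_into (pts N) inr)) z"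
      using y emb_chart_inv[OF N emb_inr d y(2)] by (simp add: loc_rep_def)
  qed
qed

lemma atlas_L: "atlas Q L"
  unfolding atlas_def
proof (intro conjI ballI)
  show "fat Q" by (rule atlas_fat[OF M])
  fix z assume "z \<in> pts L"
  then consider x where "x \<in> pts M" "z = inl x" | y where "y \<in> pts N" "z = inr y"
    using pts_L by auto
  then show "\<exists>(U, c)\<in>charts L. z \<in> U"
  proof cases
    case 1
    obtain U c where c: "(U, c) \<in> charts M" "x \<in> U" using atlas_chart[OF M 1(1)] by metis
    then have "(inl ` U, c \<circ> inv_into (pts M) inl) \<in> charts L"
      using emb_inl by (auto simp: chart_embedding_def)
    then show ?thesis using c(2) 1(2) by (intro bexI[of _ "(inl ` U, c \<circ> inv_into (pts M) inl)"]) auto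
  next
    case 2
    obtain U c where c: "(U, c) \<in> charts N" "y \<in> U" using atlas_chart[OF N 2(1)] by metis
    then have "(inr ` U, c \<circ> inv_into (pts N) inr) \<in> charts L"
      using emb_inr by (auto simp: chart_embedding_def)
    then show ?thesis using c(2) 2(2) by (intro bexI[of _ "(inr ` U, c \<circ> inv_into (pts N) inr)"]) auto
  qed
next
  fix C assume "C \<in> charts L"
  then obtain W w where C: "C = (W, w)" "(W, w) \<in> charts L" by (metis surj_pair)
  from C(2) show "case C of (U, c) \<Rightarrow> openin (mtop L) U \<and> openin (top_of_set Q) (c ` U) \<and>
      homeomorphic_map (subtopology (mtop L) U) (top_of_set (c ` U)) c"
  proof (cases rule: charts_L)
    case (1 U c)
    then show ?thesis
      using emb_open[OF M emb_inl chart_open[OF M 1(1)]] emb_chart_img[OF M emb_inl 1(1) subset_refl]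
        emb_chart_homeo[OF M emb_inl 1(1)] chart_img_open[OF M 1(1) chart_open[OF M 1(1)] subset_refl]
      by (simp only: C(1) prod.case 1)
  next
    case (2 U c)
    then show ?thesis
      using emb_open[OF N emb_inr chart_open[OF N 2(1)]] emb_chart_img[OF N emb_inr 2(1) subset_refl]
        emb_chart_homeo[OF N emb_inr 2(1)] chart_img_open[OF N 2(1) chart_open[OF N 2(1)] subset_refl]
      by (simp only: C(1) prod.case 2)
  qed
  show "case C of (U, c) \<Rightarrow> \<forall>(V, d)\<in>charts L. smooth_on (c ` (U \<inter> V)) (d \<circ> inv_into U c)"
  proof (simp only: C(1) prod.case, intro ballI)
    fix C' assume "C' \<in> charts L"
    then obtain W' w' where C': "C' = (W', w')" "(W', w') \<in> charts L" by (metis surj_pair)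
    have "smooth_on (w ` (W \<inter> W')) (w' \<circ> inv_into W w)"
      using C(2)
    proof (cases rule: charts_L)
      case (1 U c)
      from C'(2) show ?thesis
      proof (cases rule: charts_L)
        case (1 U' c')
        then show ?thesis using emb_same_transition[OF M emb_inl] \<open>(U, c) \<in> charts M\<close> \<open>W = inl ` U\<close> \<open>w = c \<circ> inv_into (pts M) inl\<close> by blast
      next
        case (2 U' c')
        then show ?thesis using transition_lr(1) \<open>(U, c) \<in> charts M\<close> \<open>W = inl ` U\<close> \<open>w = c \<circ> inv_into (pts M) inl\<close> by blast
      qed
    next
      case (2 U c)
      from C'(2) show ?thesis
      proof (cases rule: charts_L)
        case (1 U' c')
        then show ?thesis using transition_lr(2) \<open>(U, c) \<in> charts N\<close> \<open>W = inr ` U\<close> \<open>w = c \<circ> inv_into (pts N) inr\<close> by blast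
      next
        case (2 U' c')
        then show ?thesis using emb_same_transition[OF N emb_inr] \<open>(U, c) \<in> charts N\<close> \<open>W = inr ` U\<close> \<open>w = c \<circ> inv_into (pts N) inr\<close> by blast
      qed
    qed
    then show "case C' of (V, d) \<Rightarrow> smooth_on (w ` (W \<inter> V)) (d \<circ> inv_into W w)"
      by (simp add: C'(1))
  qed
qed

end

section \<open>Definite homogeneous functions on vector bundles\<close>

lemma psmooth_shrink:
  assumes F: "psmooth Q X W F" and W: "(p0, y0) \<in> W" and T: "open T" "F (p0, y0) \<in> T"
  obtains W' where "pdom Q X W'" "(p0, y0) \<in> W'" "W' \<subseteq> W" "\<forall>z\<in>W'. F z \<in> T"
proof -
  obtain A S where AS: "openin X A" "openin (top_of_set Q) S" "p0 \<in> A" "y0 \<in> S" "A \<times> S \<subseteq> W"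
    "\<forall>p\<in>A. \<forall>y\<in>S. F (p, y) \<in> T"
    by (rule psmooth_box[OF F W T])
  show thesis
    by (rule that[of "A \<times> S"]) (use AS pdom_fat[OF psmooth_pdom[OF F]] in \<open>auto intro: pdom_box\<close>)
qed

lemma sm_at_const:
  assumes M: "atlas Q M" and N: "atlas R N" and p: "p \<in> topspace X" and x: "x \<in> pts M" and y: "y \<in> pts N"
  shows "sm_at Q X M N (\<lambda>_ _. y) p x"
proof -
  obtain U c where c: "(U, c) \<in> charts M" "x \<in> U" using atlas_chart[OF M x] by metis
  obtain V d where d: "(V, d) \<in> charts N" "y \<in> V" using atlas_chart[OF N y] by metis
  have "psmooth Q X (topspace X \<times> c ` U) (\<lambda>z. d y)"
    by (intro psmooth_intros pdom_box atlas_fat[OF M] openin_topspace chart_img_open[OF M c(1) chart_open[OF M c(1)]]) simp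
  then show ?thesis
    unfolding sm_at_def using c d p chart_open[OF M c(1)]
    by (intro exI[of _ U] exI[of _ c] exI[of _ V] exI[of _ d] exI[of _ "topspace X"] exI[of _ U]) auto
qed

locale smooth_bundle =
  fixes V :: "('e, 'k::euclidean_space, 'b, 'm::{real_normed_vector, heine_borel}) vbundle"
    and tv :: "'v::euclidean_space itself"
  assumes is_bundle: "smooth_vector_bundle tv V"
begin

abbreviation "E \<equiv> total V"
abbreviation "B \<equiv> base V"
abbreviation "s \<equiv> vscale V"
abbreviation "\<pi> \<equiv> proj V"

lemma atlas_E: "atlas UNIV E" and atlas_B: "atlas UNIV B"
  using is_bundle smooth_manifold_atlas unfolding smooth_vector_bundle_def by auto

lemma proj_cont: "continuous_map (mtop E) (mtop B) \<pi>"
  using is_bundle unfolding smooth_vector_bundle_def smooth_map_def by auto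

lemma proj_pts: "x \<in> pts E \<Longrightarrow> \<pi> x \<in> pts B"
  using proj_cont by (auto simp: continuous_map_def)

lemma s_pts: "x \<in> pts E \<Longrightarrow> s a x \<in> pts E" and s_proj: "x \<in> pts E \<Longrightarrow> \<pi> (s a x) = \<pi> x"
  using is_bundle unfolding smooth_vector_bundle_def by auto

lemma triv:
  assumes "b \<in> pts B"
  obtains W and \<tau> :: "'e \<Rightarrow> 'v" where "openin (mtop B) W" "b \<in> W"
    "diffeo (submanifold_open E (\<pi> -` W)) (prod_manifold (submanifold_open B W) vector_manifold) (\<lambda>x. (\<pi> x, \<tau> x))"
    "\<And>a x. x \<in> pts E \<Longrightarrow> \<pi> x \<in> W \<Longrightarrow> \<tau> (s a x) = a *\<^sub>R \<tau> x"
proof -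
  have "\<forall>b\<in>pts B. \<exists>W (\<tau> :: 'e \<Rightarrow> 'v). openin (mtop B) W \<and> b \<in> W \<and>
        diffeo (submanifold_open E (\<pi> -` W)) (prod_manifold (submanifold_open B W) vector_manifold) (\<lambda>x. (\<pi> x, \<tau> x)) \<and>
        (\<forall>a. \<forall>x\<in>pts E. \<pi> x \<in> W \<longrightarrow> \<tau> (s a x) = a *\<^sub>R \<tau> x)"
    using is_bundle unfolding smooth_vector_bundle_def by blast
  from bspec[OF this assms] show thesis
    using that by blast
qed

lemma pts_prod: "pts (prod_manifold (submanifold_open B W) (vector_manifold :: ('v, 'v) manifold)) = (pts B \<inter> W) \<times> UNIV"
  by (simp add: prod_manifold_def submanifold_open_simps charts_vector)

lemma triv_bij:
  assumes "diffeo (submanifold_open E (\<pi> -` W)) (prod_manifold (submanifold_open B W) (vector_manifold :: ('v, 'v) manifold)) (\<lambda>x. (\<pi> x, \<tau> x))"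
  shows "bij_betw (\<lambda>x. (\<pi> x, \<tau> x)) (pts E \<inter> \<pi> -` W) ((pts B \<inter> W) \<times> UNIV)"
  using assms pts_prod unfolding diffeo_def by (simp add: submanifold_open_simps)

text \<open>A trivialization is injective and linear on fibres, so the laws of scaling are inherited
  from the model fibre.\<close>

lemma
  assumes x: "x \<in> pts E"
  shows s_s: "s a (s b x) = s (a * b) x" and s_one: "s 1 x = x"
proof -
  obtain W and \<tau> :: "'e \<Rightarrow> 'v" where W: "\<pi> x \<in> W"
    and d: "diffeo (submanifold_open E (\<pi> -` W)) (prod_manifold (submanifold_open B W) vector_manifold) (\<lambda>x. (\<pi> x, \<tau> x))"
    and \<tau>: "\<And>a x. x \<in> pts E \<Longrightarrow> \<pi> x \<in> W \<Longrightarrow> \<tau> (s a x) = a *\<^sub>R \<tau> x"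
    by (rule triv[OF proj_pts[OF x]]) blast
  have inj: "inj_on (\<lambda>x. (\<pi> x, \<tau> x)) (pts E \<inter> \<pi> -` W)"
    using triv_bij[OF d] by (rule bij_betw_imp_inj_on)
  show "s a (s b x) = s (a * b) x"
    by (rule inj_onD[OF inj]) (use x W in \<open>auto simp: s_pts s_proj \<tau>\<close>)
  show "s 1 x = x"
    by (rule inj_onD[OF inj]) (use x W in \<open>auto simp: s_pts s_proj \<tau>\<close>)
qed

lemma zero_section_iff: "x \<in> zero_section V \<longleftrightarrow> x \<in> pts E \<and> s 0 x = x"
proof
  assume "x \<in> zero_section V"
  then obtain y where "y \<in> pts E" "x = s 0 y" by (auto simp: zero_section_def)
  then show "x \<in> pts E \<and> s 0 x = x" using s_pts s_s by simp
next
  assume "x \<in> pts E \<and> s 0 x = x"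
  then show "x \<in> zero_section V" unfolding zero_section_def by (metis image_eqI)
qed

text \<open>The rank is positive, as a Euclidean space has a nonempty basis; a nonzero vector of the
  model fibre is pulled back through a trivialization.\<close>

lemma nonzero_exists:
  assumes "pts B \<noteq> {}"
  obtains x where "x \<in> pts E" "x \<notin> zero_section V"
proof -
  obtain b where b: "b \<in> pts B" using assms by (meson ex_in_conv)
  obtain W and \<tau> :: "'e \<Rightarrow> 'v" where W: "b \<in> W"
    and d: "diffeo (submanifold_open E (\<pi> -` W)) (prod_manifold (submanifold_open B W) vector_manifold) (\<lambda>x. (\<pi> x, \<tau> x))"
    and \<tau>: "\<And>a x. x \<in> pts E \<Longrightarrow> \<pi> x \<in> W \<Longrightarrow> \<tau> (s a x) = a *\<^sub>R \<tau> x"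
    by (rule triv[OF b]) blast
  obtain v :: 'v where v: "v \<noteq> 0" using nonempty_Basis nonzero_Basis by blast
  have "(b, v) \<in> (\<lambda>x. (\<pi> x, \<tau> x)) ` (pts E \<inter> \<pi> -` W)"
    using triv_bij[OF d] b W by (auto simp: bij_betw_def)
  then obtain x where x: "x \<in> pts E" "\<pi> x = b" "\<tau> x = v" by auto
  show thesis
  proof (rule that[OF x(1)])
    show "x \<notin> zero_section V"
      using zero_section_iff \<tau>[OF x(1), of 0] x W v by auto
  qed
qed

text \<open>In the chart coordinates of the total space, \<open>R1\<close> splits off the base
  coordinate and the fibre vector and \<open>R2\<close> reassembles them; scaling then multiplies
  the second component. Two charts are needed, since scaling may leave the chart of the point. If
  they are the same, \<open>R1\<close> inverts \<open>R2\<close>.\<close>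

lemma local_triv:
  assumes x1: "x1 \<in> pts E" and c: "(U, c) \<in> charts E" "x1 \<in> U" and c': "(U', c') \<in> charts E" "s a1 x1 \<in> U'"
  obtains R1 :: "'k \<Rightarrow> 'm \<times> 'v" and R2 :: "'m \<times> 'v \<Rightarrow> 'k" and S1 S2 where
    "open S1" "open S2" "smooth_on S1 R1" "smooth_on S2 R2" "c x1 \<in> S1" "S1 \<subseteq> c ` U"
    "(fst (R1 (c x1)), a1 *\<^sub>R snd (R1 (c x1))) \<in> S2"
    "\<And>x a. x \<in> U \<Longrightarrow> c x \<in> S1 \<Longrightarrow> (fst (R1 (c x)), a *\<^sub>R snd (R1 (c x))) \<in> S2 \<Longrightarrow>
       s a x \<in> U' \<and> R2 (fst (R1 (c x)), a *\<^sub>R snd (R1 (c x))) = c' (s a x)"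
    "\<And>z. (U', c') = (U, c) \<Longrightarrow> z \<in> S2 \<Longrightarrow> R2 z \<in> S1 \<and> R1 (R2 z) = z"
proof -
  obtain W and \<tau> :: "'e \<Rightarrow> 'v" where W: "openin (mtop B) W" "\<pi> x1 \<in> W"
    and df: "diffeo (submanifold_open E (\<pi> -` W)) (prod_manifold (submanifold_open B W) vector_manifold) (\<lambda>x. (\<pi> x, \<tau> x))"
    and \<tau>: "\<And>a x. x \<in> pts E \<Longrightarrow> \<pi> x \<in> W \<Longrightarrow> \<tau> (s a x) = a *\<^sub>R \<tau> x"
    by (rule triv[OF proj_pts[OF x1]]) blast
  obtain Z d where d: "(Z, d) \<in> charts B" "\<pi> x1 \<in> Z" using atlas_chart[OF atlas_B proj_pts[OF x1]] by metis
  define T where "T = (\<lambda>x. (\<pi> x, \<tau> x))"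
  let ?E = "submanifold_open E (\<pi> -` W)" and ?P = "prod_manifold (submanifold_open B W) (vector_manifold :: ('v, 'v) manifold)"
  define T' where "T' = inv_into (pts ?E) T"
  have pE: "pts ?E = pts E \<inter> \<pi> -` W" by (simp add: submanifold_open_simps)
  have sT: "smooth_map ?E ?P T" and sT': "smooth_map ?P ?E T'"
    using df unfolding diffeo_def T_def T'_def by auto
  have bij: "bij_betw T (pts E \<inter> \<pi> -` W) ((pts B \<inter> W) \<times> UNIV)"
    unfolding T_def by (rule triv_bij[OF df])
  have T'T: "T' (T x) = x" if "x \<in> pts E" "\<pi> x \<in> W" for x
    unfolding T'_def pE by (rule inv_into_f_f[OF bij_betw_imp_inj_on[OF bij]]) (use that in auto)
  have TT': "T' z \<in> pts E" "\<pi> (T' z) = fst z" "\<tau> (T' z) = snd z" if "fst z \<in> pts B \<inter> W" for z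
  proof -
    have "z \<in> T ` (pts E \<inter> \<pi> -` W)"
      using bij that by (auto simp: bij_betw_def mem_Times_iff)
    then obtain x where x: "x \<in> pts E" "\<pi> x \<in> W" "z = T x" by auto
    show "T' z \<in> pts E" "\<pi> (T' z) = fst z" "\<tau> (T' z) = snd z"
      using T'T[OF x(1,2)] x by (auto simp: T_def)
  qed
  have UE: "U \<subseteq> pts E" "U' \<subseteq> pts E" and ZB: "Z \<subseteq> pts B"
    using chart_sub[OF atlas_E c(1)] chart_sub[OF atlas_E c'(1)] chart_sub[OF atlas_B d(1)] by auto
  let ?C = "(U \<inter> \<pi> -` W, c)" and ?C' = "(U' \<inter> \<pi> -` W, c')"
  let ?e = "map_prod d (\<lambda>v::'v. v)"
  let ?D = "((Z \<inter> W) \<times> (UNIV :: 'v set), ?e)"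
  have C: "?C \<in> charts ?E" "?C' \<in> charts ?E"
    unfolding submanifold_open_simps using c c' by force+
  have dW: "(Z \<inter> W, d) \<in> charts (submanifold_open B W)"
    unfolding submanifold_open_simps using d by force
  then have D: "?D \<in> charts ?P"
    unfolding prod_manifold_def by (auto simp: charts_vector)
  define R1 where "R1 = loc_rep ?C ?D T"
  define R2 where "R2 = loc_rep ?D ?C' T'"
  define S1 where "S1 = loc_dom ?C ?D T"
  define S2 where "S2 = loc_dom ?D ?C' T'"
  have s1: "smooth_on S1 R1" and s2: "smooth_on S2 R2"
    using sT sT' C D unfolding smooth_map_def S1_def R1_def S2_def R2_def by blast+
  have S1: "S1 = c ` (U \<inter> \<pi> -` (W \<inter> Z))"
    unfolding S1_def loc_dom_def T_def by auto
  have R1: "R1 (c x) = (d (\<pi> x), \<tau> x)" if "x \<in> U" "\<pi> x \<in> W" for x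
    unfolding R1_def loc_rep_def using inv_into_Int[OF chart_inj[OF atlas_E c(1)], of x "\<pi> -` W"] that
    by (simp add: T_def)
  have inje: "inj_on ?e ((Z \<inter> W) \<times> UNIV)"
    using chart_inj[OF atlas_B d(1)] by (auto simp: inj_on_def)
  have S2: "z \<in> S2 \<longleftrightarrow> (\<exists>b v. z = (d b, v) \<and> b \<in> Z \<inter> W \<and> T' (b, v) \<in> U')" for z
  proof -
    have "T' (b, v) \<in> \<pi> -` W" if "b \<in> Z \<inter> W" for b v
      using TT'(2)[of "(b, v)"] that ZB by auto
    then show ?thesis
      unfolding S2_def loc_dom_def by (auto simp: image_iff Bex_def)
  qed
  have R2: "R2 (d b, v) = c' (T' (b, v))" if "b \<in> Z \<inter> W" for b v
  proof -
    have "inv_into ((Z \<inter> W) \<times> UNIV) ?e (?e (b, v)) = (b, v)"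
      by (rule inv_into_f_f[OF inje]) (use that in auto)
    then show ?thesis by (simp add: R2_def loc_rep_def)
  qed
  have oS1: "open S1"
  proof -
    have "openin (mtop E) {x \<in> pts E. \<pi> x \<in> W \<inter> Z}"
      by (rule openin_continuous_map_preimage[OF proj_cont]) (intro openin_Int W(1) chart_open[OF atlas_B d(1)])
    then have "openin (mtop E) (U \<inter> {x \<in> pts E. \<pi> x \<in> W \<inter> Z})"
      by (intro openin_Int chart_open[OF atlas_E c(1)])
    moreover have "U \<inter> {x \<in> pts E. \<pi> x \<in> W \<inter> Z} = U \<inter> \<pi> -` (W \<inter> Z)" using UE by auto
    ultimately show ?thesis
      unfolding S1 using chart_img_open[OF atlas_E c(1), of "U \<inter> \<pi> -` (W \<inter> Z)"] by simp
  qed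
  have oS2: "open S2"
  proof -
    have oZW: "open (d ` (Z \<inter> W))"
      using chart_img_open[OF atlas_B d(1), of "Z \<inter> W"] openin_Int[OF chart_open[OF atlas_B d(1)] W(1)] by simp
    have "openin (mtop ?E) (U' \<inter> \<pi> -` W)"
      using chart_open[OF atlas_E c'(1)] openin_subtopology_Int2[of "mtop E" U' "\<pi> -` W"]
      by (simp add: submanifold_open_simps Int_commute)
    from openin_continuous_map_preimage[OF _ this, of "mtop ?P" T']
    have I: "openin (mtop ?P) {z \<in> pts ?P. T' z \<in> U' \<inter> \<pi> -` W}"
      using sT' by (simp add: smooth_map_def)
    let ?g = "\<lambda>z :: 'm \<times> 'v. (inv_into Z d (fst z), snd z)"
    let ?S = "d ` (Z \<inter> W) \<times> (UNIV :: 'v set)"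
    have inv: "inv_into Z d (d b) = b" if "b \<in> Z" for b using chart_inv[OF atlas_B d(1) that] .
    have "continuous_map (top_of_set ?S) (top_of_set (d ` Z)) fst"
      by (auto simp: continuous_map_in_subtopology intro!: continuous_intros)
    from continuous_map_compose[OF this chart_inv_cont[OF atlas_B d(1)]]
    have "continuous_map (top_of_set ?S) (mtop B) (\<lambda>z. inv_into Z d (fst z))" by (simp add: o_def)
    moreover have "continuous_map (top_of_set ?S) euclidean (snd :: 'm \<times> 'v \<Rightarrow> 'v)"
      by (auto intro!: continuous_intros)
    ultimately have g: "continuous_map (top_of_set ?S) (mtop ?P) ?g"
      using inv by (auto simp: prod_manifold_def submanifold_open_simps charts_vector continuous_map_pairwise
          continuous_map_in_subtopology o_def)
    from openin_continuous_map_preimage[OF g I]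
    have "openin (top_of_set ?S) {z \<in> topspace (top_of_set ?S). ?g z \<in> {z \<in> pts ?P. T' z \<in> U' \<inter> \<pi> -` W}}" .
    moreover have "{z \<in> topspace (top_of_set ?S). ?g z \<in> {z \<in> pts ?P. T' z \<in> U' \<inter> \<pi> -` W}} = S2"
    proof (intro Set.set_eqI iffI)
      fix z assume "z \<in> {z \<in> topspace (top_of_set ?S). ?g z \<in> {z \<in> pts ?P. T' z \<in> U' \<inter> \<pi> -` W}}"
      then obtain b where "b \<in> Z \<inter> W" "fst z = d b" "T' (inv_into Z d (fst z), snd z) \<in> U'" by auto
      then show "z \<in> S2" unfolding S2 using inv by (intro exI[of _ b] exI[of _ "snd z"]) (auto simp: prod_eq_iff)
    next
      fix z assume "z \<in> S2"
      then obtain b v where z: "z = (d b, v)" "b \<in> Z" "b \<in> W" "T' (b, v) \<in> U'" unfolding S2 by auto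
      then show "z \<in> {z \<in> topspace (top_of_set ?S). ?g z \<in> {z \<in> pts ?P. T' z \<in> U' \<inter> \<pi> -` W}}"
        using inv ZB TT'(2)[of "(b, v)"] by (auto simp: pts_prod)
    qed
    moreover have "open ?S" by (intro open_Times oZW open_UNIV)
    ultimately show ?thesis using openin_open_eq by metis
  qed
  have fwd: "s a x \<in> U' \<and> R2 (d (\<pi> x), a *\<^sub>R \<tau> x) = c' (s a x)"
    if x: "x \<in> U" "\<pi> x \<in> W" "\<pi> x \<in> Z" and S: "(d (\<pi> x), a *\<^sub>R \<tau> x) \<in> S2" for x a
  proof -
    have xE: "x \<in> pts E" using x UE by auto
    have "T (s a x) = (\<pi> x, a *\<^sub>R \<tau> x)" using xE x by (simp add: T_def s_proj \<tau>)
    then have T's: "T' (\<pi> x, a *\<^sub>R \<tau> x) = s a x"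
      using T'T[of "s a x"] xE x by (simp add: s_pts s_proj)
    obtain b v where b: "(d (\<pi> x), a *\<^sub>R \<tau> x) = (d b, v)" "b \<in> Z \<inter> W" "T' (b, v) \<in> U'"
      using S unfolding S2 by auto
    then have "b = \<pi> x"
      using inj_onD[OF chart_inj[OF atlas_B d(1)], of "\<pi> x" b] x by auto
    then show ?thesis using b T's R2[of "\<pi> x" "a *\<^sub>R \<tau> x"] x by auto
  qed
  show thesis
  proof (rule that[OF oS1 oS2 s1 s2])
    show "c x1 \<in> S1" using c W d by (auto simp: S1)
    show "S1 \<subseteq> c ` U" by (auto simp: S1)
    have "T (s a1 x1) = (\<pi> x1, a1 *\<^sub>R \<tau> x1)" using x1 W by (simp add: T_def s_proj \<tau>)
    then have "T' (\<pi> x1, a1 *\<^sub>R \<tau> x1) = s a1 x1"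
      using T'T[of "s a1 x1"] x1 W by (simp add: s_pts s_proj)
    then show "(fst (R1 (c x1)), a1 *\<^sub>R snd (R1 (c x1))) \<in> S2"
      using R1[OF c(2) W(2)] c' W d unfolding S2 by auto
    fix x a assume x: "x \<in> U" "c x \<in> S1" "(fst (R1 (c x)), a *\<^sub>R snd (R1 (c x))) \<in> S2"
    then obtain x' where x': "c x = c x'" "x' \<in> U" "\<pi> x' \<in> W" "\<pi> x' \<in> Z" by (auto simp: S1)
    have "x' = x" using inj_onD[OF chart_inj[OF atlas_E c(1)] x'(1) x(1) x'(2)] by simp
    then have \<pi>x: "\<pi> x \<in> W" "\<pi> x \<in> Z" using x' by auto
    show "s a x \<in> U' \<and> R2 (fst (R1 (c x)), a *\<^sub>R snd (R1 (c x))) = c' (s a x)"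
      using fwd[OF x(1) \<pi>x, of a] x(3) unfolding R1[OF x(1) \<pi>x(1)] by simp
  next
    fix z assume eq: "(U', c') = (U, c)" and "z \<in> S2"
    then obtain b v where z: "z = (d b, v)" "b \<in> Z" "b \<in> W" "T' (b, v) \<in> U" unfolding S2 by auto
    let ?x = "T' (b, v)"
    have x: "\<pi> ?x = b" "\<tau> ?x = v" using TT'[of "(b, v)"] z ZB by auto
    have "R2 z = c ?x" using R2[of b v] z eq by simp
    then show "R2 z \<in> S1 \<and> R1 (R2 z) = z"
      using R1[of ?x] x z by (auto simp: S1)
  qed
qed

text \<open>Differentiating \<open>R1 (R2 z) = z\<close> exhibits the product of base model and
  fibre as a linear retract of the Euclidean model of the total space. This gives the finite
  dimension required for composing with \<open>R2\<close>.\<close>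

lemma findim_local:
  assumes x1: "x1 \<in> pts E"
  shows "findim TYPE('m \<times> 'v)"
proof -
  obtain U c where c: "(U, c) \<in> charts E" "x1 \<in> U" using atlas_chart[OF atlas_E x1] by metis
  \<comment> \<open>Scaling by 1 lets source and target chart of \<open>local_triv\<close> coincide,
    the case in which \<open>R1\<close> inverts \<open>R2\<close>.\<close>
  have c1: "s 1 x1 \<in> U" using s_one[OF x1] c by simp
  obtain R1 :: "'k \<Rightarrow> 'm \<times> 'v" and R2 :: "'m \<times> 'v \<Rightarrow> 'k" and S1 S2 where R:
    "open S1" "open S2" "smooth_on S1 R1" "smooth_on S2 R2" "c x1 \<in> S1"
    "(fst (R1 (c x1)), 1 *\<^sub>R snd (R1 (c x1))) \<in> S2"
    "\<And>z. z \<in> S2 \<Longrightarrow> R2 z \<in> S1 \<and> R1 (R2 z) = z"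
    by (rule local_triv[OF x1 c c(1) c1]) blast
  define z1 where "z1 = R1 (c x1)"
  have z1: "z1 \<in> S2" using R(6) by (simp add: z1_def)
  have y1: "R2 z1 \<in> S1" "R1 (R2 z1) = z1" using R(7)[OF z1] by auto
  obtain A where A: "(R1 has_derivative A) (at (R2 z1))"
    using smooth_on_has_derivative[OF R(3) y1(1), of "[]"] at_within_open[OF y1(1) R(1)] by auto
  obtain D where D: "(R2 has_derivative D) (at z1)"
    using smooth_on_has_derivative[OF R(4) z1, of "[]"] at_within_open[OF z1 R(2)] by auto
  have "((\<lambda>z. R1 (R2 z)) has_derivative (\<lambda>w. A (D w))) (at z1)"
    by (rule has_derivative_compose[OF D A])
  then have "((\<lambda>z. z) has_derivative (\<lambda>w. A (D w))) (at z1)"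
    by (rule has_derivative_transform_within_open[OF _ R(2) z1]) (use R(7) in auto)
  from has_derivative_unique[OF this has_derivative_ident]
  have "A (D w) = w" for w by (rule fun_cong)
  then show ?thesis
    by (rule findim_retract[OF has_derivative_bounded_linear[OF A] has_derivative_bounded_linear[OF D]])
qed

text \<open>In a local trivialization the scaled point is \<open>R2\<close> of the base coordinate
  and of \<open>a\<close> times the fibre vector, a product of smooth families framed by two fixed
  smooth maps.\<close>

lemma sm_at_scale:
  fixes M :: "('p, 'n::real_normed_vector) manifold"
  assumes M: "atlas Q M" and fd: "findim TYPE('n)" and \<Phi>: "sm_at Q X M E \<Phi> p0 x0"
    and a: "sm_at Q X M vector_manifold a p0 x0"
  shows "sm_at Q X M E (\<lambda>p x. s (a p x) (\<Phi> p x)) p0 x0"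
proof -
  let ?x1 = "\<Phi> p0 x0"
  have x1: "?x1 \<in> pts E" by (rule sm_at_pts[OF atlas_E \<Phi>])
  obtain U c where c: "(U, c) \<in> charts E" "?x1 \<in> U" using atlas_chart[OF atlas_E x1] by metis
  obtain U' c' where c': "(U', c') \<in> charts E" "s (a p0 x0) ?x1 \<in> U'"
    using atlas_chart[OF atlas_E s_pts[OF x1]] by metis
  obtain Z e where e: "(Z, e) \<in> charts M" "x0 \<in> Z" using a unfolding sm_at_def by blast
  obtain A1 B1 where A1: "openin X A1" "p0 \<in> A1" "openin (mtop M) B1" "x0 \<in> B1" "B1 \<subseteq> Z"
    "\<forall>p\<in>A1. \<forall>x\<in>B1. \<Phi> p x \<in> U"
    and F1: "psmooth Q X (A1 \<times> e ` B1) (\<lambda>z. c (\<Phi> (fst z) (inv_into Z e (snd z))))" (is "psmooth _ _ _ ?F")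
    by (rule sm_at_charts[OF M atlas_E fd findim_euclidean \<Phi> e c])
  obtain A2 B2 where A2: "openin X A2" "p0 \<in> A2" "openin (mtop M) B2" "x0 \<in> B2" "B2 \<subseteq> Z"
    and F2: "psmooth Q X (A2 \<times> e ` B2) (\<lambda>z. a (fst z) (inv_into Z e (snd z)))" (is "psmooth _ _ _ ?a")
    by (rule sm_at_vectorE[OF M fd findim_euclidean a e])
  obtain R1 :: "'k \<Rightarrow> 'm \<times> 'v" and R2 :: "'m \<times> 'v \<Rightarrow> 'k" and S1 S2 where S:
    "open S1" "open S2" and R: "smooth_on S1 R1" "smooth_on S2 R2" and cS: "c ?x1 \<in> S1"
    and S2: "(fst (R1 (c ?x1)), a p0 x0 *\<^sub>R snd (R1 (c ?x1))) \<in> S2"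
    and sR: "\<And>x a. x \<in> U \<Longrightarrow> c x \<in> S1 \<Longrightarrow> (fst (R1 (c x)), a *\<^sub>R snd (R1 (c x))) \<in> S2 \<Longrightarrow>
       s a x \<in> U' \<and> R2 (fst (R1 (c x)), a *\<^sub>R snd (R1 (c x))) = c' (s a x)"
    by (rule local_triv[OF x1 c c']) blast
  let ?W = "(A1 \<inter> A2) \<times> e ` (B1 \<inter> B2)"
  have W: "pdom Q X ?W"
    using A1 A2 by (intro pdom_box atlas_fat[OF M] chart_img_open[OF M e(1)]) auto
  have inv: "inv_into Z e (e x) = x" if "x \<in> Z" for x using chart_inv[OF M e(1) that] .
  have in0: "(p0, e x0) \<in> ?W" using A1 A2 by auto
  have F: "psmooth Q X ?W ?F" by (rule psmooth_subset[OF F1 W]) auto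
  obtain W1 where W1: "pdom Q X W1" "(p0, e x0) \<in> W1" "W1 \<subseteq> ?W" "\<forall>z\<in>W1. ?F z \<in> S1"
    by (rule psmooth_shrink[OF F in0 S(1)]) (use inv e cS in auto)
  have FW1: "psmooth Q X W1 ?F" by (rule psmooth_subset[OF F W1(1,3)])
  have aW1: "psmooth Q X W1 ?a" by (rule psmooth_subset[OF F2 W1(1)]) (use W1(3) in auto)
  have RF: "psmooth Q X W1 (\<lambda>z. R1 (?F z))"
    by (rule psmooth_compose_smooth[OF findim_euclidean FW1 R(1) fat_UNIV]) (use S W1 in \<open>auto simp: open_openin[symmetric]\<close>)
  have "psmooth Q X W1 (\<lambda>z. (fst (R1 (?F z)), ?a z *\<^sub>R snd (R1 (?F z))))"
    by (intro psmooth_Pair psmooth_intros(5) aW1 psmooth_linear[OF bounded_linear_fst RF] psmooth_linear[OF bounded_linear_snd RF])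
  then have H: "psmooth Q X W1 (\<lambda>z. (fst (R1 (?F z)), ?a z *\<^sub>R snd (R1 (?F z))))" (is "psmooth _ _ _ ?H") .
  obtain A3 S3 where A3: "openin X A3" "openin (top_of_set Q) S3" "p0 \<in> A3" "e x0 \<in> S3" "A3 \<times> S3 \<subseteq> W1"
    "\<forall>p\<in>A3. \<forall>y\<in>S3. ?H (p, y) \<in> S2"
    by (rule psmooth_box[OF H W1(2) S(2)]) (use inv e S2 in auto)
  let ?B3 = "{x \<in> Z. e x \<in> S3}"
  have B3: "openin (mtop M) ?B3" by (rule chart_preimage_open[OF M e(1) A3(2)])
  have W3: "pdom Q X (A3 \<times> e ` ?B3)"
    by (intro pdom_box atlas_fat[OF M] A3(1) chart_img_open[OF M e(1) B3]) auto
  have HW3: "psmooth Q X (A3 \<times> e ` ?B3) ?H"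
    by (rule psmooth_subset[OF H W3]) (use A3(5) in auto)
  have RH: "psmooth Q X (A3 \<times> e ` ?B3) (\<lambda>z. R2 (?H z))"
    by (rule psmooth_compose_smooth[OF findim_local[OF x1] HW3 R(2) fat_UNIV]) (use S A3(6) in \<open>auto simp: open_openin[symmetric]\<close>)
  have key: "s (a p x) (\<Phi> p x) \<in> U' \<and> R2 (?H (p, e x)) = c' (s (a p x) (\<Phi> p x))"
    if "p \<in> A3" "x \<in> ?B3" for p x
  proof -
    have pW: "(p, e x) \<in> W1" using A3(5) that by auto
    then have "(p, e x) \<in> ?W" using W1(3) by blast
    then have p1: "p \<in> A1" and "\<exists>x'\<in>B1. e x = e x'" by auto
    then have "x \<in> B1"
      using that inj_onD[OF chart_inj[OF M e(1)]] A1(5) by fastforce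
    then have U: "\<Phi> p x \<in> U" using A1(6) p1 by blast
    have "c (\<Phi> p x) \<in> S1" using W1(4) pW inv that by fastforce
    moreover have "(fst (R1 (c (\<Phi> p x))), a p x *\<^sub>R snd (R1 (c (\<Phi> p x)))) \<in> S2"
      using A3(6) that inv by fastforce
    ultimately show ?thesis using sR[OF U, of "a p x"] inv that by simp
  qed
  from RH have "psmooth Q X (A3 \<times> e ` ?B3) (\<lambda>z. c' (s (a (fst z) (inv_into Z e (snd z))) (\<Phi> (fst z) (inv_into Z e (snd z)))))"
  proof (rule psmooth_cong)
    fix z assume "z \<in> A3 \<times> e ` ?B3"
    then obtain p x where "z = (p, e x)" "p \<in> A3" "x \<in> ?B3" by auto
    then show "R2 (?H z) = c' (s (a (fst z) (inv_into Z e (snd z))) (\<Phi> (fst z) (inv_into Z e (snd z))))"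
      using key[of p x] inv by simp
  qed
  then show ?thesis
    unfolding sm_at_def using e c' A3 B3 key
    by (intro exI[of _ Z] exI[of _ e] exI[of _ U'] exI[of _ c'] exI[of _ A3] exI[of _ ?B3]) auto
qed

end

section \<open>Homogeneous functions along fibre lines\<close>

lemma vector_chart: "(UNIV, \<lambda>x. x) \<in> charts vector_manifold"
  by (simp add: charts_vector)

text \<open>The way back from the language of manifolds to calculus on an open set of a Euclidean
  space, needed to apply the theorem on even functions.\<close>

lemma psmooth_of_sm_at:
  fixes F :: "'x \<Rightarrow> 'a::euclidean_space \<Rightarrow> 'b::euclidean_space"
  assumes S: "open S" and F: "\<And>p u. p \<in> topspace X \<Longrightarrow> u \<in> S \<Longrightarrow> sm_at UNIV X vector_manifold vector_manifold F p u"
  shows "psmooth UNIV X (topspace X \<times> S) (\<lambda>z. F (fst z) (snd z))"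
proof (rule psmooth_local_cover[OF fat_UNIV])
  fix z assume z: "z \<in> topspace X \<times> S"
  obtain A B where AB: "openin X A" "fst z \<in> A" "openin (mtop (vector_manifold :: ('a, 'a) manifold)) B" "snd z \<in> B" "B \<subseteq> UNIV"
    and ps: "psmooth UNIV X (A \<times> (\<lambda>x. x) ` B) (\<lambda>z. F (fst z) (inv_into UNIV (\<lambda>x. x) (snd z)))"
    by (rule sm_at_vectorE[OF atlas_vector findim_euclidean findim_euclidean F[of "fst z" "snd z"] vector_chart UNIV_I])
      (use z in auto)
  have inv: "inv_into UNIV (\<lambda>x::'a. x) y = y" for y by (rule inv_f_eq) auto
  have W: "pdom UNIV X (A \<times> (B \<inter> S))"
    using AB S by (intro pdom_box fat_UNIV) (auto simp: charts_vector)
  have "psmooth UNIV X (A \<times> (B \<inter> S)) (\<lambda>z. F (fst z) (snd z))"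
    by (rule psmooth_cong[OF psmooth_subset[OF ps W]]) (auto simp: inv)
  then show "\<exists>W'. z \<in> W' \<and> W' \<subseteq> topspace X \<times> S \<and> psmooth UNIV X W' (\<lambda>z. F (fst z) (snd z))"
    using AB z openin_subset[OF AB(1)] by (intro exI[of _ "A \<times> (B \<inter> S)"]) (auto simp: mem_Times_iff)
qed

locale homogeneous_bundle = smooth_bundle V tv
  for V :: "('e, 'k::euclidean_space, 'b, 'm::{real_normed_vector, heine_borel}) vbundle"
    and tv :: "'v::euclidean_space itself" +
  fixes f :: "'e \<Rightarrow> real"
  assumes f_smooth: "smooth_map E vector_manifold f" and hom: "homogeneous 2 V f" and def: "definite V f"
    and B_ne: "pts B \<noteq> {}"
begin

lemma sm_at_f: "p \<in> topspace X \<Longrightarrow> x \<in> pts E \<Longrightarrow> sm_at UNIV X E vector_manifold (\<lambda>_. f) p x"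
  using smooth_map_psmap[OF atlas_E atlas_vector f_smooth, where X = X] by (auto simp: psmap_def)

lemma f_scale_nonneg: "a \<ge> 0 \<Longrightarrow> x \<in> pts E \<Longrightarrow> f (s a x) = a\<^sup>2 * f x"
  using hom by (auto simp: homogeneous_def)

lemma f_zero: "x \<in> zero_section V \<Longrightarrow> f x = 0"
  using f_scale_nonneg[of 0 x] zero_section_iff by auto

lemma f_pos_iff: "x \<in> pts E \<Longrightarrow> f x > 0 \<longleftrightarrow> x \<notin> zero_section V"
  using f_zero def by (fastforce simp: definite_def)

lemma f_nonneg: "x \<in> pts E \<Longrightarrow> f x \<ge> 0"
  using f_pos_iff f_zero by (metis less_eq_real_def)

lemma sm_at_curve:
  assumes "x \<in> pts E" "p \<in> topspace X"
  shows "sm_at UNIV X vector_manifold E (\<lambda>_ u. s u x) p u"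
  by (rule sm_at_scale[OF atlas_vector findim_euclidean sm_at_const[OF atlas_vector atlas_E] sm_at_ident[OF atlas_vector]])
    (use assms in \<open>simp_all add: charts_vector\<close>)

text \<open>A smooth function that is positively 2-homogeneous on a line is quadratic: its second derivative
  at the origin is the common value of the two one-sided ones.\<close>

lemma f_scale:
  assumes x: "x \<in> pts E"
  shows "f (s a x) = a\<^sup>2 * f x"
proof -
  define q where "q = (\<lambda>z :: unit \<times> real. f (s (snd z) x))"
  have "psmooth UNIV (euclidean :: unit topology) (topspace euclidean \<times> UNIV) (\<lambda>z. (\<lambda>_ u. f (s u x)) (fst z) (snd z))"
  proof (rule psmooth_of_sm_at[OF open_UNIV])
    fix p :: unit and u :: real
    show "sm_at UNIV euclidean vector_manifold vector_manifold (\<lambda>_ u. f (s u x)) p u"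
      by (rule sm_at_compose[OF atlas_vector atlas_E findim_euclidean findim_euclidean sm_at_curve[OF x] sm_at_f])
        (use x s_pts in auto)
  qed
  then have q: "psmooth UNIV (euclidean :: unit topology) (topspace euclidean \<times> UNIV) q"
    by (simp add: q_def)
  obtain q1 where q1: "\<And>p u. ((\<lambda>y. q (p, y)) has_real_derivative q1 (p, u)) (at u)"
    and q1s: "psmooth UNIV (euclidean :: unit topology) (topspace euclidean \<times> UNIV) q1"
    using psmooth_realE[OF q] by (metis UNIV_I mem_Sigma_iff topspace_euclidean)
  obtain q2 where q2: "\<And>p u. ((\<lambda>y. q1 (p, y)) has_real_derivative q2 (p, u)) (at u)"
    using psmooth_realE[OF q1s] by (metis UNIV_I mem_Sigma_iff topspace_euclidean)
  \<comment> \<open>Positive homogeneity describes the two half-lines separately; this is the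
    coefficient of the square on the negative one.\<close>
  define c where "c = f (s (- 1) x)"
  have qp: "q ((), u) = u\<^sup>2 * f x" if "u \<ge> 0" for u
    using f_scale_nonneg[OF that x] by (simp add: q_def)
  have qn: "q ((), u) = u\<^sup>2 * c" if "u \<le> 0" for u
    using f_scale_nonneg[of "- u" "s (- 1) x"] that s_s[OF x, of "- u" "- 1"] s_pts[OF x]
    by (simp add: q_def c_def)
  have q1p: "q1 ((), u) = 2 * u * f x" if "u > 0" for u
  proof (rule DERIV_unique[OF q1])
    have "((\<lambda>u. u\<^sup>2 * f x) has_real_derivative 2 * u * f x) (at u)"
      by (auto intro!: derivative_eq_intros)
    then show "((\<lambda>y. q ((), y)) has_real_derivative 2 * u * f x) (at u)"
      by (rule has_field_derivative_transform_within_open[where S = "{0<..}"]) (use that qp in auto)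
  qed
  have q1n: "q1 ((), u) = 2 * u * c" if "u < 0" for u
  proof (rule DERIV_unique[OF q1])
    have "((\<lambda>u. u\<^sup>2 * c) has_real_derivative 2 * u * c) (at u)"
      by (auto intro!: derivative_eq_intros)
    then show "((\<lambda>y. q ((), y)) has_real_derivative 2 * u * c) (at u)"
      by (rule has_field_derivative_transform_within_open[where S = "{..<0}"]) (use that qn in auto)
  qed
  have "((\<lambda>u. (q1 ((), u) - q1 ((), 0)) / (u - 0)) \<longlongrightarrow> q2 ((), 0)) (at 0)"
    using q2[of "()" 0] by (simp add: has_field_derivative_iff)
  \<comment> \<open>The first derivative at the origin is the limit of its values from the right,
    where it is linear.\<close>
  moreover have q10: "q1 ((), 0) = 0"
  proof -
    have cq: "isCont (\<lambda>u. q1 ((), u)) 0" by (rule DERIV_isCont[OF q2])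
    have "((\<lambda>u. q1 ((), u)) \<longlongrightarrow> q1 ((), 0)) (at_right 0)"
      using cq by (auto simp: isCont_def intro: filterlim_mono at_le)
    moreover have "((\<lambda>u. q1 ((), u)) \<longlongrightarrow> 2 * 0 * f x) (at_right 0)"
    proof (rule Lim_transform_eventually)
      show "((\<lambda>u. 2 * u * f x) \<longlongrightarrow> 2 * 0 * f x) (at_right 0)" by (intro tendsto_intros)
      show "\<forall>\<^sub>F u in at_right 0. 2 * u * f x = q1 ((), u)"
        using q1p by (auto simp: eventually_at_filter)
    qed
    ultimately show ?thesis
      using tendsto_unique[where F = "at_right (0::real)"] by fastforce
  qed
  ultimately have lim: "((\<lambda>u. q1 ((), u) / u) \<longlongrightarrow> q2 ((), 0)) (at 0)" by simp
  \<comment> \<open>The second derivative at the origin is compared with the difference quotients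
    from the right and from the left, which are constant; so both coefficients agree.\<close>
  have "((\<lambda>u. q1 ((), u) / u) \<longlongrightarrow> 2 * f x) (at_right 0)"
    by (rule Lim_transform_eventually[OF tendsto_const]) (use q1p in \<open>auto simp: eventually_at_filter\<close>)
  then have "q2 ((), 0) = 2 * f x"
    using tendsto_unique[where F = "at_right (0::real)"] filterlim_mono[OF lim order_refl at_le[where s = "{0<..}" and t = UNIV]] by fastforce
  moreover have "((\<lambda>u. q1 ((), u) / u) \<longlongrightarrow> 2 * c) (at_left 0)"
    by (rule Lim_transform_eventually[OF tendsto_const]) (use q1n in \<open>auto simp: eventually_at_filter\<close>)
  then have "q2 ((), 0) = 2 * c"
    using tendsto_unique[where F = "at_left (0::real)"] filterlim_mono[OF lim order_refl at_le[where s = "{..<0}" and t = UNIV]] by fastforce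
  ultimately have "c = f x" by simp
  then show ?thesis
    using qp[of a] qn[of a] by (cases "a \<ge> 0") (auto simp: q_def)
qed

definition "U = open_tube V f"

lemma tube_set: "pts E \<inter> {x. 0 \<le> f x \<and> f x < 1} = {x \<in> pts E. f x < 1}"
  using f_nonneg by auto

lemma pts_U: "pts U = {x \<in> pts E. f x < 1}"
  using tube_set by (simp add: U_def open_tube_def submanifold_open_simps)

lemma tube_open: "openin (mtop E) (pts E \<inter> {x. 0 \<le> f x \<and> f x < 1})"
proof -
  have "continuous_map (mtop E) euclidean f"
    using f_smooth by (simp add: smooth_map_def charts_vector)
  from openin_continuous_map_preimage[OF this, of "{..<1}"]
  show ?thesis unfolding tube_set by simp
qed

lemma atlas_U: "atlas UNIV U"
  unfolding U_def open_tube_def by (rule atlas_submanifold[OF atlas_E tube_open])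

lemma sm_at_U:
  assumes "p \<in> topspace X" "x \<in> pts U"
  shows "sm_at UNIV X U E (\<lambda>_ x. x) p x" "sm_at UNIV X E U (\<lambda>_ x. x) p x"
proof -
  have "x \<in> pts E \<inter> {x. 0 \<le> f x \<and> f x < 1}" using assms(2) unfolding pts_U tube_set .
  then show "sm_at UNIV X U E (\<lambda>_ x. x) p x" "sm_at UNIV X E U (\<lambda>_ x. x) p x"
    unfolding U_def open_tube_def using sm_at_sub[OF atlas_E tube_open assms(1)] by auto
qed

lemma sm_at_into_U:
  fixes M :: "('p, 'n::real_normed_vector) manifold"
  assumes "atlas Q M" "findim TYPE('n)" "sm_at Q X M E \<Phi> p x" "\<Phi> p x \<in> pts U" "p \<in> topspace X"
  shows "sm_at Q X M U \<Phi> p x"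
  using sm_at_compose[OF assms(1) atlas_E assms(2) findim_euclidean assms(3), of U "\<lambda>_ x. x"] sm_at_U(2)[OF assms(5,4)] by simp

lemma sm_at_from_U:
  assumes "sm_at UNIV X E N \<Phi> p x" "x \<in> pts U" "p \<in> topspace X"
  shows "sm_at UNIV X U N \<Phi> p x"
  using sm_at_compose[OF atlas_U atlas_E findim_euclidean findim_euclidean sm_at_U(1)[OF assms(3,2)], of N \<Phi>] assms(1) by simp

lemma level_one_exists: obtains x where "x \<in> pts E" "f x = 1"
proof -
  obtain x where x: "x \<in> pts E" "x \<notin> zero_section V" using nonzero_exists[OF B_ne] by metis
  then have "f x > 0" using f_pos_iff by simp
  then have "f (s (1 / sqrt (f x)) x) = 1" using f_scale[OF x(1)] by (simp add: power_divide)
  then show thesis using that s_pts[OF x(1)] by metis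
qed

text \<open>On the line through a point of level one the coordinate u has the value u^2 of f, so
  \<open>\<Psi>\<close> along this line equals \<open>\<phi>\<close> of u^2, a smooth even function
  of u. The embedding \<open>e\<close> is left abstract so that both ends of the glued manifold are
  instances.\<close>

lemma psm_leaf_coordinate:
  fixes L :: "('q, 'k) manifold" and \<phi> :: "'x \<times> real \<Rightarrow> real"
  assumes L: "atlas UNIV L" and e: "\<And>p x. p \<in> topspace X \<Longrightarrow> x \<in> pts U \<Longrightarrow> sm_at UNIV X U L (\<lambda>_. e) p x"
    and \<Psi>: "\<And>p z. p \<in> topspace X \<Longrightarrow> z \<in> pts L \<Longrightarrow> sm_at UNIV X L vector_manifold \<Psi> p z"
    and \<phi>: "\<And>p x. p \<in> topspace X \<Longrightarrow> x \<in> pts U \<Longrightarrow> \<Psi> p (e x) = \<phi> (p, f x)"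
  shows "psmooth {0..1} X (topspace X \<times> {0..<1}) \<phi>"
proof -
  obtain x where x: "x \<in> pts E" "f x = 1" by (rule level_one_exists)
  let ?J = "{-1<..<1::real}"
  define F where "F = (\<lambda>z. \<Psi> (fst z) (e (s (snd z) x)))"
  have sU: "s u x \<in> pts U" if "u \<in> ?J" for u
  proof -
    have "\<bar>u\<bar> < 1" using that by auto
    then have "u\<^sup>2 < 1" by (simp add: abs_square_less_1)
    then show ?thesis using f_scale[OF x(1)] s_pts[OF x(1)] x by (simp add: pts_U)
  qed
  have "psmooth UNIV X (topspace X \<times> ?J) (\<lambda>z. (\<lambda>p u. \<Psi> p (e (s u x))) (fst z) (snd z))"
  proof (rule psmooth_of_sm_at)
    fix p and u :: real assume pu: "p \<in> topspace X" "u \<in> ?J"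
    have "sm_at UNIV X vector_manifold U (\<lambda>_ u. s u x) p u"
      by (rule sm_at_into_U[OF atlas_vector findim_euclidean sm_at_curve[OF x(1) pu(1)] sU[OF pu(2)] pu(1)])
    from sm_at_compose[OF atlas_vector atlas_U findim_euclidean findim_euclidean this e[OF pu(1) sU[OF pu(2)]]]
    have "sm_at UNIV X vector_manifold L (\<lambda>_ u. e (s u x)) p u" .
    from sm_at_compose[OF atlas_vector L findim_euclidean findim_euclidean this \<Psi>[OF pu(1) sm_at_pts[OF L this]]]
    show "sm_at UNIV X vector_manifold vector_manifold (\<lambda>p u. \<Psi> p (e (s u x))) p u" .
  qed simp
  then have F: "psmooth UNIV X (topspace X \<times> ?J) F"
    by (simp add: F_def)
  have F\<phi>: "F (p, u) = \<phi> (p, u\<^sup>2)" if "p \<in> topspace X" "u \<in> ?J" for p u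
    using \<phi>[OF that(1) sU[OF that(2)]] f_scale[OF x(1)] x(2) by (simp add: F_def)
  have W: "pdom {0..1} X (topspace X \<times> {0..<1::real})"
  proof (intro pdom_box fat_unit_interval openin_topspace)
    show "openin (top_of_set {0..1}) {0..<1::real}"
      unfolding openin_open by (rule exI[of _ "{-1<..<1}"]) auto
  qed
  have "psm {0..1} X (topspace X \<times> {0..<1}) n \<phi>" for n
  proof (rule psm_cong[OF W even_imp_smooth_in_square[OF F]])
    show "F (p, - u) = F (p, u)" if "p \<in> topspace X" "u \<in> ?J" for p u
      using F\<phi>[OF that] F\<phi>[of p "- u"] that by simp
    fix z assume z: "z \<in> topspace X \<times> {0..<1::real}"
    then have "sqrt (snd z) < 1" "sqrt (snd z) \<ge> 0" by auto
    moreover from this have "-1 < sqrt (snd z)" by linarith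
    ultimately have "sqrt (snd z) \<in> ?J" by (simp only: greaterThanLessThan_iff)
    then show "F (fst z, sqrt (snd z)) = \<phi> z"
      using F\<phi>[of "fst z" "sqrt (snd z)"] z by auto
  qed
  then show ?thesis using W by (simp add: psmooth_def)
qed

text \<open>Scaling by the root of \<open>g\<close> multiplies f by \<open>g\<close>; thus
  \<open>lt\<close> says that the scaled point remains in the tube. Positivity of \<open>g\<close>
  keeps the root smooth, also on the zero section.\<close>

lemma sm_at_radial:
  fixes g :: "'x \<times> real \<Rightarrow> real"
  assumes g: "psmooth {0..1} X (topspace X \<times> {0..1}) g" and pos: "\<And>z. z \<in> topspace X \<times> {0..1} \<Longrightarrow> g z > 0"
    and p: "p \<in> topspace X" and x: "x \<in> pts U" and lt: "f x * g (p, f x) < 1"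
  shows "sm_at UNIV X U U (\<lambda>p x. s (sqrt (g (p, f x))) x) p x"
proof -
  have xE: "x \<in> pts E" using x by (simp add: pts_U)
  have f01: "f y \<in> {0..1}" if "y \<in> pts U" for y using that f_nonneg by (auto simp: pts_U)
  have fU: "sm_at UNIV X U vector_manifold (\<lambda>_. f) p x"
    by (rule sm_at_from_U[OF sm_at_f[OF p xE] x p])
  have gU: "sm_at UNIV X U vector_manifold (\<lambda>p x. g (p, f x)) p x"
    by (rule sm_at_scalar_compose[OF atlas_U findim_euclidean fU g openin_topspace p openin_topspace x])
      (use f01 in auto)
  have "sm_at UNIV X U vector_manifold (\<lambda>p x. sqrt (g (p, f x))) p x"
    by (rule sm_at_sqrt[OF atlas_U findim_euclidean gU pos]) (use p f01[OF x] in auto)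
  from sm_at_scale[OF atlas_U findim_euclidean sm_at_U(1)[OF p x] this]
  have "sm_at UNIV X U E (\<lambda>p x. s (sqrt (g (p, f x))) x) p x" .
  moreover have "s (sqrt (g (p, f x))) x \<in> pts U"
    using f_scale[OF xE] s_pts[OF xE] lt pos[of "(p, f x)"] p f01[OF x] by (simp add: pts_U mult.commute)
  ultimately show ?thesis
    by (rule sm_at_into_U[OF atlas_U findim_euclidean _ _ p])
qed

end

section \<open>The glued manifold\<close>

text \<open>Only one direction of the level diffeomorphism is recorded, so that the locale can be
  instantiated for \<open>\<psi>\<close> and again, with the bundles exchanged, for its
  inverse.\<close>

locale level_map = F0: homogeneous_bundle V0 tv0 f0 + F1: homogeneous_bundle V1 tv1 f1
  for V0 :: "('e0, 'k::euclidean_space, 'b0, 'm0::{real_normed_vector, heine_borel}) vbundle"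
    and tv0 :: "'v0::euclidean_space itself" and f0
    and V1 :: "('e1, 'k, 'b1, 'm1::{real_normed_vector, heine_borel}) vbundle"
    and tv1 :: "'v1::euclidean_space itself" and f1 +
  fixes \<psi> :: "'e0 \<Rightarrow> 'e1"
  assumes \<psi>: "smooth_map_subset (total V0) (level_one V0 f0) (total V1) (level_one V1 f1) \<psi>"
begin

abbreviation "\<xi> \<equiv> xi_map V0 f0 V1 \<psi>"
abbreviation "D \<equiv> pts F0.U - zero_section V0"

lemma D_iff: "x \<in> D \<longleftrightarrow> x \<in> pts F0.E \<and> 0 < f0 x \<and> f0 x < 1"
  using F0.f_pos_iff by (auto simp: F0.pts_U)

lemma normalize: assumes "x \<in> pts F0.E" "f0 x > 0" shows "F0.s (1 / sqrt (f0 x)) x \<in> level_one V0 f0"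
  using F0.f_scale[OF assms(1)] F0.s_pts[OF assms(1)] assms(2) by (simp add: level_one_def power_divide)

lemma \<psi>_level: "y \<in> level_one V0 f0 \<Longrightarrow> \<psi> y \<in> pts F1.E \<and> f1 (\<psi> y) = 1"
  using \<psi> by (auto simp: smooth_map_subset_def level_one_def)

lemma \<xi>_D: assumes "x \<in> D" shows "\<xi> x \<in> pts F1.E" "f1 (\<xi> x) = 1 - f0 x" "\<xi> x \<in> pts F1.U - zero_section V1"
proof -
  have x: "x \<in> pts F0.E" "0 < f0 x" "f0 x < 1" using assms D_iff by auto
  let ?y = "\<psi> (F0.s (1 / sqrt (f0 x)) x)"
  have y: "?y \<in> pts F1.E" "f1 ?y = 1" using \<psi>_level[OF normalize[OF x(1,2)]] by auto
  show 1: "\<xi> x \<in> pts F1.E" "f1 (\<xi> x) = 1 - f0 x"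
    unfolding xi_map_def using F1.s_pts[OF y(1)] F1.f_scale[OF y(1)] y x by auto
  show "\<xi> x \<in> pts F1.U - zero_section V1"
    using 1 x F1.f_zero[of "\<xi> x"] by (auto simp: F1.pts_U)
qed

text \<open>\<open>\<psi>\<close> is defined on a level set only and is smooth through local
  extensions. Since points are first normalized onto that level, an extension \<open>g\<close> can
  replace \<open>\<psi>\<close> near a given point, and then all factors are smooth on an open
  set.\<close>

lemma sm_at_\<xi>:
  assumes x: "x \<in> D" and p: "p \<in> topspace X"
  shows "sm_at UNIV X F0.E F1.E (\<lambda>_. \<xi>) p x"
proof -
  have x': "x \<in> pts F0.E" "0 < f0 x" "f0 x < 1" using x D_iff by auto
  let ?n = "\<lambda>x. F0.s (1 / sqrt (f0 x)) x"
  note fd = findim_euclidean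
  have f: "sm_at UNIV X F0.E vector_manifold (\<lambda>_. f0) p x" by (rule F0.sm_at_f[OF p x'(1)])
  have "sm_at UNIV X F0.E vector_manifold (\<lambda>_ x. inverse (sqrt (f0 x))) p x"
    by (rule sm_at_inverse[OF F0.atlas_E fd sm_at_sqrt[OF F0.atlas_E fd f]]) (use x' in auto)
  then have "sm_at UNIV X F0.E vector_manifold (\<lambda>_ x. 1 / sqrt (f0 x)) p x"
    by (simp add: inverse_eq_divide)
  from F0.sm_at_scale[OF F0.atlas_E fd sm_at_ident[OF F0.atlas_E p x'(1)] this]
  have n: "sm_at UNIV X F0.E F0.E (\<lambda>_. ?n) p x" .
  have nl: "?n x \<in> level_one V0 f0" by (rule normalize[OF x'(1,2)])
  then obtain W g where W: "openin (mtop F0.E) W" "?n x \<in> W" and g: "smooth_map (submanifold_open F0.E W) F1.E g"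
    and g\<psi>: "\<And>y. y \<in> W \<inter> level_one V0 f0 \<Longrightarrow> g y = \<psi> y"
    using \<psi> unfolding smooth_map_subset_def by blast
  have W': "openin (mtop F0.E) (pts F0.E \<inter> W)" using W(1) by blast
  have nW: "?n x \<in> pts F0.E \<inter> W" using W(2) F0.s_pts[OF x'(1)] by auto
  note aW = atlas_submanifold[OF F0.atlas_E W']
  have "sm_at UNIV X F0.E (submanifold_open F0.E W) (\<lambda>_. ?n) p x"
    using sm_at_compose[OF F0.atlas_E F0.atlas_E fd fd n sm_at_sub(2)[OF F0.atlas_E W' p nW]] by simp
  moreover have "sm_at UNIV X (submanifold_open F0.E W) F1.E (\<lambda>_. g) p (?n x)"
    using smooth_map_psmap[OF aW F1.atlas_E g, where X = X] p nW by (auto simp: psmap_def submanifold_open_simps)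
  ultimately have gn: "sm_at UNIV X F0.E F1.E (\<lambda>_ x. g (?n x)) p x"
    by (rule sm_at_compose[OF F0.atlas_E aW fd fd])
  have "sm_at UNIV X F0.E vector_manifold (\<lambda>_ x. sqrt (1 - f0 x)) p x"
    by (rule sm_at_sqrt[OF F0.atlas_E fd sm_at_one_minus[OF F0.atlas_E fd f]]) (use x' in auto)
  from F1.sm_at_scale[OF F0.atlas_E fd gn this]
  have G: "sm_at UNIV X F0.E F1.E (\<lambda>_ x. F1.s (sqrt (1 - f0 x)) (g (?n x))) p x" .
  obtain A B where AB: "openin X A" "p \<in> A" "openin (mtop F0.E) B" "x \<in> B" "\<forall>p\<in>A. \<forall>x\<in>B. ?n x \<in> W"
    by (rule sm_at_cont[OF F0.atlas_E F0.atlas_E n W])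
  have "openin (mtop vector_manifold) {0::real<..}" by (simp add: charts_vector)
  then obtain A' B' where AB': "openin X A'" "p \<in> A'" "openin (mtop F0.E) B'" "x \<in> B'" "\<forall>p\<in>A'. \<forall>x\<in>B'. f0 x \<in> {0<..}"
    using sm_at_cont[OF F0.atlas_E atlas_vector f, of "{0<..}"] x'(2) by auto
  show ?thesis
  proof (rule sm_at_cong[OF F0.atlas_E G, of "A \<inter> A'" "B \<inter> B'"])
    fix q y assume q: "q \<in> A \<inter> A'" and y: "y \<in> B \<inter> B'"
    then have "y \<in> pts F0.E" "f0 y > 0" "?n y \<in> W" using AB AB' openin_subset[OF AB(3)] by auto
    then have "g (?n y) = \<psi> (?n y)" using g\<psi> normalize by blast
    then show "F1.s (sqrt (1 - f0 y)) (g (?n y)) = \<xi> y" by (simp add: xi_map_def)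
  qed (use AB AB' in auto)
qed

lemma D_open: "openin (mtop F0.U) D"
proof -
  have "continuous_map (mtop F0.E) euclidean f0"
    using F0.f_smooth by (simp add: smooth_map_def charts_vector)
  from openin_continuous_map_preimage[OF this, of "{0<..}"]
  have "openin (mtop F0.E) {x \<in> pts F0.E. f0 x \<in> {0<..}}" by simp
  from openin_subtopology_Int[OF this, of "{x. 0 \<le> f0 x \<and> f0 x < 1}"]
  have "openin (mtop F0.U) ({x \<in> pts F0.E. f0 x \<in> {0<..}} \<inter> {x. 0 \<le> f0 x \<and> f0 x < 1})"
    by (simp add: F0.U_def open_tube_def submanifold_open_simps)
  moreover have "{x \<in> pts F0.E. f0 x \<in> {0<..}} \<inter> {x. 0 \<le> f0 x \<and> f0 x < 1} = D"
    by (rule Set.set_eqI) (simp only: D_iff, auto)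
  ultimately show ?thesis by simp
qed

lemma \<xi>_smooth_map: "smooth_map (submanifold_open F0.U D) F1.U \<xi>"
proof -
  have o: "openin (mtop F0.U) (pts F0.U \<inter> D)" using D_open by blast
  note aD = atlas_submanifold[OF F0.atlas_U o]
  note fd = findim_euclidean
  have "psmap UNIV (euclidean :: unit topology) (submanifold_open F0.U D) F1.U (\<lambda>_. \<xi>)"
    unfolding psmap_def
  proof (intro ballI)
    fix p :: unit and x assume p: "p \<in> topspace euclidean" and "x \<in> pts (submanifold_open F0.U D)"
    then have x: "x \<in> D" by (auto simp: submanifold_open_simps)
    then have xU: "x \<in> pts F0.U" by simp
    have "sm_at UNIV euclidean F0.E F1.U (\<lambda>_. \<xi>) p x"
      by (rule F1.sm_at_into_U[OF F0.atlas_E fd sm_at_\<xi>[OF x p] _ p]) (use \<xi>_D[OF x] in auto)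
    then have "sm_at UNIV euclidean F0.U F1.U (\<lambda>_. \<xi>) p x"
      by (rule F0.sm_at_from_U[OF _ xU p])
    moreover have "sm_at UNIV euclidean (submanifold_open F0.U D) F0.U (\<lambda>_ x. x) p x"
      by (rule sm_at_sub(1)[OF F0.atlas_U o p]) (use x in auto)
    ultimately show "sm_at UNIV euclidean (submanifold_open F0.U D) F1.U (\<lambda>_. \<xi>) p x"
      using sm_at_compose[OF aD F0.atlas_U fd fd] by fastforce
  qed
  from psmap_smooth_map[OF aD F1.atlas_U fd fd this, of "()"] show ?thesis by simp
qed

end

locale glued_bundles = F0: homogeneous_bundle V0 tv0 f0 + F1: homogeneous_bundle V1 tv1 f1
  for V0 :: "('e0, 'k::euclidean_space, 'b0, 'm0::{real_normed_vector, heine_borel}) vbundle"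
    and tv0 :: "'v0::euclidean_space itself" and f0
    and V1 :: "('e1, 'k, 'b1, 'm1::{real_normed_vector, heine_borel}) vbundle"
    and tv1 :: "'v1::euclidean_space itself" and f1 +
  fixes \<psi> :: "'e0 \<Rightarrow> 'e1"
  assumes \<psi>: "diffeo_subset (total V0) (level_one V0 f0) (total V1) (level_one V1 f1) \<psi>"
begin

sublocale F01: level_map V0 tv0 f0 V1 tv1 f1 \<psi>
  by unfold_locales (use \<psi> in \<open>simp add: diffeo_subset_def\<close>)

sublocale F10: level_map V1 tv1 f1 V0 tv0 f0 "inv_into (level_one V0 f0) \<psi>"
  by unfold_locales (use \<psi> in \<open>simp add: diffeo_subset_def\<close>)

text \<open>The value of \<open>f1\<close> at \<open>F01.\<xi> x\<close> is \<open>1 - f0 x\<close>,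
  so normalizing this point undoes the outer scaling and recovers the value of
  \<open>\<psi>\<close>. After \<open>\<psi>\<close> is inverted, the remaining roots
  cancel.\<close>

lemma F10_F01:
  assumes x: "x \<in> F01.D"
  shows "F10.\<xi> (F01.\<xi> x) = x"
proof -
  have x': "x \<in> pts F0.E" "0 < f0 x" "f0 x < 1" using x F01.D_iff by auto
  let ?n = "F0.s (1 / sqrt (f0 x)) x"
  have n: "?n \<in> level_one V0 f0" by (rule F01.normalize[OF x'(1,2)])
  have y: "\<psi> ?n \<in> pts F1.E" using F01.\<psi>_level[OF n] by simp
  have "F1.s (1 / sqrt (1 - f0 x)) (F01.\<xi> x) = \<psi> ?n"
    unfolding xi_map_def using F1.s_s[OF y] F1.s_one[OF y] x' by simp
  then have "F10.\<xi> (F01.\<xi> x) = F0.s (sqrt (f0 x)) (inv_into (level_one V0 f0) \<psi> (\<psi> ?n))"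
    unfolding xi_map_def[of V1] using F01.\<xi>_D(2)[OF x] by simp
  also have "inv_into (level_one V0 f0) \<psi> (\<psi> ?n) = ?n"
    using \<psi> n by (intro inv_into_f_f) (auto simp: diffeo_subset_def bij_betw_def)
  finally show ?thesis
    using F0.s_s[OF x'(1)] F0.s_one[OF x'(1)] x' by simp
qed

lemma F01_F10:
  assumes y: "y \<in> F10.D"
  shows "F01.\<xi> (F10.\<xi> y) = y"
proof -
  have y': "y \<in> pts F1.E" "0 < f1 y" "f1 y < 1" using y F10.D_iff by auto
  let ?n = "F1.s (1 / sqrt (f1 y)) y" and ?i = "inv_into (level_one V0 f0) \<psi>"
  have n: "?n \<in> level_one V1 f1" by (rule F10.normalize[OF y'(1,2)])
  have x: "?i ?n \<in> pts F0.E" using F10.\<psi>_level[OF n] by simp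
  have "F0.s (1 / sqrt (1 - f1 y)) (F10.\<xi> y) = ?i ?n"
    unfolding xi_map_def using F0.s_s[OF x] F0.s_one[OF x] y' by simp
  then have "F01.\<xi> (F10.\<xi> y) = F1.s (sqrt (f1 y)) (\<psi> (?i ?n))"
    unfolding xi_map_def[of V0] using F10.\<xi>_D(2)[OF y] by simp
  also have "\<psi> (?i ?n) = ?n"
    using \<psi> n by (intro f_inv_into_f) (auto simp: diffeo_subset_def bij_betw_def)
  finally show ?thesis
    using F1.s_s[OF y'(1)] F1.s_one[OF y'(1)] y' by simp
qed

sublocale G: gluing UNIV F0.U F1.U F01.D F10.D F01.\<xi> F10.\<xi>
  by unfold_locales
    (use F0.atlas_U F1.atlas_U F01.D_open F10.D_open F01.\<xi>_smooth_map F10.\<xi>_smooth_map F10_F01 F01_F10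
      F01.\<xi>_D(3) F10.\<xi>_D(3) in auto)

abbreviation "L \<equiv> L_xi V0 f0 V1 f1 \<psi>"
abbreviation "e0 \<equiv> emb0 V0 f0 V1 f1 \<psi>"
abbreviation "e1 \<equiv> emb1 V0 f0 V1 f1 \<psi>"
abbreviation "f \<equiv> f_xi V0 f0 V1 f1 \<psi>"

lemma L_eq: "L = G.L" "e0 = G.inl" "e1 = G.inr"
  by (simp_all add: L_xi_def emb0_def emb1_def F0.U_def F1.U_def)

lemma atlas_L: "atlas UNIV L"
  unfolding L_eq by (rule G.atlas_L)

lemma emb: "chart_embedding F0.U L e0" "chart_embedding F1.U L e1"
  unfolding L_eq by (rule G.emb_inl, rule G.emb_inr)

lemma pts_L: "pts L = e0 ` pts F0.U \<union> e1 ` pts F1.U"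
  unfolding L_eq by (rule G.pts_L)

lemma e0_eq_e1: "x \<in> pts F0.U \<Longrightarrow> y \<in> pts F1.U \<Longrightarrow> e0 x = e1 y \<longleftrightarrow> x \<in> F01.D \<and> y = F01.\<xi> x"
  unfolding L_eq by (rule G.inl_eq_inr)

lemma e0_e1: "x \<in> F01.D \<Longrightarrow> e1 (F01.\<xi> x) = e0 x"
  using e0_eq_e1[of x "F01.\<xi> x"] F01.\<xi>_D(3)[of x] by auto

lemma inv_e0: "x \<in> pts F0.U \<Longrightarrow> inv_into (pts F0.U) e0 (e0 x) = x"
  by (rule emb_inv[OF F0.atlas_U emb(1)])

lemma inv_e1: "x \<in> pts F1.U \<Longrightarrow> inv_into (pts F1.U) e1 (e1 x) = x"
  by (rule emb_inv[OF F1.atlas_U emb(2)])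

text \<open>The two prescriptions agree on the overlap because
  \<open>f1 (F01.\<xi> x) = 1 - f0 x\<close>, and the two tubes cover the glued space; existence and
  uniqueness for the definite description follow.\<close>

lemma f_xi_spec:
  "f \<in> extensional (pts L) \<and> (\<forall>x\<in>pts (open_tube V0 f0). f (e0 x) = f0 x) \<and> (\<forall>y\<in>pts (open_tube V1 f1). f (e1 y) = 1 - f1 y)"
proof -
  let ?P = "\<lambda>f. f \<in> extensional (pts L) \<and> (\<forall>x\<in>pts (open_tube V0 f0). f (e0 x) = f0 x) \<and>
      (\<forall>y\<in>pts (open_tube V1 f1). f (e1 y) = 1 - f1 y)"
  define h where "h z = (if z \<in> e0 ` pts F0.U then f0 (inv_into (pts F0.U) e0 z)
      else if z \<in> pts L then 1 - f1 (inv_into (pts F1.U) e1 z) else undefined)" for z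
  have h0: "h (e0 x) = f0 x" if "x \<in> pts F0.U" for x
    using that inv_e0 by (simp add: h_def)
  have h1: "h (e1 y) = 1 - f1 y" if y: "y \<in> pts F1.U" for y
  proof (cases "e1 y \<in> e0 ` pts F0.U")
    case True
    then obtain x where x: "x \<in> pts F0.U" "e0 x = e1 y" by auto
    then have "x \<in> F01.D" "y = F01.\<xi> x" using e0_eq_e1 y by auto
    then show ?thesis using h0[OF x(1)] x(2) F01.\<xi>_D(2)[of x] by simp
  next
    case False
    then show ?thesis using inv_e1[OF y] y by (simp add: h_def pts_L)
  qed
  have "?P h"
    using h0 h1 by (auto simp: F0.U_def F1.U_def h_def extensional_def pts_L)
  moreover have "g = h" if "?P g" for g
  proof
    fix z
    show "g z = h z"
    proof (cases "z \<in> pts L")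
      case True
      then consider x where "x \<in> pts F0.U" "z = e0 x" | y where "y \<in> pts F1.U" "z = e1 y" using pts_L by auto
      then show ?thesis using that h0 h1 by cases (auto simp: F0.U_def F1.U_def)
    next
      case False
      then show ?thesis using that pts_L by (auto simp: extensional_def h_def)
    qed
  qed
  ultimately have "?P (THE f. ?P f)"
    by (rule theI)
  then show ?thesis unfolding f_xi_def .
qed

lemma f_e0: "x \<in> pts F0.U \<Longrightarrow> f (e0 x) = f0 x" and f_e1: "y \<in> pts F1.U \<Longrightarrow> f (e1 y) = 1 - f1 y"
  using f_xi_spec by (auto simp: F0.U_def F1.U_def)

lemma f_range: assumes "z \<in> pts L" shows "f z \<in> {0..1}"
proof -
  from assms consider x where "x \<in> pts F0.U" "z = e0 x" | y where "y \<in> pts F1.U" "z = e1 y" using pts_L by auto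
  then show ?thesis
    using f_e0 f_e1 F0.f_nonneg F1.f_nonneg by cases (auto simp: F0.pts_U F1.pts_U less_imp_le)
qed

lemma f_surj: assumes t: "t \<in> {0..1}" obtains z where "z \<in> pts L" "f z = t"
proof (cases "t < 1")
  case True
  obtain x where x: "x \<in> pts F0.E" "f0 x = 1" by (rule F0.level_one_exists)
  have "F0.s (sqrt t) x \<in> pts F0.U" "f0 (F0.s (sqrt t) x) = t"
    using F0.f_scale[OF x(1)] F0.s_pts[OF x(1)] x t True by (auto simp: F0.pts_U)
  then show thesis using that[of "e0 (F0.s (sqrt t) x)"] f_e0 pts_L by auto
next
  case False
  \<comment> \<open>The value 1 is taken on the zero section of the second bundle, a leaf that the
    first tube does not reach.\<close>
  then have t1: "t = 1" using t by simp
  obtain x where x: "x \<in> pts F1.E" "f1 x = 1" by (rule F1.level_one_exists)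
  have "F1.s 0 x \<in> pts F1.U" "f1 (F1.s 0 x) = 0"
    using F1.f_scale[OF x(1)] F1.s_pts[OF x(1)] x by (auto simp: F1.pts_U)
  then show thesis using that[of "e1 (F1.s 0 x)"] f_e1 pts_L t1 by auto
qed

lemma e0_open: "openin (mtop L) (e0 ` pts F0.U)" and e1_open: "openin (mtop L) (e1 ` pts F1.U)"
  using emb_open[OF F0.atlas_U emb(1) openin_topspace] emb_open[OF F1.atlas_U emb(2) openin_topspace] by auto

text \<open>The images of the tubes are open, so a family on the glued space may be tested after
  pulling it back to each tube.\<close>

lemma sm_at_L_cases:
  assumes z: "z \<in> pts L" and p: "p \<in> topspace X"
    and 0: "\<And>x. x \<in> pts F0.U \<Longrightarrow> sm_at UNIV X F0.U N (\<lambda>p x. \<Phi> p (e0 x)) p x"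
    and 1: "\<And>y. y \<in> pts F1.U \<Longrightarrow> sm_at UNIV X F1.U N (\<lambda>p x. \<Phi> p (e1 x)) p y"
  shows "sm_at UNIV X L N \<Phi> p z"
proof -
  from z consider x where "x \<in> pts F0.U" "z = e0 x" | y where "y \<in> pts F1.U" "z = e1 y" using pts_L by auto
  then show ?thesis
  proof cases
    case 1
    have i: "sm_at UNIV X L F0.U (\<lambda>_. inv_into (pts F0.U) e0) p (e0 x)"
      by (rule sm_at_emb(2)[OF F0.atlas_U emb(1) p 1(1)])
    have "sm_at UNIV X F0.U N (\<lambda>p x. \<Phi> p (e0 x)) p (inv_into (pts F0.U) e0 (e0 x))"
      using 0[OF 1(1)] inv_e0[OF 1(1)] by simp
    from sm_at_compose[OF atlas_L F0.atlas_U findim_euclidean findim_euclidean i this]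
    have "sm_at UNIV X L N (\<lambda>p z. \<Phi> p (e0 (inv_into (pts F0.U) e0 z))) p (e0 x)" .
    then show ?thesis
      unfolding 1(2)
      by (rule sm_at_cong[OF atlas_L _ openin_topspace p e0_open]) (use 1 in \<open>auto simp: f_inv_into_f\<close>)
  next
    case 2
    have i: "sm_at UNIV X L F1.U (\<lambda>_. inv_into (pts F1.U) e1) p (e1 y)"
      by (rule sm_at_emb(2)[OF F1.atlas_U emb(2) p 2(1)])
    have "sm_at UNIV X F1.U N (\<lambda>p x. \<Phi> p (e1 x)) p (inv_into (pts F1.U) e1 (e1 y))"
      using assms(4)[OF 2(1)] inv_e1[OF 2(1)] by simp
    from sm_at_compose[OF atlas_L F1.atlas_U findim_euclidean findim_euclidean i this]
    have "sm_at UNIV X L N (\<lambda>p z. \<Phi> p (e1 (inv_into (pts F1.U) e1 z))) p (e1 y)" .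
    then show ?thesis
      unfolding 2(2)
      by (rule sm_at_cong[OF atlas_L _ openin_topspace p e1_open]) (use 2 in \<open>auto simp: f_inv_into_f\<close>)
  qed
qed

lemma sm_at_f:
  assumes z: "z \<in> pts L" and p: "p \<in> topspace X"
  shows "sm_at UNIV X L vector_manifold (\<lambda>_. f) p z"
proof (rule sm_at_L_cases[OF z p])
  fix x assume x: "x \<in> pts F0.U"
  then have "x \<in> pts F0.E" by (simp add: F0.pts_U)
  from F0.sm_at_from_U[OF F0.sm_at_f[OF p this] x p]
  show "sm_at UNIV X F0.U vector_manifold (\<lambda>p x. f (e0 x)) p x"
    by (rule sm_at_cong[OF F0.atlas_U _ openin_topspace p openin_topspace x]) (simp add: f_e0)
next
  fix x assume x: "x \<in> pts F1.U"
  then have "x \<in> pts F1.E" by (simp add: F1.pts_U)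
  from sm_at_one_minus[OF F1.atlas_U findim_euclidean F1.sm_at_from_U[OF F1.sm_at_f[OF p this] x p]]
  show "sm_at UNIV X F1.U vector_manifold (\<lambda>p x. f (e1 x)) p x"
    by (rule sm_at_cong[OF F1.atlas_U _ openin_topspace p openin_topspace x]) (simp add: f_e1)
qed

text \<open>No regularity of \<open>\<phi>\<close> is presupposed; it is forced by the family above
  it. The first bundle covers the levels below 1, the second one those above 0.\<close>

lemma leaf_map_smooth:
  fixes \<phi> :: "'x \<times> real \<Rightarrow> real"
  assumes \<Phi>: "psmap UNIV X L L \<Phi>" and \<phi>: "\<And>p z. p \<in> topspace X \<Longrightarrow> z \<in> pts L \<Longrightarrow> f (\<Phi> p z) = \<phi> (p, f z)"
  shows "psmooth {0..1} X (topspace X \<times> {0..1}) \<phi>"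
proof (rule psmooth_local_cover[OF fat_unit_interval])
  have f\<Phi>: "sm_at UNIV X L vector_manifold (\<lambda>p z. f (\<Phi> p z)) p z" if p: "p \<in> topspace X" and z: "z \<in> pts L" for p z
  proof -
    have "sm_at UNIV X L L \<Phi> p z" using \<Phi> that by (auto simp: psmap_def)
    from sm_at_compose[OF atlas_L atlas_L findim_euclidean findim_euclidean this sm_at_f[OF sm_at_pts[OF atlas_L this] p]]
    show ?thesis .
  qed
  have 0: "psmooth {0..1} X (topspace X \<times> {0..<1}) \<phi>"
  proof (rule F0.psm_leaf_coordinate[OF atlas_L _ f\<Phi>])
    show "f (\<Phi> p (e0 x)) = \<phi> (p, f0 x)" if "p \<in> topspace X" "x \<in> pts F0.U" for p x
      using \<phi>[of p "e0 x"] that pts_L f_e0 by simp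
  qed (use sm_at_emb(1)[OF F0.atlas_U emb(1)] in auto)
  \<comment> \<open>In the second tube the level is \<open>1 - f1\<close>, so this end is read
    backwards.\<close>
  have 1: "psmooth {0..1} X (topspace X \<times> {0..<1}) (\<lambda>z. \<phi> (fst z, 1 - snd z))"
  proof (rule F1.psm_leaf_coordinate[OF atlas_L _ f\<Phi>])
    show "f (\<Phi> p (e1 y)) = \<phi> (fst (p, f1 y), 1 - snd (p, f1 y))" if "p \<in> topspace X" "y \<in> pts F1.U" for p y
      using \<phi>[of p "e1 y"] that pts_L f_e1 by simp
  qed (use sm_at_emb(1)[OF F1.atlas_U emb(2)] in auto)
  have "openin (top_of_set {0..1}) {0<..1::real}"
    unfolding openin_open by (rule exI[of _ "{0<..<2}"]) auto
  then have W: "pdom {0..1} X (topspace X \<times> {0<..1::real})"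
    by (intro pdom_box fat_unit_interval openin_topspace)
  have "psmooth {0..1} X (topspace X \<times> {0<..1}) (\<lambda>z. 1 - snd z :: real)"
    by (intro psmooth_intros W)
  from psmooth_compose[OF findim_euclidean this 1]
  have "psmooth {0..1} X (topspace X \<times> {0<..1}) (\<lambda>z. \<phi> (fst z, 1 - (1 - snd z)))"
    by auto
  then have 2: "psmooth {0..1} X (topspace X \<times> {0<..1}) \<phi>" by simp
  fix z assume "z \<in> topspace X \<times> {0..1::real}"
  then show "\<exists>W'. z \<in> W' \<and> W' \<subseteq> topspace X \<times> {0..1} \<and> psmooth {0..1} X W' \<phi>"
  proof (cases "snd z < 1")
    case True
    then show ?thesis
      using 0 \<open>z \<in> topspace X \<times> {0..1}\<close> by (intro exI[of _ "topspace X \<times> {0..<1}"]) auto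
  next
    case False
    then show ?thesis
      using 2 \<open>z \<in> topspace X \<times> {0..1}\<close> by (intro exI[of _ "topspace X \<times> {0<..1}"]) auto
  qed
qed

end

text \<open>Here \<open>\<phi>\<close> is a reparametrization of the interval, and \<open>g0\<close>, \<open>g1\<close> are its quotients at the two ends.\<close>

definition radial_factors :: "(real \<Rightarrow> real) \<Rightarrow> (real \<Rightarrow> real) \<Rightarrow> (real \<Rightarrow> real) \<Rightarrow> bool" where
  "radial_factors \<phi> g0 g1 \<longleftrightarrow>
     (\<forall>t\<in>{0..1}. g0 t > 0 \<and> g1 t > 0 \<and> \<phi> t = t * g0 t \<and> 1 - \<phi> (1 - t) = t * g1 t)"

lemma radial_factorsD:
  assumes "radial_factors \<phi> g0 g1" and t: "t \<in> {0..1}"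
  shows "g0 t > 0" "g1 t > 0" "\<phi> t = t * g0 t" "1 - \<phi> (1 - t) = t * g1 t" "1 - \<phi> t = (1 - t) * g1 (1 - t)"
    "t > 0 \<Longrightarrow> \<phi> t > 0" "t < 1 \<Longrightarrow> \<phi> t < 1" "\<phi> t \<in> {0..1}"
proof -
  have *: "g0 t > 0" "g1 t > 0" "\<phi> t = t * g0 t" "1 - \<phi> (1 - t) = t * g1 t" if "t \<in> {0..1}" for t
    using bspec[OF assms(1)[unfolded radial_factors_def] that] by blast+
  show "g0 t > 0" "g1 t > 0" "\<phi> t = t * g0 t" "1 - \<phi> (1 - t) = t * g1 t" using *[OF t] by auto
  show eq: "1 - \<phi> t = (1 - t) * g1 (1 - t)" using *(4)[of "1 - t"] t by simp
  have g: "g1 (1 - t) > 0" using *(2)[of "1 - t"] t by simp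
  show "t > 0 \<Longrightarrow> \<phi> t > 0" using *(1,3)[OF t] by simp
  show "t < 1 \<Longrightarrow> \<phi> t < 1" using eq g by (metis diff_gt_0_iff_gt mult_pos_pos)
  have "(1 - t) * g1 (1 - t) \<ge> 0" "t * g0 t \<ge> 0" using g t *(1)[OF t] by simp_all
  then show "\<phi> t \<in> {0..1}" using eq *(3)[OF t] by simp
qed

section \<open>Radial rescaling of the glued manifold\<close>

context glued_bundles
begin

text \<open>Points of both tubes are treated in the first one; \<open>radial_e1\<close> shows that
  the second description gives the same result there. The argument \<open>1 - f z\<close> is the
  value of \<open>f1\<close>.\<close>

definition radial :: "(real \<Rightarrow> real) \<Rightarrow> (real \<Rightarrow> real) \<Rightarrow> ('e0 + 'e1) set \<Rightarrow> ('e0 + 'e1) set" where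
  "radial g0 g1 z =
    (if z \<in> e0 ` pts F0.U then e0 (F0.s (sqrt (g0 (f z))) (inv_into (pts F0.U) e0 z))
     else if z \<in> pts L then e1 (F1.s (sqrt (g1 (1 - f z))) (inv_into (pts F1.U) e1 z)) else undefined)"

context
  fixes \<phi> g0 g1
  assumes rad: "radial_factors \<phi> g0 g1"
begin

lemma radial_U0:
  assumes x: "x \<in> pts F0.U"
  shows "F0.s (sqrt (g0 (f0 x))) x \<in> pts F0.U" "f0 (F0.s (sqrt (g0 (f0 x))) x) = \<phi> (f0 x)"
proof -
  have t: "f0 x \<in> {0..1}" "f0 x < 1" and xE: "x \<in> pts F0.E" using x F0.f_nonneg by (auto simp: F0.pts_U)
  show "f0 (F0.s (sqrt (g0 (f0 x))) x) = \<phi> (f0 x)"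
    using F0.f_scale[OF xE] radial_factorsD(1,3)[OF rad t(1)] by simp
  then show "F0.s (sqrt (g0 (f0 x))) x \<in> pts F0.U"
    using F0.s_pts[OF xE] radial_factorsD(7)[OF rad t] by (simp add: F0.pts_U)
qed

lemma radial_U1:
  assumes y: "y \<in> pts F1.U"
  shows "F1.s (sqrt (g1 (f1 y))) y \<in> pts F1.U" "f1 (F1.s (sqrt (g1 (f1 y))) y) = 1 - \<phi> (1 - f1 y)"
proof -
  have t: "f1 y \<in> {0..1}" "f1 y < 1" and yE: "y \<in> pts F1.E" using y F1.f_nonneg by (auto simp: F1.pts_U)
  have t': "1 - f1 y \<in> {0..1}" "1 - f1 y > 0" using t by auto
  show "f1 (F1.s (sqrt (g1 (f1 y))) y) = 1 - \<phi> (1 - f1 y)"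
    using F1.f_scale[OF yE] radial_factorsD(2,4)[OF rad t(1)] by simp
  then show "F1.s (sqrt (g1 (f1 y))) y \<in> pts F1.U"
    using F1.s_pts[OF yE] radial_factorsD(6)[OF rad t'] by (simp add: F1.pts_U)
qed

lemma radial_e0: "x \<in> pts F0.U \<Longrightarrow> radial g0 g1 (e0 x) = e0 (F0.s (sqrt (g0 (f0 x))) x)"
  using inv_e0 f_e0 by (simp add: radial_def)

text \<open>On the overlap the gluing map has to turn scaling by the root of \<open>g0\<close> into
  scaling by the root of \<open>g1\<close>. It does, because both factors come from one
  \<open>\<phi>\<close>: they multiply \<open>f0\<close> and \<open>1 - f0\<close> to
  \<open>\<phi>\<close> and \<open>1 - \<phi>\<close>, respectively.\<close>

lemma radial_e1:
  assumes y: "y \<in> pts F1.U"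
  shows "radial g0 g1 (e1 y) = e1 (F1.s (sqrt (g1 (f1 y))) y)"
proof (cases "e1 y \<in> e0 ` pts F0.U")
  case False
  then show ?thesis using inv_e1 f_e1 y pts_L by (simp add: radial_def)
next
  case True
  then obtain x where x: "x \<in> pts F0.U" "e0 x = e1 y" by auto
  then have xD: "x \<in> F01.D" and yx: "y = F01.\<xi> x" using e0_eq_e1 y by auto
  let ?t = "f0 x" and ?c0 = "sqrt (g0 (f0 x))" and ?c1 = "sqrt (g1 (1 - f0 x))"
  have t: "?t \<in> {0..1}" "0 < ?t" "?t < 1" and xE: "x \<in> pts F0.E" using xD F01.D_iff by auto
  have f1y: "f1 y = 1 - ?t" using F01.\<xi>_D(2)[OF xD] yx by simp
  let ?x = "F0.s ?c0 x"
  have fx: "f0 ?x = \<phi> ?t" and xU: "?x \<in> pts F0.U" using radial_U0[OF x(1)] by auto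
  have \<phi>t: "\<phi> ?t > 0" "\<phi> ?t < 1" using radial_factorsD(6,7)[OF rad t(1)] t by auto
  have xD': "?x \<in> F01.D" unfolding F01.D_iff using fx \<phi>t xU F0.pts_U by auto
  have g0: "g0 ?t > 0" "\<phi> ?t = ?t * g0 ?t" using radial_factorsD(1,3)[OF rad t(1)] by auto
  let ?n = "F0.s (1 / sqrt ?t) x"
  \<comment> \<open>Radial scaling does not change the normalized point, so \<open>\<psi>\<close>
    sees the same argument before and after.\<close>
  have "F0.s (1 / sqrt (\<phi> ?t)) ?x = F0.s (1 / sqrt (\<phi> ?t) * ?c0) x"
    by (rule F0.s_s[OF xE])
  also have "1 / sqrt (\<phi> ?t) * ?c0 = 1 / sqrt ?t"
    using g0 t(2) by (simp add: real_sqrt_mult)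
  finally have n: "F0.s (1 / sqrt (\<phi> ?t)) ?x = ?n" .
  have \<psi>n: "\<psi> ?n \<in> pts F1.E" using F01.\<psi>_level[OF F01.normalize[OF xE t(2)]] by simp
  have "F01.\<xi> ?x = F1.s (sqrt (1 - \<phi> ?t)) (\<psi> ?n)"
    unfolding xi_map_def fx n ..
  also have "sqrt (1 - \<phi> ?t) = ?c1 * sqrt (1 - ?t)"
    using radial_factorsD(5)[OF rad t(1)] by (simp add: real_sqrt_mult mult.commute)
  also have "F1.s (?c1 * sqrt (1 - ?t)) (\<psi> ?n) = F1.s ?c1 (F1.s (sqrt (1 - ?t)) (\<psi> ?n))"
    by (rule F1.s_s[OF \<psi>n, symmetric])
  also have "F1.s (sqrt (1 - ?t)) (\<psi> ?n) = y"
    unfolding yx xi_map_def ..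
  finally have "F01.\<xi> ?x = F1.s (sqrt (g1 (f1 y))) y" by (simp add: f1y)
  then have "e1 (F1.s (sqrt (g1 (f1 y))) y) = e0 ?x" using e0_e1[OF xD'] by simp
  then show ?thesis using radial_e0[OF x(1)] x(2) by simp
qed

lemma radial_pts: assumes z: "z \<in> pts L" shows "radial g0 g1 z \<in> pts L" "f (radial g0 g1 z) = \<phi> (f z)"
proof -
  from z consider x where "x \<in> pts F0.U" "z = e0 x" | y where "y \<in> pts F1.U" "z = e1 y" using pts_L by auto
  then have "radial g0 g1 z \<in> pts L \<and> f (radial g0 g1 z) = \<phi> (f z)"
  proof cases
    case 1
    then show ?thesis using radial_e0 radial_U0 f_e0 pts_L by simp
  next
    case 2
    then show ?thesis using radial_e1 radial_U1 f_e1 pts_L by simp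
  qed
  then show "radial g0 g1 z \<in> pts L" "f (radial g0 g1 z) = \<phi> (f z)" by auto
qed

end

lemma radial_extensional: "radial g0 g1 \<in> extensional (pts L)"
  using pts_L by (auto simp: extensional_def radial_def)

text \<open>This supplies uniqueness for the definite description behind
  \<open>theta\<close>.\<close>

lemma radial_unique:
  assumes rad: "radial_factors \<phi> g0 g1" and h: "h \<in> extensional (pts L)"
    and h0: "\<And>x. x \<in> pts F0.U \<Longrightarrow> h (e0 x) = e0 (F0.s (sqrt (g0 (f0 x))) x)"
    and h1: "\<And>y. y \<in> pts F1.U \<Longrightarrow> h (e1 y) = e1 (F1.s (sqrt (g1 (f1 y))) y)"
  shows "h = radial g0 g1"
proof (rule extensionalityI[OF h radial_extensional])
  fix z assume "z \<in> pts L"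
  then consider x where "x \<in> pts F0.U" "z = e0 x" | y where "y \<in> pts F1.U" "z = e1 y" using pts_L by auto
  then show "h z = radial g0 g1 z"
    using h0 h1 radial_e0[OF rad] radial_e1[OF rad] by cases auto
qed

text \<open>Away from level 0 of each tube, cancelling t in
  \<open>\<phi> (\<phi>' t) = \<omega> t\<close> shows that the factors multiply. At level 0 nothing
  can be cancelled, but there the points are zero vectors, which every scaling fixes.\<close>

lemma radial_compose:
  assumes a: "radial_factors \<phi> g0 g1" and b: "radial_factors \<phi>' h0 h1" and c: "radial_factors \<omega> k0 k1"
    and \<omega>: "\<And>t. t \<in> {0..1} \<Longrightarrow> \<phi> (\<phi>' t) = \<omega> t" and z: "z \<in> pts L"
  shows "radial g0 g1 (radial h0 h1 z) = radial k0 k1 z"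
proof -
  from z consider x where "x \<in> pts F0.U" "z = e0 x" | y where "y \<in> pts F1.U" "z = e1 y" using pts_L by auto
  then show ?thesis
  proof cases
    case 1
    have t: "f0 x \<in> {0..1}" and xE: "x \<in> pts F0.E" using 1 F0.f_nonneg by (auto simp: F0.pts_U less_imp_le)
    let ?t = "f0 x"
    have "F0.s (sqrt (g0 (\<phi>' ?t))) (F0.s (sqrt (h0 ?t)) x) = F0.s (sqrt (k0 ?t)) x"
    proof (cases "?t = 0")
      case True
      then have "F0.s 0 x = x" using F0.f_pos_iff[OF xE] F0.zero_section_iff by auto
      then have s: "F0.s c x = x" for c using F0.s_s[OF xE, of c 0] by simp
      show ?thesis by (simp add: s)
    next
      case False
      have "\<phi>' ?t * g0 (\<phi>' ?t) = ?t * k0 ?t"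
        using radial_factorsD(3)[OF a radial_factorsD(8)[OF b t]] radial_factorsD(3)[OF c t] \<omega>[OF t] by simp
      then have "g0 (\<phi>' ?t) * h0 ?t = k0 ?t"
        using radial_factorsD(3)[OF b t] False by (simp add: mult.commute)
      then show ?thesis using F0.s_s[OF xE] by (simp flip: real_sqrt_mult)
    qed
    then show ?thesis
      using radial_e0[OF a radial_U0(1)[OF b 1(1)]] radial_e0[OF b 1(1)] radial_e0[OF c 1(1)] radial_U0(2)[OF b 1(1)] 1(2) by simp
  next
    case 2
    have t: "f1 y \<in> {0..1}" "1 - f1 y \<in> {0..1}" and yE: "y \<in> pts F1.E" using 2 F1.f_nonneg by (auto simp: F1.pts_U less_imp_le)
    let ?t = "f1 y" and ?r = "1 - \<phi>' (1 - f1 y)"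
    have r: "?r \<in> {0..1}" using radial_factorsD(8)[OF b t(2)] by auto
    have "F1.s (sqrt (g1 ?r)) (F1.s (sqrt (h1 ?t)) y) = F1.s (sqrt (k1 ?t)) y"
    proof (cases "?t = 0")
      case True
      then have "F1.s 0 y = y" using F1.f_pos_iff[OF yE] F1.zero_section_iff by auto
      then have s: "F1.s c y = y" for c using F1.s_s[OF yE, of c 0] by simp
      show ?thesis by (simp add: s)
    next
      case False
      have "?r * g1 ?r = ?t * k1 ?t"
        using radial_factorsD(4)[OF a r] radial_factorsD(4)[OF c t(1)] \<omega>[OF t(2)] by simp
      then have "g1 ?r * h1 ?t = k1 ?t"
        using radial_factorsD(4)[OF b t(1)] False by (simp add: mult.commute)
      then show ?thesis using F1.s_s[OF yE] by (simp flip: real_sqrt_mult)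
    qed
    then show ?thesis
      using radial_e1[OF a radial_U1(1)[OF b 2(1)]] radial_e1[OF b 2(1)] radial_e1[OF c 2(1)] radial_U1(2)[OF b 2(1)] 2(2) by simp
  qed
qed

lemma radial_id:
  assumes z: "z \<in> pts L"
  shows "radial (\<lambda>_. 1) (\<lambda>_. 1) z = z"
proof -
  have r: "radial_factors (\<lambda>t. t) (\<lambda>_. 1) (\<lambda>_. 1)" by (simp add: radial_factors_def)
  from z consider x where "x \<in> pts F0.U" "z = e0 x" | y where "y \<in> pts F1.U" "z = e1 y" using pts_L by auto
  then show ?thesis
    using radial_e0[OF r] radial_e1[OF r] F0.s_one F1.s_one by cases (auto simp: F0.pts_U F1.pts_U)
qed

lemma psmap_radial:
  fixes G0 G1 :: "'x \<times> real \<Rightarrow> real"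
  assumes G: "psmooth {0..1} X (topspace X \<times> {0..1}) G0" "psmooth {0..1} X (topspace X \<times> {0..1}) G1"
    and rad: "\<And>p. p \<in> topspace X \<Longrightarrow> radial_factors (\<phi> p) (\<lambda>t. G0 (p, t)) (\<lambda>t. G1 (p, t))"
  shows "psmap UNIV X L L (\<lambda>p. radial (\<lambda>t. G0 (p, t)) (\<lambda>t. G1 (p, t)))"
  unfolding psmap_def
proof (intro ballI sm_at_L_cases; assumption?)
  fix p x assume p: "p \<in> topspace X" and x: "x \<in> pts F0.U"
  have t: "f0 x \<in> {0..1}" "f0 x < 1" using x F0.f_nonneg by (auto simp: F0.pts_U)
  have 1: "sm_at UNIV X F0.U F0.U (\<lambda>p x. F0.s (sqrt (G0 (p, f0 x))) x) p x"
  proof (rule F0.sm_at_radial[OF G(1) _ p x])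
    show "f0 x * G0 (p, f0 x) < 1" using radial_factorsD(3,7)[OF rad[OF p] t(1)] t(2) by simp
  qed (use radial_factorsD(1)[OF rad] in auto)
  have "sm_at UNIV X F0.U L (\<lambda>_. e0) p (F0.s (sqrt (G0 (p, f0 x))) x)"
    by (rule sm_at_emb(1)[OF F0.atlas_U emb(1) p sm_at_pts[OF F0.atlas_U 1]])
  from sm_at_compose[OF F0.atlas_U F0.atlas_U findim_euclidean findim_euclidean 1 this]
  show "sm_at UNIV X F0.U L (\<lambda>p x. radial (\<lambda>t. G0 (p, t)) (\<lambda>t. G1 (p, t)) (e0 x)) p x"
    by (rule sm_at_cong[OF F0.atlas_U _ openin_topspace p openin_topspace x]) (simp add: radial_e0[OF rad])
next
  fix p x assume p: "p \<in> topspace X" and x: "x \<in> pts F1.U"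
  have t: "f1 x \<in> {0..1}" "1 - f1 x \<in> {0..1}" "f1 x < 1" using x F1.f_nonneg by (auto simp: F1.pts_U)
  have 1: "sm_at UNIV X F1.U F1.U (\<lambda>p x. F1.s (sqrt (G1 (p, f1 x))) x) p x"
  proof (rule F1.sm_at_radial[OF G(2) _ p x])
    show "f1 x * G1 (p, f1 x) < 1" using radial_factorsD(4)[OF rad[OF p] t(1)] radial_factorsD(6)[OF rad[OF p] t(2)] t(3) by simp
  qed (use radial_factorsD(2)[OF rad] in auto)
  have "sm_at UNIV X F1.U L (\<lambda>_. e1) p (F1.s (sqrt (G1 (p, f1 x))) x)"
    by (rule sm_at_emb(1)[OF F1.atlas_U emb(2) p sm_at_pts[OF F1.atlas_U 1]])
  from sm_at_compose[OF F1.atlas_U F1.atlas_U findim_euclidean findim_euclidean 1 this]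
  show "sm_at UNIV X F1.U L (\<lambda>p x. radial (\<lambda>t. G0 (p, t)) (\<lambda>t. G1 (p, t)) (e1 x)) p x"
    by (rule sm_at_cong[OF F1.atlas_U _ openin_topspace p openin_topspace x]) (simp add: radial_e1[OF rad])
qed

end

section \<open>Diffeomorphism groups\<close>

lemma carrier_Diff:
  "h \<in> carrier (Diff M) \<longleftrightarrow> h \<in> extensional (pts M) \<and> bij_betw h (pts M) (pts M) \<and>
     smooth_map M M h \<and> smooth_map M M (inv_into (pts M) h)"
  by (auto simp: Diff_def Bij_def diffeo_def)

lemma smooth_map_cong:
  fixes M :: "('p, 'm::real_normed_vector) manifold" and N :: "('q, 'n::real_normed_vector) manifold"
  assumes M: "atlas Q M" and N: "atlas R N" and fd: "findim TYPE('m)" "findim TYPE('n)"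
    and f: "smooth_map M N f" and eq: "\<And>x. x \<in> pts M \<Longrightarrow> f x = g x"
  shows "smooth_map M N g"
proof -
  have "psmap Q (euclidean :: unit topology) M N (\<lambda>_. g)"
    by (rule psmap_cong[OF M smooth_map_psmap[OF M N f]]) (rule eq)
  from psmap_smooth_map[OF M N fd this, of "()"] show ?thesis by simp
qed

lemma smooth_map_compose:
  fixes M :: "('p, 'm::real_normed_vector) manifold" and N :: "('q, 'n::real_normed_vector) manifold"
    and P :: "('r, 'l::real_normed_vector) manifold"
  assumes M: "atlas Q M" and N: "atlas R N" and P: "atlas S P"
    and fd: "findim TYPE('m)" "findim TYPE('n)" "findim TYPE('l)" and f: "smooth_map M N f" and g: "smooth_map N P g"
  shows "smooth_map M P (\<lambda>x. g (f x))"
proof -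
  have "psmap Q (euclidean :: unit topology) M P (\<lambda>_ x. g (f x))"
    by (rule psmap_compose[OF M N fd(1,2) smooth_map_psmap[OF M N f] smooth_map_psmap[OF N P g]])
  from psmap_smooth_map[OF M P fd(1,3) this, of "()"] show ?thesis by simp
qed

text \<open>Topological groups carry an extra record field, so library facts on subgroups and
  products concern different records. Being a group depends only on the three fields compared
  here.\<close>

lemma group_cong:
  assumes "carrier G = carrier H" "mult G = mult H" "one G = one H"
  shows "group G \<longleftrightarrow> group H"
  unfolding group_def monoid_def group_axioms_def Units_def assms ..

lemma tsubgroup_simps [simp]:
  "carrier (tsubgroup G S) = S" "mult (tsubgroup G S) = mult G" "one (tsubgroup G S) = one G"
  "gtop (tsubgroup G S) = subtopology (gtop G) S"
  by (simp_all add: tsubgroup_def)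

lemma group_tsubgroup:
  assumes "group G" "subgroup S G"
  shows "group (tsubgroup G S)"
proof -
  have "group (G\<lparr>carrier := S\<rparr>)"
    using subgroup.subgroup_is_group[OF assms(2,1)] .
  then show ?thesis
    by (subst group_cong[of _ "G\<lparr>carrier := S\<rparr>"]) simp_all
qed

lemma tsubgroup_tsubgroup: "B \<subseteq> A \<Longrightarrow> tsubgroup (tsubgroup G A) B = tsubgroup G B"
  by (simp add: tsubgroup_def subtopology_subtopology inf_absorb2)

lemma tprod_simps [simp]:
  "carrier (tprod G H) = carrier G \<times> carrier H"
  "mult (tprod G H) = (\<lambda>(g, h) (g', h'). (mult G g g', mult H h h'))"
  "one (tprod G H) = (one G, one H)"
  "gtop (tprod G H) = prod_topology (gtop G) (gtop H)"
  by (simp_all add: tprod_def DirProd_def)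

lemma group_tprod:
  assumes "group G" "group H"
  shows "group (tprod G H)"
proof -
  have "group (G \<times>\<times> H)" using DirProd_group[OF assms] .
  then show ?thesis
    by (subst group_cong[of _ "G \<times>\<times> H"]) (simp_all add: tprod_def)
qed

text \<open>The whole space and the unit interval are both closed model sets, so the glued manifold
  and the interval share one treatment. Closedness provides the compact coordinate balls for the
  tautological family.\<close>

locale closed_atlas =
  fixes Q :: "'m::euclidean_space set" and M :: "('p, 'm) manifold"
  assumes M: "atlas Q M" and Q: "closed Q"
begin

lemma DiffI:
  assumes "h \<in> extensional (pts M)" and h: "smooth_map M M h" and k: "smooth_map M M k"
    and kh: "\<And>x. x \<in> pts M \<Longrightarrow> k (h x) = x" and hk: "\<And>x. x \<in> pts M \<Longrightarrow> h (k x) = x"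
  shows "h \<in> carrier (Diff M)"
proof -
  have hp: "h x \<in> pts M" and kp: "k x \<in> pts M" if "x \<in> pts M" for x
    using h k that by (auto simp: smooth_map_def continuous_map_def)
  have bij: "bij_betw h (pts M) (pts M)"
    by (rule bij_betw_byWitness[where f' = k]) (use kh hk hp kp in auto)
  have "inv_into (pts M) h x = k x" if "x \<in> pts M" for x
    using bij that kp hk by (intro inv_into_f_eq) (auto simp: bij_betw_def)
  then have "smooth_map M M (inv_into (pts M) h)"
    using smooth_map_cong[OF M M findim_euclidean findim_euclidean k] by simp
  then show ?thesis using assms bij by (simp add: carrier_Diff)
qed

lemma Diff_D:
  assumes "h \<in> carrier (Diff M)"
  shows "h \<in> extensional (pts M)" "smooth_map M M h" "smooth_map M M (inv_into (pts M) h)"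
    "\<And>x. x \<in> pts M \<Longrightarrow> h x \<in> pts M" "\<And>x. x \<in> pts M \<Longrightarrow> inv_into (pts M) h x \<in> pts M"
    "\<And>x. x \<in> pts M \<Longrightarrow> inv_into (pts M) h (h x) = x" "\<And>x. x \<in> pts M \<Longrightarrow> h (inv_into (pts M) h x) = x"
    "h \<in> smooth_maps M M" "h \<in> Bij (pts M)"
proof -
  have b: "bij_betw h (pts M) (pts M)" using assms by (simp add: carrier_Diff)
  show 1: "h \<in> extensional (pts M)" "smooth_map M M h" "smooth_map M M (inv_into (pts M) h)"
    using assms by (auto simp: carrier_Diff)
  show 2: "\<And>x. x \<in> pts M \<Longrightarrow> h x \<in> pts M" using b by (auto simp: bij_betw_def)
  show "\<And>x. x \<in> pts M \<Longrightarrow> inv_into (pts M) h x \<in> pts M" using b by (auto simp: bij_betw_def inv_into_into)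
  show "\<And>x. x \<in> pts M \<Longrightarrow> inv_into (pts M) h (h x) = x" using b by (auto simp: bij_betw_def)
  show "\<And>x. x \<in> pts M \<Longrightarrow> h (inv_into (pts M) h x) = x" using b by (auto simp: bij_betw_def f_inv_into_f)
  show "h \<in> smooth_maps M M" using 1 2 by (auto simp: smooth_maps_def PiE_def)
  show "h \<in> Bij (pts M)" using 1 b by (auto simp: Bij_def)
qed

lemma one_Diff: "one (Diff M) = (\<lambda>x\<in>pts M. x)"
  by (simp add: Diff_def BijGroup_def)

lemma mult_Diff: "g \<in> carrier (Diff M) \<Longrightarrow> h \<in> carrier (Diff M) \<Longrightarrow> mult (Diff M) g h = compose (pts M) g h"
proof -
  assume "g \<in> carrier (Diff M)" "h \<in> carrier (Diff M)"
  then have "g \<in> Bij (pts M) \<and> h \<in> Bij (pts M)" using Diff_D(9) by blast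
  then show ?thesis by (simp add: Diff_def BijGroup_def)
qed

lemma ident_smooth: "smooth_map M M (\<lambda>x. x)"
proof -
  have "psmap Q (euclidean :: unit topology) M M (\<lambda>_ x. x)"
    using sm_at_ident[OF M, where X = "euclidean :: unit topology"] by (auto simp: psmap_def)
  from psmap_smooth_map[OF M M findim_euclidean findim_euclidean this, of "()"] show ?thesis by simp
qed

lemma one_closed: "(\<lambda>x\<in>pts M. x) \<in> carrier (Diff M)"
  by (rule DiffI[where k = "\<lambda>x. x"])
    (use ident_smooth smooth_map_cong[OF M M findim_euclidean findim_euclidean ident_smooth] in auto)

lemma compose_closed:
  assumes g: "g \<in> carrier (Diff M)" and h: "h \<in> carrier (Diff M)"
  shows "compose (pts M) g h \<in> carrier (Diff M)"
proof (rule DiffI)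
  let ?i = "inv_into (pts M)"
  note c = smooth_map_compose[OF M M M findim_euclidean findim_euclidean findim_euclidean]
  show "smooth_map M M (compose (pts M) g h)"
    by (rule smooth_map_cong[OF M M findim_euclidean findim_euclidean c[OF Diff_D(2)[OF h] Diff_D(2)[OF g]]])
      (simp add: compose_def)
  show "smooth_map M M (\<lambda>x. ?i h (?i g x))"
    by (rule c[OF Diff_D(3)[OF g] Diff_D(3)[OF h]])
qed (use Diff_D[OF g] Diff_D[OF h] in \<open>auto simp: compose_def\<close>)

lemma inverse_closed:
  assumes h: "h \<in> carrier (Diff M)"
  shows "(\<lambda>x\<in>pts M. inv_into (pts M) h x) \<in> carrier (Diff M)"
proof (rule DiffI)
  show "smooth_map M M (\<lambda>x\<in>pts M. inv_into (pts M) h x)"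
    by (rule smooth_map_cong[OF M M findim_euclidean findim_euclidean Diff_D(3)[OF h]]) simp
  show "smooth_map M M h" by (rule Diff_D(2)[OF h])
qed (use Diff_D[OF h] in auto)

lemma group_Diff: "group (Diff M)"
proof (rule groupI)
  show "x \<otimes>\<^bsub>Diff M\<^esub> y \<in> carrier (Diff M)" if "x \<in> carrier (Diff M)" "y \<in> carrier (Diff M)" for x y
    using compose_closed that by (simp add: mult_Diff)
  fix x y z assume x: "x \<in> carrier (Diff M)" and y: "y \<in> carrier (Diff M)" and z: "z \<in> carrier (Diff M)"
  show "x \<otimes>\<^bsub>Diff M\<^esub> y \<otimes>\<^bsub>Diff M\<^esub> z = x \<otimes>\<^bsub>Diff M\<^esub> (y \<otimes>\<^bsub>Diff M\<^esub> z)"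
    using compose_closed x y z Diff_D(4)[OF z] Diff_D(4)[OF y] by (auto simp: mult_Diff compose_def fun_eq_iff)
next
  fix x assume x: "x \<in> carrier (Diff M)"
  show "\<one>\<^bsub>Diff M\<^esub> \<otimes>\<^bsub>Diff M\<^esub> x = x"
    using one_closed x Diff_D(1,4)[OF x] by (auto simp: mult_Diff one_Diff compose_def extensional_def fun_eq_iff)
  show "\<exists>y\<in>carrier (Diff M). y \<otimes>\<^bsub>Diff M\<^esub> x = \<one>\<^bsub>Diff M\<^esub>"
    by (rule bexI[OF _ inverse_closed[OF x]])
      (use inverse_closed[OF x] x Diff_D(4,6)[OF x] in \<open>auto simp: mult_Diff one_Diff compose_def fun_eq_iff\<close>)
qed (use one_closed in \<open>simp add: one_Diff\<close>)

lemma inv_Diff: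
  assumes h: "h \<in> carrier (Diff M)"
  shows "inv\<^bsub>Diff M\<^esub> h = (\<lambda>x\<in>pts M. inv_into (pts M) h x)"
  by (rule group.inv_equality[OF group_Diff _ h inverse_closed[OF h]])
    (use inverse_closed[OF h] h Diff_D(4,6)[OF h] in \<open>auto simp: mult_Diff one_Diff compose_def fun_eq_iff\<close>)

lemma subgroup_DiffI:
  assumes "S \<subseteq> carrier (Diff M)" "(\<lambda>x\<in>pts M. x) \<in> S"
    and "\<And>g h. g \<in> S \<Longrightarrow> h \<in> S \<Longrightarrow> compose (pts M) g h \<in> S"
    and "\<And>h. h \<in> S \<Longrightarrow> (\<lambda>x\<in>pts M. inv_into (pts M) h x) \<in> S"
  shows "subgroup S (Diff M)"
proof (rule group.subgroupI[OF group_Diff])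
  show "S \<noteq> {}" using assms(2) by auto
  show "inv\<^bsub>Diff M\<^esub> a \<in> S" if "a \<in> S" for a
    using assms(1,4) that inv_Diff by (auto simp: subset_iff)
  show "a \<otimes>\<^bsub>Diff M\<^esub> b \<in> S" if "a \<in> S" "b \<in> S" for a b
    using assms(1,3) that mult_Diff by (auto simp: subset_iff)
qed (rule assms(1))

lemma gtop_Diff: "S \<subseteq> carrier (Diff M) \<Longrightarrow> subtopology (gtop (Diff M)) S = subtopology (Cinf_topology M M) S"
  by (simp add: Diff_def subtopology_subtopology inf_absorb2)

lemma topspace_Diff:
  assumes "S \<subseteq> carrier (Diff M)"
  shows "topspace (subtopology (gtop (Diff M)) S) = S"
proof -
  have "S \<subseteq> smooth_maps M M" using assms Diff_D(8) by blast
  then show ?thesis unfolding gtop_Diff[OF assms] by (auto simp: topspace_Cinf)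
qed

lemma psmap_Diff:
  assumes "S \<subseteq> carrier (Diff M)"
  shows "psmap Q (subtopology (gtop (Diff M)) S) M M (\<lambda>h. h)"
  unfolding gtop_Diff[OF assms]
  by (rule tautological_psmap[OF M Q M]) (use assms Diff_D(8) in blast)

text \<open>With \<open>psmap_Diff\<close> this is the exponential law for subspaces of the
  diffeomorphism group; the continuity proofs for \<open>\<sigma>\<close>, \<open>\<theta>\<close>
  and the deformation all end here.\<close>

lemma continuous_into_Diff:
  assumes S: "S \<subseteq> carrier (Diff M)" and \<Phi>: "psmap Q X M M \<Phi>" and in_S: "\<And>p. p \<in> topspace X \<Longrightarrow> \<Phi> p \<in> S"
  shows "continuous_map X (subtopology (gtop (Diff M)) S) \<Phi>"
proof -
  have "continuous_map X (Cinf_topology M M) \<Phi>"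
    by (rule psmap_imp_continuous_Cinf[OF M M findim_euclidean \<Phi>]) (use S in_S Diff_D(8) in blast)
  then show ?thesis
    unfolding gtop_Diff[OF S] using in_S by (auto simp: continuous_map_in_subtopology)
qed

end

section \<open>Maps of the unit interval\<close>

lemma charts_interval: "charts unit_interval = {({0..1}, \<lambda>t. t)}" "mtop unit_interval = top_of_set {0..1}"
  "pts unit_interval = {0..1}"
  by (simp_all add: unit_interval_def)

lemma inv_into_identity: "x \<in> A \<Longrightarrow> inv_into A (\<lambda>x. x) x = x"
  using inv_into_f_f[of "\<lambda>x. x" A x] by (simp add: inj_on_def)

lemma slice_continuous:
  fixes F :: "'x \<times> real \<Rightarrow> real"
  assumes "psmooth {0..1} X (topspace X \<times> {0..1}) F" "p \<in> topspace X"
  shows "smooth_on {0..1} (\<lambda>t. F (p, t))" "continuous_on {0..1} (\<lambda>t. F (p, t))"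
proof -
  have "(topspace X \<times> {0..1::real}) `` {p} = {0..1}" using assms(2) by auto
  with psmooth_smooth_on[OF assms(1), of p] show s: "smooth_on {0..1} (\<lambda>t. F (p, t))" by simp
  then have "dderiv {0..1} (\<lambda>t. F (p, t)) [] differentiable_on {0..1}"
    unfolding smooth_on_def by blast
  then show "continuous_on {0..1} (\<lambda>t. F (p, t))"
    by (simp add: differentiable_imp_continuous_on)
qed

lemma smooth_on_identity: "smooth_on {0..1::real} (\<lambda>t. t)"
proof -
  have "psmooth {0..1} (euclidean :: unit topology) (topspace euclidean \<times> {0..1::real}) snd"
    by (intro psmooth_intros pdom_box fat_unit_interval) auto
  from slice_continuous(1)[OF this, of "()"] show ?thesis by simp
qed

lemma atlas_interval: "atlas {0..1} unit_interval"
proof -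
  have "homeomorphic_map (top_of_set {0..1::real}) (top_of_set {0..1}) (\<lambda>t. t)"
    using homeomorphic_map_id[of "top_of_set {0..1::real}" "top_of_set {0..1}"] by (simp add: id_def)
  moreover have "smooth_on {0..1} ((\<lambda>t. t) \<circ> inv_into {0..1} (\<lambda>t::real. t))"
    by (rule smooth_on_cong[OF smooth_on_identity]) (simp add: inv_into_identity)
  ultimately show ?thesis
    by (simp add: atlas_def charts_interval fat_unit_interval subtopology_subtopology)
qed

interpretation Int: closed_atlas "{0..1::real}" unit_interval
  by unfold_locales (rule atlas_interval, simp)

lemma psmap_interval:
  assumes "psmooth {0..1} X (topspace X \<times> {0..1}) (\<lambda>z. \<Phi> (fst z) (snd z))"
    and "\<And>p t. p \<in> topspace X \<Longrightarrow> t \<in> {0..1} \<Longrightarrow> \<Phi> p t \<in> {0..1}"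
  shows "psmap {0..1} X unit_interval unit_interval \<Phi>"
  unfolding psmap_def sm_at_def
proof (intro ballI)
  fix p t assume p: "p \<in> topspace X" and t: "t \<in> pts unit_interval"
  have "psmooth {0..1} X (topspace X \<times> (\<lambda>t. t) ` {0..1}) (\<lambda>z. \<Phi> (fst z) (inv_into {0..1} (\<lambda>t. t) (snd z)))"
    using psmooth_cong[OF assms(1)] by (simp add: inv_into_identity mem_Times_iff)
  then show "\<exists>U c V d A B. (U, c) \<in> charts unit_interval \<and> (V, d) \<in> charts unit_interval \<and> openin X A \<and> p \<in> A \<and>
        openin (mtop unit_interval) B \<and> t \<in> B \<and> B \<subseteq> U \<and> (\<forall>p\<in>A. \<forall>x\<in>B. \<Phi> p x \<in> V) \<and>
        psmooth {0..1} X (A \<times> c ` B) (\<lambda>z. d (\<Phi> (fst z) (inv_into U c (snd z))))"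
    using p t assms(2)
    by (intro exI[of _ "{0..1}"] exI[of _ "\<lambda>t. t"] exI[of _ "topspace X"]) (auto simp: charts_interval)
qed

lemma psmap_intervalD:
  assumes \<Phi>: "psmap {0..1} X unit_interval unit_interval \<Phi>"
  shows "psmooth {0..1} X (topspace X \<times> {0..1}) (\<lambda>z. \<Phi> (fst z) (snd z))"
    and "p \<in> topspace X \<Longrightarrow> t \<in> {0..1} \<Longrightarrow> \<Phi> p t \<in> {0..1}"
proof -
  show R: "\<Phi> p t \<in> {0..1}" if "p \<in> topspace X" "t \<in> {0..1}" for p t
  proof -
    have "sm_at {0..1} X unit_interval unit_interval \<Phi> p t" using \<Phi> that by (simp add: psmap_def charts_interval)
    from sm_at_pts[OF atlas_interval this] show ?thesis by (simp add: charts_interval)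
  qed
  have c: "({0..1}, \<lambda>t. t) \<in> charts unit_interval" by (simp add: charts_interval)
  have "{(p, y). p \<in> topspace X \<and> y \<in> loc_dom ({0..1}, \<lambda>t. t) ({0..1}, \<lambda>t. t) (\<Phi> p)} = topspace X \<times> {0..1}"
    using R by (auto simp: loc_dom_def)
  with psmap_loc_rep[OF atlas_interval atlas_interval findim_euclidean findim_euclidean \<Phi> c c]
  have "psmooth {0..1} X (topspace X \<times> {0..1}) (\<lambda>(p, y). loc_rep ({0..1}, \<lambda>t. t) ({0..1}, \<lambda>t. t) (\<Phi> p) y)" by simp
  then show "psmooth {0..1} X (topspace X \<times> {0..1}) (\<lambda>z. \<Phi> (fst z) (snd z))"
    by (rule psmooth_cong) (auto simp: loc_rep_def inv_into_identity)
qed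

lemma smooth_map_interval:
  assumes "smooth_on {0..1} \<phi>" "\<And>t. t \<in> {0..1} \<Longrightarrow> \<phi> t \<in> {0..1}"
  shows "smooth_map unit_interval unit_interval \<phi>"
proof -
  have "psmooth {0..1} (euclidean :: unit topology) (topspace euclidean \<times> {0..1}) (\<lambda>z. \<phi> (snd z))"
    by (rule smooth_on_psmooth[OF assms(1) fat_unit_interval]) simp
  then have "psmap {0..1} (euclidean :: unit topology) unit_interval unit_interval (\<lambda>_. \<phi>)"
    by (intro psmap_interval) (use assms(2) in auto)
  from psmap_smooth_map[OF atlas_interval atlas_interval findim_euclidean findim_euclidean this, of "()"]
  show ?thesis by simp
qed

lemma smooth_map_intervalD:
  assumes "smooth_map unit_interval unit_interval \<phi>"
  shows "smooth_on {0..1} \<phi>"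
proof -
  have "psmooth {0..1} (euclidean :: unit topology) (topspace euclidean \<times> {0..1}) (\<lambda>z. \<phi> (snd z))"
    using psmap_intervalD(1)[OF smooth_map_psmap[OF atlas_interval atlas_interval assms, where X = "euclidean :: unit topology"]] by simp
  from slice_continuous(1)[OF this, of "()"] show ?thesis by simp
qed

section \<open>Increasing reparametrizations and their quotients\<close>

lemma smooth_on_interval_derivative:
  assumes "smooth_on {0..1::real} (\<phi> :: real \<Rightarrow> real)"
  obtains D where "\<And>t. t \<in> {0..1} \<Longrightarrow> (\<phi> has_real_derivative D t) (at t within {0..1})" "continuous_on {0..1} D"
proof -
  have P: "psmooth {0..1} (euclidean :: unit topology) (topspace euclidean \<times> {0..1}) (\<lambda>z. \<phi> (snd z))"
    by (rule smooth_on_psmooth[OF assms fat_unit_interval]) simp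
  obtain D where D: "\<And>p x. (p, x) \<in> topspace (euclidean :: unit topology) \<times> {0..1} \<Longrightarrow>
      ((\<lambda>y. \<phi> (snd (p, y))) has_real_derivative D (p, x)) (at x within {0..1})"
    and Ds: "psmooth {0..1} (euclidean :: unit topology) (topspace euclidean \<times> {0..1}) D"
    using psmooth_realE[OF P] by metis
  show thesis
    by (rule that[of "\<lambda>t. D ((), t)"]) (use D[of "()"] slice_continuous(2)[OF Ds, of "()"] in auto)
qed

text \<open>Fixed ends and a positive derivative, instead of bijectivity, make this a condition that
  is visibly preserved by convex combinations. Bijectivity follows from monotonicity and the
  intermediate value theorem.\<close>

definition increasing_diffeo :: "(real \<Rightarrow> real) \<Rightarrow> bool" where
  "increasing_diffeo \<phi> \<longleftrightarrow> \<phi> 0 = 0 \<and> \<phi> 1 = 1 \<and>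
     (\<forall>t\<in>{0..1}. \<exists>d>0. (\<phi> has_real_derivative d) (at t within {0..1}))"

lemma increasing_diffeoD:
  assumes "increasing_diffeo \<phi>"
  shows "\<phi> 0 = 0" "\<phi> 1 = 1" "\<And>a b. 0 \<le> a \<Longrightarrow> a < b \<Longrightarrow> b \<le> 1 \<Longrightarrow> \<phi> a < \<phi> b"
    "\<And>t. t \<in> {0..1} \<Longrightarrow> \<phi> t \<in> {0..1}" "\<And>y. y \<in> {0..1} \<Longrightarrow> \<exists>t\<in>{0..1}. \<phi> t = y"
proof -
  show 0: "\<phi> 0 = 0" "\<phi> 1 = 1" using assms by (auto simp: increasing_diffeo_def)
  obtain D where D: "\<And>t. t \<in> {0..1} \<Longrightarrow> D t > 0 \<and> (\<phi> has_real_derivative D t) (at t within {0..1})"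
    using assms unfolding increasing_diffeo_def by metis
  have c: "continuous_on {0..1} \<phi>"
    by (rule DERIV_continuous_on) (use D in blast)
  show mono: "\<phi> a < \<phi> b" if ab: "0 \<le> a" "a < b" "b \<le> 1" for a b
  proof (rule DERIV_pos_imp_increasing_open[OF ab(2)])
    show "\<exists>y. DERIV \<phi> x :> y \<and> y > 0" if "a < x" "x < b" for x
      using D[of x] that ab at_within_Icc_at[of 0 x 1] by auto
    show "continuous_on {a..b} \<phi>" by (rule continuous_on_subset[OF c]) (use ab in auto)
  qed
  show "\<phi> t \<in> {0..1}" if "t \<in> {0..1}" for t
    using mono[of 0 t] mono[of t 1] 0 that by (cases "t = 0"; cases "t = 1") auto
  show "\<exists>t\<in>{0..1}. \<phi> t = y" if "y \<in> {0..1}" for y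
    using IVT'[of \<phi> 0 y 1] 0 c that by auto
qed

lemma inverse_family:
  fixes F :: "'x \<times> real \<Rightarrow> real"
  assumes F: "psmooth {0..1} X (topspace X \<times> {0..1}) F"
    and inc: "\<And>p. p \<in> topspace X \<Longrightarrow> increasing_diffeo (\<lambda>t. F (p, t))"
    and G: "\<And>p t. p \<in> topspace X \<Longrightarrow> t \<in> {0..1} \<Longrightarrow> G (p, t) \<in> {0..1} \<and> F (p, G (p, t)) = t"
  shows "psmooth {0..1} X (topspace X \<times> {0..1}) G"
proof -
  have "\<forall>p\<in>topspace X. \<forall>t\<in>{0..1}. \<exists>d>0. ((\<lambda>t. F (p, t)) has_real_derivative d) (at t within {0..1})"
    using inc by (simp add: increasing_diffeo_def)
  then obtain D where "\<And>p t. p \<in> topspace X \<Longrightarrow> t \<in> {0..1} \<Longrightarrow>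
      D p t > 0 \<and> ((\<lambda>t. F (p, t)) has_real_derivative D p t) (at t within {0..1})" by metis
  then show ?thesis
    by (intro psmooth_inverse_function[OF F, where D = "\<lambda>z. D (fst z) (snd z)"])
      (use G increasing_diffeoD(4)[OF inc] in auto)
qed

text \<open>At 0 the quotient is the derivative of \<open>\<phi>\<close> at 0, by continuity of
  \<open>g\<close>, and that derivative is positive; elsewhere it is a quotient of positive
  numbers.\<close>

lemma quotient_pos:
  assumes inc: "increasing_diffeo \<phi>" and g: "\<And>t. t \<in> {0..1} \<Longrightarrow> \<phi> t = t * g t" and c: "continuous_on {0..1} g"
    and t: "t \<in> {0..1}"
  shows "g t > 0"
proof (cases "t = 0")
  case False
  then have "\<phi> t > 0" using increasing_diffeoD(1)[OF inc] increasing_diffeoD(3)[OF inc, of 0 t] t by auto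
  then show ?thesis using g[OF t] t False by (simp add: zero_less_mult_iff)
next
  case True
  obtain d where d: "d > 0" "(\<phi> has_real_derivative d) (at 0 within {0..1})"
    using bspec[OF conjunct2[OF conjunct2[OF inc[unfolded increasing_diffeo_def]]], of 0] by auto
  have "((\<lambda>x. (\<phi> x - \<phi> 0) / (x - 0)) \<longlongrightarrow> d) (at 0 within {0..1})"
    using d(2) by (simp add: has_field_derivative_iff)
  then have "(g \<longlongrightarrow> d) (at 0 within {0..1})"
    by (rule Lim_transform_within[where d = 1]) (use g increasing_diffeoD(1)[OF inc] in auto)
  moreover have "(g \<longlongrightarrow> g 0) (at 0 within {0..1})"
    using c by (simp add: continuous_on_def)
  moreover have "at 0 within {0..1::real} \<noteq> bot"
    by (simp add: at_within_Icc_at_right trivial_limit_at_right_real)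
  ultimately have "g 0 = d" using tendsto_unique by blast
  then show ?thesis using d True by simp
qed

text \<open>The second bundle sees levels through \<open>1 - t\<close>; this is the
  reparametrization in its coordinate.\<close>

lemma reversed_increasing:
  assumes "increasing_diffeo \<phi>"
  shows "increasing_diffeo (\<lambda>t. 1 - \<phi> (1 - t))"
  unfolding increasing_diffeo_def
proof (intro conjI ballI)
  fix t :: real assume t: "t \<in> {0..1}"
  then have "1 - t \<in> {0..1}" by auto
  then obtain d where d: "d > 0" "(\<phi> has_real_derivative d) (at (1 - t) within {0..1})"
    using assms unfolding increasing_diffeo_def by blast
  have img: "(\<lambda>t. 1 - t) ` {0..1::real} = {0..1}"
    by (auto simp: image_iff intro!: bexI[of _ "1 - _"])
  have "((\<lambda>t. 1 - t) has_real_derivative -1) (at t within {0..1})"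
    by (auto intro!: derivative_eq_intros)
  with d(2) have "((\<lambda>t. \<phi> (1 - t)) has_real_derivative d * (-1)) (at t within {0..1})"
    using DERIV_image_chain[of \<phi> d "\<lambda>t. 1 - t" t "{0..1}" "-1"] img by (simp add: o_def)
  then have "((\<lambda>t. 1 - \<phi> (1 - t)) has_real_derivative d) (at t within {0..1})"
    by (auto intro!: derivative_eq_intros)
  then show "\<exists>d>0. ((\<lambda>t. 1 - \<phi> (1 - t)) has_real_derivative d) (at t within {0..1})"
    using d(1) by blast
qed (use increasing_diffeoD(1,2)[OF assms] in auto)

lemma quotient_family:
  fixes F :: "'x \<times> real \<Rightarrow> real"
  assumes F: "psmooth {0..1} X (topspace X \<times> {0..1}) F"
    and inc: "\<And>p. p \<in> topspace X \<Longrightarrow> increasing_diffeo (\<lambda>t. F (p, t))"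
  obtains G where "psmooth {0..1} X (topspace X \<times> {0..1}) G"
    "\<And>p t. p \<in> topspace X \<Longrightarrow> t \<in> {0..1} \<Longrightarrow> G (p, t) > 0 \<and> F (p, t) = t * G (p, t)"
proof -
  obtain G where G: "psmooth {0..1} X (topspace X \<times> {0..1}) G"
    and FG: "\<And>p t. p \<in> topspace X \<Longrightarrow> t \<in> {0..1} \<Longrightarrow> F (p, t) - F (p, 0) = t * G (p, t)"
    using hadamard[OF F] by (metis atLeastAtMost_iff convex_closed_interval convex_real_interval(5) less_eq_real_def openin_subtopology_self zero_less_one)
  have eq: "F (p, t) = t * G (p, t)" if "p \<in> topspace X" "t \<in> {0..1}" for p t
    using FG[OF that] increasing_diffeoD(1)[OF inc[OF that(1)]] by simp
  have "G (p, t) > 0" if "p \<in> topspace X" "t \<in> {0..1}" for p t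
    by (rule quotient_pos[OF inc[OF that(1)] _ slice_continuous(2)[OF G that(1)] that(2)]) (rule eq[OF that(1)])
  then show thesis using G eq that by blast
qed

lemma radial_factors_family:
  fixes F :: "'x \<times> real \<Rightarrow> real"
  assumes F: "psmooth {0..1} X (topspace X \<times> {0..1}) F"
    and inc: "\<And>p. p \<in> topspace X \<Longrightarrow> increasing_diffeo (\<lambda>t. F (p, t))"
  obtains G0 G1 where "psmooth {0..1} X (topspace X \<times> {0..1}) G0" "psmooth {0..1} X (topspace X \<times> {0..1}) G1"
    "\<And>p. p \<in> topspace X \<Longrightarrow> radial_factors (\<lambda>t. F (p, t)) (\<lambda>t. G0 (p, t)) (\<lambda>t. G1 (p, t))"
proof -
  have W: "pdom {0..1} X (topspace X \<times> {0..1::real})" by (rule psmooth_pdom[OF F])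
  have "psmooth {0..1} X (topspace X \<times> {0..1}) (\<lambda>z. 1 - snd z :: real)"
    by (intro psmooth_intros W)
  from psmooth_compose[OF findim_euclidean this F]
  have "psmooth {0..1} X (topspace X \<times> {0..1}) (\<lambda>z. F (fst z, 1 - snd z))" by auto
  then have F': "psmooth {0..1} X (topspace X \<times> {0..1}) (\<lambda>z. 1 - F (fst z, 1 - snd z))"
    by (intro psmooth_intros W)
  obtain G0 where G0: "psmooth {0..1} X (topspace X \<times> {0..1}) G0"
    "\<And>p t. p \<in> topspace X \<Longrightarrow> t \<in> {0..1} \<Longrightarrow> G0 (p, t) > 0 \<and> F (p, t) = t * G0 (p, t)"
    using quotient_family[OF F inc] by metis
  have inc': "increasing_diffeo (\<lambda>t. 1 - F (fst (p, t), 1 - snd (p, t)))" if "p \<in> topspace X" for p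
    using reversed_increasing[OF inc[OF that]] by simp
  obtain G1 where G1: "psmooth {0..1} X (topspace X \<times> {0..1}) G1"
    "\<And>p t. p \<in> topspace X \<Longrightarrow> t \<in> {0..1} \<Longrightarrow> G1 (p, t) > 0 \<and> 1 - F (fst (p, t), 1 - snd (p, t)) = t * G1 (p, t)"
    using quotient_family[OF F' inc'] by metis
  show thesis
    by (rule that[OF G0(1) G1(1)]) (use G0(2) G1(2) in \<open>auto simp: radial_factors_def\<close>)
qed

text \<open>Division determines the factor away from 0 and continuity determines it at 0, so any
  smooth positive quotient identifies the definite description.\<close>

lemma theta_factor_eq:
  assumes g: "smooth_on {0..1} g" "\<And>t. t \<in> {0..1} \<Longrightarrow> g t > 0 \<and> \<phi> t = t * g t" and t: "t \<in> {0..1}"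
  shows "theta_factor \<phi> t = g t"
proof -
  let ?P = "\<lambda>g. g \<in> extensional {0..1} \<and> smooth_on {0..1} g \<and> (\<forall>t\<in>{0..1}. g t > 0 \<and> \<phi> t = t * g t)"
  have cont: "continuous_on {0..1} h" if "smooth_on {0..1} h" for h :: "real \<Rightarrow> real"
  proof -
    have "dderiv {0..1} h [] differentiable_on {0..1}" using that unfolding smooth_on_def by blast
    then show ?thesis by (simp add: differentiable_imp_continuous_on)
  qed
  have eq: "h t = g t" if h: "smooth_on {0..1} h" "\<And>t. t \<in> {0..1} \<Longrightarrow> \<phi> t = t * h t" and t: "t \<in> {0..1}" for h t
  proof (cases "t = 0")
    case False
    then show ?thesis using h(2)[OF t] g(2)[OF t] by simp
  next
    case True
    have "(h \<longlongrightarrow> h 0) (at 0 within {0..1})" using cont[OF h(1)] by (simp add: continuous_on_def)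
    moreover have "(h \<longlongrightarrow> g 0) (at 0 within {0..1})"
    proof (rule Lim_transform_within[where d = 1])
      show "(g \<longlongrightarrow> g 0) (at 0 within {0..1})" using cont[OF g(1)] by (simp add: continuous_on_def)
      fix x :: real assume x: "x \<in> {0..1}" "0 < dist x 0"
      then show "g x = h x" using h(2)[OF x(1)] g(2)[OF x(1)] by simp
    qed simp
    moreover have "at 0 within {0..1::real} \<noteq> bot"
      by (simp add: at_within_Icc_at_right trivial_limit_at_right_real)
    ultimately show ?thesis using tendsto_unique True by blast
  qed
  have "?P (restrict g {0..1})"
    using g by (auto intro: smooth_on_cong[OF g(1)])
  moreover have "h = restrict g {0..1}" if "?P h" for h
    by (rule extensionalityI[of _ "{0..1}"]) (use that eq in auto)
  ultimately have "theta_factor \<phi> = restrict g {0..1}"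
    unfolding theta_factor_def by (rule the_equality)
  then show ?thesis using t by simp
qed

text \<open>A positive derivative makes a bijection of the interval fix both ends. Conversely, the
  inverse of an increasing function with positive derivative is smooth by
  \<open>inverse_family\<close> over a one-point parameter space.\<close>

lemma pos_diffeo_iff:
  "\<phi> \<in> carrier Diff_interval_plus \<longleftrightarrow> \<phi> \<in> extensional {0..1} \<and> smooth_on {0..1} \<phi> \<and> increasing_diffeo \<phi>"
proof
  assume \<phi>: "\<phi> \<in> carrier Diff_interval_plus"
  then have D: "\<phi> \<in> carrier (Diff unit_interval)" and pos: "\<And>t. t \<in> {0..1} \<Longrightarrow> vector_derivative \<phi> (at t within {0..1}) > 0"
    by (auto simp: Diff_interval_plus_def)
  have s: "smooth_on {0..1} \<phi>" by (rule smooth_map_intervalD[OF Int.Diff_D(2)[OF D]])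
  obtain d where d: "\<And>t. t \<in> {0..1} \<Longrightarrow> (\<phi> has_real_derivative d t) (at t within {0..1})"
    using smooth_on_interval_derivative[OF s] by metis
  have "vector_derivative \<phi> (at t within {0..1}) = d t" if "t \<in> {0..1}" for t
    using vector_derivative_within_cbox[of 0 1 t \<phi> "d t"] d[OF that] that
    by (simp add: has_real_derivative_iff_has_vector_derivative)
  then have dpos: "d t > 0" if "t \<in> {0..1}" for t using pos[OF that] that by simp
  have c: "continuous_on {0..1} \<phi>" by (rule DERIV_continuous_on) (use d in blast)
  have mono: "\<phi> a < \<phi> b" if ab: "0 \<le> a" "a < b" "b \<le> 1" for a b
  proof (rule DERIV_pos_imp_increasing_open[OF ab(2)])
    show "\<exists>y. DERIV \<phi> x :> y \<and> y > 0" if "a < x" "x < b" for x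
      using d[of x] dpos[of x] that ab at_within_Icc_at[of 0 x 1] by auto
    show "continuous_on {a..b} \<phi>" by (rule continuous_on_subset[OF c]) (use ab in auto)
  qed
  have b: "\<phi> ` {0..1} = {0..1}" using D by (simp add: carrier_Diff charts_interval bij_betw_def)
  have r: "\<phi> t \<in> {0..1}" if "t \<in> {0..1}" for t using b that by blast
  \<comment> \<open>If the preimage of 0 were not 0, monotonicity would give 0 a negative value;
    likewise at the other end.\<close>
  obtain t0 t1 where t: "t0 \<in> {0..1}" "\<phi> t0 = 0" "t1 \<in> {0..1}" "\<phi> t1 = 1"
    using b by (metis (no_types, lifting) atLeastAtMost_iff imageE order_refl zero_le_one)
  have "\<phi> 0 = 0" using mono[of 0 t0] t r[of 0] by (cases "t0 = 0") auto
  moreover have "\<phi> 1 = 1" using mono[of t1 1] t r[of 1] by (cases "t1 = 1") auto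
  ultimately have "increasing_diffeo \<phi>"
    unfolding increasing_diffeo_def using d dpos by blast
  then show "\<phi> \<in> extensional {0..1} \<and> smooth_on {0..1} \<phi> \<and> increasing_diffeo \<phi>"
    using s Int.Diff_D(1)[OF D] by (simp add: charts_interval)
next
  assume \<phi>: "\<phi> \<in> extensional {0..1} \<and> smooth_on {0..1} \<phi> \<and> increasing_diffeo \<phi>"
  then have inc: "increasing_diffeo \<phi>" and s: "smooth_on {0..1} \<phi>" by auto
  define k where "k t = (SOME u. u \<in> {0..1} \<and> \<phi> u = t)" for t
  have k: "k t \<in> {0..1} \<and> \<phi> (k t) = t" if "t \<in> {0..1}" for t
    unfolding k_def using increasing_diffeoD(5)[OF inc that] by (rule someI2_bex) auto
  have \<phi>s: "psmooth {0..1} (euclidean :: unit topology) (topspace euclidean \<times> {0..1}) (\<lambda>z. \<phi> (snd z))"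
    by (rule smooth_on_psmooth[OF s fat_unit_interval]) simp
  have "psmooth {0..1} (euclidean :: unit topology) (topspace euclidean \<times> {0..1}) (\<lambda>z. k (snd z))"
    by (rule inverse_family[OF \<phi>s]) (use inc k in auto)
  from slice_continuous(1)[OF this, of "()"] have ks: "smooth_on {0..1} k" by simp
  have inj: "u = v" if "u \<in> {0..1}" "v \<in> {0..1}" "\<phi> u = \<phi> v" for u v
    using increasing_diffeoD(3)[OF inc, of u v] increasing_diffeoD(3)[OF inc, of v u] that
    by (cases u v rule: linorder_cases) auto
  have D: "\<phi> \<in> carrier (Diff unit_interval)"
  proof (rule Int.DiffI)
    show "smooth_map unit_interval unit_interval \<phi>"
      by (rule smooth_map_interval[OF s increasing_diffeoD(4)[OF inc]])
    show "smooth_map unit_interval unit_interval k"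
      by (rule smooth_map_interval[OF ks]) (use k in blast)
    show "k (\<phi> x) = x" if "x \<in> pts unit_interval" for x
      using inj[of "k (\<phi> x)" x] k[of "\<phi> x"] increasing_diffeoD(4)[OF inc, of x] that by (simp add: charts_interval)
  qed (use \<phi> k in \<open>auto simp: charts_interval\<close>)
  have "vector_derivative \<phi> (at t within {0..1}) > 0" if t: "t \<in> {0..1}" for t
  proof -
    obtain d where d: "d > 0" "(\<phi> has_real_derivative d) (at t within {0..1})"
      using inc t unfolding increasing_diffeo_def by blast
    then show ?thesis
      using vector_derivative_within_cbox[of 0 1 t \<phi> d] t
      by (simp add: has_real_derivative_iff_has_vector_derivative)
  qed
  then show "\<phi> \<in> carrier Diff_interval_plus"
    using D by (simp add: Diff_interval_plus_def)
qed

text \<open>By the chain rule with the inverse the derivative never vanishes. Being continuous on a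
  connected set, it has a constant sign, and the sign decides what happens to the end
  points.\<close>

lemma diffeo_interval_cases:
  assumes D: "\<phi> \<in> carrier (Diff unit_interval)"
  shows "\<phi> \<in> carrier Diff_interval_plus \<or> \<phi> 0 = 1 \<and> \<phi> 1 = 0"
proof -
  let ?i = "inv_into {0..1} \<phi>"
  note DD = Int.Diff_D[OF D, unfolded charts_interval]
  have s: "smooth_on {0..1} \<phi>" and si: "smooth_on {0..1} ?i"
    using smooth_map_intervalD[OF DD(2)] smooth_map_intervalD[OF DD(3)] by auto
  obtain d where d: "\<And>t. t \<in> {0..1} \<Longrightarrow> (\<phi> has_real_derivative d t) (at t within {0..1})" and cd: "continuous_on {0..1} d"
    using smooth_on_interval_derivative[OF s] by metis
  obtain e where e: "\<And>t. t \<in> {0..1} \<Longrightarrow> (?i has_real_derivative e t) (at t within {0..1})"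
    using smooth_on_interval_derivative[OF si] by metis
  have b: "\<phi> ` {0..1} = {0..1}" using D by (simp add: carrier_Diff charts_interval bij_betw_def)
  have r: "\<phi> t \<in> {0..1}" if "t \<in> {0..1}" for t using b that by blast
  have d0: "d t \<noteq> 0" if t: "t \<in> {0..1}" for t
  proof
    assume 0: "d t = 0"
    have "(?i has_real_derivative e (\<phi> t)) (at (\<phi> t) within \<phi> ` {0..1})"
      by (rule has_field_derivative_subset[OF e[OF r[OF t]]]) (simp add: b)
    from DERIV_image_chain[OF this d[OF t]] have "((\<lambda>t. ?i (\<phi> t)) has_real_derivative e (\<phi> t) * d t) (at t within {0..1})"
      by (simp add: o_def)
    then have "((\<lambda>t. t) has_real_derivative e (\<phi> t) * d t) (at t within {0..1})"
      by (rule has_field_derivative_transform_within[where d = 1]) (use t DD(6) in auto)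
    moreover have "((\<lambda>t. t) has_real_derivative 1) (at t within {0..1})" by simp
    ultimately have "(\<lambda>v. e (\<phi> t) * d t * v) = (\<lambda>v. 1 * v)"
      using fat_unique[OF fat_unit_interval t] unfolding has_field_derivative_def by blast
    from fun_cong[OF this, of 1] 0 show False by simp
  qed
  have c: "continuous_on {0..1} \<phi>" by (rule DERIV_continuous_on) (use d in blast)
  have "(\<forall>t\<in>{0..1}. d t > 0) \<or> (\<forall>t\<in>{0..1}. d t < 0)"
  proof (rule ccontr)
    assume "\<not> ?thesis"
    then obtain u v where uv: "u \<in> {0..1}" "v \<in> {0..1}" "d u < 0" "d v > 0"
      using d0 by (metis linorder_neqE_linordered_idom)
    have "connected (d ` {0..1})" by (rule connected_continuous_image[OF cd]) simp
    then have "0 \<in> d ` {0..1}"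
      using uv unfolding connected_iff_interval by (meson imageI less_imp_le)
    then show False using d0 by auto
  qed
  then show ?thesis
  proof
    assume pos: "\<forall>t\<in>{0..1}. d t > 0"
    have "vector_derivative \<phi> (at t within {0..1}) > 0" if t: "t \<in> {0..1}" for t
      using vector_derivative_within_cbox[of 0 1 t \<phi> "d t"] t d[OF t] pos
      by (simp add: has_real_derivative_iff_has_vector_derivative)
    then show ?thesis using D by (simp add: Diff_interval_plus_def)
  next
    assume neg: "\<forall>t\<in>{0..1}. d t < 0"
    have mono: "\<phi> a > \<phi> b" if ab: "0 \<le> a" "a < b" "b \<le> 1" for a b
    proof (rule DERIV_neg_imp_decreasing_open[OF ab(2)])
      show "\<exists>y. DERIV \<phi> x :> y \<and> y < 0" if "a < x" "x < b" for x
        using d[of x] neg that ab at_within_Icc_at[of 0 x 1] by auto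
      show "continuous_on {a..b} \<phi>" by (rule continuous_on_subset[OF c]) (use ab in auto)
    qed
    obtain t0 t1 where t: "t0 \<in> {0..1}" "\<phi> t0 = 0" "t1 \<in> {0..1}" "\<phi> t1 = 1"
      using b by (metis (no_types, lifting) atLeastAtMost_iff imageE order_refl zero_le_one)
    have "\<phi> 0 = 1" using mono[of 0 t1] t r[of 0] by (cases "t1 = 0") auto
    moreover have "\<phi> 1 = 0" using mono[of t0 1] t r[of 1] by (cases "t0 = 1") auto
    ultimately show ?thesis by simp
  qed
qed

lemma increasing_diffeo_cong:
  assumes "increasing_diffeo \<phi>" "\<And>t. t \<in> {0..1} \<Longrightarrow> \<phi> t = \<phi>' t"
  shows "increasing_diffeo \<phi>'"
  unfolding increasing_diffeo_def
proof (intro conjI ballI)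
  fix t :: real assume t: "t \<in> {0..1}"
  then obtain d where d: "d > 0" "(\<phi> has_real_derivative d) (at t within {0..1})"
    using assms(1) unfolding increasing_diffeo_def by blast
  then have "(\<phi>' has_real_derivative d) (at t within {0..1})"
    by (intro has_field_derivative_transform_within[OF d(2), of 1]) (use t assms(2) in auto)
  then show "\<exists>d>0. (\<phi>' has_real_derivative d) (at t within {0..1})" using d by blast
qed (use increasing_diffeoD(1,2)[OF assms(1)] assms(2)[of 0] assms(2)[of 1] in auto)

lemma Diff_interval_plus_eq: "Diff_interval_plus = tsubgroup (Diff unit_interval) (carrier Diff_interval_plus)"
  by (simp add: Diff_interval_plus_def)

text \<open>Either both ends are fixed or they are exchanged, so the value at 0 reveals the
  orientation; closure under composition and inversion is then checked at 0.\<close>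

lemma pos_diffeo_iff_zero:
  assumes "\<phi> \<in> carrier (Diff unit_interval)"
  shows "\<phi> \<in> carrier Diff_interval_plus \<longleftrightarrow> \<phi> 0 = 0"
  using diffeo_interval_cases[OF assms] increasing_diffeoD(1) pos_diffeo_iff by fastforce

lemma subgroup_Diff_interval_plus: "subgroup (carrier Diff_interval_plus) (Diff unit_interval)"
proof (rule Int.subgroup_DiffI)
  show sub: "carrier Diff_interval_plus \<subseteq> carrier (Diff unit_interval)"
    by (auto simp: Diff_interval_plus_def)
  show "(\<lambda>x\<in>pts unit_interval. x) \<in> carrier Diff_interval_plus"
    using pos_diffeo_iff_zero[OF Int.one_closed] by (simp add: charts_interval)
  show "compose (pts unit_interval) g h \<in> carrier Diff_interval_plus"
    if "g \<in> carrier Diff_interval_plus" "h \<in> carrier Diff_interval_plus" for g h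
  proof -
    have D: "g \<in> carrier (Diff unit_interval)" "h \<in> carrier (Diff unit_interval)" using that sub by auto
    have "g 0 = 0" "h 0 = 0" using pos_diffeo_iff_zero D that by auto
    then show ?thesis
      using pos_diffeo_iff_zero[OF Int.compose_closed[OF D]] by (simp add: charts_interval compose_def)
  qed
  show "(\<lambda>x\<in>pts unit_interval. inv_into (pts unit_interval) h x) \<in> carrier Diff_interval_plus"
    if h: "h \<in> carrier Diff_interval_plus" for h
  proof -
    have hD: "h \<in> carrier (Diff unit_interval)" using h sub by blast
    have "h 0 = 0" using pos_diffeo_iff_zero[OF hD] h by simp
    then have "inv_into {0..1} h 0 = 0"
      using Int.Diff_D(6)[OF hD, of 0] by (simp add: charts_interval)
    then show ?thesis
      using pos_diffeo_iff_zero[OF Int.inverse_closed[OF hD]] by (simp add: charts_interval)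
  qed
qed

section \<open>Foliated diffeomorphisms\<close>

lemma inv_tprod:
  assumes "group G" "group H" "g \<in> carrier G" "h \<in> carrier H"
  shows "inv\<^bsub>tprod G H\<^esub> (g, h) = (inv\<^bsub>G\<^esub> g, inv\<^bsub>H\<^esub> h)"
  by (rule group.inv_equality[OF group_tprod[OF assms(1,2)]])
    (use assms in \<open>auto simp: group.l_inv group.inv_closed\<close>)

lemma tgroup_iso_identity: "tgroup_iso G G (\<lambda>x. x)"
  using homeomorphic_map_id[of "gtop G" "gtop G"]
  by (simp add: tgroup_iso_def iso_def hom_def bij_betw_def id_def)

context glued_bundles
begin

sublocale LM: closed_atlas UNIV L
  by unfold_locales (rule atlas_L, simp)

abbreviation "\<sigma> \<equiv> sigma L f"
abbreviation "\<theta> \<equiv> theta V0 f0 V1 f1 \<psi>"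
abbreviation "DL \<equiv> Diff L"
abbreviation "DI \<equiv> Diff unit_interval"
abbreviation "DP \<equiv> Diff_interval_plus"
abbreviation "fol \<equiv> carrier (D_fol L (leaves L f))"

lemma fol_iff: "h \<in> fol \<longleftrightarrow> h \<in> carrier DL \<and> (\<forall>l\<in>leaves L f. h ` l \<in> leaves L f)"
  by (simp add: D_fol_def)

lemma fol_Diff: "fol \<subseteq> carrier DL"
  using fol_iff by blast

lemma leaf_self: "z \<in> pts L \<Longrightarrow> z \<in> leaf L f (f z) \<and> leaf L f (f z) \<in> leaves L f"
  using f_range by (auto simp: leaf_def leaves_def)

lemma fol_image_leaf:
  assumes h: "h \<in> fol" and z: "z \<in> pts L"
  shows "h ` leaf L f (f z) = leaf L f (f (h z))"
proof -
  have "h ` leaf L f (f z) \<in> leaves L f" using h leaf_self[OF z] fol_iff by blast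
  then obtain t where t: "h ` leaf L f (f z) = leaf L f t" by (auto simp: leaves_def)
  moreover have "h z \<in> h ` leaf L f (f z)" using leaf_self[OF z] by blast
  ultimately show ?thesis by (simp add: leaf_def)
qed

lemma fol_value:
  assumes "h \<in> fol" "z \<in> pts L" "w \<in> pts L" "f z = f w"
  shows "f (h z) = f (h w)"
proof -
  have "h w \<in> h ` leaf L f (f z)" using leaf_self[OF assms(3)] assms(4) by auto
  then show ?thesis using fol_image_leaf[OF assms(1,2)] by (simp add: leaf_def)
qed

text \<open>Injectivity of \<open>\<phi>\<close> is what makes the image the whole leaf: the
  preimage of a point of the target leaf has the right level.\<close>

lemma leaf_preserving_image:
  assumes h: "h \<in> carrier DL" and \<phi>: "\<phi> \<in> carrier DI" and eq: "\<And>z. z \<in> pts L \<Longrightarrow> \<phi> (f z) = f (h z)" and t: "t \<in> {0..1}"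
  shows "h ` leaf L f t = leaf L f (\<phi> t)"
proof (intro subset_antisym subsetI)
  fix w assume "w \<in> h ` leaf L f t"
  then show "w \<in> leaf L f (\<phi> t)" using eq LM.Diff_D(4)[OF h] by (auto simp: leaf_def)
next
  fix w assume w: "w \<in> leaf L f (\<phi> t)"
  let ?z = "inv_into (pts L) h w"
  have z: "?z \<in> pts L" "h ?z = w" using LM.Diff_D(5,7)[OF h] w by (auto simp: leaf_def)
  then have "\<phi> (f ?z) = \<phi> t" using eq[OF z(1)] w by (simp add: leaf_def)
  moreover have "inv_into {0..1} \<phi> (\<phi> (f ?z)) = f ?z" "inv_into {0..1} \<phi> (\<phi> t) = t"
    using Int.Diff_D(6)[OF \<phi>, unfolded charts_interval(3), OF f_range[OF z(1)]]
      Int.Diff_D(6)[OF \<phi>, unfolded charts_interval(3), OF t] .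
  ultimately have "f ?z = t" by metis
  then show "w \<in> h ` leaf L f t" using z by (intro image_eqI[of _ _ ?z]) (auto simp: leaf_def)
qed

lemma folI:
  assumes h: "h \<in> carrier DL" and \<phi>: "\<phi> \<in> carrier DI" and eq: "\<And>z. z \<in> pts L \<Longrightarrow> \<phi> (f z) = f (h z)"
  shows "h \<in> fol"
  unfolding fol_iff
proof (intro conjI ballI h)
  fix l assume "l \<in> leaves L f"
  then obtain t where t: "t \<in> {0..1}" "l = leaf L f t" by (auto simp: leaves_def)
  then show "h ` l \<in> leaves L f"
    using leaf_preserving_image[OF h \<phi> eq t(1)] Int.Diff_D(4)[OF \<phi>, of t] by (auto simp: leaves_def charts_interval)
qed

text \<open>The definition speaks only of forward images of leaves. But a leaf meets the image of
  the leaf through the preimage of one of its points, and that image is a leaf, hence the same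
  one.\<close>

lemma fol_inverse:
  assumes h: "h \<in> fol"
  shows "(\<lambda>z\<in>pts L. inv_into (pts L) h z) \<in> fol"
  unfolding fol_iff
proof (intro conjI ballI)
  have hD: "h \<in> carrier DL" using h fol_Diff by blast
  show "(\<lambda>z\<in>pts L. inv_into (pts L) h z) \<in> carrier DL" by (rule LM.inverse_closed[OF hD])
  fix l assume "l \<in> leaves L f"
  then obtain t where t: "t \<in> {0..1}" "l = leaf L f t" by (auto simp: leaves_def)
  obtain z where z: "z \<in> pts L" "f z = t" by (rule f_surj[OF t(1)])
  let ?k = "inv_into (pts L) h"
  have kz: "?k z \<in> pts L" "h (?k z) = z" using LM.Diff_D(5,7)[OF hD] z by auto
  have hl: "h ` leaf L f (f (?k z)) = l" using fol_image_leaf[OF h kz(1)] kz z t by simp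
  have "(\<lambda>z\<in>pts L. ?k z) ` l = leaf L f (f (?k z))"
  proof -
    have "(\<lambda>z\<in>pts L. ?k z) ` h ` leaf L f (f (?k z)) = (\<lambda>z. z) ` leaf L f (f (?k z))"
      unfolding image_image by (rule image_cong) (use LM.Diff_D(4,6)[OF hD] in \<open>auto simp: leaf_def\<close>)
    then show ?thesis using hl by simp
  qed
  then show "(\<lambda>z\<in>pts L. ?k z) ` l \<in> leaves L f" using leaf_self[OF kz(1)] by simp
qed

text \<open>A candidate for \<open>sigma\<close>, evaluated at an arbitrarily chosen point of each
  level; it provides the existence that the definite description requires.\<close>

definition leaf_map :: "(('e0 + 'e1) set \<Rightarrow> ('e0 + 'e1) set) \<Rightarrow> real \<Rightarrow> real" where
  "leaf_map h = (\<lambda>t\<in>{0..1}. f (h (SOME z. z \<in> pts L \<and> f z = t)))"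

lemma leaf_map:
  assumes h: "h \<in> fol" and z: "z \<in> pts L"
  shows "leaf_map h (f z) = f (h z)"
proof -
  have "(SOME w. w \<in> pts L \<and> f w = f z) \<in> pts L \<and> f (SOME w. w \<in> pts L \<and> f w = f z) = f z"
    by (rule someI[of _ z]) (use z in auto)
  then show ?thesis
    using fol_value[OF h _ z] f_range[OF z] by (simp add: leaf_map_def)
qed

lemma leaf_map_smooth_map:
  assumes h: "h \<in> fol"
  shows "smooth_map unit_interval unit_interval (leaf_map h)"
proof (rule smooth_map_interval)
  have hD: "h \<in> carrier DL" using h fol_Diff by blast
  have "psmooth {0..1} (euclidean :: unit topology) (topspace euclidean \<times> {0..1}) (\<lambda>z. leaf_map h (snd z))"
    by (rule leaf_map_smooth[OF smooth_map_psmap[OF atlas_L atlas_L LM.Diff_D(2)[OF hD]]]) (simp add: leaf_map[OF h])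
  from slice_continuous(1)[OF this, of "()"] show "smooth_on {0..1} (leaf_map h)" by simp
  fix t :: real assume t: "t \<in> {0..1}"
  obtain z where z: "z \<in> pts L" "f z = t" by (rule f_surj[OF t])
  then show "leaf_map h t \<in> {0..1}"
    using leaf_map[OF h z(1)] f_range[OF LM.Diff_D(4)[OF hD z(1)]] by simp
qed

text \<open>The inverse is the leaf map of the inverse diffeomorphism, so its smoothness comes from
  the same argument and requires no inverse function theorem.\<close>

lemma leaf_map_Diff:
  assumes h: "h \<in> fol"
  shows "leaf_map h \<in> carrier DI"
proof (rule Int.DiffI)
  have hD: "h \<in> carrier DL" using h fol_Diff by blast
  let ?k = "\<lambda>z\<in>pts L. inv_into (pts L) h z"
  have k: "?k \<in> fol" by (rule fol_inverse[OF h])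
  show "smooth_map unit_interval unit_interval (leaf_map h)" by (rule leaf_map_smooth_map[OF h])
  show "smooth_map unit_interval unit_interval (leaf_map ?k)" by (rule leaf_map_smooth_map[OF k])
  show "leaf_map h \<in> extensional (pts unit_interval)" by (simp add: leaf_map_def charts_interval)
  fix t assume "t \<in> pts unit_interval"
  then have t: "t \<in> {0..1}" by (simp add: charts_interval)
  obtain z where z: "z \<in> pts L" "f z = t" by (rule f_surj[OF t])
  have p: "h z \<in> pts L" "?k z \<in> pts L" "?k (h z) = z" "h (?k z) = z"
    using LM.Diff_D(4-7)[OF hD] z by auto
  show "leaf_map ?k (leaf_map h t) = t"
    using leaf_map[OF h z(1)] leaf_map[OF k p(1)] p z by simp
  show "leaf_map h (leaf_map ?k t) = t"
    using leaf_map[OF k z(1)] leaf_map[OF h p(2)] p z by simp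
qed

text \<open>f takes every value in the interval, so the defining equation determines the
  reparametrization.\<close>

lemma sigma_eqI:
  assumes \<phi>: "\<phi> \<in> carrier DI" and eq: "\<And>z. z \<in> pts L \<Longrightarrow> \<phi> (f z) = f (h z)"
  shows "\<sigma> h = \<phi>"
  unfolding sigma_def
proof (rule the_equality)
  fix \<phi>' assume \<phi>': "\<phi>' \<in> carrier DI \<and> (\<forall>z\<in>pts L. \<phi>' (f z) = f (h z))"
  show "\<phi>' = \<phi>"
  proof (rule extensionalityI[of _ "{0..1}"])
    show "\<phi>' \<in> extensional {0..1}" "\<phi> \<in> extensional {0..1}"
      using \<phi> \<phi>' Int.Diff_D(1) by (auto simp: charts_interval)
    fix t :: real assume t: "t \<in> {0..1}"
    obtain z where "z \<in> pts L" "f z = t" by (rule f_surj[OF t])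
    then show "\<phi>' t = \<phi> t" using \<phi>' eq by force
  qed
qed (use assms in auto)

lemma sigma_fol:
  assumes h: "h \<in> fol"
  shows "\<sigma> h \<in> carrier DI" "z \<in> pts L \<Longrightarrow> \<sigma> h (f z) = f (h z)"
proof -
  have "\<sigma> h = leaf_map h" by (rule sigma_eqI[OF leaf_map_Diff[OF h] leaf_map[OF h]])
  then show "\<sigma> h \<in> carrier DI" "z \<in> pts L \<Longrightarrow> \<sigma> h (f z) = f (h z)"
    using leaf_map_Diff[OF h] leaf_map[OF h] by auto
qed

lemma sigma_id: "(\<lambda>z\<in>pts L. z) \<in> fol" "\<sigma> (\<lambda>z\<in>pts L. z) = (\<lambda>t\<in>{0..1}. t)"
proof -
  have 1: "(\<lambda>t\<in>{0..1}. t) \<in> carrier DI" using Int.one_closed by (simp add: charts_interval)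
  have eq: "(\<lambda>t\<in>{0..1}. t) (f z) = f ((\<lambda>z\<in>pts L. z) z)" if "z \<in> pts L" for z using f_range[OF that] that by simp
  show "(\<lambda>z\<in>pts L. z) \<in> fol" by (rule folI[OF LM.one_closed 1 eq])
  show "\<sigma> (\<lambda>z\<in>pts L. z) = (\<lambda>t\<in>{0..1}. t)" by (rule sigma_eqI[OF 1 eq])
qed

lemma sigma_compose:
  assumes g: "g \<in> fol" and h: "h \<in> fol"
  shows "compose (pts L) g h \<in> fol" "\<sigma> (compose (pts L) g h) = compose {0..1} (\<sigma> g) (\<sigma> h)"
proof -
  have gD: "g \<in> carrier DL" and hD: "h \<in> carrier DL" using g h fol_Diff by auto
  have 1: "compose {0..1} (\<sigma> g) (\<sigma> h) \<in> carrier DI"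
    using Int.compose_closed[OF sigma_fol(1)[OF g] sigma_fol(1)[OF h]] by (simp add: charts_interval)
  have eq: "compose {0..1} (\<sigma> g) (\<sigma> h) (f z) = f (compose (pts L) g h z)" if z: "z \<in> pts L" for z
    using sigma_fol(2)[OF h z] sigma_fol(2)[OF g LM.Diff_D(4)[OF hD z]] f_range[OF z] z by (simp add: compose_def)
  show "compose (pts L) g h \<in> fol" by (rule folI[OF LM.compose_closed[OF gD hD] 1 eq])
  show "\<sigma> (compose (pts L) g h) = compose {0..1} (\<sigma> g) (\<sigma> h)" by (rule sigma_eqI[OF 1 eq])
qed

lemma sigma_inverse:
  assumes h: "h \<in> fol"
  shows "\<sigma> (\<lambda>z\<in>pts L. inv_into (pts L) h z) = (\<lambda>t\<in>{0..1}. inv_into {0..1} (\<sigma> h) t)"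
proof (rule sigma_eqI)
  have hD: "h \<in> carrier DL" using h fol_Diff by blast
  show "(\<lambda>t\<in>{0..1}. inv_into {0..1} (\<sigma> h) t) \<in> carrier DI"
    using Int.inverse_closed[OF sigma_fol(1)[OF h]] by (simp add: charts_interval)
  fix z assume z: "z \<in> pts L"
  let ?w = "inv_into (pts L) h z"
  have w: "?w \<in> pts L" "h ?w = z" using LM.Diff_D(5,7)[OF hD z] by auto
  have "f z = \<sigma> h (f ?w)" using sigma_fol(2)[OF h w(1)] w(2) by simp
  then have "inv_into {0..1} (\<sigma> h) (f z) = f ?w"
    using Int.Diff_D(6)[OF sigma_fol(1)[OF h], of "f ?w"] f_range[OF w(1)] by (simp add: charts_interval)
  then show "(\<lambda>t\<in>{0..1}. inv_into {0..1} (\<sigma> h) t) (f z) = f ((\<lambda>z\<in>pts L. inv_into (pts L) h z) z)"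
    using z f_range[OF z] by simp
qed

text \<open>\<open>leaf_map_smooth\<close> is applied to the tautological family over a subspace of
  the group. Thus the smoothness of each \<open>\<sigma> h\<close> and the continuous dependence on
  h come out together, and continuity of \<open>\<sigma>\<close> follows by the exponential
  law.\<close>

lemma psmap_sigma:
  assumes "P \<subseteq> fol"
  shows "psmooth {0..1} (subtopology (gtop DL) P) (topspace (subtopology (gtop DL) P) \<times> {0..1}) (\<lambda>z. \<sigma> (fst z) (snd z))"
    and "psmap {0..1} (subtopology (gtop DL) P) unit_interval unit_interval \<sigma>"
proof -
  have PD: "P \<subseteq> carrier DL" using assms fol_Diff by blast
  have tp: "topspace (subtopology (gtop DL) P) = P" by (rule LM.topspace_Diff[OF PD])
  show 1: "psmooth {0..1} (subtopology (gtop DL) P) (topspace (subtopology (gtop DL) P) \<times> {0..1}) (\<lambda>z. \<sigma> (fst z) (snd z))"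
    by (rule leaf_map_smooth[OF LM.psmap_Diff[OF PD]]) (use assms sigma_fol(2) in \<open>auto simp: tp\<close>)
  show "psmap {0..1} (subtopology (gtop DL) P) unit_interval unit_interval \<sigma>"
  proof (rule psmap_interval[OF 1])
    fix h and t :: real assume "h \<in> topspace (subtopology (gtop DL) P)" "t \<in> {0..1}"
    then show "\<sigma> h t \<in> {0..1}"
      using Int.Diff_D(4)[OF sigma_fol(1), of h t] assms by (auto simp: tp charts_interval)
  qed
qed

lemma S_R_eq: "S_R L f = tsubgroup DL {h \<in> fol. \<sigma> h = (\<lambda>t\<in>{0..1}. t)}"
  and D_lp_eq: "D_lp L (leaves L f) = S_R L f"
proof -
  have 1: "(\<lambda>t\<in>{0..1}. t) \<in> carrier DI" using Int.one_closed by (simp add: charts_interval)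
  have "{h \<in> carrier DL. \<forall>z\<in>pts L. f (h z) = f z} = {h \<in> fol. \<sigma> h = (\<lambda>t\<in>{0..1}. t)}"
  proof (intro subset_antisym subsetI)
    fix h assume h: "h \<in> {h \<in> carrier DL. \<forall>z\<in>pts L. f (h z) = f z}"
    then have eq: "(\<lambda>t\<in>{0..1}. t) (f z) = f (h z)" if "z \<in> pts L" for z using f_range[OF that] that by simp
    have "h \<in> fol" by (rule folI[OF _ 1 eq]) (use h in blast)
    moreover have "\<sigma> h = (\<lambda>t\<in>{0..1}. t)" by (rule sigma_eqI[OF 1 eq])
    ultimately show "h \<in> {h \<in> fol. \<sigma> h = (\<lambda>t\<in>{0..1}. t)}" by blast
  next
    fix h assume h: "h \<in> {h \<in> fol. \<sigma> h = (\<lambda>t\<in>{0..1}. t)}"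
    then have "f (h z) = f z" if "z \<in> pts L" for z using sigma_fol(2)[of h z] f_range[OF that] that by auto
    then show "h \<in> {h \<in> carrier DL. \<forall>z\<in>pts L. f (h z) = f z}" using h fol_Diff by auto
  qed
  then show "S_R L f = tsubgroup DL {h \<in> fol. \<sigma> h = (\<lambda>t\<in>{0..1}. t)}" by (simp add: S_R_def)
  have "{h \<in> carrier DL. \<forall>l\<in>leaves L f. h ` l = l} = {h \<in> carrier DL. \<forall>z\<in>pts L. f (h z) = f z}"
  proof (intro subset_antisym subsetI)
    fix h assume h: "h \<in> {h \<in> carrier DL. \<forall>l\<in>leaves L f. h ` l = l}"
    have "f (h z) = f z" if z: "z \<in> pts L" for z
    proof -
      have "h ` leaf L f (f z) = leaf L f (f z)" using h leaf_self[OF z] by blast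
      then have "h z \<in> leaf L f (f z)" using leaf_self[OF z] by blast
      then show ?thesis by (simp add: leaf_def)
    qed
    then show "h \<in> {h \<in> carrier DL. \<forall>z\<in>pts L. f (h z) = f z}" using h by simp
  next
    fix h assume h: "h \<in> {h \<in> carrier DL. \<forall>z\<in>pts L. f (h z) = f z}"
    then have eq: "(\<lambda>t\<in>{0..1}. t) (f z) = f (h z)" if "z \<in> pts L" for z using f_range[OF that] that by simp
    have "h ` l = l" if "l \<in> leaves L f" for l
      using leaf_preserving_image[OF _ 1 eq] h that by (force simp: leaves_def)
    then show "h \<in> {h \<in> carrier DL. \<forall>l\<in>leaves L f. h ` l = l}" using h by simp
  qed
  then show "D_lp L (leaves L f) = S_R L f" by (simp add: D_lp_def S_R_def)
qed

lemma S_LR_iff: "(\<phi>, h) \<in> carrier (S_LR L f) \<longleftrightarrow> h \<in> fol \<and> \<phi> = \<sigma> h"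
proof
  assume "(\<phi>, h) \<in> carrier (S_LR L f)"
  then have *: "\<phi> \<in> carrier DI" "h \<in> carrier DL" "\<And>z. z \<in> pts L \<Longrightarrow> \<phi> (f z) = f (h z)" by (auto simp: S_LR_def)
  show "h \<in> fol \<and> \<phi> = \<sigma> h" using folI[OF *(2,1,3)] sigma_eqI[OF *(1,3)] by auto
next
  assume "h \<in> fol \<and> \<phi> = \<sigma> h"
  then show "(\<phi>, h) \<in> carrier (S_LR L f)" using sigma_fol fol_Diff by (auto simp: S_LR_def)
qed

text \<open>For a subgroup \<open>K\<close> of the diffeomorphism group of the interval, \<open>\<sigma>\<close> restricted to the
  preimage of \<open>K\<close>; both sequences of the theorem are instances.\<close>

context
  fixes K assumes K: "subgroup K DI"
begin

definition "Pre = {h \<in> fol. \<sigma> h \<in> K}"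
definition "Graph = {(\<phi>, h). h \<in> Pre \<and> \<phi> = \<sigma> h}"

lemma K_sub: "K \<subseteq> carrier DI"
  using subgroup.subset[OF K] .

lemma Pre_fol: "Pre \<subseteq> fol" and Pre_Diff: "Pre \<subseteq> carrier DL"
  using fol_Diff by (auto simp: Pre_def)

lemma one_K: "(\<lambda>t\<in>{0..1}. t) \<in> K"
  using subgroup.one_closed[OF K] by (simp add: Int.one_Diff charts_interval)

lemma subgroup_Pre: "subgroup Pre DL"
proof (rule LM.subgroup_DiffI[OF Pre_Diff])
  show "(\<lambda>x\<in>pts L. x) \<in> Pre" using sigma_id one_K by (simp add: Pre_def)
  show "compose (pts L) g h \<in> Pre" if "g \<in> Pre" "h \<in> Pre" for g h
  proof -
    have gh: "g \<in> fol" "h \<in> fol" "\<sigma> g \<in> K" "\<sigma> h \<in> K" using that by (auto simp: Pre_def)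
    have "compose {0..1} (\<sigma> g) (\<sigma> h) \<in> K"
      using subgroup.m_closed[OF K gh(3,4)] Int.mult_Diff[OF sigma_fol(1)[OF gh(1)] sigma_fol(1)[OF gh(2)]]
      by (simp add: charts_interval)
    then show ?thesis using sigma_compose[OF gh(1,2)] by (simp add: Pre_def)
  qed
  show "(\<lambda>x\<in>pts L. inv_into (pts L) h x) \<in> Pre" if "h \<in> Pre" for h
  proof -
    have h: "h \<in> fol" "\<sigma> h \<in> K" using that by (auto simp: Pre_def)
    have "(\<lambda>t\<in>{0..1}. inv_into {0..1} (\<sigma> h) t) \<in> K"
      using subgroup.m_inv_closed[OF K h(2)] Int.inv_Diff[OF sigma_fol(1)[OF h(1)]] by (simp add: charts_interval)
    then show ?thesis using fol_inverse[OF h(1)] sigma_inverse[OF h(1)] by (simp add: Pre_def)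
  qed
qed

lemma mult_Pre: "g \<in> Pre \<Longrightarrow> h \<in> Pre \<Longrightarrow> mult DL g h \<in> Pre \<and> \<sigma> (mult DL g h) = mult DI (\<sigma> g) (\<sigma> h)"
proof -
  assume g: "g \<in> Pre" and h: "h \<in> Pre"
  then have gh: "g \<in> fol" "h \<in> fol" and D: "g \<in> carrier DL" "h \<in> carrier DL"
    using Pre_fol Pre_Diff by auto
  show "mult DL g h \<in> Pre \<and> \<sigma> (mult DL g h) = mult DI (\<sigma> g) (\<sigma> h)"
    using subgroup.m_closed[OF subgroup_Pre g h] sigma_compose(2)[OF gh] LM.mult_Diff[OF D]
      Int.mult_Diff[OF sigma_fol(1)[OF gh(1)] sigma_fol(1)[OF gh(2)]] by (simp add: charts_interval)
qed

lemma subgroup_Graph: "subgroup Graph (tprod DI DL)"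
proof (rule group.subgroupI[OF group_tprod[OF Int.group_Diff LM.group_Diff]])
  show "Graph \<subseteq> carrier (tprod DI DL)"
    using Pre_fol Pre_Diff sigma_fol(1) by (auto simp: Graph_def)
  show "Graph \<noteq> {}"
    using subgroup.one_closed[OF subgroup_Pre] by (auto simp: Graph_def)
  show "inv\<^bsub>tprod DI DL\<^esub> a \<in> Graph" if "a \<in> Graph" for a
  proof -
    obtain h where h: "a = (\<sigma> h, h)" "h \<in> Pre" using \<open>a \<in> Graph\<close> by (auto simp: Graph_def)
    have hf: "h \<in> fol" and hD: "h \<in> carrier DL" using h Pre_fol Pre_Diff by auto
    have "inv\<^bsub>tprod DI DL\<^esub> a = (inv\<^bsub>DI\<^esub> (\<sigma> h), inv\<^bsub>DL\<^esub> h)"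
      unfolding h(1) by (rule inv_tprod[OF Int.group_Diff LM.group_Diff sigma_fol(1)[OF hf] hD])
    moreover have "inv\<^bsub>DL\<^esub> h \<in> Pre" by (rule subgroup.m_inv_closed[OF subgroup_Pre h(2)])
    moreover have "inv\<^bsub>DI\<^esub> (\<sigma> h) = \<sigma> (inv\<^bsub>DL\<^esub> h)"
      using Int.inv_Diff[OF sigma_fol(1)[OF hf]] LM.inv_Diff[OF hD] sigma_inverse[OF hf] by (simp add: charts_interval)
    ultimately show ?thesis by (simp add: Graph_def)
  qed
  show "a \<otimes>\<^bsub>tprod DI DL\<^esub> b \<in> Graph" if "a \<in> Graph" "b \<in> Graph" for a b
    using that mult_Pre by (auto simp: Graph_def)
qed

lemma hom_snd: "snd \<in> hom (tsubgroup (tprod DI DL) Graph) (tsubgroup DL Pre)"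
  and hom_fst: "fst \<in> hom (tsubgroup (tprod DI DL) Graph) (tsubgroup DI K)"
  and hom_sigma: "\<sigma> \<in> hom (tsubgroup DL Pre) (tsubgroup DI K)"
  and hom_pair: "(\<lambda>h. (\<sigma> h, h)) \<in> hom (tsubgroup DL Pre) (tsubgroup (tprod DI DL) Graph)"
  using mult_Pre by (auto simp: hom_def Graph_def Pre_def)

lemma continuous_sigma: "continuous_map (gtop (tsubgroup DL Pre)) (gtop (tsubgroup DI K)) \<sigma>"
  using Int.continuous_into_Diff[OF K_sub psmap_sigma(2)[OF Pre_fol]] LM.topspace_Diff[OF Pre_Diff]
  by (simp add: Pre_def)

lemma topspace_Graph: "topspace (gtop (tsubgroup (tprod DI DL) Graph)) = Graph"
proof -
  have "topspace (gtop DI) = carrier DI"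
    using Int.topspace_Diff[OF subset_refl] by (simp add: Diff_def subtopology_subtopology)
  moreover have "topspace (gtop DL) = carrier DL"
    using LM.topspace_Diff[OF subset_refl] by (simp add: Diff_def subtopology_subtopology)
  ultimately show ?thesis
    using Pre_fol Pre_Diff sigma_fol(1) by (auto simp: Graph_def)
qed

text \<open>The inverse has the components \<open>\<sigma>\<close> and the identity, so its
  continuity is the continuity of \<open>\<sigma>\<close>.\<close>

lemma homeomorphic_snd:
  "homeomorphic_maps (gtop (tsubgroup (tprod DI DL) Graph)) (gtop (tsubgroup DL Pre)) snd (\<lambda>h. (\<sigma> h, h))"
  unfolding homeomorphic_maps_def
proof (intro conjI)
  have tG: "topspace (subtopology (prod_topology (gtop DI) (gtop DL)) Graph) = Graph"
    using topspace_Graph by simp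
  have tP: "topspace (subtopology (gtop DL) Pre) = Pre" by (rule LM.topspace_Diff[OF Pre_Diff])
  show "continuous_map (gtop (tsubgroup (tprod DI DL) Graph)) (gtop (tsubgroup DL Pre)) snd"
    unfolding tsubgroup_simps tprod_simps
  proof (rule continuous_map_into_subtopology)
    show "continuous_map (subtopology (prod_topology (gtop DI) (gtop DL)) Graph) (gtop DL) snd"
      by (rule continuous_map_from_subtopology[OF continuous_map_snd])
    show "snd \<in> topspace (subtopology (prod_topology (gtop DI) (gtop DL)) Graph) \<rightarrow> Pre"
      unfolding tG by (auto simp: Graph_def)
  qed
  have "continuous_map (gtop (tsubgroup DL Pre)) (gtop DI) \<sigma>"
    using continuous_sigma by (simp add: continuous_map_in_subtopology)
  then have "continuous_map (subtopology (gtop DL) Pre) (prod_topology (gtop DI) (gtop DL)) (\<lambda>h. (\<sigma> h, h))"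
    using continuous_map_from_subtopology[OF continuous_map_id, of "gtop DL" Pre]
    by (simp add: continuous_map_pairwise o_def id_def)
  then show "continuous_map (gtop (tsubgroup DL Pre)) (gtop (tsubgroup (tprod DI DL) Graph)) (\<lambda>h. (\<sigma> h, h))"
    unfolding tsubgroup_simps tprod_simps
  proof (rule continuous_map_into_subtopology)
    show "(\<lambda>h. (\<sigma> h, h)) \<in> topspace (subtopology (gtop DL) Pre) \<rightarrow> Graph"
      unfolding tP by (auto simp: Graph_def)
  qed
  show "\<forall>x\<in>topspace (gtop (tsubgroup (tprod DI DL) Graph)). (\<sigma> (snd x), snd x) = x"
    unfolding topspace_Graph by (auto simp: Graph_def)
qed simp

lemma snd_tgroup_hom: "tgroup_hom (tsubgroup (tprod DI DL) Graph) (tsubgroup DL Pre) snd"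
  using hom_snd homeomorphic_snd by (simp add: tgroup_hom_def homeomorphic_maps_def)

lemma isomorphisms_snd:
  "tgroup_isomorphisms (tsubgroup (tprod DI DL) Graph) (tsubgroup DL Pre) snd (\<lambda>h. (\<sigma> h, h))"
  unfolding tgroup_isomorphisms_def group_isomorphisms_def
  using hom_snd hom_pair homeomorphic_snd by (auto simp: Graph_def)

lemma kernel_eq: "{h \<in> Pre. \<sigma> h = (\<lambda>t\<in>{0..1}. t)} = {h \<in> fol. \<sigma> h = (\<lambda>t\<in>{0..1}. t)}"
  using one_K by (auto simp: Pre_def)

text \<open>Surjectivity is the only ingredient that is not uniform in \<open>K\<close>: it comes
  from \<open>\<theta>\<close> in the orientation preserving case and from an end-swapping
  diffeomorphism in the full one.\<close>

lemma ses_isomorphism_snd: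
  assumes surj: "K \<subseteq> \<sigma> ` Pre"
  shows "ses_isomorphism (\<lambda>h. h) snd (\<lambda>\<phi>. \<phi>)
     (S_R L f) (\<lambda>h. ((\<lambda>t\<in>{0..1}. t), h)) (tsubgroup (tprod DI DL) Graph) fst (tsubgroup DI K)
     (S_R L f) (\<lambda>h. h) (tsubgroup DL Pre) \<sigma> (tsubgroup DI K)"
proof -
  let ?i = "(\<lambda>t\<in>{0..1}. t) :: real \<Rightarrow> real" and ?G = "tsubgroup (tprod DI DL) Graph" and ?F = "tsubgroup DL Pre" and ?K = "tsubgroup DI K"
  let ?R = "{h \<in> fol. \<sigma> h = ?i}"
  have SR: "S_R L f = tsubgroup DL ?R" by (rule S_R_eq)
  have RP: "?R \<subseteq> Pre" using one_K by (auto simp: Pre_def)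
  have gF: "group ?F" by (rule group_tsubgroup[OF LM.group_Diff subgroup_Pre])
  have gG: "group ?G" by (rule group_tsubgroup[OF group_tprod[OF Int.group_Diff LM.group_Diff] subgroup_Graph])
  have gK: "group ?K" by (rule group_tsubgroup[OF Int.group_Diff K])
  have gh: "group_hom ?F ?K \<sigma>" using gF gK hom_sigma by (simp add: group_hom_def group_hom_axioms_def)
  \<comment> \<open>Every subgroup contains the identity, so the kernel is the same group for each
    choice of \<open>K\<close>.\<close>
  have "kernel ?F ?K \<sigma> = ?R" using kernel_eq by (auto simp: kernel_def Int.one_Diff charts_interval)
  then have sR: "subgroup ?R ?F" using group_hom.subgroup_kernel[OF gh] by simp
  have "group (tsubgroup ?F ?R)" by (rule group_tsubgroup[OF gF sR])
  then have gR: "group (S_R L f)" unfolding SR using tsubgroup_tsubgroup[OF RP, of DL] by simp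
  have ii: "mult DI ?i ?i = ?i"
    using monoid.l_one[OF group.is_monoid[OF Int.group_Diff], of ?i] Int.one_closed by (simp add: Int.one_Diff charts_interval)
  have ti: "topspace (gtop DI) = carrier DI"
    using Int.topspace_Diff[OF subset_refl] by (simp add: Diff_def subtopology_subtopology)
  have iD: "?i \<in> carrier DI" using Int.one_closed by (simp add: charts_interval)
  have tR: "topspace (subtopology (gtop DL) ?R) = ?R"
    by (rule LM.topspace_Diff) (use RP Pre_Diff in blast)
  have cR: "continuous_map (subtopology (gtop DL) ?R) (gtop DL) (\<lambda>h. h)"
    using continuous_map_from_subtopology[OF continuous_map_id, of "gtop DL" ?R] by (simp add: id_def)
  have multR: "mult DL g h \<in> ?R" if "g \<in> ?R" "h \<in> ?R" for g h
    using subgroup.m_closed[OF sR that] by simp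
  have j: "tgroup_hom (S_R L f) ?G (\<lambda>h. (?i, h))"
    unfolding tgroup_hom_def SR
  proof
    show "(\<lambda>h. (?i, h)) \<in> hom (tsubgroup DL ?R) ?G"
      using ii RP multR by (auto simp: hom_def Graph_def)
    have "continuous_map (subtopology (gtop DL) ?R) (gtop DI) (\<lambda>_. ?i)"
      using iD ti by simp
    with cR have "continuous_map (subtopology (gtop DL) ?R) (prod_topology (gtop DI) (gtop DL)) (\<lambda>h. (?i, h))"
      by (simp add: continuous_map_pairwise o_def)
    then show "continuous_map (gtop (tsubgroup DL ?R)) (gtop ?G) (\<lambda>h. (?i, h))"
      unfolding tsubgroup_simps tprod_simps
    proof (rule continuous_map_into_subtopology)
      show "(\<lambda>h. (?i, h)) \<in> topspace (subtopology (gtop DL) ?R) \<rightarrow> Graph"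
        unfolding tR using RP by (auto simp: Graph_def)
    qed
  qed
  have incl: "tgroup_hom (S_R L f) ?F (\<lambda>h. h)"
    unfolding tgroup_hom_def SR
  proof
    show "(\<lambda>h. h) \<in> hom (tsubgroup DL ?R) ?F" using RP by (auto simp: hom_def)
    show "continuous_map (gtop (tsubgroup DL ?R)) (gtop ?F) (\<lambda>h. h)"
      unfolding tsubgroup_simps
      by (rule continuous_map_into_subtopology[OF cR]) (unfold tR, use RP in auto)
  qed
  have tG: "topspace (subtopology (prod_topology (gtop DI) (gtop DL)) Graph) = Graph"
    using topspace_Graph by simp
  have q: "tgroup_hom ?G ?K fst"
    unfolding tgroup_hom_def
  proof
    show "continuous_map (gtop ?G) (gtop ?K) fst"
      unfolding tsubgroup_simps tprod_simps
    proof (rule continuous_map_into_subtopology)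
      show "continuous_map (subtopology (prod_topology (gtop DI) (gtop DL)) Graph) (gtop DI) fst"
        by (rule continuous_map_from_subtopology[OF continuous_map_fst])
      show "fst \<in> topspace (subtopology (prod_topology (gtop DI) (gtop DL)) Graph) \<rightarrow> K"
        unfolding tG by (auto simp: Graph_def Pre_def)
    qed
  qed (rule hom_fst)
  have s: "tgroup_hom ?F ?K \<sigma>" using hom_sigma continuous_sigma by (simp add: tgroup_hom_def)
  have k: "carrier (S_R L f) = ?R" unfolding SR by simp
  have "tgroup_ses (S_R L f) (\<lambda>h. (?i, h)) ?G fst ?K"
    unfolding tgroup_ses_def
  proof (intro conjI gR gG gK j q)
    show "(\<lambda>h. (?i, h)) \<in> mon (S_R L f) ?G"
      using j by (auto simp: mon_def tgroup_hom_def inj_on_def)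
    show "fst \<in> epi ?G ?K"
      using hom_fst surj by (force simp: epi_def Graph_def Pre_def image_iff)
    show "(\<lambda>h. (?i, h)) ` carrier (S_R L f) = kernel ?G ?K fst"
      unfolding k using RP by (auto simp: kernel_def Graph_def Int.one_Diff charts_interval Pre_def)
  qed
  moreover have "tgroup_ses (S_R L f) (\<lambda>h. h) ?F \<sigma> ?K"
    unfolding tgroup_ses_def
  proof (intro conjI gR gF gK incl s)
    show "(\<lambda>h. h) \<in> mon (S_R L f) ?F"
      using incl by (auto simp: mon_def tgroup_hom_def)
    show "\<sigma> \<in> epi ?F ?K"
      using hom_sigma surj by (auto simp: epi_def Pre_def)
    show "(\<lambda>h. h) ` carrier (S_R L f) = kernel ?F ?K \<sigma>"
      unfolding k \<open>kernel ?F ?K \<sigma> = ?R\<close> by simp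
  qed
  moreover have "tgroup_iso ?G ?F snd"
    using isomorphisms_snd unfolding tgroup_iso_def tgroup_isomorphisms_def homeomorphic_map_maps
    using group_isomorphisms_imp_iso by blast
  ultimately show ?thesis
    unfolding ses_isomorphism_def k by (auto simp: Graph_def tgroup_iso_identity)
qed

end

end

section \<open>The section and the deformation\<close>

lemma radial_factors_cong:
  assumes "radial_factors \<phi> g0 g1" "\<And>t. t \<in> {0..1} \<Longrightarrow> \<phi> t = \<eta> t"
  shows "radial_factors \<eta> g0 g1"
  unfolding radial_factors_def
proof
  fix t :: real assume t: "t \<in> {0..1}"
  then have "1 - t \<in> {0..1}" by auto
  then show "g0 t > 0 \<and> g1 t > 0 \<and> \<eta> t = t * g0 t \<and> 1 - \<eta> (1 - t) = t * g1 t"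
    using radial_factorsD(1-4)[OF assms(1) t] assms(2)[OF t] assms(2)[of "1 - t"] by simp
qed

lemma radial_factors_exist:
  assumes "\<phi> \<in> carrier Diff_interval_plus"
  obtains g0 g1 where "radial_factors \<phi> g0 g1" "smooth_on {0..1} g0" "smooth_on {0..1} g1"
proof -
  have \<phi>: "smooth_on {0..1} \<phi>" "increasing_diffeo \<phi>" using assms pos_diffeo_iff by auto
  have "psmooth {0..1} (euclidean :: unit topology) (topspace euclidean \<times> {0..1}) (\<lambda>z. \<phi> (snd z))"
    by (rule smooth_on_psmooth[OF \<phi>(1) fat_unit_interval]) simp
  then obtain G0 G1 where G: "psmooth {0..1} (euclidean :: unit topology) (topspace euclidean \<times> {0..1}) G0"
      "psmooth {0..1} (euclidean :: unit topology) (topspace euclidean \<times> {0..1}) G1"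
    and rad: "\<And>p. p \<in> topspace (euclidean :: unit topology) \<Longrightarrow>
      radial_factors (\<lambda>t. \<phi> (snd (p, t))) (\<lambda>t. G0 (p, t)) (\<lambda>t. G1 (p, t))"
    by (rule radial_factors_family) (use \<phi>(2) in auto)
  show thesis
    by (rule that[of "\<lambda>t. G0 ((), t)" "\<lambda>t. G1 ((), t)"])
      (use rad[of "()"] slice_continuous(1)[OF G(1), of "()"] slice_continuous(1)[OF G(2), of "()"] in auto)
qed

lemma Diff_interval_plusD:
  assumes \<phi>: "\<phi> \<in> carrier Diff_interval_plus"
  shows "\<phi> \<in> carrier (Diff unit_interval)" "smooth_on {0..1} \<phi>" "increasing_diffeo \<phi>"
    "(\<lambda>t\<in>{0..1}. inv_into {0..1} \<phi> t) \<in> carrier Diff_interval_plus"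
    "\<And>t. t \<in> {0..1} \<Longrightarrow> \<phi> (inv_into {0..1} \<phi> t) = t"
    "\<And>t. t \<in> {0..1} \<Longrightarrow> inv_into {0..1} \<phi> (\<phi> t) = t"
    "\<And>t. t \<in> {0..1} \<Longrightarrow> inv_into {0..1} \<phi> t \<in> {0..1}"
    "\<And>t. t \<in> {0..1} \<Longrightarrow> \<phi> t \<in> {0..1}"
proof -
  show D: "\<phi> \<in> carrier (Diff unit_interval)" using \<phi> subgroup.subset[OF subgroup_Diff_interval_plus] by blast
  show "smooth_on {0..1} \<phi>" "increasing_diffeo \<phi>" using \<phi> pos_diffeo_iff by auto
  show "(\<lambda>t\<in>{0..1}. inv_into {0..1} \<phi> t) \<in> carrier Diff_interval_plus"
    using subgroup.m_inv_closed[OF subgroup_Diff_interval_plus \<phi>] Int.inv_Diff[OF D] by (simp add: charts_interval)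
  show "\<And>t. t \<in> {0..1} \<Longrightarrow> \<phi> (inv_into {0..1} \<phi> t) = t"
    "\<And>t. t \<in> {0..1} \<Longrightarrow> inv_into {0..1} \<phi> (\<phi> t) = t"
    "\<And>t. t \<in> {0..1} \<Longrightarrow> inv_into {0..1} \<phi> t \<in> {0..1}"
    "\<And>t. t \<in> {0..1} \<Longrightarrow> \<phi> t \<in> {0..1}"
    using Int.Diff_D(4-7)[OF D, unfolded charts_interval(3)] by blast+
qed

context glued_bundles
begin

lemma radial_smooth_map:
  assumes rad: "radial_factors \<phi> g0 g1" and g: "smooth_on {0..1} g0" "smooth_on {0..1} g1"
  shows "smooth_map L L (radial g0 g1)"
proof -
  have G: "psmooth {0..1} (euclidean :: unit topology) (topspace euclidean \<times> {0..1}) (\<lambda>z. g0 (snd z))"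
    "psmooth {0..1} (euclidean :: unit topology) (topspace euclidean \<times> {0..1}) (\<lambda>z. g1 (snd z))"
    by (rule smooth_on_psmooth[OF g(1) fat_unit_interval] smooth_on_psmooth[OF g(2) fat_unit_interval]; simp)+
  have "psmap UNIV (euclidean :: unit topology) L L (\<lambda>p. radial (\<lambda>t. g0 (snd (p, t))) (\<lambda>t. g1 (snd (p, t))))"
    by (rule psmap_radial[OF G, where \<phi> = "\<lambda>_. \<phi>"]) (use rad in simp)
  from psmap_smooth_map[OF atlas_L atlas_L findim_euclidean findim_euclidean this, of "()"]
  show ?thesis by simp
qed

text \<open>By \<open>radial_compose\<close> the radial map of the inverse reparametrization is the
  inverse, and it is smooth for the same reason as the map itself.\<close>

lemma radial_Diff:
  assumes \<phi>: "\<phi> \<in> carrier DP" and rad: "radial_factors \<phi> g0 g1"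
    and g: "smooth_on {0..1} g0" "smooth_on {0..1} g1"
  shows "radial g0 g1 \<in> carrier DL"
proof -
  let ?i = "inv_into {0..1} \<phi>"
  note \<phi>D = Diff_interval_plusD[OF \<phi>]
  obtain h0 h1 where h: "radial_factors (\<lambda>t\<in>{0..1}. ?i t) h0 h1" "smooth_on {0..1} h0" "smooth_on {0..1} h1"
    by (rule radial_factors_exist[OF \<phi>D(4)])
  have i: "radial_factors ?i h0 h1" by (rule radial_factors_cong[OF h(1)]) simp
  have one: "radial_factors (\<lambda>t. t) (\<lambda>_. 1) (\<lambda>_. 1)" by (simp add: radial_factors_def)
  show ?thesis
  proof (rule LM.DiffI[OF radial_extensional radial_smooth_map[OF rad g] radial_smooth_map[OF i h(2,3)]])
    fix z assume z: "z \<in> pts L"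
    show "radial h0 h1 (radial g0 g1 z) = z"
      using radial_compose[OF i rad one \<phi>D(6) z] radial_id[OF z] by simp
    show "radial g0 g1 (radial h0 h1 z) = z"
      using radial_compose[OF rad i one \<phi>D(5) z] radial_id[OF z] by simp
  qed
qed

text \<open>Both definite descriptions, that of the factors and that of \<open>theta\<close> itself,
  are evaluated here; from this point on \<open>\<theta>\<close> is handled through explicit radial
  maps.\<close>

lemma theta_eq_radial:
  assumes \<phi>: "\<phi> \<in> carrier DP" and rad: "radial_factors \<phi> g0 g1"
    and g: "smooth_on {0..1} g0" "smooth_on {0..1} g1"
  shows "\<theta> \<phi> = radial g0 g1"
proof -
  have t0: "theta_factor \<phi> (f0 x) = g0 (f0 x)" if "x \<in> pts F0.U" for x
    by (rule theta_factor_eq[OF g(1)])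
      (use radial_factorsD(1,3)[OF rad] that F0.f_nonneg in \<open>auto simp: F0.pts_U\<close>)
  have t1: "theta_factor (\<lambda>t. 1 - \<phi> (1 - t)) (f1 y) = g1 (f1 y)" if "y \<in> pts F1.U" for y
    by (rule theta_factor_eq[OF g(2)])
      (use radial_factorsD(2,4)[OF rad] that F1.f_nonneg in \<open>auto simp: F1.pts_U\<close>)
  show ?thesis
    unfolding theta_def F0.U_def[symmetric] F1.U_def[symmetric]
  proof (rule the_equality)
    show "radial g0 g1 \<in> carrier DL \<and>
      (\<forall>x\<in>pts F0.U. radial g0 g1 (e0 x) = e0 (F0.s (sqrt (theta_factor \<phi> (f0 x))) x)) \<and>
      (\<forall>y\<in>pts F1.U. radial g0 g1 (e1 y) = e1 (F1.s (sqrt (theta_factor (\<lambda>t. 1 - \<phi> (1 - t)) (f1 y))) y))"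
      using radial_Diff[OF \<phi> rad g] radial_e0[OF rad] radial_e1[OF rad] by (simp add: t0 t1)
    fix h assume h: "h \<in> carrier DL \<and>
      (\<forall>x\<in>pts F0.U. h (e0 x) = e0 (F0.s (sqrt (theta_factor \<phi> (f0 x))) x)) \<and>
      (\<forall>y\<in>pts F1.U. h (e1 y) = e1 (F1.s (sqrt (theta_factor (\<lambda>t. 1 - \<phi> (1 - t)) (f1 y))) y))"
    then have hD: "h \<in> carrier DL" by blast
    show "h = radial g0 g1"
      by (rule radial_unique[OF rad LM.Diff_D(1)[OF hD]]) (use h in \<open>simp_all add: t0 t1\<close>)
  qed
qed

lemma theta_Diff:
  assumes \<phi>: "\<phi> \<in> carrier DP"
  shows "\<theta> \<phi> \<in> carrier DL" "z \<in> pts L \<Longrightarrow> f (\<theta> \<phi> z) = \<phi> (f z)"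
proof -
  obtain g0 g1 where g: "radial_factors \<phi> g0 g1" "smooth_on {0..1} g0" "smooth_on {0..1} g1"
    by (rule radial_factors_exist[OF \<phi>])
  show "\<theta> \<phi> \<in> carrier DL" "z \<in> pts L \<Longrightarrow> f (\<theta> \<phi> z) = \<phi> (f z)"
    unfolding theta_eq_radial[OF \<phi> g] using radial_Diff[OF \<phi> g] radial_pts[OF g(1)] by auto
qed

lemma theta_fol:
  assumes \<phi>: "\<phi> \<in> carrier DP"
  shows "\<theta> \<phi> \<in> fol" "\<sigma> (\<theta> \<phi>) = \<phi>"
  using folI[OF theta_Diff(1)[OF \<phi>] Diff_interval_plusD(1)[OF \<phi>]]
    sigma_eqI[OF Diff_interval_plusD(1)[OF \<phi>]] theta_Diff(2)[OF \<phi>] by auto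

lemma theta_compose:
  assumes \<phi>: "\<phi> \<in> carrier DP" and \<eta>: "\<eta> \<in> carrier DP"
  shows "compose {0..1} \<phi> \<eta> \<in> carrier DP" "\<theta> (compose {0..1} \<phi> \<eta>) = compose (pts L) (\<theta> \<phi>) (\<theta> \<eta>)"
proof -
  show c: "compose {0..1} \<phi> \<eta> \<in> carrier DP"
    using subgroup.m_closed[OF subgroup_Diff_interval_plus \<phi> \<eta>]
      Int.mult_Diff[OF Diff_interval_plusD(1)[OF \<phi>] Diff_interval_plusD(1)[OF \<eta>]] by (simp add: charts_interval)
  obtain g0 g1 where g: "radial_factors \<phi> g0 g1" "smooth_on {0..1} g0" "smooth_on {0..1} g1"
    by (rule radial_factors_exist[OF \<phi>])
  obtain h0 h1 where h: "radial_factors \<eta> h0 h1" "smooth_on {0..1} h0" "smooth_on {0..1} h1"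
    by (rule radial_factors_exist[OF \<eta>])
  obtain k0 k1 where k: "radial_factors (compose {0..1} \<phi> \<eta>) k0 k1" "smooth_on {0..1} k0" "smooth_on {0..1} k1"
    by (rule radial_factors_exist[OF c])
  show "\<theta> (compose {0..1} \<phi> \<eta>) = compose (pts L) (\<theta> \<phi>) (\<theta> \<eta>)"
    unfolding theta_eq_radial[OF \<phi> g] theta_eq_radial[OF \<eta> h] theta_eq_radial[OF c k]
  proof (rule extensionalityI[OF radial_extensional compose_extensional])
    fix z assume z: "z \<in> pts L"
    have "\<phi> (\<eta> t) = compose {0..1} \<phi> \<eta> t" if "t \<in> {0..1}" for t using that by (rule compose_eq[symmetric])
    from radial_compose[OF g(1) h(1) k(1) this z]
    show "radial k0 k1 z = compose (pts L) (radial g0 g1) (radial h0 h1) z"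
      unfolding compose_eq[OF z] by simp
  qed
qed

lemma theta_id: "\<theta> (\<lambda>t\<in>{0..1}. t) = (\<lambda>z\<in>pts L. z)"
proof -
  have i: "(\<lambda>t\<in>{0..1}. t) \<in> carrier DP"
    using subgroup.one_closed[OF subgroup_Diff_interval_plus] by (simp add: Int.one_Diff charts_interval)
  have "radial_factors (\<lambda>t. t) (\<lambda>_. 1) (\<lambda>_. 1)" by (simp add: radial_factors_def)
  then have r: "radial_factors (\<lambda>t\<in>{0..1}. t) (\<lambda>_. 1) (\<lambda>_. 1)"
    by (rule radial_factors_cong) (rule restrict_apply'[symmetric])
  have "psmooth {0..1} (euclidean :: unit topology) (topspace euclidean \<times> {0..1::real}) (\<lambda>_. 1::real)"
    by (intro psmooth_intros pdom_box fat_unit_interval) auto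
  from slice_continuous(1)[OF this, of "()"] have s: "smooth_on {0..1::real} (\<lambda>_. 1::real)" by simp
  show ?thesis
    unfolding theta_eq_radial[OF i r s s]
    by (rule extensionalityI[OF radial_extensional restrict_extensional]) (simp add: radial_id)
qed

text \<open>The elements of the group are undefined off the interval, so a smooth family enters
  through its restrictions. The factors are chosen for the whole family at once, which makes them
  continuous in the parameter.\<close>

lemma psmap_theta:
  fixes F :: "'x \<times> real \<Rightarrow> real"
  assumes F: "psmooth {0..1} X (topspace X \<times> {0..1}) F"
    and P: "\<And>p. p \<in> topspace X \<Longrightarrow> (\<lambda>t\<in>{0..1}. F (p, t)) \<in> carrier DP"
  shows "psmap UNIV X L L (\<lambda>p. \<theta> (\<lambda>t\<in>{0..1}. F (p, t)))"
proof -
  have inc: "increasing_diffeo (\<lambda>t. F (p, t))" if "p \<in> topspace X" for p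
    by (rule increasing_diffeo_cong[OF Diff_interval_plusD(3)[OF P[OF that]]]) simp
  obtain G0 G1 where G: "psmooth {0..1} X (topspace X \<times> {0..1}) G0" "psmooth {0..1} X (topspace X \<times> {0..1}) G1"
    and rad: "\<And>p. p \<in> topspace X \<Longrightarrow> radial_factors (\<lambda>t. F (p, t)) (\<lambda>t. G0 (p, t)) (\<lambda>t. G1 (p, t))"
    by (rule radial_factors_family[OF F inc]) auto
  have rad': "radial_factors (\<lambda>t\<in>{0..1}. F (p, t)) (\<lambda>t. G0 (p, t)) (\<lambda>t. G1 (p, t))" if "p \<in> topspace X" for p
    by (rule radial_factors_cong[OF rad[OF that]]) (rule restrict_apply'[symmetric])
  have "\<theta> (\<lambda>t\<in>{0..1}. F (p, t)) = radial (\<lambda>t. G0 (p, t)) (\<lambda>t. G1 (p, t))" if p: "p \<in> topspace X" for p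
    by (rule theta_eq_radial[OF P[OF p] rad'[OF p] slice_continuous(1)[OF G(1) p] slice_continuous(1)[OF G(2) p]])
  then show ?thesis
    by (intro psmap_cong[OF atlas_L psmap_radial[OF G rad]]) auto
qed

abbreviation "PreP \<equiv> Pre (carrier DP)"

lemma theta_section: "tgroup_section (tsubgroup DL PreP) DP \<sigma> \<theta>"
proof -
  have in_Pre: "\<theta> \<phi> \<in> PreP" if "\<phi> \<in> carrier DP" for \<phi>
    using theta_fol[OF that] that by (simp add: Pre_def[OF subgroup_Diff_interval_plus])
  have "\<theta> \<in> hom DP (tsubgroup DL PreP)"
  proof (rule homI)
    fix \<phi> \<eta> assume \<phi>: "\<phi> \<in> carrier DP" and \<eta>: "\<eta> \<in> carrier DP"
    have "mult DP = mult DI" by (simp add: Diff_interval_plus_def)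
    then show "\<theta> (\<phi> \<otimes>\<^bsub>DP\<^esub> \<eta>) = \<theta> \<phi> \<otimes>\<^bsub>tsubgroup DL PreP\<^esub> \<theta> \<eta>"
      using theta_compose(2)[OF \<phi> \<eta>] LM.mult_Diff[OF theta_Diff(1)[OF \<phi>] theta_Diff(1)[OF \<eta>]]
        Int.mult_Diff[OF Diff_interval_plusD(1)[OF \<phi>] Diff_interval_plusD(1)[OF \<eta>]] by (simp add: charts_interval)
  qed (simp add: in_Pre)
  moreover have "continuous_map (gtop DP) (gtop (tsubgroup DL PreP)) \<theta>"
  proof -
    have sub: "carrier DP \<subseteq> carrier DI" using subgroup.subset[OF subgroup_Diff_interval_plus] .
    let ?X = "subtopology (gtop DI) (carrier DP)"
    have t: "topspace ?X = carrier DP" by (rule Int.topspace_Diff[OF sub])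
    have r: "(\<lambda>t\<in>{0..1}. \<phi> t) = \<phi>" if "\<phi> \<in> carrier DP" for \<phi>
      using pos_diffeo_iff that extensional_restrict by metis
    have F: "psmooth {0..1} ?X (topspace ?X \<times> {0..1}) (\<lambda>z. fst z (snd z))"
      by (rule psmap_intervalD(1)[OF Int.psmap_Diff[OF sub]])
    have "psmap UNIV ?X L L (\<lambda>\<phi>. \<theta> (\<lambda>t\<in>{0..1}. fst (\<phi>, t) (snd (\<phi>, t))))"
      by (rule psmap_theta[OF F]) (simp add: t r)
    then have "psmap UNIV ?X L L \<theta>"
      by (rule psmap_cong[OF atlas_L]) (simp add: t r)
    then have "continuous_map ?X (subtopology (gtop DL) PreP) \<theta>"
      by (rule LM.continuous_into_Diff[OF Pre_Diff[OF subgroup_Diff_interval_plus]]) (simp add: t in_Pre)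
    moreover have "gtop DP = ?X" by (subst Diff_interval_plus_eq) simp
    ultimately show ?thesis by simp
  qed
  ultimately show ?thesis
    using theta_fol(2) by (simp add: tgroup_section_def tgroup_hom_def)
qed

text \<open>A section into the preimage of \<open>K\<close>, followed by the homeomorphism onto the
  graph, has the required form because \<open>\<sigma>\<close> undoes \<open>s\<close>.\<close>

lemma section_Graph:
  assumes K: "subgroup K DI" and s: "tgroup_section (tsubgroup DL (Pre K)) (tsubgroup DI K) \<sigma> s"
  shows "tgroup_section (tsubgroup (tprod DI DL) (Graph K)) (tsubgroup DI K) fst (\<lambda>\<phi>. (\<phi>, s \<phi>))"
proof -
  let ?G = "tsubgroup (tprod DI DL) (Graph K)" and ?K = "tsubgroup DI K"
  have hom: "s \<in> hom ?K (tsubgroup DL (Pre K))" and cont: "continuous_map (gtop ?K) (gtop (tsubgroup DL (Pre K))) s"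
    and \<sigma>s: "\<And>\<phi>. \<phi> \<in> K \<Longrightarrow> \<sigma> (s \<phi>) = \<phi>"
    using s by (auto simp: tgroup_section_def tgroup_hom_def)
  have "(\<lambda>\<phi>. (\<phi>, s \<phi>)) \<in> hom ?K ?G"
  proof (rule homI)
    show "(\<phi>, s \<phi>) \<in> carrier ?G" if "\<phi> \<in> carrier ?K" for \<phi>
      using hom_in_carrier[OF hom that] \<sigma>s that by (simp add: Graph_def[OF K])
    show "(\<phi> \<otimes>\<^bsub>?K\<^esub> \<eta>, s (\<phi> \<otimes>\<^bsub>?K\<^esub> \<eta>)) = (\<phi>, s \<phi>) \<otimes>\<^bsub>?G\<^esub> (\<eta>, s \<eta>)"
      if "\<phi> \<in> carrier ?K" "\<eta> \<in> carrier ?K" for \<phi> \<eta>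
      using hom_mult[OF hom that] by simp
  qed
  moreover have "continuous_map (gtop ?K) (gtop ?G) (\<lambda>\<phi>. (\<phi>, s \<phi>))"
  proof (rule continuous_map_eq)
    show "continuous_map (gtop ?K) (gtop ?G) ((\<lambda>h. (\<sigma> h, h)) \<circ> s)"
      using homeomorphic_snd[OF K] by (intro continuous_map_compose[OF cont]) (simp add: homeomorphic_maps_def)
    have "topspace (gtop ?K) = K" using Int.topspace_Diff[OF K_sub[OF K]] by simp
    then show "((\<lambda>h. (\<sigma> h, h)) \<circ> s) \<phi> = (\<phi>, s \<phi>)" if "\<phi> \<in> topspace (gtop ?K)" for \<phi>
      using \<sigma>s that by simp
  qed
  ultimately show ?thesis by (simp add: tgroup_section_def tgroup_hom_def)
qed

section \<open>The groups of the theorem as preimages and graphs of \<open>\<sigma>\<close>\<close>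

lemma subgroup_DI: "subgroup (carrier DI) DI"
  by (rule group.subgroup_self[OF Int.group_Diff])

lemma Pre_DI: "Pre (carrier DI) = fol"
  using sigma_fol(1) by (auto simp: Pre_def[OF subgroup_DI])

lemma D_fol_eq: "D_fol L (leaves L f) = tsubgroup DL (Pre (carrier DI))"
  unfolding Pre_DI by (simp add: D_fol_def)

lemma DI_eq: "tsubgroup DI (carrier DI) = DI"
  by (simp add: tsubgroup_def Diff_def subtopology_subtopology)

lemma S_LR_eq: "S_LR L f = tsubgroup (tprod DI DL) (Graph (carrier DI))"
proof -
  have "Graph (carrier DI) = carrier (S_LR L f)"
    using S_LR_iff by (auto simp: Graph_def[OF subgroup_DI] Pre_DI)
  then show ?thesis by (simp add: S_LR_def)
qed

lemma S_LR_plus_eq: "S_LR_plus L f = tsubgroup (tprod DI DL) (Graph (carrier DP))"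
proof -
  have "Graph (carrier DP) = {(\<phi>, h) \<in> carrier (S_LR L f). \<phi> \<in> carrier DP}"
    using S_LR_iff by (auto simp: Graph_def[OF subgroup_Diff_interval_plus] Pre_def[OF subgroup_Diff_interval_plus])
  moreover have "Graph (carrier DP) \<subseteq> Graph (carrier DI)"
    using Diff_interval_plusD(1)
    by (auto simp: Graph_def[OF subgroup_Diff_interval_plus] Pre_def[OF subgroup_Diff_interval_plus]
        Graph_def[OF subgroup_DI] Pre_def[OF subgroup_DI])
  ultimately show ?thesis
    unfolding S_LR_plus_def S_LR_eq by (simp add: tsubgroup_tsubgroup)
qed

text \<open>A foliated map sends the leaf at level t to the leaf at level
  \<open>\<sigma> h t\<close>. Thus preserving the two end leaves means fixing the two ends, which
  characterizes the increasing diffeomorphisms.\<close>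

lemma D_fol_plus_eq: "D_fol_plus L f = tsubgroup DL PreP"
proof -
  have "(h ` leaf L f 0 = leaf L f 0 \<and> h ` leaf L f 1 = leaf L f 1) \<longleftrightarrow> \<sigma> h \<in> carrier DP" if h: "h \<in> fol" for h
  proof -
    note s = sigma_fol[OF h]
    have img: "h ` leaf L f t = leaf L f (\<sigma> h t)" if "t \<in> {0..1}" for t
      by (rule leaf_preserving_image[OF _ s that]) (use h fol_Diff in blast)
    have 01: "(0::real) \<in> {0..1}" "(1::real) \<in> {0..1}" by auto
    have "\<sigma> h 0 \<in> {0..1}" using Int.Diff_D(4)[OF s(1), unfolded charts_interval(3), OF 01(1)] .
    \<comment> \<open>A point on the leaf is needed to conclude from equal leaves to equal
      levels.\<close>
    then obtain z where z: "z \<in> pts L" "f z = \<sigma> h 0" by (rule f_surj)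
    have "\<sigma> h 0 = 0" if "leaf L f (\<sigma> h 0) = leaf L f 0"
    proof -
      have "z \<in> leaf L f 0" unfolding that[symmetric] using z by (simp add: leaf_def)
      then show ?thesis using z by (simp add: leaf_def)
    qed
    moreover have "\<sigma> h 0 = 0 \<and> \<sigma> h 1 = 1" if "\<sigma> h \<in> carrier DP"
      using increasing_diffeoD(1,2)[OF Diff_interval_plusD(3)[OF that]] by simp
    ultimately show ?thesis
      unfolding img[OF 01(1)] img[OF 01(2)] using pos_diffeo_iff_zero[OF s(1)] by auto
  qed
  then have "{h \<in> fol. h ` leaf L f 0 = leaf L f 0 \<and> h ` leaf L f 1 = leaf L f 1} = PreP"
    unfolding Pre_def[OF subgroup_Diff_interval_plus] by blast
  then show ?thesis by (simp add: D_fol_plus_def)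
qed

lemma surj_plus: "carrier DP \<subseteq> \<sigma> ` PreP"
  using theta_fol by (force simp: Pre_def[OF subgroup_Diff_interval_plus])

text \<open>One foliated diffeomorphism that exchanges the two ends suffices to hit the
  orientation reversing diffeomorphisms of the interval.\<close>

lemma surj_all:
  assumes "D_fol_plus L f \<noteq> D_fol L (leaves L f)"
  shows "carrier DI \<subseteq> \<sigma> ` Pre (carrier DI)"
proof
  have "PreP \<noteq> fol" using assms D_fol_plus_eq D_fol_eq Pre_DI by metis
  then obtain k where k: "k \<in> fol" "\<sigma> k \<notin> carrier DP" by (auto simp: Pre_def[OF subgroup_Diff_interval_plus])
  have k01: "\<sigma> k 0 = 1" "\<sigma> k 1 = 0" using diffeo_interval_cases[OF sigma_fol(1)[OF k(1)]] k(2) by auto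
  fix \<phi> assume \<phi>: "\<phi> \<in> carrier DI"
  show "\<phi> \<in> \<sigma> ` Pre (carrier DI)"
  proof (cases "\<phi> \<in> carrier DP")
    case True
    then show ?thesis using theta_fol unfolding Pre_DI by force
  next
    case False
    \<comment> \<open>The product of two reversing maps preserves orientation and can be lifted by
      \<open>\<theta>\<close>; composing the lift with the inverse of \<open>k\<close> removes the
      factor \<open>\<sigma> k\<close> again.\<close>
    let ?\<eta> = "compose {0..1} \<phi> (\<sigma> k)" and ?k' = "\<lambda>z\<in>pts L. inv_into (pts L) k z"
    have \<phi>01: "\<phi> 0 = 1" "\<phi> 1 = 0" using diffeo_interval_cases[OF \<phi>] False by auto
    have \<eta>D: "?\<eta> \<in> carrier DI"
      using Int.compose_closed[OF \<phi> sigma_fol(1)[OF k(1)]] by (simp add: charts_interval)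
    have \<eta>: "?\<eta> \<in> carrier DP"
      using pos_diffeo_iff_zero[OF \<eta>D] k01 \<phi>01 by (simp add: compose_def)
    have k': "?k' \<in> fol" "\<sigma> ?k' = (\<lambda>t\<in>{0..1}. inv_into {0..1} (\<sigma> k) t)"
      by (rule fol_inverse[OF k(1)], rule sigma_inverse[OF k(1)])
    have "\<sigma> (compose (pts L) (\<theta> ?\<eta>) ?k') = compose {0..1} ?\<eta> (\<lambda>t\<in>{0..1}. inv_into {0..1} (\<sigma> k) t)"
      using sigma_compose(2)[OF theta_fol(1)[OF \<eta>] k'(1)] theta_fol(2)[OF \<eta>] k'(2) by simp
    also have "\<dots> = \<phi>"
    proof (rule extensionalityI[OF compose_extensional])
      show "\<phi> \<in> extensional {0..1}" using Int.Diff_D(1)[OF \<phi>] by (simp add: charts_interval)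
      note kD = Int.Diff_D[OF sigma_fol(1)[OF k(1)], unfolded charts_interval(3)]
      fix t :: real assume t: "t \<in> {0..1}"
      show "compose {0..1} ?\<eta> (\<lambda>t\<in>{0..1}. inv_into {0..1} (\<sigma> k) t) t = \<phi> t"
        unfolding compose_eq[OF t] restrict_apply'[OF t] compose_eq[OF kD(5)[OF t]] kD(7)[OF t] ..
    qed
    finally show ?thesis
      using sigma_compose(1)[OF theta_fol(1)[OF \<eta>] k'(1)] unfolding Pre_DI by (metis image_eqI)
  qed
qed

text \<open>Composing \<open>h\<close> with a lift of a reparametrization composes their values
  under \<open>\<sigma>\<close>. The path of reparametrizations from the identity to the inverse of
  \<open>\<sigma> h\<close> is affine, hence constant when \<open>\<sigma> h\<close> is the
  identity, and its end brings \<open>h\<close> into the kernel.\<close>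

lemma deformation_retract: "strong_deformation_retract (gtop (D_fol_plus L f)) (carrier (S_R L f))"
proof -
  let ?X = "subtopology (gtop DL) PreP"
  let ?Y = "prod_topology (top_of_set {0..1::real}) ?X"
  let ?S = "carrier (S_R L f)"
  note DPs = subgroup_Diff_interval_plus
  have tX: "topspace ?X = PreP" by (rule LM.topspace_Diff[OF Pre_Diff[OF DPs]])
  then have tY: "topspace ?Y = {0..1} \<times> PreP" by simp
  have PD: "h \<in> fol" "h \<in> carrier DL" "\<sigma> h \<in> carrier DP" if "h \<in> PreP" for h
    using that fol_Diff by (auto simp: Pre_def[OF DPs])
  have SR: "?S = {h \<in> fol. \<sigma> h = (\<lambda>t\<in>{0..1}. t)}" unfolding S_R_eq by simp
  have SP: "?S \<subseteq> PreP" using SR one_K[OF DPs] by (auto simp: Pre_def[OF DPs])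
  have cs: "continuous_map ?Y ?X snd" by (rule continuous_map_snd)
  \<comment> \<open>Parameters are pairs of a time and a diffeomorphism. \<open>J\<close> is the
    inverse of \<open>\<sigma> h\<close>, and \<open>F\<close> is the affine path from the identity
    to \<open>J\<close>.\<close>
  define J where "J z = inv_into {0..1} (\<sigma> (snd (fst z))) (snd z)" for z :: "(real \<times> (('e0 + 'e1) set \<Rightarrow> ('e0 + 'e1) set)) \<times> real"
  define F where "F z = (1 - fst (fst z)) * snd z + fst (fst z) * J z" for z
  have W: "pdom {0..1} ?Y (topspace ?Y \<times> {0..1::real})"
    by (intro pdom_box fat_unit_interval openin_topspace openin_subtopology_self)
  \<comment> \<open>The smooth family \<open>\<sigma>\<close> over the group is pulled back along
    the projection to \<open>h\<close> and then inverted, so the inverses depend continuously on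
    \<open>h\<close> with all derivatives.\<close>
  have Js: "psmooth {0..1} ?Y (topspace ?Y \<times> {0..1}) J"
  proof (rule inverse_family)
    show "psmooth {0..1} ?Y (topspace ?Y \<times> {0..1}) (\<lambda>z. \<sigma> (fst (snd (fst z), snd z)) (snd (snd (fst z), snd z)))"
      by (rule psmooth_pull[OF cs _ W psmap_sigma(1)[OF Pre_fol[OF DPs]]]) (unfold tX tY, auto)
    fix q assume q: "q \<in> topspace ?Y"
    then have D: "\<sigma> (snd q) \<in> carrier DP" using PD tY by auto
    show "increasing_diffeo (\<lambda>t. \<sigma> (fst (snd (fst (q, t)), snd (q, t))) (snd (snd (fst (q, t)), snd (q, t))))"
      using Diff_interval_plusD(3)[OF D] by simp
    fix t :: real assume t: "t \<in> {0..1}"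
    show "J (q, t) \<in> {0..1} \<and> \<sigma> (fst (snd (fst (q, J (q, t))), snd (q, J (q, t)))) (snd (snd (fst (q, J (q, t))), snd (q, J (q, t)))) = t"
      using Diff_interval_plusD(5,7)[OF D t] by (simp add: J_def)
  qed
  have par: "psmooth {0..1::real} ?Y (topspace ?Y \<times> {0..1}) (\<lambda>z. fst (fst z))"
    using psmooth_param[OF W continuous_map_into_fulltopology[OF continuous_map_fst]] .
  have "psmooth {0..1} ?Y (topspace ?Y \<times> {0..1}) (\<lambda>z. (1 - fst (fst z)) * snd z + fst (fst z) * J z)"
    by (intro psmooth_intros(3,6) psmooth_intros(4)[OF psmooth_intros(1)[OF W] par] psmooth_intros(2)[OF W] par Js)
  then have Fs: "psmooth {0..1} ?Y (topspace ?Y \<times> {0..1}) F" unfolding F_def .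
  \<comment> \<open>A convex combination of increasing diffeomorphisms with fixed ends is of the
    same kind, so \<open>\<theta>\<close> applies at every time.\<close>
  have FP: "(\<lambda>t\<in>{0..1}. F (q, t)) \<in> carrier DP" if q: "q \<in> topspace ?Y" for q
    unfolding pos_diffeo_iff
  proof (intro conjI restrict_extensional)
    show "smooth_on {0..1} (\<lambda>t\<in>{0..1}. F (q, t))"
      by (rule smooth_on_cong[OF slice_continuous(1)[OF Fs q]]) (rule restrict_apply'[symmetric])
    have s: "0 \<le> fst q" "fst q \<le> 1" and D: "\<sigma> (snd q) \<in> carrier DP" using q PD unfolding tY by auto
    let ?j = "inv_into {0..1} (\<sigma> (snd q))"
    have j: "increasing_diffeo ?j"
      by (rule increasing_diffeo_cong[OF Diff_interval_plusD(3)[OF Diff_interval_plusD(4)[OF D]]]) (rule restrict_apply')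
    have "increasing_diffeo (\<lambda>t. F (q, t))"
      unfolding increasing_diffeo_def
    proof (intro conjI ballI)
      show "F (q, 0) = 0" "F (q, 1) = 1"
        using increasing_diffeoD(1,2)[OF j] by (simp_all add: F_def J_def)
      fix t :: real assume "t \<in> {0..1}"
      then obtain d where d: "d > 0" "(?j has_real_derivative d) (at t within {0..1})"
        using j unfolding increasing_diffeo_def by blast
      have "((\<lambda>t. F (q, t)) has_real_derivative (1 - fst q) + fst q * d) (at t within {0..1})"
        unfolding F_def J_def using d(2) by (auto intro!: derivative_eq_intros)
      \<comment> \<open>At time 0 the first term is positive, at later times the second.\<close>
      moreover have "(1 - fst q) + fst q * d > 0"
        using s d(1) by (cases "fst q = 0") (auto intro: add_nonneg_pos)
      ultimately show "\<exists>d>0. ((\<lambda>t. F (q, t)) has_real_derivative d) (at t within {0..1})" by blast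
    qed
    then show "increasing_diffeo (\<lambda>t\<in>{0..1}. F (q, t))"
      by (rule increasing_diffeo_cong) (rule restrict_apply'[symmetric])
  qed
  define H where "H q = compose (pts L) (\<theta> (\<lambda>t\<in>{0..1}. F (q, t))) (snd q)" for q
  have HP: "H q \<in> PreP" and H\<sigma>: "\<sigma> (H q) = compose {0..1} (\<lambda>t\<in>{0..1}. F (q, t)) (\<sigma> (snd q))" if q: "q \<in> topspace ?Y" for q
  proof -
    have h: "snd q \<in> PreP" using q unfolding tY by auto
    note t = theta_fol[OF FP[OF q]]
    show "\<sigma> (H q) = compose {0..1} (\<lambda>t\<in>{0..1}. F (q, t)) (\<sigma> (snd q))"
      unfolding H_def sigma_compose(2)[OF t(1) PD(1)[OF h]] t(2) ..
    moreover have "H q \<in> fol" unfolding H_def by (rule sigma_compose(1)[OF t(1) PD(1)[OF h]])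
    ultimately show "H q \<in> PreP"
      using theta_compose(1)[OF FP[OF q] PD(3)[OF h]] by (simp add: Pre_def[OF DPs])
  qed
  have "psmap UNIV ?Y L L (\<lambda>q. snd q)"
    by (rule psmap_pull[OF atlas_L cs LM.psmap_Diff[OF Pre_Diff[OF DPs]]])
  from psmap_compose[OF atlas_L atlas_L findim_euclidean findim_euclidean this psmap_theta[OF Fs FP]]
  have "psmap UNIV ?Y L L H"
    by (rule psmap_cong[OF atlas_L]) (simp_all add: H_def compose_eq)
  then have Hc: "continuous_map ?Y ?X H"
    by (rule LM.continuous_into_Diff[OF Pre_Diff[OF DPs]]) (rule HP)
  have ext: "H (s, h) = h" if h: "h \<in> PreP" and F: "(\<lambda>t\<in>{0..1}. F ((s, h), t)) = (\<lambda>t\<in>{0..1}. t)" for s h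
  proof (rule extensionalityI[of _ "pts L"])
    show "h \<in> extensional (pts L)" by (rule LM.Diff_D(1)[OF PD(2)[OF h]])
    show "H (s, h) \<in> extensional (pts L)" unfolding H_def by (rule compose_extensional)
    show "H (s, h) z = h z" if z: "z \<in> pts L" for z
      unfolding H_def F theta_id using LM.Diff_D(4)[OF PD(2)[OF h] z] z by (simp add: compose_def)
  qed
  have H0: "H (0, h) = h" if "h \<in> PreP" for h
    by (rule ext[OF that]) (simp add: F_def)
  have HS: "H (s, h) = h" if h: "h \<in> ?S" for s h
  proof (rule ext)
    show hP: "h \<in> PreP" using h SP by blast
    have "F ((s, h), t) = t" if t: "t \<in> {0..1}" for t
    proof -
      have "\<sigma> h = (\<lambda>t\<in>{0..1}. t)" using h unfolding SR by blast
      then have "\<sigma> h t = t" using restrict_apply'[OF t] by metis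
      then have "inv_into {0..1} (\<sigma> h) t = t"
        using Diff_interval_plusD(6)[OF PD(3)[OF hP] t] by simp
      then show ?thesis by (simp add: F_def J_def algebra_simps)
    qed
    then show "(\<lambda>t\<in>{0..1}. F ((s, h), t)) = (\<lambda>t\<in>{0..1}. t)" by (rule restrict_ext)
  qed
  have H1: "H (1, h) \<in> ?S" if h: "h \<in> PreP" for h
  proof -
    have q: "(1, h) \<in> topspace ?Y" unfolding tY using h by auto
    note D = Diff_interval_plusD[OF PD(3)[OF h]]
    have "\<sigma> (H (1, h)) = (\<lambda>t\<in>{0..1}. t)"
      unfolding H\<sigma>[OF q]
    proof (rule extensionalityI[OF compose_extensional restrict_extensional])
      fix t :: real assume t: "t \<in> {0..1}"
      have "compose {0..1} (\<lambda>t\<in>{0..1}. F ((1, h), t)) (\<sigma> h) t = F ((1, h), \<sigma> h t)"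
        unfolding compose_eq[OF t] by (rule restrict_apply'[OF D(8)[OF t]])
      also have "\<dots> = t" using D(6)[OF t] by (simp add: F_def J_def)
      finally show "compose {0..1} (\<lambda>t\<in>{0..1}. F ((1, h), t)) (\<sigma> (snd (1, h))) t = (\<lambda>t\<in>{0..1}. t) t"
        unfolding restrict_apply'[OF t] by simp
    qed
    then show ?thesis unfolding SR using PD(1)[OF HP[OF q]] by blast
  qed
  have hom: "homotopic_with (\<lambda>k. \<forall>x\<in>?S. k x = x) ?X ?X id (\<lambda>h. H (1, h))"
  proof (subst homotopic_with)
    show "(\<forall>x\<in>?S. h x = x) \<longleftrightarrow> (\<forall>x\<in>?S. k x = x)" if "\<And>x. x \<in> topspace ?X \<Longrightarrow> h x = k x" for h k
      using SP tX that by (simp add: subset_iff)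
    show "\<exists>h. continuous_map ?Y ?X h \<and> (\<forall>x\<in>topspace ?X. h (0, x) = id x) \<and>
        (\<forall>x\<in>topspace ?X. h (1, x) = H (1, x)) \<and> (\<forall>t\<in>{0..1}. \<forall>x\<in>?S. h (t, x) = x)"
      using Hc H0 HS tX by (intro exI[of _ H]) auto
  qed
  have g: "gtop (D_fol_plus L f) = ?X" unfolding D_fol_plus_eq by simp
  show ?thesis
    unfolding strong_deformation_retract_def g tX
    by (intro conjI exI[of _ "\<lambda>h. H (1, h)"] SP hom) (use H1 in auto)
qed

lemma ses_isomorphism_plus:
  "ses_isomorphism (\<lambda>h. h) snd (\<lambda>\<phi>. \<phi>)
     (S_R L f) (\<lambda>h. ((\<lambda>t\<in>{0..1}. t), h)) (S_LR_plus L f) fst DP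
     (S_R L f) (\<lambda>h. h) (D_fol_plus L f) \<sigma> DP"
  using ses_isomorphism_snd[OF subgroup_Diff_interval_plus surj_plus]
  unfolding S_LR_plus_eq D_fol_plus_eq Diff_interval_plus_eq[symmetric] .

lemma ses_isomorphism_all:
  assumes "D_fol_plus L f \<noteq> D_fol L (leaves L f)"
  shows "ses_isomorphism (\<lambda>h. h) snd (\<lambda>\<phi>. \<phi>)
     (S_R L f) (\<lambda>h. ((\<lambda>t\<in>{0..1}. t), h)) (S_LR L f) fst DI
     (S_R L f) (\<lambda>h. h) (D_fol L (leaves L f)) \<sigma> DI"
  using ses_isomorphism_snd[OF subgroup_DI surj_all[OF assms]]
  unfolding DI_eq S_LR_eq[symmetric] D_fol_eq[symmetric] .

lemma isomorphisms_plus: "tgroup_isomorphisms (S_LR_plus L f) (D_fol_plus L f) snd (\<lambda>h. (\<sigma> h, h))"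
  unfolding S_LR_plus_eq D_fol_plus_eq by (rule isomorphisms_snd[OF subgroup_Diff_interval_plus])

lemma isomorphisms_all: "tgroup_isomorphisms (S_LR L f) (D_fol L (leaves L f)) snd (\<lambda>h. (\<sigma> h, h))"
  unfolding S_LR_eq D_fol_eq by (rule isomorphisms_snd[OF subgroup_DI])

lemma snd_hom_all: "tgroup_hom (S_LR L f) (D_fol L (leaves L f)) snd"
  unfolding S_LR_eq D_fol_eq by (rule snd_tgroup_hom[OF subgroup_DI])

lemma section_sigma: "tgroup_section (D_fol_plus L f) DP \<sigma> \<theta>"
  unfolding D_fol_plus_eq by (rule theta_section)

lemma section_fst: "tgroup_section (S_LR_plus L f) DP fst (\<lambda>\<phi>. (\<phi>, \<theta> \<phi>))"
  using section_Graph[OF subgroup_Diff_interval_plus, of \<theta>] theta_section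
  unfolding S_LR_plus_eq Diff_interval_plus_eq[symmetric] by blast

end

theorem theorem6p7:
  fixes V\<^sub>0 :: "('e0, 'k::euclidean_space, 'b0, 'm0::{real_normed_vector, heine_borel}) vbundle"
    and V\<^sub>1 :: "('e1, 'k, 'b1, 'm1::{real_normed_vector, heine_borel}) vbundle"
    and f\<^sub>0 :: "'e0 \<Rightarrow> real" and f\<^sub>1 :: "'e1 \<Rightarrow> real" and \<psi> :: "'e0 \<Rightarrow> 'e1"
  defines "L \<equiv> L_xi V\<^sub>0 f\<^sub>0 V\<^sub>1 f\<^sub>1 \<psi>"
    and "f \<equiv> f_xi V\<^sub>0 f\<^sub>0 V\<^sub>1 f\<^sub>1 \<psi>"
    and "\<theta> \<equiv> theta V\<^sub>0 f\<^sub>0 V\<^sub>1 f\<^sub>1 \<psi>"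
  defines "\<F> \<equiv> leaves L f"
    and "\<sigma> \<equiv> sigma L f"
    and "j \<equiv> (\<lambda>h :: ('e0 + 'e1) set \<Rightarrow> ('e0 + 'e1) set. ((\<lambda>t\<in>{0..1}. t) :: real \<Rightarrow> real, h))"
    and "p\<^sub>1 \<equiv> (fst :: (real \<Rightarrow> real) \<times> (('e0 + 'e1) set \<Rightarrow> ('e0 + 'e1) set) \<Rightarrow> _)"
    and "p\<^sub>2 \<equiv> (snd :: (real \<Rightarrow> real) \<times> (('e0 + 'e1) set \<Rightarrow> ('e0 + 'e1) set) \<Rightarrow> _)"
  defines "\<sigma>hat \<equiv> (\<lambda>h. (\<sigma> h, h))"
    and "\<theta>hat \<equiv> (\<lambda>\<phi>. (\<phi>, \<theta> \<phi>))"
  assumes "smooth_vector_bundle TYPE('v0::euclidean_space) V\<^sub>0"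
    and "smooth_vector_bundle TYPE('v1::euclidean_space) V\<^sub>1"
    and "compact_space (mtop (base V\<^sub>0))" and "pts (base V\<^sub>0) \<noteq> {}"
    and "compact_space (mtop (base V\<^sub>1))" and "pts (base V\<^sub>1) \<noteq> {}"
    and "smooth_map (total V\<^sub>0) vector_manifold f\<^sub>0" and "homogeneous 2 V\<^sub>0 f\<^sub>0" and "definite V\<^sub>0 f\<^sub>0"
    and "smooth_map (total V\<^sub>1) vector_manifold f\<^sub>1" and "homogeneous 2 V\<^sub>1 f\<^sub>1" and "definite V\<^sub>1 f\<^sub>1"
    and "diffeo_subset (total V\<^sub>0) (level_one V\<^sub>0 f\<^sub>0) (total V\<^sub>1) (level_one V\<^sub>1 f\<^sub>1) \<psi>"
  shows "tgroup_hom (S_LR L f) (D_fol L \<F>) p\<^sub>2 \<and>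
         S_R L f = D_lp L \<F> \<and>
         ses_isomorphism (\<lambda>h. h) p\<^sub>2 (\<lambda>\<phi>. \<phi>)
           (S_R L f) j (S_LR_plus L f) p\<^sub>1 Diff_interval_plus
           (D_lp L \<F>) (\<lambda>h. h) (D_fol_plus L f) \<sigma> Diff_interval_plus \<and>
         tgroup_isomorphisms (S_LR_plus L f) (D_fol_plus L f) p\<^sub>2 \<sigma>hat \<and>
         tgroup_section (S_LR_plus L f) Diff_interval_plus p\<^sub>1 \<theta>hat \<and>
         tgroup_section (D_fol_plus L f) Diff_interval_plus \<sigma> \<theta> \<and>
         strong_deformation_retract (gtop (D_fol_plus L f)) (carrier (D_lp L \<F>)) \<and>
         (D_fol_plus L f \<noteq> D_fol L \<F> \<longrightarrow>
           ses_isomorphism (\<lambda>h. h) p\<^sub>2 (\<lambda>\<phi>. \<phi>)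
             (S_R L f) j (S_LR L f) p\<^sub>1 (Diff unit_interval)
             (D_lp L \<F>) (\<lambda>h. h) (D_fol L \<F>) \<sigma> (Diff unit_interval) \<and>
           tgroup_isomorphisms (S_LR L f) (D_fol L \<F>) p\<^sub>2 \<sigma>hat)"
proof -
  interpret glued_bundles V\<^sub>0 "TYPE('v0)" f\<^sub>0 V\<^sub>1 "TYPE('v1)" f\<^sub>1 \<psi>
    by unfold_locales (use assms in auto)
  show ?thesis
    unfolding assms(1-10) D_lp_eq
    by (intro conjI impI refl snd_hom_all ses_isomorphism_plus isomorphisms_plus section_fst section_sigma
        deformation_retract ses_isomorphism_all isomorphisms_all)
qed

end
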